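(* Let $n\ge1$, $\mathfrak g=\mathrm{Der}(\mathbb C[t_1,\dots,t_n])$, and let $V$ be a simple $\mathfrak g$-module. Then the following statements are equivalent: (1) there are positive integers $k_1,\dots,k_n$ such that each of $t_1^{k_1+1}\partial_1,\ t_2^{k_2+1}\partial_2,\ \dots,\ t_n^{k_n+1}\partial_n$ acts locally finitely on $V$; (2) $V$ is a smooth $\mathfrak g$-module; (3) $V$ is either isomorphic to the induced module $\mathrm{Ind}_{\mathfrak g_{\ge0}}^{\mathfrak g}E$ for some simple smooth $\mathfrak g_{\ge0}$-module $E$ with height $\ell_E\ge2$, or isomorphic to the unique simple quotient of the tensor $\mathfrak g$-module $F(P_0,M)$ for some simple $\mathfrak{gl}_n$-module $M$.
   Context: All vector spaces are over $\mathbb C$; $\mathbb Z_+$ denotes the non-negative integers. Write $\partial_i=\partial/\partial t_i$, $t^\alpha=t_1^{\alpha_1}\cdots t_n^{\alpha_n}$, $|\alpha|=\alpha_1+\dots+\alpha_n$ for $\alpha\in\mathbb Z_+^n$. $\mathfrak g$ is $\mathbb Z$-graded: $\mathfrak g=\bigoplus_{k\ge-1}\mathfrak g_k$, $\mathfrak g_k=\mathrm{Span}\{t^\alpha\partial_i\mid |\alpha|=k+1,\ 1\le i\le n\}$, and $\mathfrak g_{\ge r}=\bigoplus_{k\ge r}\mathfrak g_k$. A $\mathfrak g$-module (or $\mathfrak g_{\ge0}$-module) $V$ is smooth if for every $v\in V$ there is $m\in\mathbb Z_+$ with $\mathfrak g_i v=0$ for all $i\ge m$. For such $V$ and $r\in\mathbb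 Z_+$, $V^{(r)}=\{v\in V\mid \mathfrak g_{\ge r}v=0\}$, and the height is $\ell_V=\min\{r\in\mathbb Z_+\mid V^{(r)}\ne0\}$. An operator $x$ acts locally finitely on $V$ if $\mathrm{Span}\{x^k v\mid k\ge0\}$ is finite-dimensional for every $v\in V$. $\mathrm{Ind}_{\mathfrak g_{\ge0}}^{\mathfrak g}E=U(\mathfrak g)\otimes_{U(\mathfrak g_{\ge0})}E$. $E_{ij}$ are the matrix units of $\mathfrak{gl}_n$. $\mathcal K_n^+=\mathbb C[t_1,\dots,t_n,\partial_1,\dots,\partial_n]$ is the Weyl algebra, and $P_0=\mathcal K_n^+/\sum_{i=1}^n\mathcal K_n^+t_i$, a left $\mathcal K_n^+$-module. For a $\mathfrak{gl}_n$-module $M$, $F(P_0,M)=P_0\otimes_{\mathbb C}M$ is the $\mathfrak g$-module with action $$(t^\alpha\partial_j)\circ(g\otimes v)=((t^\alpha\partial_j)g)\otimes v+\sum_{i=1}^n(\partial_i(t^\alpha)g)\otimes E_{ij}v$$ for $\alpha\in\mathbb Z_+^n$, $1\le j\le n$, $g\in P_0$, $v\in M$. *)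

theory Defs
  imports
    "HOL-Analysis.Analysis"
    "HOL-Algebra.QuotRing"
    "HOL-Algebra.Module"
    "HOL-Library.Poly_Mapping"
    "HOL-Library.Function_Algebras"
begin

section \<open>Complex vector spaces with operators, quotients and tensor products\<close>

definition complex_ring :: "complex ring" where
  "complex_ring = \<lparr>carrier = UNIV, mult = (*), one = 1, zero = 0, add = (+)\<rparr>"

text \<open>A complex vector space together with operators indexed by a type. The fields
  \<^const>\<open>mult\<close> and \<^const>\<open>one\<close>, which every \<^type>\<open>module\<close> record carries, are only meaningful
  when the vector space is an associative algebra.\<close>

record ('a, 'v) op_module = "(complex, 'v) module" +
  act :: "'a \<Rightarrow> 'v \<Rightarrow> 'v"

definition op_module_of ::
  "(complex \<Rightarrow> 'v \<Rightarrow> 'v) \<Rightarrow> ('a \<Rightarrow> 'v \<Rightarrow> 'v) \<Rightarrow> ('a, 'v::ab_group_add) op_module" where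
  "op_module_of s \<rho> = \<lparr>carrier = UNIV, mult = undefined, one = undefined,
     zero = 0, add = (+), smult = s, act = \<rho>\<rparr>"

text \<open>The coset space \<open>V / N\<close>; for an algebra and a two-sided ideal its ring part is \<open>V Quot N\<close>.\<close>

definition quot_module :: "('a, 'v) op_module \<Rightarrow> 'v set \<Rightarrow> ('a, 'v set) op_module" where
  "quot_module V N = \<lparr>carrier = a_rcosets\<^bsub>V\<^esub> N, mult = rcoset_mult V N,
     one = N +>\<^bsub>V\<^esub> \<one>\<^bsub>V\<^esub>, zero = N, add = set_add V,
     smult = (\<lambda>c X. \<Union>x\<in>X. N +>\<^bsub>V\<^esub> (c \<odot>\<^bsub>V\<^esub> x)),
     act = (\<lambda>a X. \<Union>x\<in>X. N +>\<^bsub>V\<^esub> act V a x)\<rparr>"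

definition subspace_span :: "('a, 'v) op_module \<Rightarrow> 'v set \<Rightarrow> 'v set" where
  "subspace_span V S = \<Inter>{W. submodule W complex_ring V \<and> S \<subseteq> W}"

definition locally_finite :: "('a, 'v) op_module \<Rightarrow> 'a \<Rightarrow> bool" where
  "locally_finite V x \<longleftrightarrow> (\<forall>v\<in>carrier V. \<exists>B. finite B \<and> B \<subseteq> carrier V \<and>
     subspace_span V {(act V x ^^ k) v | k. True} = subspace_span V B)"

abbreviation fscale :: "complex \<Rightarrow> ('b \<Rightarrow>\<^sub>0 complex) \<Rightarrow> ('b \<Rightarrow>\<^sub>0 complex)" where
  "fscale c \<equiv> Poly_Mapping.map ((*) c)"

text \<open>The free vector space on a set \<open>S\<close> of basis vectors, with operators \<open>T\<close>.\<close>

definition free_space ::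
  "'b set \<Rightarrow> ('a \<Rightarrow> ('b \<Rightarrow>\<^sub>0 complex) \<Rightarrow> ('b \<Rightarrow>\<^sub>0 complex)) \<Rightarrow> ('a, 'b \<Rightarrow>\<^sub>0 complex) op_module" where
  "free_space S T = \<lparr>carrier = {f. Poly_Mapping.keys f \<subseteq> S}, mult = undefined, one = undefined,
     zero = 0, add = (+), smult = fscale, act = T\<rparr>"

definition lin_ext ::
  "('b \<Rightarrow> ('c \<Rightarrow>\<^sub>0 complex)) \<Rightarrow> ('b \<Rightarrow>\<^sub>0 complex) \<Rightarrow> ('c \<Rightarrow>\<^sub>0 complex)" where
  "lin_ext F f = (\<Sum>b\<in>Poly_Mapping.keys f. fscale (Poly_Mapping.lookup f b) (F b))"

abbreviation pure :: "'x \<Rightarrow> 'y \<Rightarrow> ('x \<times> 'y \<Rightarrow>\<^sub>0 complex)" where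
  "pure x y \<equiv> Poly_Mapping.single (x, y) 1"

definition bilinear_rels ::
  "('a, 'x) op_module \<Rightarrow> ('b, 'y) op_module \<Rightarrow> ('x \<times> 'y \<Rightarrow>\<^sub>0 complex) set" where
  "bilinear_rels X Y =
     {pure (x \<oplus>\<^bsub>X\<^esub> x') y - pure x y - pure x' y | x x' y.
        x \<in> carrier X \<and> x' \<in> carrier X \<and> y \<in> carrier Y}
   \<union> {pure x (y \<oplus>\<^bsub>Y\<^esub> y') - pure x y - pure x y' | x y y'.
        x \<in> carrier X \<and> y \<in> carrier Y \<and> y' \<in> carrier Y}
   \<union> {pure (c \<odot>\<^bsub>X\<^esub> x) y - fscale c (pure x y) | c x y. x \<in> carrier X \<and> y \<in> carrier Y}
   \<union> {pure x (c \<odot>\<^bsub>Y\<^esub> y) - fscale c (pure x y) | c x y. x \<in> carrier X \<and> y \<in> carrier Y}"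

text \<open>The tensor product over the complex numbers, modulo additional relations \<open>B\<close>
  (none for the plain tensor product, the balancing relations for a tensor product over an
  algebra). The operators \<open>T\<close> are given on representatives.\<close>

definition tensor_module ::
  "('a, 'x) op_module \<Rightarrow> ('b, 'y) op_module \<Rightarrow> ('x \<times> 'y \<Rightarrow>\<^sub>0 complex) set
    \<Rightarrow> ('g \<Rightarrow> ('x \<times> 'y \<Rightarrow>\<^sub>0 complex) \<Rightarrow> ('x \<times> 'y \<Rightarrow>\<^sub>0 complex))
    \<Rightarrow> ('g, ('x \<times> 'y \<Rightarrow>\<^sub>0 complex) set) op_module" where
  "tensor_module X Y B T =
     quot_module (free_space (carrier X \<times> carrier Y) T)
       (module.span fscale (bilinear_rels X Y \<union> B))"


section \<open>Lie algebras and their modules\<close>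

text \<open>A complex Lie algebra on a subset \<open>lset\<close> of a type, whose addition is that of the type.\<close>

record 'g lie_algebra =
  lset :: "'g set"
  lscale :: "complex \<Rightarrow> 'g \<Rightarrow> 'g"
  lbracket :: "'g \<Rightarrow> 'g \<Rightarrow> 'g"

definition lie_module :: "'g::ab_group_add lie_algebra \<Rightarrow> ('g, 'v) op_module \<Rightarrow> bool" where
  "lie_module L V \<longleftrightarrow> Module.module complex_ring V \<and>
     (\<forall>x\<in>lset L. \<forall>v\<in>carrier V. act V x v \<in> carrier V) \<and>
     (\<forall>x\<in>lset L. \<forall>v\<in>carrier V. \<forall>w\<in>carrier V. act V x (v \<oplus>\<^bsub>V\<^esub> w) = act V x v \<oplus>\<^bsub>V\<^esub> act V x w) \<and>
     (\<forall>x\<in>lset L. \<forall>c. \<forall>v\<in>carrier V. act V x (c \<odot>\<^bsub>V\<^esub> v) = c \<odot>\<^bsub>V\<^esub> act V x v) \<and>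
     (\<forall>x\<in>lset L. \<forall>y\<in>lset L. \<forall>v\<in>carrier V. act V (x + y) v = act V x v \<oplus>\<^bsub>V\<^esub> act V y v) \<and>
     (\<forall>c. \<forall>x\<in>lset L. \<forall>v\<in>carrier V. act V (lscale L c x) v = c \<odot>\<^bsub>V\<^esub> act V x v) \<and>
     (\<forall>x\<in>lset L. \<forall>y\<in>lset L. \<forall>v\<in>carrier V.
        act V (lbracket L x y) v = act V x (act V y v) \<ominus>\<^bsub>V\<^esub> act V y (act V x v))"

definition lie_submodule :: "'g lie_algebra \<Rightarrow> 'v set \<Rightarrow> ('g, 'v) op_module \<Rightarrow> bool" where
  "lie_submodule L W V \<longleftrightarrow>
     submodule W complex_ring V \<and> (\<forall>x\<in>lset L. \<forall>w\<in>W. act V x w \<in> W)"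

definition simple_lie_module :: "'g::ab_group_add lie_algebra \<Rightarrow> ('g, 'v) op_module \<Rightarrow> bool" where
  "simple_lie_module L V \<longleftrightarrow> lie_module L V \<and> carrier V \<noteq> {\<zero>\<^bsub>V\<^esub>} \<and>
     (\<forall>W. lie_submodule L W V \<longrightarrow> W = {\<zero>\<^bsub>V\<^esub>} \<or> W = carrier V)"

definition lie_module_iso ::
  "'g lie_algebra \<Rightarrow> ('g, 'v) op_module \<Rightarrow> ('g, 'w) op_module \<Rightarrow> bool" where
  "lie_module_iso L V W \<longleftrightarrow> (\<exists>\<phi>. bij_betw \<phi> (carrier V) (carrier W) \<and>
     (\<forall>v\<in>carrier V. \<forall>v'\<in>carrier V. \<phi> (v \<oplus>\<^bsub>V\<^esub> v') = \<phi> v \<oplus>\<^bsub>W\<^esub> \<phi> v') \<and>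
     (\<forall>c. \<forall>v\<in>carrier V. \<phi> (c \<odot>\<^bsub>V\<^esub> v) = c \<odot>\<^bsub>W\<^esub> \<phi> v) \<and>
     (\<forall>x\<in>lset L. \<forall>v\<in>carrier V. \<phi> (act V x v) = act W x (\<phi> v)))"

definition simple_quotient_kernel ::
  "'g::ab_group_add lie_algebra \<Rightarrow> ('g, 'v) op_module \<Rightarrow> 'v set \<Rightarrow> bool" where
  "simple_quotient_kernel L V N \<longleftrightarrow>
     lie_submodule L N V \<and> simple_lie_module L (quot_module V N)"

definition iso_unique_simple_quotient ::
  "'g::ab_group_add lie_algebra \<Rightarrow> ('g, 'v) op_module \<Rightarrow> ('g, 'w) op_module \<Rightarrow> bool" where
  "iso_unique_simple_quotient L V W \<longleftrightarrow> (\<exists>N. simple_quotient_kernel L W N \<and>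
     (\<forall>N'. simple_quotient_kernel L W N' \<longrightarrow> N' = N) \<and>
     lie_module_iso L V (quot_module W N))"


section \<open>Universal enveloping algebras and induced modules\<close>

datatype 'g free_monoid = Word (letters: "'g list")

instantiation free_monoid :: (type) monoid_add
begin

definition zero_free_monoid :: "'a free_monoid" where
  "zero_free_monoid = Word []"

definition plus_free_monoid :: "'a free_monoid \<Rightarrow> 'a free_monoid \<Rightarrow> 'a free_monoid" where
  "plus_free_monoid u v = Word (letters u @ letters v)"

instance
  by standard (auto simp: zero_free_monoid_def plus_free_monoid_def)

end

text \<open>Noncommutative polynomials: the monoid algebra of the free monoid, with the
  convolution product.\<close>

type_synonym 'g free_alg = "'g free_monoid \<Rightarrow>\<^sub>0 complex"

definition free_algebra :: "'g set \<Rightarrow> ('g free_alg, 'g free_alg) op_module" where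
  "free_algebra S = \<lparr>carrier = {f. \<forall>w\<in>Poly_Mapping.keys f. set (letters w) \<subseteq> S},
     mult = (*), one = 1, zero = 0, add = (+), smult = fscale, act = (*)\<rparr>"

abbreviation gen :: "'g \<Rightarrow> 'g free_alg" where
  "gen x \<equiv> Poly_Mapping.single (Word [x]) 1"

text \<open>The linearity relations turn the free algebra on the set underlying \<open>L\<close> into the tensor
  algebra of the vector space \<open>L\<close>.\<close>

definition env_rels :: "'g::ab_group_add lie_algebra \<Rightarrow> 'g free_alg set" where
  "env_rels L =
     {gen (x + y) - gen x - gen y | x y. x \<in> lset L \<and> y \<in> lset L}
   \<union> {gen (lscale L c x) - fscale c (gen x) | c x. x \<in> lset L}
   \<union> {gen x * gen y - gen y * gen x - gen (lbracket L x y) | x y. x \<in> lset L \<and> y \<in> lset L}"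

definition env_ideal :: "'g::ab_group_add lie_algebra \<Rightarrow> 'g free_alg set" where
  "env_ideal L = genideal (free_algebra (lset L)) (env_rels L)"

definition env_class :: "'g::ab_group_add lie_algebra \<Rightarrow> 'g free_alg \<Rightarrow> 'g free_alg set" where
  "env_class L a = env_ideal L +>\<^bsub>free_algebra (lset L)\<^esub> a"

definition env_algebra ::
  "'g::ab_group_add lie_algebra \<Rightarrow> ('g free_alg, 'g free_alg set) op_module" where
  "env_algebra L = quot_module (free_algebra (lset L)) (env_ideal L)"

text \<open>The action on a module of the element of the enveloping algebra represented by \<open>a\<close>.\<close>

definition env_act :: "('g, 'v) op_module \<Rightarrow> 'g free_alg \<Rightarrow> 'v \<Rightarrow> 'v" where
  "env_act V a v = (\<Oplus>\<^bsub>V\<^esub>w\<in>Poly_Mapping.keys a.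
     Poly_Mapping.lookup a w \<odot>\<^bsub>V\<^esub> foldr (act V) (letters w) v)"

text \<open>\<open>U(L) \<otimes> E\<close> over \<open>U(H)\<close> for a subalgebra \<open>H\<close> of \<open>L\<close>. Elements of \<open>U(H)\<close> are given by
  representatives \<open>a\<close> in the free algebra on \<open>H\<close>; such an element acts on the right of \<open>U(L)\<close>
  through its image \<open>env_class L a\<close> under the canonical map from \<open>U(H)\<close> to \<open>U(L)\<close>.\<close>

definition balanced_rels ::
  "'g::ab_group_add lie_algebra \<Rightarrow> 'g lie_algebra \<Rightarrow> ('g, 'e) op_module
    \<Rightarrow> ('g free_alg set \<times> 'e \<Rightarrow>\<^sub>0 complex) set" where
  "balanced_rels L H E =
     {pure (u \<otimes>\<^bsub>env_algebra L\<^esub> env_class L a) e - pure u (env_act E a e) | u a e.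
        u \<in> carrier (env_algebra L) \<and> a \<in> carrier (free_algebra (lset H)) \<and> e \<in> carrier E}"

definition induced_module ::
  "'g::ab_group_add lie_algebra \<Rightarrow> 'g lie_algebra \<Rightarrow> ('g, 'e) op_module
    \<Rightarrow> ('g, ('g free_alg set \<times> 'e \<Rightarrow>\<^sub>0 complex) set) op_module" where
  "induced_module L H E = tensor_module (env_algebra L) E (balanced_rels L H E)
     (\<lambda>x. lin_ext (\<lambda>(u, e). pure (env_class L (gen x) \<otimes>\<^bsub>env_algebra L\<^esub> u) e))"


section \<open>Derivations of the polynomial ring\<close>

type_synonym 'n cpoly = "('n \<Rightarrow>\<^sub>0 nat) \<Rightarrow>\<^sub>0 complex"
type_synonym 'n poly_op = "'n cpoly \<Rightarrow> 'n cpoly"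

abbreviation tmonom :: "('n \<Rightarrow>\<^sub>0 nat) \<Rightarrow> 'n cpoly" where
  "tmonom \<alpha> \<equiv> Poly_Mapping.single \<alpha> 1"

abbreviation tvar :: "'n \<Rightarrow> 'n cpoly" where
  "tvar i \<equiv> tmonom (Poly_Mapping.single i 1)"

definition mult_op :: "'n cpoly \<Rightarrow> 'n poly_op" where
  "mult_op f = (\<lambda>p. f * p)"

text \<open>If the exponent of \<open>t\<^sub>i\<close> in \<open>\<alpha>\<close> vanishes, then so does the coefficient below, and the
  truncated exponent is irrelevant.\<close>

definition pdiff :: "'n \<Rightarrow> 'n poly_op" where
  "pdiff i p = (\<Sum>\<alpha>\<in>Poly_Mapping.keys p. Poly_Mapping.single (\<alpha> - Poly_Mapping.single i 1)
     (of_nat (Poly_Mapping.lookup \<alpha> i) * Poly_Mapping.lookup p \<alpha>))"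

definition op_scale :: "complex \<Rightarrow> 'n poly_op \<Rightarrow> 'n poly_op" where
  "op_scale c D = (\<lambda>p. fscale c (D p))"

definition derivations :: "'n poly_op set" where
  "derivations = {D. (\<forall>p q. D (p + q) = D p + D q) \<and> (\<forall>c p. D (fscale c p) = fscale c (D p)) \<and>
     (\<forall>p q. D (p * q) = D p * q + p * D q)}"

definition witt :: "'n poly_op lie_algebra" where
  "witt = \<lparr>lset = derivations, lscale = op_scale, lbracket = (\<lambda>D D' p. D (D' p) - D' (D p))\<rparr>"

definition monom_field :: "('n \<Rightarrow>\<^sub>0 nat) \<Rightarrow> 'n \<Rightarrow> 'n poly_op" where
  "monom_field \<alpha> i = (\<lambda>p. tmonom \<alpha> * pdiff i p)"

definition witt_grade :: "int \<Rightarrow> 'n::finite poly_op set" where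
  "witt_grade k = module.span op_scale
     {monom_field \<alpha> i | \<alpha> i. int (\<Sum>j\<in>UNIV. Poly_Mapping.lookup \<alpha> j) = k + 1}"

definition witt_ge :: "int \<Rightarrow> 'n::finite poly_op set" where
  "witt_ge r = module.span op_scale (\<Union>k\<in>{r..}. witt_grade k)"

definition witt_nonneg :: "'n::finite poly_op lie_algebra" where
  "witt_nonneg = witt\<lparr>lset := witt_ge 0\<rparr>"

definition smooth :: "('n::finite poly_op, 'v) op_module \<Rightarrow> bool" where
  "smooth V \<longleftrightarrow> (\<forall>v\<in>carrier V. \<exists>m::nat. \<forall>i\<ge>m. \<forall>x\<in>witt_grade (int i). act V x v = \<zero>\<^bsub>V\<^esub>)"

definition annihilated :: "('n::finite poly_op, 'v) op_module \<Rightarrow> nat \<Rightarrow> 'v set" where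
  "annihilated V r = {v\<in>carrier V. \<forall>x\<in>witt_ge (int r). act V x v = \<zero>\<^bsub>V\<^esub>}"

definition height :: "('n::finite poly_op, 'v) op_module \<Rightarrow> nat" where
  "height V = (LEAST r. annihilated V r \<noteq> {\<zero>\<^bsub>V\<^esub>})"


section \<open>The Weyl algebra and tensor modules\<close>

text \<open>The Weyl algebra as the algebra of operators on the polynomial ring generated by the
  multiplications by variables and the partial derivatives.\<close>

inductive_set weyl_ops :: "'n poly_op set" where
  var: "mult_op (tvar i) \<in> weyl_ops"
| diff: "pdiff i \<in> weyl_ops"
| one: "id \<in> weyl_ops"
| add: "P \<in> weyl_ops \<Longrightarrow> Q \<in> weyl_ops \<Longrightarrow> P + Q \<in> weyl_ops"
| scale: "P \<in> weyl_ops \<Longrightarrow> op_scale c P \<in> weyl_ops"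
| comp: "P \<in> weyl_ops \<Longrightarrow> Q \<in> weyl_ops \<Longrightarrow> P \<circ> Q \<in> weyl_ops"

definition weyl_algebra :: "('n poly_op, 'n poly_op) op_module" where
  "weyl_algebra = \<lparr>carrier = weyl_ops, mult = (\<circ>), one = id, zero = 0, add = (+),
     smult = op_scale, act = (\<circ>)\<rparr>"

definition P0 :: "('n::finite poly_op, 'n poly_op set) op_module" where
  "P0 = quot_module weyl_algebra
     {\<Sum>i\<in>UNIV. a i \<circ> mult_op (tvar i) | a. \<forall>i. a i \<in> weyl_ops}"

definition gl :: "(complex^'n^'n) lie_algebra" where
  "gl = \<lparr>lset = UNIV, lscale = (\<lambda>c A. \<chi> i j. c * A $ i $ j),
     lbracket = (\<lambda>A B. A ** B - B ** A)\<rparr>"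

definition mat_unit :: "'n \<Rightarrow> 'n \<Rightarrow> complex^'n^'n" where
  "mat_unit i j = (\<chi> a b. if a = i \<and> b = j then 1 else 0)"

text \<open>The tensor module \<open>F(P\<^sub>0, M)\<close>. As \<open>D = \<Sum>\<^sub>j D(t\<^sub>j) \<partial>\<^sub>j\<close> for a derivation \<open>D\<close>, the linear
  extension to all derivations of the action of the fields \<open>t\<^sup>\<alpha> \<partial>\<^sub>j\<close> is
  \<open>D (g \<otimes> v) = D g \<otimes> v + \<Sum>\<^sub>i\<^sub>j \<partial>\<^sub>i(D(t\<^sub>j)) g \<otimes> E\<^sub>i\<^sub>j v\<close>; derivations and polynomials act on \<open>P\<^sub>0\<close>
  as elements of the Weyl algebra.\<close>

definition tensor_field_act ::
  "(complex^'n^'n, 'm) op_module \<Rightarrow> 'n::finite poly_op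
    \<Rightarrow> ('n poly_op set \<times> 'm \<Rightarrow>\<^sub>0 complex) \<Rightarrow> ('n poly_op set \<times> 'm \<Rightarrow>\<^sub>0 complex)" where
  "tensor_field_act M D = lin_ext (\<lambda>(g, v). pure (act P0 D g) v +
     (\<Sum>i\<in>UNIV. \<Sum>j\<in>UNIV.
        pure (act P0 (mult_op (pdiff i (D (tvar j)))) g) (act M (mat_unit i j) v)))"

definition tensor_field_module ::
  "(complex^'n^'n, 'm) op_module
    \<Rightarrow> ('n::finite poly_op, ('n poly_op set \<times> 'm \<Rightarrow>\<^sub>0 complex) set) op_module" where
  "tensor_field_module M = tensor_module P0 M {} (tensor_field_act M)"

text \<open>The types \<open>'e\<close> and \<open>'m\<close> are those in which the existentially quantified modules \<open>E\<close> and
  \<open>M\<close> have their carriers.\<close>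

definition induced_or_tensor_quotient ::
  "'e itself \<Rightarrow> 'm itself \<Rightarrow> ('n::finite poly_op, 'v) op_module \<Rightarrow> bool" where
  "induced_or_tensor_quotient _ _ V \<longleftrightarrow>
     (\<exists>E::('n poly_op, 'e) op_module. simple_lie_module witt_nonneg E \<and> smooth E \<and>
        height E \<ge> 2 \<and> lie_module_iso witt V (induced_module witt witt_nonneg E))
   \<or> (\<exists>M::(complex^'n^'n, 'm) op_module. simple_lie_module gl M \<and>
        iso_unique_simple_quotient witt V (tensor_field_module M))"

end

theory Submission
  imports Defs
begin

text \<open>(1) implies (2): finitely many commuting locally finite operators \<open>t\<^sub>i\<^sup>k\<^sup>+\<^sup>1 \<partial>\<^sub>i\<close> have finite-dimensional
  stable subspaces \<open>W\<close>, and for the whole Lie algebra \<open>L\<close> of derivations \<open>L W\<close> is again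
  finite-dimensional. Counting dimensions, some nonzero polynomial in each \<open>t\<^sub>i\<close> times \<open>\<partial>\<^sub>i\<close> kills
  \<open>W\<close>; brackets turn it into an ideal \<open>I\<close> of polynomials with \<open>(I L) W = 0\<close>, which is stable under
  the given operators and therefore contains a power of every \<open>t\<^sub>i\<close>.

  (2) implies (1): for large \<open>k\<close> the operator \<open>t\<^sub>i\<^sup>k\<^sup>+\<^sup>1 \<partial>\<^sub>i\<close> kills a nonzero vector, and the vectors on
  which it is nilpotent form a submodule.

  (2) implies (3): let \<open>r\<close> be the height of \<open>V\<close>. If \<open>r \<ge> 2\<close>, then \<open>V\<close> is free over the constant
  derivations on \<open>V\<^sup>(\<^sup>r\<^sup>)\<close>, hence induced from it. If \<open>r \<le> 1\<close>, then \<open>V\<close> is either free over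
  \<open>E = V\<^sup>(\<^sup>1\<^sup>)\<close>, or the part of top degree of a relation yields an eigenvector of the Euler field in \<open>V\<^sup>(\<^sup>1\<^sup>)\<close> and
  \<open>E\<close> is its eigenspace there. In each case \<open>V\<close> is compared with a module \<open>W\<close> generated by an
  equivariant image of \<open>E\<close> through the submodule of \<open>V \<times> W\<close> generated by the graph of \<open>E \<rightarrow> W\<close>: it is
  the graph of a surjection \<open>W \<rightarrow> V\<close> whose kernel contains every proper submodule of \<open>W\<close>.

  (3) implies (2): both kinds of modules are generated by smooth vectors, and the smooth vectors form
  a submodule.\<close>

text \<open>The obstacle in (2) implies (3) is the size of Ind E and F(P0, M): no basis of either is
  constructed. All such information is taken from V instead. A pair in the submodule generated by
  the graph is (sum d^\<beta> e_\<beta>, sum d^\<beta> \<iota>(e_\<beta>)) with the same e_\<beta>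
  on both sides, so if V is free over the constant derivations, a relation in V is also one in W.
  This takes the place of the Poincare-Birkhoff-Witt theorem. Of W it has to be known that
  \<iota>(E) generates it and that \<iota> \<noteq> 0; the latter rests on P0 \<noteq> 0, or on
  letting U(g) act on V.

  Without freeness, E has to be separated from the d^\<beta> E with \<beta> \<noteq> 0 in another
  way. If E belongs to the eigenvalue \<mu> of the Euler field, then d^\<beta> E belongs to \<mu> -
  |\<beta>|, and a polynomial in the Euler field projects to E in V and in W at once.
  \<open>base_closed\<close> is the common form in which the comparison uses either
  separation.\<close>

declare One_nat_def [simp del] plus_fun_def [simp del] zero_fun_def [simp del]

section \<open>Polynomials and their derivations\<close>

lemma lookup_fscale [simp]:
  "Poly_Mapping.lookup (fscale c p) k = c * Poly_Mapping.lookup p k"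
  by (simp add: Poly_Mapping.map.rep_eq when_def)

interpretation pm: vector_space "fscale :: complex \<Rightarrow> ('b \<Rightarrow>\<^sub>0 complex) \<Rightarrow> ('b \<Rightarrow>\<^sub>0 complex)"
  by standard (auto intro!: poly_mapping_eqI simp: lookup_add algebra_simps)

interpretation op: vector_space "op_scale :: complex \<Rightarrow> 'n poly_op \<Rightarrow> 'n poly_op"
  by standard (auto simp: op_scale_def fun_eq_iff pm.scale_right_distrib pm.scale_left_distrib)

lemma fscale_single [simp]: "fscale c (Poly_Mapping.single k d) = Poly_Mapping.single k (c * d)"
  by (rule poly_mapping_eqI) (simp add: lookup_single when_def)

lemma fscale_conv_mult:
  "fscale c (p :: 'a::monoid_add \<Rightarrow>\<^sub>0 complex) = Poly_Mapping.single 0 c * p"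
  by (rule mult_map_scale_conv_mult)

lemma fscale_mult_left:
  fixes p q :: "'a::monoid_add \<Rightarrow>\<^sub>0 complex"
  shows "fscale c p * q = fscale c (p * q)"
  by (simp add: fscale_conv_mult mult.assoc)

lemma fscale_mult_right:
  fixes p q :: "'a::comm_monoid_add \<Rightarrow>\<^sub>0 complex"
  shows "p * fscale c q = fscale c (p * q)"
  by (simp add: fscale_conv_mult ac_simps)

lemma poly_mapping_induct [case_names single add]:
  fixes f :: "'a \<Rightarrow>\<^sub>0 'b::monoid_add"
  assumes single: "\<And>k c. P (Poly_Mapping.single k c)"
    and add: "\<And>f g. P f \<Longrightarrow> P g \<Longrightarrow> P (f + g)"
  shows "P f"
proof (induction f rule: Poly_Mapping.update_induct)
  case const
  show ?case using single[of undefined 0] by simp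
next
  case (update f a b)
  have "Poly_Mapping.update a b f = f + Poly_Mapping.single a b"
    using update by (intro poly_mapping_eqI)
      (auto simp: lookup_update lookup_add lookup_single when_def in_keys_iff)
  then show ?case using update single add by simp
qed

lemma sum_fun_apply: "(\<Sum>a\<in>A. f a) x = (\<Sum>a\<in>A. f a x)"
  by (induction A rule: infinite_finite_induct) auto

lemma poly_mapping_expand:
  "f = (\<Sum>k\<in>Poly_Mapping.keys f. Poly_Mapping.single k (Poly_Mapping.lookup f k))"
  by (rule poly_mapping_eqI)
    (auto simp: lookup_sum lookup_single when_def in_keys_iff)

section \<open>Multi-indices and their total degree\<close>

definition mdeg :: "('n::finite \<Rightarrow>\<^sub>0 nat) \<Rightarrow> nat" where
  "mdeg \<alpha> = (\<Sum>j\<in>UNIV. Poly_Mapping.lookup \<alpha> j)"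

abbreviation unit_idx :: "'n \<Rightarrow> ('n \<Rightarrow>\<^sub>0 nat)" where
  "unit_idx i \<equiv> Poly_Mapping.single i 1"

lemma mdeg_add [simp]: "mdeg (\<alpha> + \<beta>) = mdeg \<alpha> + mdeg \<beta>"
  by (simp add: mdeg_def lookup_add sum.distrib)

lemma mdeg_single [simp]: "mdeg (Poly_Mapping.single i k) = k"
  by (simp add: mdeg_def lookup_single when_def)

lemma mdeg_zero [simp]: "mdeg 0 = 0"
  by (simp add: mdeg_def)

lemma mdeg_eq_0_iff [simp]: "mdeg \<alpha> = 0 \<longleftrightarrow> \<alpha> = 0"
  by (auto simp: mdeg_def intro!: poly_mapping_eqI)

lemma lookup_le_mdeg: "Poly_Mapping.lookup \<alpha> i \<le> mdeg \<alpha>"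
  unfolding mdeg_def by (rule member_le_sum) auto

lemma idx_minus_add:
  "Poly_Mapping.lookup \<alpha> i \<noteq> 0 \<Longrightarrow> \<alpha> - unit_idx i + unit_idx i = (\<alpha> :: 'n \<Rightarrow>\<^sub>0 nat)"
  by (rule poly_mapping_eqI) (auto simp: lookup_add lookup_minus lookup_single when_def)

lemma mdeg_minus_unit:
  "Poly_Mapping.lookup \<alpha> i \<noteq> 0 \<Longrightarrow> Suc (mdeg (\<alpha> - unit_idx i)) = mdeg \<alpha>"
  using mdeg_add[of "\<alpha> - unit_idx i" "unit_idx i"] by (simp add: idx_minus_add del: mdeg_add)

lemma multi_idx_induct [case_names zero step]:
  fixes \<alpha> :: "'n::finite \<Rightarrow>\<^sub>0 nat"
  assumes "P 0" and step: "\<And>\<alpha> i. P \<alpha> \<Longrightarrow> P (\<alpha> + unit_idx i)"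
  shows "P \<alpha>"
proof (induction "mdeg \<alpha>" arbitrary: \<alpha>)
  case 0
  then show ?case using assms by simp
next
  case (Suc m)
  then obtain i where i: "Poly_Mapping.lookup \<alpha> i \<noteq> 0"
    by (metis mdeg_eq_0_iff lookup_zero nat.distinct(1) poly_mapping_eqI)
  then have "P (\<alpha> - unit_idx i)"
    using Suc mdeg_minus_unit[OF i] by auto
  then show ?case using step idx_minus_add[OF i] by metis
qed

lemma finite_mdeg_le: "finite {\<alpha> :: 'n::finite \<Rightarrow>\<^sub>0 nat. mdeg \<alpha> \<le> N}"
proof (rule finite_imageD)
  show "finite (Poly_Mapping.lookup ` {\<alpha> :: 'n \<Rightarrow>\<^sub>0 nat. mdeg \<alpha> \<le> N})"
  proof (rule finite_subset)
    show "Poly_Mapping.lookup ` {\<alpha> :: 'n \<Rightarrow>\<^sub>0 nat. mdeg \<alpha> \<le> N} \<subseteq> (UNIV \<rightarrow>\<^sub>E {..N})"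
      using lookup_le_mdeg le_trans by (fastforce simp: PiE_def)
    show "finite (UNIV \<rightarrow>\<^sub>E {..N} :: ('n \<Rightarrow> nat) set)"
      by (rule finite_PiE) auto
  qed
  show "inj_on Poly_Mapping.lookup {\<alpha> :: 'n \<Rightarrow>\<^sub>0 nat. mdeg \<alpha> \<le> N}"
    by (auto intro: inj_onI poly_mapping_eqI)
qed

section \<open>Partial derivatives of polynomials\<close>

lemma pdiff_eq_sum:
  assumes "finite A" "Poly_Mapping.keys p \<subseteq> A"
  shows "pdiff i p = (\<Sum>\<alpha>\<in>A. Poly_Mapping.single (\<alpha> - unit_idx i)
     (of_nat (Poly_Mapping.lookup \<alpha> i) * Poly_Mapping.lookup p \<alpha>))"
  unfolding pdiff_def using assms by (intro sum.mono_neutral_left) (auto simp: in_keys_iff)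

lemma pdiff_add: "pdiff i (p + q) = pdiff i p + pdiff i q"
proof -
  let ?A = "Poly_Mapping.keys p \<union> Poly_Mapping.keys q"
  show ?thesis
    using keys_add[of p q]
    by (subst (1 2 3) pdiff_eq_sum[of ?A])
      (auto simp: lookup_add algebra_simps single_add sum.distrib)
qed

lemma pdiff_single:
  "pdiff i (Poly_Mapping.single \<alpha> c)
   = Poly_Mapping.single (\<alpha> - unit_idx i) (of_nat (Poly_Mapping.lookup \<alpha> i) * c)"
  by (subst pdiff_eq_sum[of "{\<alpha>}"]) auto

lemma pdiff_fscale: "pdiff i (fscale c p) = fscale c (pdiff i p)"
  by (induction p rule: poly_mapping_induct)
    (simp_all add: pdiff_single pdiff_add pm.scale_right_distrib mult.left_commute)

lemma pdiff_zero [simp]: "pdiff i 0 = 0"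
  by (simp add: pdiff_def)

lemma pdiff_mult: "pdiff i (p * q) = pdiff i p * q + p * pdiff i q"
proof (induction p rule: poly_mapping_induct)
  case (single \<alpha> a)
  show ?case
  proof (induction q rule: poly_mapping_induct)
    case (single \<beta> b)
    \<comment> \<open>Subtraction of exponents is truncated, so it commutes with addition only where
      the exponent of t_i is positive; where it is 0, the coefficient in \<open>pdiff\<close>
      vanishes as well.\<close>
    have 1: "\<alpha> - unit_idx i + \<beta> = \<alpha> + \<beta> - unit_idx i" if "Poly_Mapping.lookup \<alpha> i \<noteq> 0"
      using that by (intro poly_mapping_eqI) (auto simp: lookup_add lookup_minus lookup_single when_def)
    have 2: "\<alpha> + (\<beta> - unit_idx i) = \<alpha> + \<beta> - unit_idx i" if "Poly_Mapping.lookup \<beta> i \<noteq> 0"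
      using that by (intro poly_mapping_eqI) (auto simp: lookup_add lookup_minus lookup_single when_def)
    show ?case
      using 1 2
      by (cases "Poly_Mapping.lookup \<alpha> i = 0"; cases "Poly_Mapping.lookup \<beta> i = 0")
        (auto simp: pdiff_single mult_single lookup_add algebra_simps simp flip: single_add)
  qed (simp add: pdiff_add algebra_simps)
qed (simp add: pdiff_add algebra_simps)

lemma pdiff_tvar [simp]: "pdiff i (tvar j) = (if i = j then 1 else 0)"
  by (auto simp: pdiff_single lookup_single when_def)

lemma pdiff_one [simp]: "pdiff i 1 = 0"
  using pdiff_single[of i 0 1] by simp

lemma pdiff_commute: "pdiff i (pdiff j p) = pdiff j (pdiff i p)"
proof (induction p rule: poly_mapping_induct)
  case (single \<alpha> c)
  have "\<alpha> - unit_idx i - unit_idx j = \<alpha> - unit_idx j - unit_idx i"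
    by (intro poly_mapping_eqI) (auto simp: lookup_minus lookup_single when_def)
  then show ?case
    by (auto simp: pdiff_single lookup_minus lookup_single when_def algebra_simps)
qed (simp add: pdiff_add)

section \<open>Derivations and polynomial vector fields\<close>

lemma derivation_add: "D \<in> derivations \<Longrightarrow> D (p + q) = D p + D q"
  and derivation_fscale: "D \<in> derivations \<Longrightarrow> D (fscale c p) = fscale c (D p)"
  and derivation_mult: "D \<in> derivations \<Longrightarrow> D (p * q) = D p * q + p * D q"
  by (auto simp: derivations_def)

lemma derivation_zero: "D \<in> derivations \<Longrightarrow> D 0 = 0"
  using derivation_fscale[of D 0 0] by simp

lemma derivation_one: "D \<in> derivations \<Longrightarrow> D 1 = 0"
  using derivation_mult[of D 1 1] by simp

lemma derivation_sum: "D \<in> derivations \<Longrightarrow> D (sum f A) = (\<Sum>a\<in>A. D (f a))"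
  by (induction A rule: infinite_finite_induct) (auto simp: derivation_zero derivation_add)

text \<open>The Leibniz rule carries agreement from the variables to all monomials. Most later
  identities between brackets of fields are checked on the variables through this rule.\<close>

lemma derivation_eqI:
  assumes "D \<in> derivations" "D' \<in> derivations" "\<And>j. D (tvar j) = D' (tvar (j::'n::finite))"
  shows "D = D'"
proof
  have mon: "D (tmonom \<alpha>) = D' (tmonom \<alpha>)" for \<alpha>
  proof (induction \<alpha> rule: multi_idx_induct)
    case zero
    show ?case using assms by (simp add: derivation_one)
  next
    case (step \<alpha> i)
    have "tmonom (\<alpha> + unit_idx i) = tmonom \<alpha> * (tvar i :: 'n cpoly)"
      by (simp add: mult_single)
    then show ?case using step assms by (simp add: derivation_mult)
  qed
  show "D p = D' p" for p
  proof (induction p rule: poly_mapping_induct)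
    case (single \<alpha> c)
    have "Poly_Mapping.single \<alpha> c = fscale c (tmonom \<alpha>)" by simp
    then show ?case using mon assms by (metis derivation_fscale)
  qed (use assms in \<open>simp add: derivation_add\<close>)
qed

definition fld :: "'n cpoly \<Rightarrow> 'n \<Rightarrow> 'n poly_op" where
  "fld p j = (\<lambda>q. p * pdiff j q)"

lemma monom_field_eq_fld: "monom_field \<alpha> j = fld (tmonom \<alpha>) j"
  by (simp add: monom_field_def fld_def)

lemma pdiff_eq_fld: "pdiff j = fld 1 j"
  by (simp add: fld_def fun_eq_iff)

lemma fld_derivation [simp, intro]: "fld p j \<in> derivations"
  by (auto simp: fld_def derivations_def pdiff_add pdiff_fscale pdiff_mult fscale_mult_right
      distrib_left mult.assoc mult.left_commute)

lemma pdiff_derivation [simp, intro]: "pdiff j \<in> derivations"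
  by (simp add: pdiff_eq_fld)

lemma fld_tvar [simp]: "fld p j (tvar i) = (if j = i then p else 0)"
  by (simp add: fld_def)

lemma fld_add: "fld (p + q) j = fld p j + fld q j"
  and fld_fscale: "fld (fscale c p) j = op_scale c (fld p j)"
  and fld_diff: "fld (p - q) j = fld p j - fld q j"
  by (simp_all add: fld_def op_scale_def fun_eq_iff distrib_right left_diff_distrib fscale_mult_left)

lemma fld_zero [simp]: "fld 0 j = 0"
  by (simp add: fld_def fun_eq_iff)

lemma fld_sum: "fld (sum f A) j = (\<Sum>a\<in>A. fld (f a) j)"
  by (induction A rule: infinite_finite_induct) (auto simp: fld_add)

lemma derivations_subspace: "op.subspace (derivations :: 'n poly_op set)"
  by (auto simp: op.subspace_def derivations_def op_scale_def algebra_simps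
      pm.scale_right_distrib fscale_mult_left fscale_mult_right pm.scale_left_commute)

lemmas derivations_closed =
  op.subspace_0[OF derivations_subspace] op.subspace_add[OF derivations_subspace]
  op.subspace_scale[OF derivations_subspace] op.subspace_diff[OF derivations_subspace]
  op.subspace_neg[OF derivations_subspace] op.subspace_sum[OF derivations_subspace]

lemma derivation_expand:
  fixes D :: "'n::finite poly_op"
  assumes "D \<in> derivations"
  shows "D = (\<Sum>j\<in>UNIV. fld (D (tvar j)) j)"
proof (rule derivation_eqI)
  show "(\<Sum>j\<in>UNIV. fld (D (tvar j)) j) \<in> derivations"
    by (intro derivations_closed) auto
  show "D (tvar i) = (\<Sum>j\<in>UNIV. fld (D (tvar j)) j) (tvar i)" for i
    by (simp add: sum_fun_apply sum.delta' cong: if_cong)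
qed (fact assms)

lemma derivation_apply:
  fixes D :: "'n::finite poly_op"
  assumes "D \<in> derivations"
  shows "D p = (\<Sum>j\<in>UNIV. D (tvar j) * pdiff j p)"
  using fun_cong[OF derivation_expand[OF assms], of p] by (simp add: sum_fun_apply fld_def)

lemma bracket_derivation:
  assumes "D \<in> derivations" "D' \<in> derivations"
  shows "(\<lambda>p. D (D' p) - D' (D p)) \<in> derivations"
  using assms
  by (auto simp: derivations_def algebra_simps pm.scale_right_diff_distrib)

lemma lset_witt [simp]: "lset witt = derivations"
  and lscale_witt [simp]: "lscale witt = op_scale"
  and lbracket_witt: "lbracket witt D D' = (\<lambda>p. D (D' p) - D' (D p))"
  by (simp_all add: witt_def)

lemma lset_witt_nonneg [simp]: "lset witt_nonneg = witt_ge 0"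
  and lscale_witt_nonneg [simp]: "lscale witt_nonneg = op_scale"
  and lbracket_witt_nonneg: "lbracket witt_nonneg D D' = (\<lambda>p. D (D' p) - D' (D p))"
  by (simp_all add: witt_def witt_nonneg_def)

lemma bracket_fld:
  "lbracket witt (fld p i) (fld q j) = fld (p * pdiff i q) j - fld (q * pdiff j p) i"
  by (auto simp: lbracket_witt fld_def fun_eq_iff pdiff_mult algebra_simps pdiff_commute)

lemma lbracket_witt_derivation [simp]:
  "D \<in> derivations \<Longrightarrow> D' \<in> derivations \<Longrightarrow> lbracket witt D D' \<in> derivations"
  by (simp add: lbracket_witt bracket_derivation)

section \<open>The filtration by the order of vanishing at the origin\<close>

definition ord_ge :: "int \<Rightarrow> 'n::finite cpoly \<Rightarrow> bool" where
  "ord_ge k p \<longleftrightarrow> (\<forall>\<alpha>\<in>Poly_Mapping.keys p. k \<le> int (mdeg \<alpha>))"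

lemma ord_ge_zero [simp]: "ord_ge k 0"
  by (simp add: ord_ge_def)

lemma ord_ge_nonpos: "k \<le> 0 \<Longrightarrow> ord_ge k p"
  by (auto simp: ord_ge_def)

lemma ord_ge_mono: "ord_ge k p \<Longrightarrow> l \<le> k \<Longrightarrow> ord_ge l p"
  by (force simp: ord_ge_def)

lemma ord_ge_add: "ord_ge k p \<Longrightarrow> ord_ge k q \<Longrightarrow> ord_ge k (p + q)"
  using keys_add[of p q] by (auto simp: ord_ge_def)

lemma ord_ge_fscale: "ord_ge k p \<Longrightarrow> ord_ge k (fscale c p)"
  by (auto simp: ord_ge_def in_keys_iff)

lemma ord_ge_diff: "ord_ge k p \<Longrightarrow> ord_ge k q \<Longrightarrow> ord_ge k (p - q)"
  using ord_ge_add[of k p "fscale (-1) q"] ord_ge_fscale[of k q "-1"] by simp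

lemma ord_ge_sum: "(\<And>a. a \<in> A \<Longrightarrow> ord_ge k (f a)) \<Longrightarrow> ord_ge k (sum f A)"
  by (induction A rule: infinite_finite_induct) (auto intro: ord_ge_add)

lemma ord_ge_mult: "ord_ge k p \<Longrightarrow> ord_ge l q \<Longrightarrow> ord_ge (k + l) (p * q)"
  using keys_mult[of p q] by (fastforce simp: ord_ge_def)

lemma ord_ge_single: "k \<le> int (mdeg \<alpha>) \<Longrightarrow> ord_ge k (Poly_Mapping.single \<alpha> c)"
  by (auto simp: ord_ge_def)

lemma ord_ge_pdiff: 
  assumes "ord_ge k p" shows "ord_ge (k - 1) (pdiff i p)"
  unfolding pdiff_def
proof (rule ord_ge_sum)
  fix \<alpha> assume "\<alpha> \<in> Poly_Mapping.keys p"
  then have k: "k \<le> int (mdeg \<alpha>)" using assms by (auto simp: ord_ge_def)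
  show "ord_ge (k - 1) (Poly_Mapping.single (\<alpha> - unit_idx i)
          (of_nat (Poly_Mapping.lookup \<alpha> i) * Poly_Mapping.lookup p \<alpha>))"
    using k mdeg_minus_unit[of \<alpha> i]
    by (cases "Poly_Mapping.lookup \<alpha> i = 0") (auto intro!: ord_ge_single)
qed

text \<open>Coefficients of order r + 1 raise the order by r, because each partial derivative costs
  one. Orders are integers so that r = -1, the case of constant fields, is covered.\<close>

lemma ord_ge_derivation:
  assumes "D \<in> derivations" "\<And>j. ord_ge (r + 1) (D (tvar j))" "ord_ge k p"
  shows "ord_ge (k + r) (D p)"
proof -
  have "ord_ge ((r + 1) + (k - 1)) (D (tvar j) * pdiff j p)" for j
    using assms by (intro ord_ge_mult ord_ge_pdiff)
  then show ?thesis
    unfolding derivation_apply[OF assms(1), of p] by (intro ord_ge_sum) (simp add: add.commute)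
qed

text \<open>From here on the filtration is handled through orders of coefficients instead of spans.
  For the converse, the values on the variables are expanded into monomials, which exhibits D as a
  combination of monomial fields of degree at least r.\<close>

lemma witt_ge_iff:
  "D \<in> witt_ge r \<longleftrightarrow> D \<in> derivations \<and> (\<forall>j. ord_ge (r + 1) (D (tvar j)))"
proof
  let ?S = "{D \<in> derivations. \<forall>j. ord_ge (r + 1) (D (tvar j))} :: 'a poly_op set"
  have sub: "op.subspace ?S"
    by (auto simp: op.subspace_def intro!: derivations_closed ord_ge_add)
      (auto simp: op_scale_def intro!: ord_ge_fscale)
  have "witt_grade k \<subseteq> ?S" if "k \<ge> r" for k
    unfolding witt_grade_def using that
    by (intro op.span_minimal sub)
      (auto simp: monom_field_eq_fld simp flip: mdeg_def intro!: ord_ge_single)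
  then have "witt_ge r \<subseteq> ?S"
    unfolding witt_ge_def by (intro op.span_minimal sub) auto
  then show "D \<in> witt_ge r \<Longrightarrow> D \<in> derivations \<and> (\<forall>j. ord_ge (r + 1) (D (tvar j)))"
    by auto
  assume D: "D \<in> derivations \<and> (\<forall>j. ord_ge (r + 1) (D (tvar j)))"
  have "fld (Poly_Mapping.single \<alpha> (Poly_Mapping.lookup (D (tvar j)) \<alpha>)) j \<in> witt_ge r"
    if "\<alpha> \<in> Poly_Mapping.keys (D (tvar j))" for \<alpha> j
  proof -
    have "r + 1 \<le> int (mdeg \<alpha>)" using D that by (auto simp: ord_ge_def)
    then have "monom_field \<alpha> j \<in> witt_ge r"
      unfolding witt_ge_def witt_grade_def
      by (intro op.span_base UN_I[of "int (mdeg \<alpha>) - 1"] CollectI exI[of _ \<alpha>] exI[of _ j])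
        (auto simp: mdeg_def)
    then show ?thesis
      using fld_fscale[of "Poly_Mapping.lookup (D (tvar j)) \<alpha>" "tmonom \<alpha>" j]
      by (auto simp: monom_field_eq_fld witt_ge_def intro: op.span_scale)
  qed
  then have "fld (D (tvar j)) j \<in> witt_ge r" for j
    by (subst poly_mapping_expand) (auto simp: fld_sum witt_ge_def intro: op.span_sum)
  then show "D \<in> witt_ge r"
    using D by (subst derivation_expand) (auto simp: witt_ge_def intro: op.span_sum)
qed

lemma witt_ge_derivation: "D \<in> witt_ge r \<Longrightarrow> D \<in> derivations"
  by (simp add: witt_ge_iff)

lemma witt_ge_subspace: "op.subspace (witt_ge r)"
  unfolding witt_ge_def by (rule op.subspace_span)

lemma witt_ge_mono: "r \<le> s \<Longrightarrow> D \<in> witt_ge s \<Longrightarrow> D \<in> witt_ge r"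
  by (auto simp: witt_ge_iff intro: ord_ge_mono)

lemma witt_ge_minus_one: "D \<in> derivations \<Longrightarrow> r \<le> -1 \<Longrightarrow> D \<in> witt_ge r"
  by (auto simp: witt_ge_iff intro: ord_ge_nonpos)

lemma witt_ge_bracket:
  assumes "D \<in> witt_ge r" "D' \<in> witt_ge s"
  shows "lbracket witt D D' \<in> witt_ge (r + s)"
proof -
  have "ord_ge (s + 1 + r) (D (D' (tvar j)))" "ord_ge (r + 1 + s) (D' (D (tvar j)))" for j
    using assms unfolding witt_ge_iff by (blast intro: ord_ge_derivation)+
  then have "ord_ge (r + s + 1) (D (D' (tvar j)))" "ord_ge (r + s + 1) (D' (D (tvar j)))" for j
    by (metis (no_types) ord_ge_mono order_refl add.assoc add.commute)+
  then show ?thesis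
    using assms unfolding witt_ge_iff lbracket_witt
    by (intro conjI allI bracket_derivation ord_ge_diff) auto
qed

lemma fld_witt_ge: "ord_ge (r + 1) p \<Longrightarrow> fld p j \<in> witt_ge r"
  by (simp add: witt_ge_iff)

lemma witt_grade_subset_ge: "r \<le> k \<Longrightarrow> D \<in> witt_grade k \<Longrightarrow> D \<in> witt_ge r"
  unfolding witt_ge_def by (intro op.span_base) auto

lemma witt_ge_induct:
  assumes "D \<in> witt_ge r"
    and sub: "op.subspace {D. P D}" and base: "\<And>k D. k \<ge> r \<Longrightarrow> D \<in> witt_grade k \<Longrightarrow> P D"
  shows "P D"
proof -
  have "witt_ge r \<subseteq> {D. P D}"
    unfolding witt_ge_def using base by (intro op.span_minimal sub) auto
  then show ?thesis using assms(1) by auto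
qed

text \<open>The constant terms of the coefficients are split off. Therefore a subspace stable under
  the part of non-negative degree generates a submodule by constant derivations alone.\<close>

lemma derivation_decompose:
  fixes D :: "'n::finite poly_op"
  assumes "D \<in> derivations"
  obtains D' where "D' \<in> witt_ge 0"
    "D = (\<Sum>j\<in>UNIV. op_scale (Poly_Mapping.lookup (D (tvar j)) 0) (pdiff j)) + D'"
proof -
  let ?C = "(\<Sum>j\<in>UNIV. op_scale (Poly_Mapping.lookup (D (tvar j)) 0) (pdiff j))"
  have C: "?C (tvar i) = Poly_Mapping.single 0 (Poly_Mapping.lookup (D (tvar i)) 0)" for i
    by (simp add: sum_fun_apply op_scale_def if_distrib sum.delta fscale_conv_mult cong: if_cong)
  have "D - ?C \<in> derivations"
    using assms by (intro derivations_closed) auto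
  moreover have "ord_ge 1 ((D - ?C) (tvar i))" for i
    unfolding minus_apply C
  proof -
    have "\<alpha> \<noteq> 0" if "\<alpha> \<in> Poly_Mapping.keys (D (tvar i) -
         Poly_Mapping.single 0 (Poly_Mapping.lookup (D (tvar i)) 0))" for \<alpha>
      using that by (auto simp: in_keys_iff lookup_minus)
    then have "mdeg \<alpha> \<noteq> 0" if "\<alpha> \<in> Poly_Mapping.keys (D (tvar i) -
         Poly_Mapping.single 0 (Poly_Mapping.lookup (D (tvar i)) 0))" for \<alpha>
      using that mdeg_eq_0_iff by blast
    then show "ord_ge 1 (D (tvar i) - Poly_Mapping.single 0 (Poly_Mapping.lookup (D (tvar i)) 0))"
      unfolding ord_ge_def by fastforce
  qed
  ultimately have "D - ?C \<in> witt_ge 0" by (simp add: witt_ge_iff)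
  then show ?thesis by (rule that) simp
qed

section \<open>Modules over the complex numbers and their quotients\<close>

lemma complex_ring_simps [simp]:
  "carrier complex_ring = UNIV" "mult complex_ring = (*)" "one complex_ring = 1"
  "zero complex_ring = 0" "add complex_ring = (+)"
  by (simp_all add: complex_ring_def)

lemma cring_complex_ring: "cring complex_ring"
proof (rule cringI)
  show "abelian_group complex_ring"
    by (rule abelian_groupI) (auto simp: algebra_simps intro: exI[of _ "- x" for x])
  show "Group.comm_monoid complex_ring"
    by (rule comm_monoidI) (auto simp: algebra_simps)
qed (auto simp: algebra_simps)

locale cmod =
  fixes V :: "('a, 'v) op_module" (structure)
  assumes module: "Module.module complex_ring V"
begin

sublocale mm: Module.module complex_ring V
  by (rule module)

lemma add_closed [simp]: "x \<in> carrier V \<Longrightarrow> y \<in> carrier V \<Longrightarrow> x \<oplus> y \<in> carrier V"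
  and zero_closed [simp]: "\<zero> \<in> carrier V"
  and smult_closed [simp]: "x \<in> carrier V \<Longrightarrow> c \<odot> x \<in> carrier V"
  and add_zero [simp]: "x \<in> carrier V \<Longrightarrow> x \<oplus> \<zero> = x"
  and zero_add [simp]: "x \<in> carrier V \<Longrightarrow> \<zero> \<oplus> x = x"
  and diff_closed [simp]: "x \<in> carrier V \<Longrightarrow> y \<in> carrier V \<Longrightarrow> x \<ominus> y \<in> carrier V"
  using mm.smult_closed[of c x] by auto

lemma smult_add: "x \<in> carrier V \<Longrightarrow> y \<in> carrier V \<Longrightarrow> c \<odot> (x \<oplus> y) = c \<odot> x \<oplus> c \<odot> y"
  and add_smult: "x \<in> carrier V \<Longrightarrow> (c + d) \<odot> x = c \<odot> x \<oplus> d \<odot> x"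
  and smult_smult: "x \<in> carrier V \<Longrightarrow> c \<odot> (d \<odot> x) = (c * d) \<odot> x"
  and one_smult [simp]: "x \<in> carrier V \<Longrightarrow> 1 \<odot> x = x"
  and zero_smult [simp]: "x \<in> carrier V \<Longrightarrow> 0 \<odot> x = \<zero>"
  and smult_zero [simp]: "c \<odot> \<zero> = \<zero>"
  using mm.smult_r_distr[of c x y] mm.smult_l_distr[of c d x] mm.smult_assoc1[of c d x]
    mm.smult_one[of x] mm.smult_l_null[of x] mm.smult_r_null[of c]
  by auto

lemma uminus_eq_smult: "x \<in> carrier V \<Longrightarrow> \<ominus> x = (-1) \<odot> x"
  using add_smult[of x "-1" 1] by (intro mm.M.minus_equality) auto

lemma diff_eq_smult: "x \<in> carrier V \<Longrightarrow> y \<in> carrier V \<Longrightarrow> x \<ominus> y = x \<oplus> (-1) \<odot> y"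
  by (simp add: a_minus_def uminus_eq_smult)

lemma diff_self [simp]: "x \<in> carrier V \<Longrightarrow> x \<ominus> x = \<zero>"
  by (simp add: a_minus_def mm.M.r_neg)

lemma diff_eq_zero_iff: "x \<in> carrier V \<Longrightarrow> y \<in> carrier V \<Longrightarrow> x \<ominus> y = \<zero> \<longleftrightarrow> x = y"
  by (metis add_zero a_minus_def mm.M.a_assoc mm.M.a_inv_closed mm.M.l_neg mm.M.r_neg zero_add)

lemma submodule_iff:
  "submodule N complex_ring V \<longleftrightarrow> N \<subseteq> carrier V \<and> \<zero> \<in> N \<and>
     (\<forall>x\<in>N. \<forall>y\<in>N. x \<oplus> y \<in> N) \<and> (\<forall>c. \<forall>x\<in>N. c \<odot> x \<in> N)"
proof
  assume N: "submodule N complex_ring V"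
  interpret subgroup N "add_monoid V" using N by (rule submodule.axioms)
  show "N \<subseteq> carrier V \<and> \<zero> \<in> N \<and>
     (\<forall>x\<in>N. \<forall>y\<in>N. x \<oplus> y \<in> N) \<and> (\<forall>c. \<forall>x\<in>N. c \<odot> x \<in> N)"
    using submodule.smult_closed[OF N] subset m_closed one_closed by auto
next
  assume N: "N \<subseteq> carrier V \<and> \<zero> \<in> N \<and>
     (\<forall>x\<in>N. \<forall>y\<in>N. x \<oplus> y \<in> N) \<and> (\<forall>c. \<forall>x\<in>N. c \<odot> x \<in> N)"
  then have "\<ominus> x \<in> N" if "x \<in> N" for x
    using uminus_eq_smult[of x] that by auto
  then show "submodule N complex_ring V"
    using N by (intro mm.submoduleI) auto
qed

end

locale csub = cmod +
  fixes N
  assumes submod: "submodule N complex_ring V"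
begin

lemma N_carrier: "x \<in> N \<Longrightarrow> x \<in> carrier V"
  and N_zero [simp]: "\<zero> \<in> N"
  and N_add: "x \<in> N \<Longrightarrow> y \<in> N \<Longrightarrow> x \<oplus> y \<in> N"
  and N_smult: "x \<in> N \<Longrightarrow> c \<odot> x \<in> N"
  using submod by (auto simp: submodule_iff)

sublocale ab: abelian_subgroup N V
proof (rule abelian_subgroupI3)
  show "additive_subgroup N V"
    using submod by (intro additive_subgroup.intro) (rule submodule.axioms)
qed (rule mm.M.abelian_group_axioms)

lemma cls_def: "N +> x = {n \<oplus> x | n. n \<in> N}"
  unfolding a_r_coset_def' by auto

lemma diff_add: "x \<in> carrier V \<Longrightarrow> y \<in> carrier V \<Longrightarrow> (x \<ominus> y) \<oplus> y = x"
  by (simp add: a_minus_def mm.M.a_assoc mm.M.l_neg)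

lemma add_diff: "x \<in> carrier V \<Longrightarrow> y \<in> carrier V \<Longrightarrow> (x \<oplus> y) \<ominus> y = x"
  by (simp add: a_minus_def mm.M.a_assoc mm.M.r_neg)

lemma cls_eq_iff:
  assumes "x \<in> carrier V" "y \<in> carrier V"
  shows "N +> x = N +> y \<longleftrightarrow> x \<ominus> y \<in> N"
proof
  assume "N +> x = N +> y"
  then have "x \<in> N +> y" using ab.a_rcos_self[OF assms(1)] by simp
  then obtain n where "n \<in> N" "x = n \<oplus> y" unfolding cls_def by blast
  then show "x \<ominus> y \<in> N" using assms N_carrier add_diff by simp
next
  assume "x \<ominus> y \<in> N"
  then have "x \<in> N +> y" unfolding cls_def using diff_add[OF assms] by force
  then show "N +> x = N +> y" using ab.a_repr_independence' assms by simp
qed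

lemma cls_self: "x \<in> carrier V \<Longrightarrow> x \<in> N +> x"
  by (rule ab.a_rcos_self)

lemma mem_cls: "x \<in> carrier V \<Longrightarrow> y \<in> N +> x \<longleftrightarrow> y \<in> carrier V \<and> y \<ominus> x \<in> N"
  using cls_eq_iff[of y x] ab.a_repr_independence'[of y x] ab.a_rcos_self[of y]
    ab.a_elemrcos_carrier[of x y] by auto

lemma cls_eq_N_iff: "x \<in> carrier V \<Longrightarrow> N +> x = N \<longleftrightarrow> x \<in> N"
  using ab.a_rcos_const ab.a_rcos_self by blast

lemma carrier_quot: "carrier (quot_module V N) = (\<lambda>x. N +> x) ` carrier V"
  by (auto simp: quot_module_def A_RCOSETS_def')

lemma zero_quot: "zero (quot_module V N) = N"
  by (simp add: quot_module_def)

lemma cls_zero: "N +> \<zero> = N"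
  by (simp add: cls_eq_N_iff)

lemma add_quot:
  "x \<in> carrier V \<Longrightarrow> y \<in> carrier V \<Longrightarrow>
     (N +> x) \<oplus>\<^bsub>quot_module V N\<^esub> (N +> y) = N +> (x \<oplus> y)"
  by (simp add: quot_module_def ab.a_rcos_sum)

text \<open>Operators on \<open>quot_module\<close> are unions over all representatives of a coset.
  If T preserves N, all representatives contribute the same coset and the union collapses.\<close>

lemma lift_quot:
  assumes "x \<in> carrier V" and T: "\<And>y. y \<in> carrier V \<Longrightarrow> T y \<in> carrier V"
    "\<And>y z. y \<in> carrier V \<Longrightarrow> z \<in> carrier V \<Longrightarrow> T (y \<oplus> z) = T y \<oplus> T z"
    "\<And>y. y \<in> N \<Longrightarrow> T y \<in> N"
  shows "(\<Union>y\<in>N +> x. N +> T y) = N +> T x"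
proof -
  have "N +> T y = N +> T x" if y: "y \<in> N +> x" for y
  proof -
    obtain n where n: "n \<in> N" "y = n \<oplus> x" using y unfolding cls_def by blast
    then have "T y = T n \<oplus> T x" using assms N_carrier by auto
    then have "T y \<in> N +> T x" using n T unfolding cls_def by blast
    then show ?thesis using ab.a_repr_independence'[of "T y" "T x"] T assms by auto
  qed
  then show ?thesis using cls_self[OF assms(1)] by blast
qed

lemma smult_quot:
  "x \<in> carrier V \<Longrightarrow> c \<odot>\<^bsub>quot_module V N\<^esub> (N +> x) = N +> (c \<odot> x)"
  by (simp add: quot_module_def lift_quot smult_add N_smult)

lemma act_quot:
  assumes "x \<in> carrier V" "\<And>y. y \<in> carrier V \<Longrightarrow> act V a y \<in> carrier V"
    "\<And>y z. y \<in> carrier V \<Longrightarrow> z \<in> carrier V \<Longrightarrow> act V a (y \<oplus> z) = act V a y \<oplus> act V a z"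
    "\<And>y. y \<in> N \<Longrightarrow> act V a y \<in> N"
  shows "act (quot_module V N) a (N +> x) = N +> act V a x"
  using lift_quot[of x "act V a"] assms by (simp add: quot_module_def)

lemma quot_cmod: "cmod (quot_module V N)"
proof (rule cmod.intro, rule Module.moduleI)
  let ?Q = "quot_module V N"
  show "cring complex_ring" by (rule cring_complex_ring)
  show "abelian_group ?Q"
  proof (rule abelian_groupI)
    fix X assume "X \<in> carrier ?Q"
    then obtain x where "x \<in> carrier V" "X = N +> x" by (auto simp: carrier_quot)
    then show "\<exists>Y\<in>carrier ?Q. Y \<oplus>\<^bsub>?Q\<^esub> X = \<zero>\<^bsub>?Q\<^esub>"
      by (intro bexI[of _ "N +> (\<ominus> x)"])
        (auto simp: carrier_quot zero_quot add_quot mm.M.l_neg cls_zero)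
  qed (auto simp: carrier_quot zero_quot add_quot mm.M.a_ac cls_zero
      add_quot[of \<zero>, simplified cls_zero] intro: image_eqI[where x = \<zero>])
qed (auto simp: carrier_quot add_quot smult_quot smult_add add_smult smult_smult)

lemma diff_quot:
  assumes "x \<in> carrier V" "y \<in> carrier V"
  shows "(N +> x) \<ominus>\<^bsub>quot_module V N\<^esub> (N +> y) = N +> (x \<ominus> y)"
proof -
  interpret Q: cmod "quot_module V N" by (rule quot_cmod)
  show ?thesis using assms
    by (simp add: Q.diff_eq_smult carrier_quot smult_quot add_quot diff_eq_smult)
qed

end

section \<open>Lie modules, their submodules and quotients\<close>

definition lie_closed :: "'g::ab_group_add lie_algebra \<Rightarrow> bool" where
  "lie_closed L \<longleftrightarrow> (\<forall>x\<in>lset L. \<forall>y\<in>lset L. x + y \<in> lset L \<and> lbracket L x y \<in> lset L) \<and>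
     (\<forall>c. \<forall>x\<in>lset L. lscale L c x \<in> lset L)"

lemma lie_closed_witt [simp]: "lie_closed witt"
  by (auto simp: lie_closed_def intro!: derivations_closed)

lemma lie_closed_gl [simp]: "lie_closed gl"
  by (simp add: lie_closed_def gl_def)

text \<open>The operators need to satisfy the axioms of a Lie module only modulo \<open>N\<close>.\<close>

lemma quot_lie_module:
  fixes L :: "'g::ab_group_add lie_algebra" and V :: "('g, 'v) op_module" (structure)
  assumes "csub V N" and L: "lie_closed L"
    and act: "\<And>x v. x \<in> lset L \<Longrightarrow> v \<in> carrier V \<Longrightarrow> act V x v \<in> carrier V"
      "\<And>x v w. x \<in> lset L \<Longrightarrow> v \<in> carrier V \<Longrightarrow> w \<in> carrier V \<Longrightarrow>
         act V x (v \<oplus> w) = act V x v \<oplus> act V x w"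
      "\<And>x c v. x \<in> lset L \<Longrightarrow> v \<in> carrier V \<Longrightarrow> act V x (c \<odot> v) = c \<odot> act V x v"
      "\<And>x v. x \<in> lset L \<Longrightarrow> v \<in> N \<Longrightarrow> act V x v \<in> N"
    and mod: "\<And>x y v. x \<in> lset L \<Longrightarrow> y \<in> lset L \<Longrightarrow> v \<in> carrier V \<Longrightarrow>
         act V (x + y) v \<ominus> (act V x v \<oplus> act V y v) \<in> N"
      "\<And>x c v. x \<in> lset L \<Longrightarrow> v \<in> carrier V \<Longrightarrow> act V (lscale L c x) v \<ominus> c \<odot> act V x v \<in> N"
      "\<And>x y v. x \<in> lset L \<Longrightarrow> y \<in> lset L \<Longrightarrow> v \<in> carrier V \<Longrightarrow>
         act V (lbracket L x y) v \<ominus> (act V x (act V y v) \<ominus> act V y (act V x v)) \<in> N"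
  shows "lie_module L (quot_module V N)"
    and "\<And>x v. x \<in> lset L \<Longrightarrow> v \<in> carrier V \<Longrightarrow>
           act (quot_module V N) x (N +> v) = N +> act V x v"
proof -
  interpret csub V N by fact
  interpret Q: cmod "quot_module V N" by (rule quot_cmod)
  show aq: "act (quot_module V N) x (N +> v) = N +> act V x v"
    if "x \<in> lset L" "v \<in> carrier V" for x v
    using that act by (intro act_quot) auto
  have cl: "x + y \<in> lset L" "lbracket L x y \<in> lset L" "lscale L c x \<in> lset L"
    if "x \<in> lset L" "y \<in> lset L" for x y c
    using L that by (auto simp: lie_closed_def)
  show "lie_module L (quot_module V N)"
    unfolding lie_module_def carrier_quot
    using Q.module act mod cl
    by (auto simp: aq add_quot smult_quot diff_quot cls_eq_iff)
qed

locale lmod = cmod V for L :: "'g::ab_group_add lie_algebra" and V :: "('g, 'v) op_module" (structure) +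
  assumes lie_module: "lie_module L V"
begin

lemma act_closed [simp]: "x \<in> lset L \<Longrightarrow> v \<in> carrier V \<Longrightarrow> act V x v \<in> carrier V"
  and act_add: "x \<in> lset L \<Longrightarrow> v \<in> carrier V \<Longrightarrow> w \<in> carrier V \<Longrightarrow>
         act V x (v \<oplus> w) = act V x v \<oplus> act V x w"
  and act_smult: "x \<in> lset L \<Longrightarrow> v \<in> carrier V \<Longrightarrow> act V x (c \<odot> v) = c \<odot> act V x v"
  and add_act: "x \<in> lset L \<Longrightarrow> y \<in> lset L \<Longrightarrow> v \<in> carrier V \<Longrightarrow>
         act V (x + y) v = act V x v \<oplus> act V y v"
  and scale_act: "x \<in> lset L \<Longrightarrow> v \<in> carrier V \<Longrightarrow> act V (lscale L c x) v = c \<odot> act V x v"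
  and bracket_act: "x \<in> lset L \<Longrightarrow> y \<in> lset L \<Longrightarrow> v \<in> carrier V \<Longrightarrow>
         act V (lbracket L x y) v = act V x (act V y v) \<ominus> act V y (act V x v)"
  using lie_module by (auto simp: lie_module_def)

lemma act_zero [simp]: "x \<in> lset L \<Longrightarrow> act V x \<zero> = \<zero>"
  using act_smult[of x \<zero> 0] by simp

lemma act_swap:
  assumes "x \<in> lset L" "y \<in> lset L" "v \<in> carrier V"
  shows "act V x (act V y v) = act V y (act V x v) \<oplus> act V (lbracket L x y) v"
proof -
  let ?a = "act V x (act V y v)" and ?b = "act V y (act V x v)"
  have c: "?a \<in> carrier V" "?b \<in> carrier V" using assms by auto
  have "?b \<oplus> (?a \<ominus> ?b) = ?a"
    using c by (simp add: a_minus_def mm.M.a_lcomm mm.M.r_neg)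
  then show ?thesis using assms by (simp add: bracket_act)
qed

lemma lie_submodule_iff:
  "lie_submodule L W V \<longleftrightarrow> W \<subseteq> carrier V \<and> \<zero> \<in> W \<and> (\<forall>x\<in>W. \<forall>y\<in>W. x \<oplus> y \<in> W) \<and>
     (\<forall>c. \<forall>x\<in>W. c \<odot> x \<in> W) \<and> (\<forall>x\<in>lset L. \<forall>w\<in>W. act V x w \<in> W)"
  by (auto simp: lie_submodule_def submodule_iff)

lemma lie_submodule_quot:
  assumes L: "lie_closed L" and N: "lie_submodule L N V"
  shows "lie_module L (quot_module V N)"
    and "\<And>x v. x \<in> lset L \<Longrightarrow> v \<in> carrier V \<Longrightarrow>
           act (quot_module V N) x (N +>\<^bsub>V\<^esub> v) = N +>\<^bsub>V\<^esub> act V x v"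
proof -
  interpret csub V N
    using N by (intro csub.intro cmod_axioms csub_axioms.intro) (simp add: lie_submodule_def)
  have *: "\<And>x v. x \<in> lset L \<Longrightarrow> v \<in> N \<Longrightarrow> act V x v \<in> N"
    using N by (simp add: lie_submodule_def)
  show "lie_module L (quot_module V N)"
    by (rule quot_lie_module[OF csub_axioms L])
      (simp_all add: act_add act_smult * add_act scale_act bracket_act)
  show "\<And>x v. x \<in> lset L \<Longrightarrow> v \<in> carrier V \<Longrightarrow>
           act (quot_module V N) x (N +>\<^bsub>V\<^esub> v) = N +>\<^bsub>V\<^esub> act V x v"
    by (rule act_quot) (auto simp: act_add *)
qed

end

lemma lie_module_lmod: "lie_module L V \<Longrightarrow> lmod L V"
  by (intro lmod.intro cmod.intro lmod_axioms.intro) (simp_all add: lie_module_def)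

lemma lie_module_iso_simple:
  assumes V: "simple_lie_module L V" and Q: "lie_module L Q" and iso: "lie_module_iso L V Q"
  shows "simple_lie_module L Q"
proof -
  interpret V: lmod L V using V by (intro lie_module_lmod) (simp add: simple_lie_module_def)
  interpret Q: lmod L Q using Q by (rule lie_module_lmod)
  obtain \<phi> where bij: "bij_betw \<phi> (carrier V) (carrier Q)"
    and add: "\<And>v v'. v \<in> carrier V \<Longrightarrow> v' \<in> carrier V \<Longrightarrow> \<phi> (v \<oplus>\<^bsub>V\<^esub> v') = \<phi> v \<oplus>\<^bsub>Q\<^esub> \<phi> v'"
    and smult: "\<And>c v. v \<in> carrier V \<Longrightarrow> \<phi> (c \<odot>\<^bsub>V\<^esub> v) = c \<odot>\<^bsub>Q\<^esub> \<phi> v"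
    and act: "\<And>x v. x \<in> lset L \<Longrightarrow> v \<in> carrier V \<Longrightarrow> \<phi> (act V x v) = act Q x (\<phi> v)"
    using iso by (auto simp: lie_module_iso_def)
  have mem: "\<phi> v \<in> carrier Q" if "v \<in> carrier V" for v using bij that by (auto simp: bij_betw_def)
  have zero: "\<phi> \<zero>\<^bsub>V\<^esub> = \<zero>\<^bsub>Q\<^esub>" using smult[of "\<zero>\<^bsub>V\<^esub>" 0] mem by simp
  have img: "\<phi> ` carrier V = carrier Q" using bij by (simp add: bij_betw_def)
  have "W = {\<zero>\<^bsub>Q\<^esub>} \<or> W = carrier Q" if W: "lie_submodule L W Q" for W
  proof -
    let ?U = "{v \<in> carrier V. \<phi> v \<in> W}"
    have "lie_submodule L ?U V"
      using W unfolding V.lie_submodule_iff Q.lie_submodule_iff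
      by (auto simp: add smult act zero)
    then have "?U = {\<zero>\<^bsub>V\<^esub>} \<or> ?U = carrier V" using V by (auto simp: simple_lie_module_def)
    moreover have "\<phi> ` ?U = W"
    proof -
      have "W \<subseteq> \<phi> ` carrier V" using W img by (simp add: Q.lie_submodule_iff)
      then show ?thesis by auto
    qed
    ultimately show ?thesis using img zero by auto
  qed
  moreover have "carrier Q \<noteq> {\<zero>\<^bsub>Q\<^esub>}"
  proof
    assume "carrier Q = {\<zero>\<^bsub>Q\<^esub>}"
    then have "\<phi> v = \<phi> \<zero>\<^bsub>V\<^esub>" if "v \<in> carrier V" for v using mem[OF that] zero by simp
    then have "carrier V \<subseteq> {\<zero>\<^bsub>V\<^esub>}"
      using bij V.zero_closed unfolding bij_betw_def inj_on_def by blast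
    then have "carrier V = {\<zero>\<^bsub>V\<^esub>}" using V.zero_closed by blast
    then show False using V by (auto simp: simple_lie_module_def)
  qed
  ultimately show ?thesis using Q by (auto simp: simple_lie_module_def)
qed

section \<open>Submodules generated by a module over the non-negative part\<close>

definition idx_list :: "'n::finite list" where
  "idx_list = (SOME xs. distinct xs \<and> set xs = UNIV)"

lemma idx_list: "distinct (idx_list :: 'n::finite list)" "set (idx_list :: 'n list) = UNIV"
proof -
  have "\<exists>xs. distinct xs \<and> set xs = (UNIV :: 'n set)"
    using finite_distinct_list[of "UNIV :: 'n set"] by auto
  then have "distinct (idx_list :: 'n list) \<and> set (idx_list :: 'n list) = UNIV"
    unfolding idx_list_def by (rule someI_ex)
  then show "distinct (idx_list :: 'n list)" "set (idx_list :: 'n list) = UNIV" by auto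
qed

text \<open>The monomial d^\<beta> in a family of operators. The enumeration \<open>idx_list\<close>
  makes it meaningful for any family; for commuting operators the order of the factors is
  immaterial.\<close>

definition mpow :: "('n::finite \<Rightarrow> 'a \<Rightarrow> 'a) \<Rightarrow> ('n \<Rightarrow>\<^sub>0 nat) \<Rightarrow> 'a \<Rightarrow> 'a" where
  "mpow d \<beta> x = foldr (\<lambda>i. d i ^^ Poly_Mapping.lookup \<beta> i) idx_list x"

lemma mpow_zero [simp]: "mpow d 0 x = x"
proof -
  have "foldr (\<lambda>i. d i ^^ Poly_Mapping.lookup 0 i) xs x = x" for xs
    by (induction xs) auto
  then show ?thesis by (simp add: mpow_def)
qed

lemma mpow_induct:
  assumes "Q x" "\<And>i y. Q y \<Longrightarrow> Q (d i y)"
  shows "Q (mpow d \<beta> x)"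
proof -
  have *: "Q ((d i ^^ k) y)" if "Q y" for i k y
    using that assms(2) by (induction k) auto
  have "Q (foldr (\<lambda>i. d i ^^ Poly_Mapping.lookup \<beta> i) xs x)" for xs
    using assms(1) * by (induction xs) auto
  then show ?thesis by (simp add: mpow_def)
qed

text \<open>Commutation is asked on an invariant set C only, because the operators of a module
  commute on its carrier and may be arbitrary outside. The new factor d i moves to the front past
  the other powers; i occurs exactly once in \<open>idx_list\<close>.\<close>

lemma mpow_step:
  assumes x: "x \<in> C" and C: "\<And>i y. y \<in> C \<Longrightarrow> d i y \<in> C"
    and comm: "\<And>i j y. y \<in> C \<Longrightarrow> d i (d j y) = d j (d i y)"
  shows "mpow d (\<beta> + unit_idx i) x = d i (mpow d \<beta> x)"
proof -
  let ?F = "\<lambda>\<beta> xs. foldr (\<lambda>i. d i ^^ Poly_Mapping.lookup \<beta> i) xs x"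
  have powC: "(d j ^^ k) y \<in> C" if "y \<in> C" for j k y
    using that C by (induction k) auto
  have FC: "?F \<beta> xs \<in> C" for \<beta> xs
    using x powC by (induction xs) auto
  have pow: "(d j ^^ k) (d i y) = d i ((d j ^^ k) y)" if "y \<in> C" for j k y
    using that
  proof (induction k)
    case (Suc k)
    then show ?case using comm powC by simp
  qed simp
  have 1: "?F (\<beta> + unit_idx i) xs = ?F \<beta> xs" if "i \<notin> set xs" for xs
    using that by (induction xs) (auto simp: lookup_add lookup_single)
  have 2: "?F (\<beta> + unit_idx i) xs = d i (?F \<beta> xs)" if "distinct xs" "i \<in> set xs" for xs
    using that
  proof (induction xs)
    case (Cons j xs)
    show ?case
    proof (cases "j = i")
      case True
      then show ?thesis using Cons 1[of xs] by (simp add: lookup_add flip: Suc_eq_plus1)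
    next
      case False
      then have "?F (\<beta> + unit_idx i) xs = d i (?F \<beta> xs)" using Cons by simp
      then show ?thesis using False pow FC by (simp add: lookup_add lookup_single)
    qed
  qed simp
  show ?thesis using 2[of idx_list] by (simp add: mpow_def idx_list)
qed

lemma zero_derivation [simp]: "0 \<in> derivations"
  by (rule derivations_closed)

context cmod begin

lemma finsum_additive:
  assumes "\<And>x y. x \<in> carrier V \<Longrightarrow> y \<in> carrier V \<Longrightarrow> T (x \<oplus> y) = T x \<oplus> T y"
    and "T \<zero> = \<zero>" and "\<And>x. x \<in> carrier V \<Longrightarrow> T x \<in> carrier V"
    and "finite A" "\<And>a. a \<in> A \<Longrightarrow> g a \<in> carrier V"
  shows "T (finsum V g A) = finsum V (\<lambda>a. T (g a)) A"
  using assms(4,5)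
proof (induction A rule: finite_induct)
  case (insert a A)
  then have "g \<in> A \<rightarrow> carrier V" "g a \<in> carrier V" by auto
  then show ?case using insert assms(1,3)
    by (simp add: mm.M.finsum_insert Pi_def)
qed (simp add: assms)

lemma finsum_superset:
  assumes "finite B" "A \<subseteq> B" "\<And>i. i \<in> B - A \<Longrightarrow> g i = \<zero>" "\<And>i. i \<in> B \<Longrightarrow> g i \<in> carrier V"
  shows "finsum V g A = finsum V g B"
  using assms by (intro mm.M.add.finprod_mono_neutral_cong_left) auto

end

section \<open>The Euler field as a grading operator\<close>

definition euler :: "'n::finite poly_op" where
  "euler = (\<Sum>j\<in>UNIV. fld (tvar j) j)"

lemma euler_tvar [simp]: "euler (tvar i) = tvar i"
  by (simp add: euler_def sum_fun_apply sum.delta cong: if_cong)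

lemma euler_derivation [simp]: "euler \<in> derivations"
  unfolding euler_def by (intro derivations_closed) auto

lemma euler_witt_ge: "euler \<in> witt_ge 0"
  by (auto simp: witt_ge_iff intro!: ord_ge_single)

lemma bracket_euler_pdiff: "lbracket witt euler (pdiff i) = op_scale (-1) (pdiff i)"
proof (rule derivation_eqI)
  show "lbracket witt euler (pdiff i) (tvar j) = op_scale (- 1) (pdiff i) (tvar j)" for j
    by (simp add: lbracket_witt op_scale_def derivation_one derivation_zero)
qed (auto intro!: derivations_closed)

lemma bracket_pdiff: "lbracket witt (pdiff i) (pdiff j) = 0"
  by (simp add: lbracket_witt fun_eq_iff pdiff_commute)

locale witt_mod = lmod witt V for V :: "('n::finite poly_op, 'v) op_module" (structure)
begin

lemma act_0 [simp]: "v \<in> carrier V \<Longrightarrow> act V 0 v = \<zero>"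
  using scale_act[of 0 v 0] by simp

abbreviation dV :: "'n \<Rightarrow> 'v \<Rightarrow> 'v" where
  "dV i \<equiv> act V (pdiff i)"

lemma dV_commute: "v \<in> carrier V \<Longrightarrow> dV i (dV j v) = dV j (dV i v)"
  using act_swap[of "pdiff i" "pdiff j" v] by (simp add: bracket_pdiff)

lemma mpow_closed [simp]: "v \<in> carrier V \<Longrightarrow> mpow dV \<beta> v \<in> carrier V"
  by (rule mpow_induct[where Q = "\<lambda>v. v \<in> carrier V"]) auto

lemma mpow_Suc: "v \<in> carrier V \<Longrightarrow> mpow dV (\<beta> + unit_idx i) v = dV i (mpow dV \<beta> v)"
  by (rule mpow_step[where C = "carrier V"]) (auto simp: dV_commute)

lemma mpow_add:
  assumes "v \<in> carrier V" "w \<in> carrier V"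
  shows "mpow dV \<beta> (v \<oplus> w) = mpow dV \<beta> v \<oplus> mpow dV \<beta> w"
proof (induction \<beta> rule: multi_idx_induct)
  case (step \<beta> i)
  then show ?case using assms by (simp add: mpow_Suc act_add)
qed simp

lemma mpow_smult:
  assumes "v \<in> carrier V"
  shows "mpow dV \<beta> (c \<odot> v) = c \<odot> mpow dV \<beta> v"
proof (induction \<beta> rule: multi_idx_induct)
  case (step \<beta> i)
  then show ?case using assms by (simp add: mpow_Suc act_smult)
qed simp

lemma mpow_zero_vec [simp]: "mpow dV \<beta> \<zero> = \<zero>"
  using mpow_smult[of \<zero> \<beta> 0] by simp

definition shift :: "complex \<Rightarrow> 'v \<Rightarrow> 'v" where
  "shift c v = act V euler v \<oplus> c \<odot> v"

lemma shift_closed [simp]: "v \<in> carrier V \<Longrightarrow> shift c v \<in> carrier V"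
  by (simp add: shift_def)

lemma shift_add: "v \<in> carrier V \<Longrightarrow> w \<in> carrier V \<Longrightarrow> shift c (v \<oplus> w) = shift c v \<oplus> shift c w"
  by (simp add: shift_def act_add smult_add mm.M.a_ac)

lemma shift_smult: "v \<in> carrier V \<Longrightarrow> shift c (d \<odot> v) = d \<odot> shift c v"
  by (simp add: shift_def act_smult smult_add smult_smult mult.commute)

lemma shift_commute: "v \<in> carrier V \<Longrightarrow> shift c (shift d v) = shift d (shift c v)"
  by (simp add: shift_def act_add act_smult smult_add smult_smult mm.M.a_ac mult.commute)

text \<open>Since [euler, \<partial>_i] = - \<partial>_i, a partial derivative lowers Euler
  eigenvalues by one; pulling it out changes the constant c to c - 1.\<close>

lemma shift_dV:
  assumes "v \<in> carrier V"
  shows "shift c (dV i v) = dV i (shift (c - 1) v)"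
proof -
  have "act V (lbracket witt euler (pdiff i)) v = (-1) \<odot> dV i v"
    using assms scale_act[of "pdiff i" v "-1"] by (simp add: bracket_euler_pdiff)
  then have 1: "act V euler (dV i v) = dV i (act V euler v) \<oplus> (-1) \<odot> dV i v"
    using act_swap[of euler "pdiff i" v] assms by simp
  have "(c - 1) \<odot> dV i v = (-1) \<odot> dV i v \<oplus> c \<odot> dV i v"
    using add_smult[of "dV i v" "-1" c] assms by simp
  then show ?thesis
    using assms 1 by (simp add: shift_def act_add act_smult mm.M.a_assoc)
qed

text \<open>With Eu for the action of the Euler field, this is (Eu - \<mu> + 1) ... (Eu - \<mu> +
  K). It kills the eigenvalues \<mu> - 1, ..., \<mu> - K and is K! on the eigenvalue \<mu>: an
  unnormalized projection.\<close>

fun eproj :: "complex \<Rightarrow> nat \<Rightarrow> 'v \<Rightarrow> 'v" where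
  "eproj \<mu> 0 v = v"
| "eproj \<mu> (Suc K) v = shift (of_nat (Suc K) - \<mu>) (eproj \<mu> K v)"

lemma eproj_closed [simp]: "v \<in> carrier V \<Longrightarrow> eproj \<mu> K v \<in> carrier V"
  by (induction K) auto

lemma eproj_add:
  "v \<in> carrier V \<Longrightarrow> w \<in> carrier V \<Longrightarrow> eproj \<mu> K (v \<oplus> w) = eproj \<mu> K v \<oplus> eproj \<mu> K w"
  by (induction K) (auto simp: shift_add)

lemma eproj_smult: "v \<in> carrier V \<Longrightarrow> eproj \<mu> K (c \<odot> v) = c \<odot> eproj \<mu> K v"
  by (induction K) (auto simp: shift_smult)

text \<open>Pulling out \<partial>_i shifts the constants 1, ..., K + 1 of the factors to 0, ..., K,
  and the factor with constant 0 kills the eigenvalue \<mu>. One factor is spent on the derivative,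
  hence Suc K against K.\<close>

lemma eproj_dV:
  assumes "v \<in> carrier V"
  shows "eproj \<mu> (Suc K) (dV i v) = dV i (shift (- \<mu>) (eproj \<mu> K v))"
proof (induction K)
  case 0
  then show ?case using assms shift_dV[of v "1 - \<mu>" i] by simp
next
  case (Suc K)
  have "eproj \<mu> (Suc (Suc K)) (dV i v)
      = shift (of_nat (Suc (Suc K)) - \<mu>) (dV i (shift (- \<mu>) (eproj \<mu> K v)))"
    using Suc by simp
  also have "\<dots> = dV i (shift (of_nat (Suc K) - \<mu>) (shift (- \<mu>) (eproj \<mu> K v)))"
    using shift_dV[of "shift (- \<mu>) (eproj \<mu> K v)" "of_nat (Suc (Suc K)) - \<mu>" i] assms
    by (simp add: algebra_simps)
  finally show ?case using assms by (simp add: shift_commute)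
qed

lemma eproj_eigen:
  assumes "v \<in> carrier V" "act V euler v = \<mu> \<odot> v"
  shows "eproj \<mu> K v = fact K \<odot> v"
proof (induction K)
  case (Suc K)
  have "shift (of_nat (Suc K) - \<mu>) v = of_nat (Suc K) \<odot> v"
    using assms add_smult[of v \<mu> "of_nat (Suc K) - \<mu>"] by (simp add: shift_def)
  then show ?case using Suc assms by (simp add: shift_smult smult_smult mult.commute)
qed (use assms in simp)

end

text \<open>W stands for an induced module, a tensor module or V itself, and \<iota> for the map
  from E to its generators. Only equivariance under the non-negative part is assumed; how far
  \<iota> extends to V is read off from \<open>tgen\<close>.\<close>

locale lifting = V: witt_mod V + W: witt_mod W
  for V :: "('n::finite poly_op, 'v) op_module" and W :: "('n poly_op, 'w) op_module" +
  fixes E :: "'v set" and \<iota> :: "'v \<Rightarrow> 'w"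
  assumes E_sub: "submodule E complex_ring V"
    and E_act: "\<And>x e. x \<in> witt_ge 0 \<Longrightarrow> e \<in> E \<Longrightarrow> act V x e \<in> E"
    and \<iota>_closed [simp]: "\<And>e. e \<in> E \<Longrightarrow> \<iota> e \<in> carrier W"
    and \<iota>_add: "\<And>e e'. e \<in> E \<Longrightarrow> e' \<in> E \<Longrightarrow> \<iota> (e \<oplus>\<^bsub>V\<^esub> e') = \<iota> e \<oplus>\<^bsub>W\<^esub> \<iota> e'"
    and \<iota>_smult: "\<And>c e. e \<in> E \<Longrightarrow> \<iota> (c \<odot>\<^bsub>V\<^esub> e) = c \<odot>\<^bsub>W\<^esub> \<iota> e"
    and \<iota>_act: "\<And>x e. x \<in> witt_ge 0 \<Longrightarrow> e \<in> E \<Longrightarrow> \<iota> (act V x e) = act W x (\<iota> e)"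
begin

lemma E_carrier [simp]: "e \<in> E \<Longrightarrow> e \<in> carrier V"
  and E_zero [simp]: "\<zero>\<^bsub>V\<^esub> \<in> E"
  and E_add [simp]: "e \<in> E \<Longrightarrow> e' \<in> E \<Longrightarrow> e \<oplus>\<^bsub>V\<^esub> e' \<in> E"
  and E_smult [simp]: "e \<in> E \<Longrightarrow> c \<odot>\<^bsub>V\<^esub> e \<in> E"
  using E_sub by (auto simp: V.submodule_iff)

lemma \<iota>_zero [simp]: "\<iota> \<zero>\<^bsub>V\<^esub> = \<zero>\<^bsub>W\<^esub>"
  using \<iota>_smult[of "\<zero>\<^bsub>V\<^esub>" 0] by simp

text \<open>The submodule of \<open>V \<times> W\<close> generated by the graph of \<open>\<iota>\<close>. Closure under the constant derivations
  suffices, since the part of non-negative degree preserves the graph.\<close>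

inductive_set tgen :: "('v \<times> 'w) set" where
  base: "e \<in> E \<Longrightarrow> (e, \<iota> e) \<in> tgen"
| add: "(v, f) \<in> tgen \<Longrightarrow> (v', f') \<in> tgen \<Longrightarrow> (v \<oplus>\<^bsub>V\<^esub> v', f \<oplus>\<^bsub>W\<^esub> f') \<in> tgen"
| smult: "(v, f) \<in> tgen \<Longrightarrow> (c \<odot>\<^bsub>V\<^esub> v, c \<odot>\<^bsub>W\<^esub> f) \<in> tgen"
| dif: "(v, f) \<in> tgen \<Longrightarrow> (V.dV i v, W.dV i f) \<in> tgen"

lemma tgen_carrier: "(v, f) \<in> tgen \<Longrightarrow> v \<in> carrier V \<and> f \<in> carrier W"
  by (induction rule: tgen.induct) auto

lemma tgen_zero: "(\<zero>\<^bsub>V\<^esub>, \<zero>\<^bsub>W\<^esub>) \<in> tgen"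
  using base[OF E_zero] by simp

lemma tgen_act:
  assumes "(v, f) \<in> tgen" "x \<in> derivations"
  shows "(act V x v, act W x f) \<in> tgen"
  using assms
proof (induction arbitrary: x rule: tgen.induct)
  case (base e)
  define c where "c = (\<lambda>j. Poly_Mapping.lookup (x (tvar j)) 0)"
  obtain x' where x': "x' \<in> witt_ge 0"
    and x: "x = (\<Sum>j\<in>UNIV. op_scale (c j) (pdiff j)) + x'"
    using derivation_decompose[OF base(2)] unfolding c_def .
  have "(act V (\<Sum>j\<in>S. op_scale (c j) (pdiff j)) e, act W (\<Sum>j\<in>S. op_scale (c j) (pdiff j)) (\<iota> e)) \<in> tgen
      \<and> (\<Sum>j\<in>S. op_scale (c j) (pdiff j)) \<in> derivations"
    if "finite S" for S :: "'n set"
    using that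
  proof (induction S rule: finite_induct)
    case empty
    show ?case unfolding sum.empty using base tgen_zero by (simp only: V.act_0 W.act_0 E_carrier \<iota>_closed zero_derivation simp_thms)
  next
    case (insert j S)
    then have d: "op_scale (c j) (pdiff j) \<in> derivations" "(\<Sum>j\<in>S. op_scale (c j) (pdiff j)) \<in> derivations"
      by (auto intro!: derivations_closed)
    have "(c j \<odot>\<^bsub>V\<^esub> V.dV j e, c j \<odot>\<^bsub>W\<^esub> W.dV j (\<iota> e)) \<in> tgen"
      using base by (intro tgen.smult tgen.dif tgen.base)
    then have 1: "(act V (op_scale (c j) (pdiff j)) e, act W (op_scale (c j) (pdiff j)) (\<iota> e)) \<in> tgen"
      using base V.scale_act[of "pdiff j" e "c j"] W.scale_act[of "pdiff j" "\<iota> e" "c j"] by simp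
    have e: "e \<in> carrier V" "\<iota> e \<in> carrier W" using base by simp_all
    note dd = d[folded lset_witt]
    have "(\<Sum>j\<in>insert j S. op_scale (c j) (pdiff j)) = op_scale (c j) (pdiff j) + (\<Sum>j\<in>S. op_scale (c j) (pdiff j))"
      by (rule sum.insert[OF insert(1,2)])
    moreover have "(act V (op_scale (c j) (pdiff j) + (\<Sum>j\<in>S. op_scale (c j) (pdiff j))) e,
        act W (op_scale (c j) (pdiff j) + (\<Sum>j\<in>S. op_scale (c j) (pdiff j))) (\<iota> e)) \<in> tgen"
      unfolding V.add_act[OF dd e(1)] W.add_act[OF dd e(2)]
      by (rule tgen.add) (use 1 insert in auto)
    ultimately show ?case using derivations_closed(2)[OF d] by metis
  qed
  note 1 = this[OF finite]
  have 2: "(act V x' e, act W x' (\<iota> e)) \<in> tgen"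
    using tgen.base[OF E_act[OF x' base(1)]] base x' by (simp add: \<iota>_act)
  show ?case
    using tgen.add[OF conjunct1[OF 1] 2] base x' conjunct2[OF 1]
      V.add_act[of "\<Sum>j\<in>UNIV. op_scale (c j) (pdiff j)" x' e]
      W.add_act[of "\<Sum>j\<in>UNIV. op_scale (c j) (pdiff j)" x' "\<iota> e"]
    by (simp add: witt_ge_derivation flip: x)
next
  case (add v f v' f')
  then show ?case using tgen_carrier[of v f] tgen_carrier[of v' f']
    by (simp add: V.act_add W.act_add tgen.add)
next
  case (smult v f c)
  then show ?case using tgen_carrier[of v f]
    by (simp add: V.act_smult W.act_smult tgen.smult)
next
  case (dif v f i)
  \<comment> \<open>x is arbitrary in the induction, so the hypothesis covers the bracket of x with
    \<partial>_i as well as x itself.\<close>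
  have "(V.dV i (act V x v) \<oplus>\<^bsub>V\<^esub> act V (lbracket witt x (pdiff i)) v,
      W.dV i (act W x f) \<oplus>\<^bsub>W\<^esub> act W (lbracket witt x (pdiff i)) f) \<in> tgen"
    using dif by (intro tgen.add tgen.dif) auto
  then show ?case using dif tgen_carrier[of v f]
    V.act_swap[of x "pdiff i" v] W.act_swap[of x "pdiff i" f] by simp
qed

lemma tgen_diff:
  "(v, f) \<in> tgen \<Longrightarrow> (v', f') \<in> tgen \<Longrightarrow> (v \<ominus>\<^bsub>V\<^esub> v', f \<ominus>\<^bsub>W\<^esub> f') \<in> tgen"
  using tgen_carrier[of v f] tgen_carrier[of v' f']
  by (simp add: V.diff_eq_smult W.diff_eq_smult tgen.add tgen.smult)

definition pair_sub :: "('v \<times> 'w) set \<Rightarrow> bool" where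
  "pair_sub S \<longleftrightarrow> S \<subseteq> tgen \<and> (\<zero>\<^bsub>V\<^esub>, \<zero>\<^bsub>W\<^esub>) \<in> S \<and>
     (\<forall>v f v' f'. (v, f) \<in> S \<longrightarrow> (v', f') \<in> S \<longrightarrow> (v \<oplus>\<^bsub>V\<^esub> v', f \<oplus>\<^bsub>W\<^esub> f') \<in> S) \<and>
     (\<forall>c v f. (v, f) \<in> S \<longrightarrow> (c \<odot>\<^bsub>V\<^esub> v, c \<odot>\<^bsub>W\<^esub> f) \<in> S) \<and>
     (\<forall>x\<in>derivations. \<forall>v f. (v, f) \<in> S \<longrightarrow> (act V x v, act W x f) \<in> S)"

lemma pair_subD:
  assumes "pair_sub S"
  shows "\<And>v f. (v, f) \<in> S \<Longrightarrow> (v, f) \<in> tgen"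
    and "\<And>v f v' f'. (v, f) \<in> S \<Longrightarrow> (v', f') \<in> S \<Longrightarrow> (v \<oplus>\<^bsub>V\<^esub> v', f \<oplus>\<^bsub>W\<^esub> f') \<in> S"
    and "\<And>c v f. (v, f) \<in> S \<Longrightarrow> (c \<odot>\<^bsub>V\<^esub> v, c \<odot>\<^bsub>W\<^esub> f) \<in> S"
    and "\<And>x v f. x \<in> derivations \<Longrightarrow> (v, f) \<in> S \<Longrightarrow> (act V x v, act W x f) \<in> S"
    and "(\<zero>\<^bsub>V\<^esub>, \<zero>\<^bsub>W\<^esub>) \<in> S"
  using assms by (auto simp: pair_sub_def)

lemma pair_sub_tgen: "pair_sub tgen"
  by (auto simp: pair_sub_def tgen_zero tgen_act intro: tgen.intros)

text \<open>If the first components of a submodule S of \<open>tgen\<close> exhaust V, this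
  condition puts the whole graph of \<iota> into S. It is applied to the pairs whose second
  component lies in a submodule of W.\<close>

definition base_closed :: bool where
  "base_closed \<longleftrightarrow> (\<forall>S m f. pair_sub S \<longrightarrow> m \<in> E \<longrightarrow> (m, f) \<in> S \<longrightarrow> (m, \<iota> m) \<in> S)"

text \<open>If only 0 lies over 0, then \<open>tgen\<close> is the graph of a function, and the only
  partner of m is \<iota> m.\<close>

lemma base_closed_functional:
  assumes "\<And>f. (\<zero>\<^bsub>V\<^esub>, f) \<in> tgen \<Longrightarrow> f = \<zero>\<^bsub>W\<^esub>"
  shows base_closed
  unfolding base_closed_def
proof (intro allI impI)
  fix S m f assume "pair_sub S" "m \<in> E" "(m, f) \<in> S"
  then have mf: "(m, f) \<in> tgen" by (auto simp: pair_sub_def)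
  then have "(m \<ominus>\<^bsub>V\<^esub> m, f \<ominus>\<^bsub>W\<^esub> \<iota> m) \<in> tgen"
    by (intro tgen_diff base \<open>m \<in> E\<close>)
  then have "f \<ominus>\<^bsub>W\<^esub> \<iota> m = \<zero>\<^bsub>W\<^esub>"
    using assms \<open>m \<in> E\<close> by simp
  then have "f = \<iota> m" using tgen_carrier[OF mf] \<open>m \<in> E\<close> by (simp add: W.diff_eq_zero_iff)
  then show "(m, \<iota> m) \<in> S" using \<open>(m, f) \<in> S\<close> by simp
qed

text \<open>Long products in the Euler field kill every term with a partial derivative and multiply
  the component in E by a factorial, with the same m on both sides. The claim is made for all K'
  beyond a bound so that two summands can share one K'.\<close>

lemma eproj_tgen:
  assumes ev: "\<And>e. e \<in> E \<Longrightarrow> act V euler e = \<mu> \<odot>\<^bsub>V\<^esub> e" and "(v, f) \<in> tgen"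
  shows "\<exists>m\<in>E. \<exists>K. \<forall>K'\<ge>K. V.eproj \<mu> K' v = fact K' \<odot>\<^bsub>V\<^esub> m \<and> W.eproj \<mu> K' f = fact K' \<odot>\<^bsub>W\<^esub> \<iota> m"
  using assms(2)
proof (induction rule: tgen.induct)
  case (base e)
  then have "act W euler (\<iota> e) = \<mu> \<odot>\<^bsub>W\<^esub> \<iota> e"
    using ev \<iota>_act[OF euler_witt_ge base] by (simp add: \<iota>_smult)
  then show ?case using base ev by (intro bexI[of _ e]) (auto simp: V.eproj_eigen W.eproj_eigen)
next
  case (add v f v' f')
  obtain m K where 1: "m \<in> E" "\<And>K'. K' \<ge> K \<Longrightarrow> V.eproj \<mu> K' v = fact K' \<odot>\<^bsub>V\<^esub> m"
    "\<And>K'. K' \<ge> K \<Longrightarrow> W.eproj \<mu> K' f = fact K' \<odot>\<^bsub>W\<^esub> \<iota> m" using add by blast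
  obtain m' L where 2: "m' \<in> E" "\<And>K'. K' \<ge> L \<Longrightarrow> V.eproj \<mu> K' v' = fact K' \<odot>\<^bsub>V\<^esub> m'"
    "\<And>K'. K' \<ge> L \<Longrightarrow> W.eproj \<mu> K' f' = fact K' \<odot>\<^bsub>W\<^esub> \<iota> m'" using add by blast
  show ?case
    using 1 2 add tgen_carrier[of v f] tgen_carrier[of v' f']
    by (intro bexI[of _ "m \<oplus>\<^bsub>V\<^esub> m'"] exI[of _ "max K L"])
      (auto simp: V.eproj_add W.eproj_add V.smult_add W.smult_add \<iota>_add)
next
  case (smult v f c)
  obtain m K where 1: "m \<in> E" "\<And>K'. K' \<ge> K \<Longrightarrow> V.eproj \<mu> K' v = fact K' \<odot>\<^bsub>V\<^esub> m"
    "\<And>K'. K' \<ge> K \<Longrightarrow> W.eproj \<mu> K' f = fact K' \<odot>\<^bsub>W\<^esub> \<iota> m" using smult by blast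
  show ?case
    using 1 smult tgen_carrier[of v f]
    by (intro bexI[of _ "c \<odot>\<^bsub>V\<^esub> m"] exI[of _ K])
      (auto simp: V.eproj_smult W.eproj_smult V.smult_smult W.smult_smult \<iota>_smult mult.commute)
next
  case (dif v f i)
  obtain m K where m: "m \<in> E" "\<And>K'. K' \<ge> K \<Longrightarrow> V.eproj \<mu> K' v = fact K' \<odot>\<^bsub>V\<^esub> m"
    "\<And>K'. K' \<ge> K \<Longrightarrow> W.eproj \<mu> K' f = fact K' \<odot>\<^bsub>W\<^esub> \<iota> m" using dif by blast
  have ev': "act W euler (\<iota> m) = \<mu> \<odot>\<^bsub>W\<^esub> \<iota> m"
    using ev \<iota>_act[OF euler_witt_ge m(1)] m(1) by (simp add: \<iota>_smult)
  have sV: "V.shift (- \<mu>) m = \<zero>\<^bsub>V\<^esub>" and sW: "W.shift (- \<mu>) (\<iota> m) = \<zero>\<^bsub>W\<^esub>"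
    using ev ev' m(1) V.add_smult[of m \<mu> "- \<mu>"] W.add_smult[of "\<iota> m" \<mu> "- \<mu>"]
    by (simp_all add: V.shift_def W.shift_def)
  \<comment> \<open>\<open>eproj_dV\<close> spends one factor on the derivative, hence the bound Suc
    K; the component in E of such a term is 0.\<close>
  have "V.eproj \<mu> K' (V.dV i v) = \<zero>\<^bsub>V\<^esub> \<and> W.eproj \<mu> K' (W.dV i f) = \<zero>\<^bsub>W\<^esub>" if le: "K' \<ge> Suc K" for K'
  proof -
    obtain L where L: "K' = Suc L" "L \<ge> K" using le by (metis Suc_le_D Suc_le_mono)
    show ?thesis
      unfolding L(1) using m L(2) tgen_carrier[OF dif(1)] sV sW
      by (simp add: V.eproj_dV W.eproj_dV V.shift_smult W.shift_smult del: V.eproj.simps W.eproj.simps)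
  qed
  then show ?case by (intro bexI[of _ "\<zero>\<^bsub>V\<^esub>"] exI[of _ "Suc K"]) auto
qed

lemma pair_sub_eproj:
  assumes "pair_sub S" "(v, f) \<in> S"
  shows "(V.eproj \<mu> K v, W.eproj \<mu> K f) \<in> S"
proof (induction K)
  case (Suc K)
  have "(V.shift c v, W.shift c f) \<in> S" if "(v, f) \<in> S" for c v f
    unfolding V.shift_def W.shift_def
    by (intro pair_subD(2-4)[OF assms(1)] euler_derivation that)
  then show ?case using Suc by simp
qed (use assms in simp)

text \<open>The operator \<open>eproj\<close> is applied to (m, f) inside S. On V it is
  multiplication of m by K!, which identifies the m0 supplied by \<open>eproj_tgen\<close> with m;
  on W the result is then K! times \<iota> m.\<close>

lemma base_closed_eigen:
  assumes ev: "\<And>e. e \<in> E \<Longrightarrow> act V euler e = \<mu> \<odot>\<^bsub>V\<^esub> e"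
  shows base_closed
  unfolding base_closed_def
proof (intro allI impI)
  fix S m f assume S: "pair_sub S" and m: "m \<in> E" and mf: "(m, f) \<in> S"
  then have "(m, f) \<in> tgen" by (auto simp: pair_sub_def)
  from eproj_tgen[OF ev this] obtain m0 K where m0: "m0 \<in> E"
    "V.eproj \<mu> K m = fact K \<odot>\<^bsub>V\<^esub> m0" "W.eproj \<mu> K f = fact K \<odot>\<^bsub>W\<^esub> \<iota> m0" by blast
  have "fact K \<odot>\<^bsub>V\<^esub> m = fact K \<odot>\<^bsub>V\<^esub> m0"
    using m0(2) V.eproj_eigen[of m \<mu> K] ev m by simp
  then have "inverse (fact K) \<odot>\<^bsub>V\<^esub> (fact K \<odot>\<^bsub>V\<^esub> m) = inverse (fact K) \<odot>\<^bsub>V\<^esub> (fact K \<odot>\<^bsub>V\<^esub> m0)"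
    by simp
  then have "m = m0" using m m0(1) by (simp add: V.smult_smult)
  moreover have "(inverse (fact K) \<odot>\<^bsub>V\<^esub> V.eproj \<mu> K m, inverse (fact K) \<odot>\<^bsub>W\<^esub> W.eproj \<mu> K f) \<in> S"
    using pair_sub_eproj[OF S mf] by (rule pair_subD(3)[OF S])
  ultimately show "(m, \<iota> m) \<in> S"
    using m0 by (simp add: V.smult_smult W.smult_smult)
qed

end

context lifting
begin

definition asum :: "(('n \<Rightarrow>\<^sub>0 nat) \<Rightarrow> 'v) \<Rightarrow> ('n \<Rightarrow>\<^sub>0 nat) set \<Rightarrow> 'v" where
  "asum e A = finsum V (\<lambda>\<beta>. mpow V.dV \<beta> (e \<beta>)) A"

definition bsum :: "(('n \<Rightarrow>\<^sub>0 nat) \<Rightarrow> 'v) \<Rightarrow> ('n \<Rightarrow>\<^sub>0 nat) set \<Rightarrow> 'w" where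
  "bsum e A = finsum W (\<lambda>\<beta>. mpow W.dV \<beta> (\<iota> (e \<beta>))) A"

text \<open>Applying constant derivations to the graph treats both components alike, so they keep
  the same coefficient family. It is required to vanish off A so that the index sets of two summands
  can be enlarged to their union.\<close>

lemma tgen_sum:
  assumes "(v, f) \<in> tgen"
  shows "\<exists>e A. finite A \<and> (\<forall>\<beta>. e \<beta> \<in> E) \<and> (\<forall>\<beta>. \<beta> \<notin> A \<longrightarrow> e \<beta> = \<zero>\<^bsub>V\<^esub>) \<and> v = asum e A \<and> f = bsum e A"
  using assms
proof (induction rule: tgen.induct)
  case (base m)
  show ?case
    using base by (intro exI[of _ "\<lambda>\<beta>. if \<beta> = 0 then m else \<zero>\<^bsub>V\<^esub>"] exI[of _ "{0}"])
      (simp add: asum_def bsum_def V.mm.M.finsum_insert W.mm.M.finsum_insert)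
next
  case (add v f v' f')
  obtain e A where 1: "finite A" "\<And>\<beta>. e \<beta> \<in> E" "\<And>\<beta>. \<beta> \<notin> A \<Longrightarrow> e \<beta> = \<zero>\<^bsub>V\<^esub>" "v = asum e A" "f = bsum e A"
    using add by metis
  obtain e' A' where 2: "finite A'" "\<And>\<beta>. e' \<beta> \<in> E" "\<And>\<beta>. \<beta> \<notin> A' \<Longrightarrow> e' \<beta> = \<zero>\<^bsub>V\<^esub>" "v' = asum e' A'" "f' = bsum e' A'"
    using add by metis
  have a: "v = asum e (A \<union> A')" "v' = asum e' (A \<union> A')"
    unfolding asum_def 1(4) 2(4) using 1(1-3) 2(1-3) by (auto intro!: V.finsum_superset)
  have b: "f = bsum e (A \<union> A')" "f' = bsum e' (A \<union> A')"
    unfolding bsum_def 1(5) 2(5) using 1(1-3) 2(1-3) by (auto intro!: W.finsum_superset)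
  have "v \<oplus>\<^bsub>V\<^esub> v' = asum (\<lambda>\<beta>. e \<beta> \<oplus>\<^bsub>V\<^esub> e' \<beta>) (A \<union> A')"
    using 1(2) 2(2) by (simp add: a asum_def V.mpow_add V.mm.M.finsum_addf Pi_def)
  moreover have "f \<oplus>\<^bsub>W\<^esub> f' = bsum (\<lambda>\<beta>. e \<beta> \<oplus>\<^bsub>V\<^esub> e' \<beta>) (A \<union> A')"
    using 1(2) 2(2) by (simp add: b bsum_def \<iota>_add W.mpow_add W.mm.M.finsum_addf Pi_def)
  ultimately show ?case
    using 1(1-3) 2(1-3) by (intro exI[of _ "\<lambda>\<beta>. e \<beta> \<oplus>\<^bsub>V\<^esub> e' \<beta>"] exI[of _ "A \<union> A'"]) auto
next
  case (smult v f c)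
  obtain e A where 1: "finite A" "\<And>\<beta>. e \<beta> \<in> E" "\<And>\<beta>. \<beta> \<notin> A \<Longrightarrow> e \<beta> = \<zero>\<^bsub>V\<^esub>" "v = asum e A" "f = bsum e A"
    using smult by metis
  have "c \<odot>\<^bsub>V\<^esub> v = asum (\<lambda>\<beta>. c \<odot>\<^bsub>V\<^esub> e \<beta>) A"
    unfolding 1(4) asum_def using 1(1,2)
    by (subst V.finsum_additive) (auto simp: V.smult_add V.mpow_smult)
  moreover have "c \<odot>\<^bsub>W\<^esub> f = bsum (\<lambda>\<beta>. c \<odot>\<^bsub>V\<^esub> e \<beta>) A"
    unfolding 1(5) bsum_def using 1(1,2)
    by (subst W.finsum_additive) (auto simp: W.smult_add W.mpow_smult \<iota>_smult)
  ultimately show ?case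
    using 1(1-3) by (intro exI[of _ "\<lambda>\<beta>. c \<odot>\<^bsub>V\<^esub> e \<beta>"] exI[of _ A]) auto
next
  case (dif v f i)
  obtain e A where 1: "finite A" "\<And>\<beta>. e \<beta> \<in> E" "\<And>\<beta>. \<beta> \<notin> A \<Longrightarrow> e \<beta> = \<zero>\<^bsub>V\<^esub>" "v = asum e A" "f = bsum e A"
    using dif by metis
  \<comment> \<open>The index \<beta> is moved to \<beta> + \<open>unit_idx i\<close>. Indices with
    exponent 0 at i are not reached and get the default 0; truncated subtraction would return a
    wrong coefficient there.\<close>
  define e' where "e' = (\<lambda>\<beta>. if Poly_Mapping.lookup \<beta> i = 0 then \<zero>\<^bsub>V\<^esub> else e (\<beta> - unit_idx i))"
  have e': "e' (\<beta> + unit_idx i) = e \<beta>" for \<beta>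
    by (simp add: e'_def lookup_add)
  let ?h = "\<lambda>\<beta>. \<beta> + unit_idx i"
  have e'E: "e' \<beta> \<in> E" for \<beta> using 1(2) by (simp add: e'_def)
  have "V.dV i v = finsum V (\<lambda>\<beta>. V.dV i (mpow V.dV \<beta> (e \<beta>))) A"
    unfolding 1(4) asum_def using 1(1,2)
    by (intro V.finsum_additive) (auto simp: V.act_add)
  also have "\<dots> = finsum V (\<lambda>\<beta>. mpow V.dV (?h \<beta>) (e' (?h \<beta>))) A"
    using 1(2) by (simp add: e' V.mpow_Suc)
  also have "\<dots> = asum e' (?h ` A)"
    unfolding asum_def by (intro V.mm.M.finsum_reindex[symmetric]) (use e'E in \<open>auto intro: inj_onI\<close>)
  finally have a: "V.dV i v = asum e' (?h ` A)" .
  have "W.dV i f = finsum W (\<lambda>\<beta>. W.dV i (mpow W.dV \<beta> (\<iota> (e \<beta>)))) A"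
    unfolding 1(5) bsum_def using 1(1,2)
    by (intro W.finsum_additive) (auto simp: W.act_add)
  also have "\<dots> = finsum W (\<lambda>\<beta>. mpow W.dV (?h \<beta>) (\<iota> (e' (?h \<beta>)))) A"
    using 1(2) by (simp add: e' W.mpow_Suc)
  also have "\<dots> = bsum e' (?h ` A)"
    unfolding bsum_def by (intro W.mm.M.finsum_reindex[symmetric]) (use e'E in \<open>auto intro: inj_onI\<close>)
  finally have b: "W.dV i f = bsum e' (?h ` A)" .
  have "e' \<beta> = \<zero>\<^bsub>V\<^esub>" if "\<beta> \<notin> ?h ` A" for \<beta>
    using that 1(3)[of "\<beta> - unit_idx i"] idx_minus_add[of \<beta> i] by (force simp: e'_def image_iff)
  then show ?case
    using a b e'E 1(1) by (intro exI[of _ e'] exI[of _ "?h ` A"]) auto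
qed

definition free_over :: bool where
  "free_over \<longleftrightarrow> (\<forall>e A. finite A \<longrightarrow> (\<forall>\<beta>. e \<beta> \<in> E) \<longrightarrow> asum e A = \<zero>\<^bsub>V\<^esub> \<longrightarrow> (\<forall>\<beta>\<in>A. e \<beta> = \<zero>\<^bsub>V\<^esub>))"

text \<open>A pair over 0 is a relation among the d^\<beta> e_\<beta> in V. Freeness makes every
  e_\<beta> vanish, and the parallel sum in W vanishes with them.\<close>

lemma free_over_functional:
  assumes free_over "(\<zero>\<^bsub>V\<^esub>, f) \<in> tgen"
  shows "f = \<zero>\<^bsub>W\<^esub>"
proof -
  obtain e A where 1: "finite A" "\<And>\<beta>. e \<beta> \<in> E" "asum e A = \<zero>\<^bsub>V\<^esub>" "f = bsum e A"
    using tgen_sum[OF assms(2)] by metis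
  then have "\<forall>\<beta>\<in>A. e \<beta> = \<zero>\<^bsub>V\<^esub>" using assms(1) unfolding free_over_def by blast
  then show ?thesis unfolding 1(4) bsum_def by (intro W.mm.M.add.finprod_one_eqI) simp
qed

lemma pair_sub_restrict:
  assumes N: "lie_submodule witt N W"
  shows "pair_sub {(v, f). (v, f) \<in> tgen \<and> f \<in> N}"
proof -
  have N': "\<zero>\<^bsub>W\<^esub> \<in> N" "\<And>f f'. f \<in> N \<Longrightarrow> f' \<in> N \<Longrightarrow> f \<oplus>\<^bsub>W\<^esub> f' \<in> N"
    "\<And>c f. f \<in> N \<Longrightarrow> c \<odot>\<^bsub>W\<^esub> f \<in> N" "\<And>x f. x \<in> derivations \<Longrightarrow> f \<in> N \<Longrightarrow> act W x f \<in> N"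
    using N unfolding W.lie_submodule_iff by auto
  show ?thesis
    unfolding pair_sub_def by (auto simp: N' tgen_zero tgen_act tgen.add tgen.smult)
qed

lemma pair_sub_fst:
  assumes S: "pair_sub S"
  shows "lie_submodule witt {v. \<exists>f. (v, f) \<in> S} V"
  unfolding V.lie_submodule_iff
proof (intro conjI subsetI ballI allI, goal_cases)
  case (1 v) then show ?case using pair_subD(1)[OF S] tgen_carrier by blast
next
  case 2 show ?case using pair_subD(5)[OF S] by blast
next
  case (3 v v') then show ?case using pair_subD(2)[OF S] by blast
next
  case (4 c v) then show ?case using pair_subD(3)[OF S] by blast
next
  case (5 x v) then show ?case using pair_subD(4)[OF S] by auto
qed

lemmas tgen_fst_submodule = pair_sub_fst[OF pair_sub_tgen]

lemma tgen_snd_submodule: "lie_submodule witt {f. \<exists>v. (v, f) \<in> tgen} W"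
  unfolding W.lie_submodule_iff
proof (intro conjI subsetI ballI allI, goal_cases)
  case (1 v) then show ?case using tgen_carrier by blast
next
  case 2 show ?case using tgen_zero by blast
next
  case (3 v v') then show ?case using tgen.add by blast
next
  case (4 c v) then show ?case using tgen.smult by blast
next
  case (5 x v) then show ?case using tgen_act by auto
qed

lemma tgen_fst_surj:
  assumes "simple_lie_module witt V" "E \<noteq> {\<zero>\<^bsub>V\<^esub>}" "v \<in> carrier V"
  shows "\<exists>f. (v, f) \<in> tgen"
proof -
  obtain e where e: "e \<in> E" "e \<noteq> \<zero>\<^bsub>V\<^esub>" using assms(2) E_zero by blast
  have "{v. \<exists>f. (v, f) \<in> tgen} \<noteq> {\<zero>\<^bsub>V\<^esub>}" using tgen.base[OF e(1)] e(2) by blast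
  then have "{v. \<exists>f. (v, f) \<in> tgen} = carrier V"
    using assms(1) tgen_fst_submodule by (auto simp: simple_lie_module_def)
  then show ?thesis using assms(3) by blast
qed

end

section \<open>Comparison of a simple module with a generated one\<close>

locale generated_lifting = lifting +
  assumes simple: "simple_lie_module witt V"
    and gen: "\<And>N. lie_submodule witt N W \<Longrightarrow> \<iota> ` E \<subseteq> N \<Longrightarrow> N = carrier W"
    and nz: "\<exists>e\<in>E. \<iota> e \<noteq> \<zero>\<^bsub>W\<^esub>"
    and bc: base_closed
begin

lemma simpleD: "lie_submodule witt U V \<Longrightarrow> U = {\<zero>\<^bsub>V\<^esub>} \<or> U = carrier V"
  using simple by (auto simp: simple_lie_module_def)

lemma E_nz: "E \<noteq> {\<zero>\<^bsub>V\<^esub>}"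
  using nz \<iota>_zero by auto

lemma snd_surj: "f \<in> carrier W \<Longrightarrow> \<exists>v. (v, f) \<in> tgen"
  using gen[OF tgen_snd_submodule] tgen.base by blast

text \<open>The v with (v, 0) in \<open>tgen\<close> form a submodule of the simple module V. If it
  were all of V, \<open>base_closed\<close> would give \<iota> = 0. Hence it is 0, and the map from
  W to V is well defined.\<close>

lemma fst_unique:
  assumes "(v, f) \<in> tgen" "(v', f) \<in> tgen"
  shows "v = v'"
proof -
  let ?S = "{(v, f). (v, f) \<in> tgen \<and> f \<in> {\<zero>\<^bsub>W\<^esub>}}" and ?Z = "{v. (v, \<zero>\<^bsub>W\<^esub>) \<in> tgen}"
  have S: "pair_sub ?S"
    by (rule pair_sub_restrict) (simp add: W.lie_submodule_iff)
  have "{v. \<exists>f. (v, f) \<in> ?S} = ?Z" by simp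
  then have "?Z = {\<zero>\<^bsub>V\<^esub>} \<or> ?Z = carrier V"
    using simpleD[OF pair_sub_fst[OF S]] by simp
  moreover have False if "?Z = carrier V"
  proof -
    have "\<iota> m = \<zero>\<^bsub>W\<^esub>" if m: "m \<in> E" for m
    proof -
      have "m \<in> ?Z" using \<open>?Z = carrier V\<close> E_carrier[OF m] by simp
      then have "(m, \<zero>\<^bsub>W\<^esub>) \<in> ?S" by simp
      then have "(m, \<iota> m) \<in> ?S" using bc S m unfolding base_closed_def by meson
      then show ?thesis by simp
    qed
    then show False using nz by blast
  qed
  moreover have "(v \<ominus>\<^bsub>V\<^esub> v', \<zero>\<^bsub>W\<^esub>) \<in> tgen"
    using tgen_diff[OF assms] tgen_carrier[OF assms(1)] by simp
  ultimately have "v \<ominus>\<^bsub>V\<^esub> v' = \<zero>\<^bsub>V\<^esub>" by blast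
  then show ?thesis using tgen_carrier assms by (simp add: V.diff_eq_zero_iff)
qed

definition ker where
  "ker = {f. (\<zero>\<^bsub>V\<^esub>, f) \<in> tgen}"

lemma ker_submodule: "lie_submodule witt ker W"
  unfolding W.lie_submodule_iff ker_def
proof (intro conjI subsetI ballI allI, goal_cases)
  case (3 f f') then show ?case using tgen.add[of "\<zero>\<^bsub>V\<^esub>" f "\<zero>\<^bsub>V\<^esub>" f'] by simp
next
  case (4 c f) then show ?case using tgen.smult[of "\<zero>\<^bsub>V\<^esub>" f c] by simp
next
  case (5 x f) then show ?case using tgen_act[of "\<zero>\<^bsub>V\<^esub>" f x] by simp
qed (use tgen_carrier tgen_zero in auto)

sublocale K: csub W ker
  using ker_submodule by (intro csub.intro W.cmod_axioms csub_axioms.intro) (simp add: lie_submodule_def)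

text \<open>Sending v to its fibre inverts the map from W/ker to V. As the fibre is literally a
  coset, \<open>iso_quot\<close> needs no choice of representatives.\<close>

lemma fiber:
  assumes vf: "(v, f) \<in> tgen"
  shows "{g. (v, g) \<in> tgen} = ker +>\<^bsub>W\<^esub> f"
proof (rule Set.set_eqI)
  fix g
  have "(v, g) \<in> tgen \<longleftrightarrow> g \<in> carrier W \<and> (\<zero>\<^bsub>V\<^esub>, g \<ominus>\<^bsub>W\<^esub> f) \<in> tgen"
  proof
    assume "(v, g) \<in> tgen"
    then show "g \<in> carrier W \<and> (\<zero>\<^bsub>V\<^esub>, g \<ominus>\<^bsub>W\<^esub> f) \<in> tgen"
      using tgen_diff[OF _ vf, of v g] tgen_carrier[OF vf] tgen_carrier[of v g] by simp
  next
    assume "g \<in> carrier W \<and> (\<zero>\<^bsub>V\<^esub>, g \<ominus>\<^bsub>W\<^esub> f) \<in> tgen"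
    then show "(v, g) \<in> tgen"
      using tgen.add[OF _ vf, of "\<zero>\<^bsub>V\<^esub>" "g \<ominus>\<^bsub>W\<^esub> f"] tgen_carrier[OF vf] by (simp add: K.diff_add)
  qed
  then show "g \<in> {g. (v, g) \<in> tgen} \<longleftrightarrow> g \<in> ker +>\<^bsub>W\<^esub> f"
    using tgen_carrier[OF vf] by (simp add: K.mem_cls) (simp add: ker_def)
qed

lemma iso_quot: "lie_module_iso witt V (quot_module W ker)"
  unfolding lie_module_iso_def
proof (intro exI[of _ "\<lambda>v. {g. (v, g) \<in> tgen}"] conjI ballI allI)
  let ?\<psi> = "\<lambda>v. {g. (v, g) \<in> tgen}"
  have ex: "\<exists>f\<in>carrier W. (v, f) \<in> tgen" if "v \<in> carrier V" for v
    using tgen_fst_surj[OF simple E_nz that] tgen_carrier by blast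
  show "bij_betw ?\<psi> (carrier V) (carrier (quot_module W ker))"
  proof (rule bij_betw_imageI)
    show "inj_on ?\<psi> (carrier V)"
    proof (rule inj_onI)
      fix v v' assume "v \<in> carrier V" "v' \<in> carrier V" and eq: "?\<psi> v = ?\<psi> v'"
      then obtain f where "(v, f) \<in> tgen" using ex by blast
      then show "v = v'" using eq fst_unique by blast
    qed
    show "?\<psi> ` carrier V = carrier (quot_module W ker)"
      unfolding K.carrier_quot
    proof (intro equalityI subsetI)
      fix X assume "X \<in> ?\<psi> ` carrier V"
      then obtain v f where "X = ?\<psi> v" "f \<in> carrier W" "(v, f) \<in> tgen" using ex by blast
      then show "X \<in> (\<lambda>x. ker +>\<^bsub>W\<^esub> x) ` carrier W" using fiber by blast
    next
      fix X assume "X \<in> (\<lambda>x. ker +>\<^bsub>W\<^esub> x) ` carrier W"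
      then obtain f where f: "f \<in> carrier W" "X = ker +>\<^bsub>W\<^esub> f" by blast
      then obtain v where "(v, f) \<in> tgen" using snd_surj by blast
      then show "X \<in> ?\<psi> ` carrier V" using fiber f tgen_carrier by blast
    qed
  qed
  fix v assume v: "v \<in> carrier V"
  obtain f where f: "f \<in> carrier W" "(v, f) \<in> tgen" using ex[OF v] by blast
  show "?\<psi> (c \<odot>\<^bsub>V\<^esub> v) = c \<odot>\<^bsub>quot_module W ker\<^esub> ?\<psi> v" for c
    using fiber[OF tgen.smult[OF f(2)], of c] fiber[OF f(2)] f by (simp add: K.smult_quot)
  show "?\<psi> (act V x v) = act (quot_module W ker) x (?\<psi> v)" if "x \<in> lset witt" for x
    using fiber[OF tgen_act[OF f(2)], of x] fiber[OF f(2)] f that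
      W.lie_submodule_quot(2)[OF _ ker_submodule, of x f] by simp
  fix v' assume v': "v' \<in> carrier V"
  obtain f' where f': "f' \<in> carrier W" "(v', f') \<in> tgen" using ex[OF v'] by blast
  show "?\<psi> (v \<oplus>\<^bsub>V\<^esub> v') = ?\<psi> v \<oplus>\<^bsub>quot_module W ker\<^esub> ?\<psi> v'"
    using fiber[OF tgen.add[OF f(2) f'(2)]] fiber[OF f(2)] fiber[OF f'(2)] f f'
    by (simp add: K.add_quot)
qed

text \<open>If N were not inside \<open>ker\<close>, the pairs with second component in N would lie
  over all of V; \<open>base_closed\<close> would then put \<iota>(E) into N, and \<iota>(E)
  generates W.\<close>

lemma proper_subset_ker:
  assumes N: "lie_submodule witt N W" and "N \<noteq> carrier W"
  shows "N \<subseteq> ker"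
proof -
  let ?S = "{(v, f). (v, f) \<in> tgen \<and> f \<in> N}" and ?Z = "{v. \<exists>f\<in>N. (v, f) \<in> tgen}"
  have S: "pair_sub ?S" by (rule pair_sub_restrict[OF N])
  have "{v. \<exists>f. (v, f) \<in> ?S} = ?Z" by auto
  then have "?Z = {\<zero>\<^bsub>V\<^esub>} \<or> ?Z = carrier V"
    using simpleD[OF pair_sub_fst[OF S]] by simp
  moreover have False if Z: "?Z = carrier V"
  proof -
    have "\<iota> m \<in> N" if m: "m \<in> E" for m
    proof -
      obtain f where "(m, f) \<in> ?S" using Z E_carrier[OF m] by blast
      then have "(m, \<iota> m) \<in> ?S" using bc S m unfolding base_closed_def by meson
      then show ?thesis by simp
    qed
    then have "N = carrier W" using gen[OF N] by blast
    then show False using assms(2) by simp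
  qed
  ultimately have Z: "?Z = {\<zero>\<^bsub>V\<^esub>}" by blast
  show ?thesis
  proof
    fix f assume f: "f \<in> N"
    then have "f \<in> carrier W" using N unfolding W.lie_submodule_iff by auto
    then obtain v where v: "(v, f) \<in> tgen" using snd_surj by auto
    then have "v \<in> ?Z" using f by auto
    then show "f \<in> ker" using Z v unfolding ker_def by simp
  qed
qed

lemma ker_kernel: "simple_quotient_kernel witt W ker"
  unfolding simple_quotient_kernel_def
  using ker_submodule lie_module_iso_simple[OF simple _ iso_quot]
    W.lie_submodule_quot(1)[OF _ ker_submodule] by simp

text \<open>N is proper, hence inside \<open>ker\<close>, and the image of \<open>ker\<close> in the
  simple quotient W/N is 0 or everything. The second case would give \<open>ker\<close> = W, which a
  nonzero \<iota>(e) prevents by \<open>fst_unique\<close>.\<close>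

lemma ker_unique:
  assumes "simple_quotient_kernel witt W N"
  shows "N = ker"
proof -
  have N: "lie_submodule witt N W" and Q: "simple_lie_module witt (quot_module W N)"
    using assms by (auto simp: simple_quotient_kernel_def)
  interpret N: csub W N
    using N by (intro csub.intro W.cmod_axioms csub_axioms.intro) (simp add: lie_submodule_def)
  have "N \<noteq> carrier W"
  proof
    assume NW: "N = carrier W"
    have "carrier (quot_module W N) = {N}"
      unfolding N.carrier_quot using N.cls_eq_N_iff NW W.zero_closed by (auto simp: image_iff)
    then show False using Q by (simp add: simple_lie_module_def N.zero_quot)
  qed
  then have sub: "N \<subseteq> ker" using N by (rule proper_subset_ker[rotated])
  have Ql: "lmod witt (quot_module W N)"
    by (rule lie_module_lmod) (rule W.lie_submodule_quot(1)[OF _ N], simp)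
  let ?U = "(\<lambda>x. N +>\<^bsub>W\<^esub> x) ` ker"
  have "lie_submodule witt ?U (quot_module W N)"
    unfolding lmod.lie_submodule_iff[OF Ql] N.carrier_quot N.zero_quot
  proof (intro conjI ballI allI)
    show "?U \<subseteq> (\<lambda>x. N +>\<^bsub>W\<^esub> x) ` carrier W" using K.N_carrier by blast
    show "N \<in> ?U" using N.cls_zero K.N_zero by (metis image_eqI)
    show "X \<oplus>\<^bsub>quot_module W N\<^esub> Y \<in> ?U" if "X \<in> ?U" "Y \<in> ?U" for X Y
      using that K.N_carrier K.N_add by (auto simp: N.add_quot)
    show "c \<odot>\<^bsub>quot_module W N\<^esub> X \<in> ?U" if "X \<in> ?U" for c X
      using that K.N_carrier K.N_smult by (auto simp: N.smult_quot)
    show "act (quot_module W N) x X \<in> ?U" if "x \<in> lset witt" "X \<in> ?U" for x X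
      using that K.N_carrier ker_submodule W.lie_submodule_quot(2)[OF _ N, of x]
      unfolding W.lie_submodule_iff by auto
  qed
  then have "?U = {N} \<or> ?U = carrier (quot_module W N)"
    using Q by (simp add: simple_lie_module_def N.zero_quot)
  then show ?thesis
  proof
    assume U: "?U = {N}"
    have "f \<in> N" if "f \<in> ker" for f
    proof -
      have "N +>\<^bsub>W\<^esub> f = N" using U that by blast
      then show ?thesis using N.cls_eq_N_iff[OF K.N_carrier[OF that]] by simp
    qed
    then show ?thesis using sub by blast
  next
    assume U: "?U = carrier (quot_module W N)"
    have all: "f \<in> ker" if f: "f \<in> carrier W" for f
    proof -
      have "N +>\<^bsub>W\<^esub> f \<in> ?U" using U f N.carrier_quot by blast
      then obtain g where g: "g \<in> ker" "N +>\<^bsub>W\<^esub> f = N +>\<^bsub>W\<^esub> g" by blast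
      then have "f \<ominus>\<^bsub>W\<^esub> g \<in> ker" using N.cls_eq_iff[OF f K.N_carrier[OF g(1)]] sub by auto
      then have "(f \<ominus>\<^bsub>W\<^esub> g) \<oplus>\<^bsub>W\<^esub> g \<in> ker" using g K.N_add by blast
      then show ?thesis using f g K.N_carrier by (simp add: K.diff_add)
    qed
    obtain e where e: "e \<in> E" "\<iota> e \<noteq> \<zero>\<^bsub>W\<^esub>" using nz by blast
    have "\<iota> e \<in> ker" by (rule all[OF \<iota>_closed[OF e(1)]])
    then have "(\<zero>\<^bsub>V\<^esub>, \<iota> e) \<in> tgen" unfolding ker_def by simp
    then have "e = \<zero>\<^bsub>V\<^esub>" using fst_unique[OF tgen.base[OF e(1)]] by simp
    then show ?thesis using e by simp
  qed
qed

theorem iso_unique_simple_quotient: "iso_unique_simple_quotient witt V W"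
  unfolding iso_unique_simple_quotient_def using ker_kernel ker_unique iso_quot by blast

theorem iso_of_functional:
  assumes "\<And>f. (\<zero>\<^bsub>V\<^esub>, f) \<in> tgen \<Longrightarrow> f = \<zero>\<^bsub>W\<^esub>"
  shows "lie_module_iso witt V W"
  unfolding lie_module_iso_def
proof (intro exI[of _ "\<lambda>v. THE f. (v, f) \<in> tgen"] conjI ballI allI)
  let ?\<psi> = "\<lambda>v. THE f. (v, f) \<in> tgen"
  have un: "f = f'" if "(v, f) \<in> tgen" "(v, f') \<in> tgen" for v f f'
  proof -
    have "f \<ominus>\<^bsub>W\<^esub> f' = \<zero>\<^bsub>W\<^esub>"
      using assms tgen_diff[OF that] tgen_carrier[OF that(1)] by simp
    then show ?thesis using tgen_carrier that by (simp add: W.diff_eq_zero_iff)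
  qed
  have eq: "?\<psi> v = f" if "(v, f) \<in> tgen" for v f
    using that un by blast
  have ex: "\<exists>f\<in>carrier W. (v, f) \<in> tgen" if "v \<in> carrier V" for v
    using tgen_fst_surj[OF simple E_nz that] tgen_carrier by blast
  show "bij_betw ?\<psi> (carrier V) (carrier W)"
  proof (rule bij_betw_imageI)
    show "inj_on ?\<psi> (carrier V)"
    proof (rule inj_onI)
      fix v v' assume *: "v \<in> carrier V" "v' \<in> carrier V" "?\<psi> v = ?\<psi> v'"
      obtain f f' where "(v, f) \<in> tgen" "(v', f') \<in> tgen" using ex * by meson
      then show "v = v'" using eq *(3) fst_unique by metis
    qed
    show "?\<psi> ` carrier V = carrier W"
    proof (intro equalityI subsetI)
      fix f assume "f \<in> ?\<psi> ` carrier V"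
      then show "f \<in> carrier W" using ex eq by force
    next
      fix f assume "f \<in> carrier W"
      then obtain v where "(v, f) \<in> tgen" using snd_surj by blast
      then show "f \<in> ?\<psi> ` carrier V"
        using eq tgen_carrier by (intro image_eqI[where x = v]) auto
    qed
  qed
  fix v assume v: "v \<in> carrier V"
  obtain f where f: "(v, f) \<in> tgen" using ex[OF v] by blast
  show "?\<psi> (c \<odot>\<^bsub>V\<^esub> v) = c \<odot>\<^bsub>W\<^esub> ?\<psi> v" for c
    unfolding eq[OF f] by (rule eq[OF tgen.smult[OF f]])
  show "?\<psi> (act V x v) = act W x (?\<psi> v)" if "x \<in> lset witt" for x
    unfolding eq[OF f] using that by (intro eq[OF tgen_act[OF f]]) simp
  fix v' assume v': "v' \<in> carrier V"
  obtain f' where f': "(v', f') \<in> tgen" using ex[OF v'] by blast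
  show "?\<psi> (v \<oplus>\<^bsub>V\<^esub> v') = ?\<psi> v \<oplus>\<^bsub>W\<^esub> ?\<psi> v'"
    unfolding eq[OF f] eq[OF f'] by (rule eq[OF tgen.add[OF f f']])
qed

end

section \<open>Smooth modules\<close>

lemma annihilated_iff:
  "v \<in> annihilated V r \<longleftrightarrow> v \<in> carrier V \<and> (\<forall>x\<in>witt_ge (int r). act V x v = \<zero>\<^bsub>V\<^esub>)"
  by (simp add: annihilated_def)

text \<open>Smoothness is defined degree by degree, annihilation through the filtration; the grades
  of degree at least m span the latter. L is general because the result serves both
  \<open>witt\<close> and \<open>witt_nonneg\<close>.\<close>

lemma annihilated_grades:
  fixes L :: "'n::finite poly_op lie_algebra" and V :: "('n poly_op, 'v) op_module"
  assumes V: "lmod L V" and L: "witt_ge 0 \<subseteq> lset L" "lscale L = op_scale" and v: "v \<in> carrier V"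
  shows "(\<forall>i\<ge>m. \<forall>x\<in>witt_grade (int i). act V x v = \<zero>\<^bsub>V\<^esub>) \<longleftrightarrow> v \<in> annihilated V m"
proof
  interpret lmod L V by fact
  assume *: "\<forall>i\<ge>m. \<forall>x\<in>witt_grade (int i). act V x v = \<zero>\<^bsub>V\<^esub>"
  \<comment> \<open>Membership is kept in the induction predicate, because the module axioms only
    concern elements of L.\<close>
  have "x \<in> witt_ge (int m) \<and> act V x v = \<zero>\<^bsub>V\<^esub>" if "x \<in> witt_ge (int m)" for x
  proof (rule witt_ge_induct[OF that])
    have lset: "x \<in> lset L" if "x \<in> witt_ge (int m)" for x
      using witt_ge_mono[of 0 "int m" x] L(1) that by auto
    have 0: "0 \<in> witt_ge (int m)" by (rule op.subspace_0[OF witt_ge_subspace])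
    have "act V (op_scale 0 0) v = \<zero>\<^bsub>V\<^esub>"
      using scale_act[OF lset[OF 0] v, of 0] v lset[OF 0] L(2) by simp
    then show "op.subspace {x. x \<in> witt_ge (int m) \<and> act V x v = \<zero>\<^bsub>V\<^esub>}"
      unfolding op.subspace_def
      using 0 v lset scale_act[OF lset v] L(2) add_act[OF lset lset v]
      by (auto intro!: op.subspace_add[OF witt_ge_subspace] op.subspace_scale[OF witt_ge_subspace])
    fix k and D :: "'n poly_op"
    assume k: "int m \<le> k" "D \<in> witt_grade k"
    then have "act V D v = \<zero>\<^bsub>V\<^esub>" using *[rule_format, of "nat k" D] by auto
    then show "D \<in> witt_ge (int m) \<and> act V D v = \<zero>\<^bsub>V\<^esub>"
      using witt_grade_subset_ge[OF k] by simp
  qed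
  then show "v \<in> annihilated V m" using v by (simp add: annihilated_iff)
next
  assume *: "v \<in> annihilated V m"
  show "\<forall>i\<ge>m. \<forall>x\<in>witt_grade (int i). act V x v = \<zero>\<^bsub>V\<^esub>"
  proof (intro allI impI ballI)
    fix i x assume "m \<le> i" "x \<in> (witt_grade (int i) :: 'n poly_op set)"
    then have "x \<in> witt_ge (int m)" by (intro witt_grade_subset_ge[of "int m" "int i"]) auto
    then show "act V x v = \<zero>\<^bsub>V\<^esub>" using * by (simp add: annihilated_iff)
  qed
qed

lemma smooth_iff_annihilated:
  fixes L :: "'n::finite poly_op lie_algebra" and V :: "('n poly_op, 'v) op_module"
  assumes V: "lmod L V" and L: "witt_ge 0 \<subseteq> lset L" "lscale L = op_scale"
  shows "smooth V \<longleftrightarrow> (\<forall>v\<in>carrier V. \<exists>m. v \<in> annihilated V m)"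
  unfolding smooth_def using annihilated_grades[OF V L] by blast

lemma annihilated_mono: "r \<le> s \<Longrightarrow> v \<in> annihilated V r \<Longrightarrow> v \<in> annihilated V s"
  using witt_ge_mono[of "int r" "int s"] by (auto simp: annihilated_iff)

context witt_mod begin

lemma smooth_iff: "smooth V \<longleftrightarrow> (\<forall>v\<in>carrier V. \<exists>m. v \<in> annihilated V m)"
  by (rule smooth_iff_annihilated[OF lmod_axioms]) (auto intro: witt_ge_derivation)

lemma annihilated_submodule: "submodule (annihilated V r) complex_ring V"
  unfolding submodule_iff annihilated_iff
  by (auto simp: annihilated_iff witt_ge_derivation act_add act_smult)

text \<open>x may have a component of degree -1, so its bracket with a field of degree at least m +
  1 is only known to have degree at least m.\<close>

lemma annihilated_act:
  assumes v: "v \<in> annihilated V m" and x: "x \<in> derivations"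
  shows "act V x v \<in> annihilated V (Suc m)"
proof -
  have "act V y (act V x v) = \<zero>" if y: "y \<in> witt_ge (int (Suc m))" for y
  proof -
    have "lbracket witt y x \<in> witt_ge (int (Suc m) + (-1))"
      using y x by (intro witt_ge_bracket[OF y] witt_ge_minus_one order_refl)
    then have "act V (lbracket witt y x) v = \<zero>" using v by (simp add: annihilated_iff)
    moreover have "act V y v = \<zero>"
      using v y annihilated_mono[of m "Suc m" v V] by (simp add: annihilated_iff)
    ultimately show ?thesis
      using act_swap[of y x v] v x witt_ge_derivation[OF y] by (simp add: annihilated_iff)
  qed
  then show ?thesis using v x by (simp add: annihilated_iff)
qed

lemma annihilated_act_nonneg:
  assumes v: "v \<in> annihilated V m" and x: "x \<in> witt_ge 0"
  shows "act V x v \<in> annihilated V m"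
proof -
  have xd: "x \<in> derivations" by (rule witt_ge_derivation[OF x])
  have "act V y (act V x v) = \<zero>" if y: "y \<in> witt_ge (int m)" for y
  proof -
    have "lbracket witt y x \<in> witt_ge (int m + 0)"
      using y x by (intro witt_ge_bracket)
    then have "act V (lbracket witt y x) v = \<zero>" "act V y v = \<zero>"
      using v y by (simp_all add: annihilated_iff)
    then show ?thesis
      using act_swap[of y x v] v xd witt_ge_derivation[OF y] by (simp add: annihilated_iff)
  qed
  then show ?thesis using v xd by (simp add: annihilated_iff)
qed

lemma smooth_vectors_submodule: "lie_submodule witt {v. \<exists>m. v \<in> annihilated V m} V"
  unfolding lie_submodule_iff
proof (intro conjI subsetI ballI allI, goal_cases)
  case (3 v w)
  then obtain m n where "v \<in> annihilated V m" "w \<in> annihilated V n" by blast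
  then have "v \<in> annihilated V (max m n)" "w \<in> annihilated V (max m n)"
    by (auto intro: annihilated_mono[rotated])
  then show ?case using annihilated_submodule[of "max m n"] by (auto simp: submodule_iff)
next
  case (4 c v)
  then obtain m where "v \<in> annihilated V m" by blast
  then have "c \<odot> v \<in> annihilated V m" using annihilated_submodule[of m] by (simp add: submodule_iff)
  then show ?case by blast
next
  case (5 x v)
  then show ?case using annihilated_act by auto
qed (use annihilated_submodule in \<open>auto simp: submodule_iff annihilated_iff\<close>)

lemma smooth_of_simple:
  assumes "simple_lie_module witt V" "v \<in> annihilated V m" "v \<noteq> \<zero>"
  shows "smooth V"
proof -
  have "{v. \<exists>m. v \<in> annihilated V m} = {\<zero>} \<or> {v. \<exists>m. v \<in> annihilated V m} = carrier V"
    using assms(1) smooth_vectors_submodule by (simp add: simple_lie_module_def)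
  then have "{v. \<exists>m. v \<in> annihilated V m} = carrier V" using assms(2,3) by blast
  then show ?thesis using smooth_iff by blast
qed

end

section \<open>Modules carried by a whole type\<close>

lemma op_module_of_simps [simp]:
  "carrier (op_module_of s \<rho>) = UNIV" "zero (op_module_of s \<rho>) = 0"
  "add (op_module_of s \<rho>) = (+)" "smult (op_module_of s \<rho>) = s" "act (op_module_of s \<rho>) = \<rho>"
  by (simp_all add: op_module_of_def)

locale wmod =
  fixes scale :: "complex \<Rightarrow> 'v::ab_group_add \<Rightarrow> 'v"
    and \<rho> :: "'n::finite poly_op \<Rightarrow> 'v \<Rightarrow> 'v"
  assumes lie: "lie_module witt (op_module_of scale \<rho>)"
begin

abbreviation "V \<equiv> op_module_of scale \<rho>"

sublocale M: witt_mod V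
  using lie by (intro witt_mod.intro lie_module_lmod)

sublocale vector_space scale
  using M.smult_add[simplified] M.add_smult[simplified] M.smult_smult[simplified] M.one_smult[simplified]
  by unfold_locales auto

lemma minus_V [simp]: "x \<ominus>\<^bsub>V\<^esub> y = x - y"
  using M.diff_eq_smult[of x y] by simp

lemma finsum_V: "finsum V g A = sum g A"
proof (induction A rule: infinite_finite_induct)
  case (infinite A)
  then show ?case by (simp add: M.mm.M.finsum_infinite)
next
  case (insert a A)
  then show ?case by (simp add: M.mm.M.finsum_insert Pi_def)
qed simp

lemma submodule_V: "submodule W complex_ring V \<longleftrightarrow> subspace W"
  by (auto simp: M.submodule_iff subspace_def)

lemma lie_submodule_V:
  "lie_submodule witt W V \<longleftrightarrow> subspace W \<and> (\<forall>x\<in>derivations. \<forall>w\<in>W. \<rho> x w \<in> W)"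
  by (simp add: lie_submodule_def submodule_V)

lemma subspace_span_V: "subspace_span V S = span S"
  by (simp add: subspace_span_def submodule_V span_def hull_def)

lemma \<rho>_add: "x \<in> derivations \<Longrightarrow> \<rho> x (v + w) = \<rho> x v + \<rho> x w"
  and \<rho>_scale: "x \<in> derivations \<Longrightarrow> \<rho> x (scale c v) = scale c (\<rho> x v)"
  and \<rho>_zero [simp]: "x \<in> derivations \<Longrightarrow> \<rho> x 0 = 0"
  and add_\<rho>: "x \<in> derivations \<Longrightarrow> y \<in> derivations \<Longrightarrow> \<rho> (x + y) v = \<rho> x v + \<rho> y v"
  and scale_\<rho>: "x \<in> derivations \<Longrightarrow> \<rho> (op_scale c x) v = scale c (\<rho> x v)"
  and zero_\<rho> [simp]: "\<rho> 0 v = 0"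
  and bracket_\<rho>: "x \<in> derivations \<Longrightarrow> y \<in> derivations \<Longrightarrow>
        \<rho> (lbracket witt x y) v = \<rho> x (\<rho> y v) - \<rho> y (\<rho> x v)"
  using M.act_add[of x v w] M.act_smult[of x v c] M.act_zero[of x] M.add_act[of x y v]
    M.scale_act[of x v c] M.bracket_act[of x y v] M.act_0[of v] by simp_all

lemma diff_\<rho>: "x \<in> derivations \<Longrightarrow> y \<in> derivations \<Longrightarrow> \<rho> (x - y) v = \<rho> x v - \<rho> y v"
  using add_\<rho>[of "x - y" y v] derivations_closed(4)[of x y] by simp

lemma \<rho>_sum: "x \<in> derivations \<Longrightarrow> \<rho> x (sum g A) = (\<Sum>a\<in>A. \<rho> x (g a))"
  by (induction A rule: infinite_finite_induct) (auto simp: \<rho>_add)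

lemma sum_\<rho>: "(\<And>a. a \<in> A \<Longrightarrow> x a \<in> derivations) \<Longrightarrow> \<rho> (sum x A) v = (\<Sum>a\<in>A. \<rho> (x a) v)"
proof (induction A rule: infinite_finite_induct)
  case (insert a A)
  have "\<rho> (x a + sum x A) v = \<rho> (x a) v + \<rho> (sum x A) v"
    using insert by (intro add_\<rho> derivations_closed) auto
  then show ?case using insert by (simp only: sum.insert insert_iff simp_thms)
next
  case (infinite A)
  show ?case by (simp only: sum.infinite[OF infinite(1)] zero_\<rho>)
qed (simp only: sum.empty zero_\<rho>)

lemma \<rho>_swap: "x \<in> derivations \<Longrightarrow> y \<in> derivations \<Longrightarrow>
    \<rho> x (\<rho> y v) = \<rho> y (\<rho> x v) + \<rho> (lbracket witt x y) v"
  by (simp add: bracket_\<rho>)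

lemma \<rho>_span:
  assumes x: "x \<in> derivations" and S: "\<And>s. s \<in> S \<Longrightarrow> \<rho> x s \<in> W" and W: "subspace W" and v: "v \<in> span S"
  shows "\<rho> x v \<in> W"
  using v
proof (induction rule: span_induct)
  case base
  show ?case using W x by (auto simp: subspace_def \<rho>_add \<rho>_scale)
qed (fact S)

abbreviation F :: "'n cpoly \<Rightarrow> 'n \<Rightarrow> 'v \<Rightarrow> 'v" where
  "F p j \<equiv> \<rho> (fld p j)"

lemma F_add: "F (p + q) j v = F p j v + F q j v"
  and F_diff: "F (p - q) j v = F p j v - F q j v"
  and F_scale: "F (fscale c p) j v = scale c (F p j v)"
  by (simp_all add: fld_add fld_diff fld_fscale add_\<rho> diff_\<rho> scale_\<rho>)

lemma F_sum: "F (sum p A) j v = (\<Sum>a\<in>A. F (p a) j v)"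
  unfolding fld_sum by (rule sum_\<rho>) simp

lemma F_swap: "F p i (F q j v) = F q j (F p i v) + (F (p * pdiff i q) j v - F (q * pdiff j p) i v)"
  by (subst \<rho>_swap) (simp_all add: bracket_fld diff_\<rho>)

lemma \<rho>_expand: "D \<in> derivations \<Longrightarrow> \<rho> D v = (\<Sum>j\<in>UNIV. F (D (tvar j)) j v)"
  by (subst derivation_expand) (auto simp: sum_\<rho>)

end

locale simple_wmod = wmod +
  assumes simple: "simple_lie_module witt V"
begin

lemma simpleD:
  assumes "subspace W" "\<And>x w. x \<in> derivations \<Longrightarrow> w \<in> W \<Longrightarrow> \<rho> x w \<in> W"
  shows "W = {0} \<or> W = UNIV"
  using simple assms lie_submodule_V[of W] by (auto simp: simple_lie_module_def)

lemma ex_nonzero: "\<exists>v::'a. v \<noteq> 0"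
  using simple by (auto simp: simple_lie_module_def)

end

section \<open>Locally finite operators\<close>

context wmod begin

lemma pow_add: "x \<in> derivations \<Longrightarrow> (\<rho> x ^^ N) (v + w) = (\<rho> x ^^ N) v + (\<rho> x ^^ N) w"
  by (induction N) (auto simp: \<rho>_add)

lemma pow_scale: "x \<in> derivations \<Longrightarrow> (\<rho> x ^^ N) (scale c v) = scale c ((\<rho> x ^^ N) v)"
  by (induction N) (auto simp: \<rho>_scale)

lemma pow_zero: "x \<in> derivations \<Longrightarrow> (\<rho> x ^^ N) 0 = 0"
  by (induction N) auto

lemma pow_zero_mono: "x \<in> derivations \<Longrightarrow> (\<rho> x ^^ N) v = 0 \<Longrightarrow> N \<le> M \<Longrightarrow> (\<rho> x ^^ M) v = 0"
  by (metis comp_apply funpow_add le_add_diff_inverse2 pow_zero)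

lemma annihilated_V: "v \<in> annihilated V r \<longleftrightarrow> (\<forall>x\<in>witt_ge (int r). \<rho> x v = 0)"
  by (simp add: annihilated_iff)

lemma F_single: "F (Poly_Mapping.single \<alpha> c) j v = scale c (F (tmonom \<alpha>) j v)"
  using F_scale[of c "tmonom \<alpha>" j v] by simp

lemma F_expand: "F p j v = (\<Sum>\<alpha>\<in>Poly_Mapping.keys p. scale (Poly_Mapping.lookup p \<alpha>) (F (tmonom \<alpha>) j v))"
proof -
  have "F (\<Sum>\<alpha>\<in>Poly_Mapping.keys p. Poly_Mapping.single \<alpha> (Poly_Mapping.lookup p \<alpha>)) j v
      = (\<Sum>\<alpha>\<in>Poly_Mapping.keys p. scale (Poly_Mapping.lookup p \<alpha>) (F (tmonom \<alpha>) j v))"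
    unfolding F_sum by (rule sum.cong[OF refl F_single])
  then show ?thesis by (simp only: poly_mapping_expand[symmetric])
qed

lemma annihilatedI:
  assumes "\<And>\<alpha> j. mdeg \<alpha> \<ge> Suc r \<Longrightarrow> F (tmonom \<alpha>) j v = 0"
  shows "v \<in> annihilated V r"
  unfolding annihilated_V
proof
  fix x assume x: "x \<in> (witt_ge (int r) :: 'n poly_op set)"
  have "F (x (tvar j)) j v = 0" for j
  proof -
    have "F (tmonom \<alpha>) j v = 0" if "\<alpha> \<in> Poly_Mapping.keys (x (tvar j))" for \<alpha>
    proof -
      have "int r + 1 \<le> int (mdeg \<alpha>)" using x that by (auto simp: witt_ge_iff ord_ge_def)
      then show ?thesis using assms[of \<alpha> j] by simp
    qed
    then show ?thesis unfolding F_expand[of "x (tvar j)"] by (simp add: sum.neutral)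
  qed
  then show "\<rho> x v = 0" using \<rho>_expand[OF witt_ge_derivation[OF x]] by simp
qed

text \<open>Moving x to the right past y gives a term with one more x on w, and a term with [x, y]
  in place of y, whose degree is larger by at least 1. Either way the measure (c - j) + (m - s)
  drops. It ends at j = c, where x^j w = 0, or at s \<ge> m, where y kills x^j w.\<close>

lemma nilpotent_step:
  assumes x: "x \<in> witt_ge k" "k \<ge> 1" and c: "(\<rho> x ^^ c) w = 0"
    and m: "\<And>j. j < c \<Longrightarrow> (\<rho> x ^^ j) w \<in> annihilated V m"
    and "j \<le> c" "y \<in> witt_ge s" "(c - j) + nat (int m - s) \<le> N"
  shows "(\<rho> x ^^ N) (\<rho> y ((\<rho> x ^^ j) w)) = 0"
  using assms(5-)
proof (induction N arbitrary: j y s)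
  case 0
  then have "j = c" by simp
  then show ?case using c witt_ge_derivation[OF 0(2)] by simp
next
  case (Suc N)
  have xd: "x \<in> derivations" and yd: "y \<in> derivations"
    using x Suc witt_ge_derivation by auto
  show ?case
  proof (cases "j = c \<or> s \<ge> int m")
    case True
    then have "\<rho> y ((\<rho> x ^^ j) w) = 0"
    proof (cases "j = c")
      case False
      then have "s \<ge> int m" "j < c" using True Suc by auto
      then show ?thesis using m[of j] witt_ge_mono[of "int m" s y] Suc by (simp add: annihilated_V)
    qed (use c yd in simp)
    then show ?thesis using pow_zero[OF xd, of "Suc N"] by (simp only:)
  next
    case False
    then have j: "j < c" and s: "s < int m" using Suc by auto
    have 1: "\<rho> x (\<rho> y ((\<rho> x ^^ j) w)) = \<rho> y ((\<rho> x ^^ Suc j) w) + \<rho> (lbracket witt x y) ((\<rho> x ^^ j) w)"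
      using \<rho>_swap[OF xd yd] by simp
    have 2: "(\<rho> x ^^ N) (\<rho> y ((\<rho> x ^^ Suc j) w)) = 0"
      using Suc.prems j by (intro Suc.IH[where s = s]) auto
    have "lbracket witt x y \<in> witt_ge (k + s)" using x Suc by (intro witt_ge_bracket)
    then have 3: "(\<rho> x ^^ N) (\<rho> (lbracket witt x y) ((\<rho> x ^^ j) w)) = 0"
      using Suc.prems j x s by (intro Suc.IH[where s = "k + s"]) auto
    show ?thesis using 1 2 3 by (simp add: pow_add[OF xd] funpow_swap1)
  qed
qed

end

context simple_wmod begin

lemma nilpotent_of_smooth:
  assumes sm: "\<And>v. \<exists>m. v \<in> annihilated V m"
    and x: "x \<in> witt_ge k" "k \<ge> 1" and v: "v \<noteq> 0" "\<rho> x v = 0"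
  shows "\<exists>N. (\<rho> x ^^ N) w = 0"
proof -
  let ?W = "{w. \<exists>N. (\<rho> x ^^ N) w = 0}"
  have xd: "x \<in> derivations" using x witt_ge_derivation by auto
  have "?W = {0} \<or> ?W = UNIV"
  proof (rule simpleD)
    show "subspace ?W"
      unfolding subspace_def
    proof (intro conjI ballI allI)
      show "0 \<in> ?W" using pow_zero[OF xd, of 0] by blast
      fix a b c assume "a \<in> ?W"
      then obtain N where N: "(\<rho> x ^^ N) a = 0" by blast
      then show "scale c a \<in> ?W" using pow_scale[OF xd, of N c a] by auto
      assume "b \<in> ?W"
      then obtain M where M: "(\<rho> x ^^ M) b = 0" by blast
      have "(\<rho> x ^^ (max N M)) (a + b) = 0"
        using pow_zero_mono[OF xd N, of "max N M"] pow_zero_mono[OF xd M, of "max N M"]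
        by (simp add: pow_add[OF xd])
      then show "a + b \<in> ?W" by blast
    qed
    fix y :: "'b poly_op" and w assume y: "y \<in> derivations" and "w \<in> ?W"
    then obtain c where c: "(\<rho> x ^^ c) w = 0" by blast
    \<comment> \<open>Only the finitely many x^j w with j < c matter; the sum of their bounds serves
      as a common degree.\<close>
    obtain f where f: "\<And>j. (\<rho> x ^^ j) w \<in> annihilated V (f j)"
      using choice[of "\<lambda>j m. (\<rho> x ^^ j) w \<in> annihilated V m"] sm by auto
    have m: "(\<rho> x ^^ j) w \<in> annihilated V (\<Sum>j<c. f j)" if "j < c" for j
      using that member_le_sum[of j "{..<c}" f] by (intro annihilated_mono[OF _ f]) auto
    \<comment> \<open>An arbitrary derivation has degree at least -1, so c + m + 1 applications of x
      suffice, where m is the common bound.\<close>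
    have y1: "y \<in> witt_ge (-1)" by (rule witt_ge_minus_one[OF y]) simp
    show "\<rho> y w \<in> ?W"
      using nilpotent_step[OF x c m le0 y1 order_refl] by auto
  qed
  moreover have "v \<in> ?W" using v by (auto intro!: exI[of _ "Suc 0"])
  ultimately show ?thesis using v by blast
qed

theorem locally_finite_of_smooth:
  assumes "smooth V"
  shows "\<exists>k::'b \<Rightarrow> nat. (\<forall>i. k i > 0) \<and>
     (\<forall>i. locally_finite V (monom_field (Poly_Mapping.single i (k i + 1)) i))"
proof -
  have sm: "\<exists>m. v \<in> annihilated V m" for v using assms M.smooth_iff by simp
  obtain v :: 'a where v: "v \<noteq> 0" using ex_nonzero by blast
  obtain m where m: "v \<in> annihilated V m" using sm by blast
  define k where "k = Suc m"
  have "locally_finite V (monom_field (Poly_Mapping.single i (k + 1)) i)" for i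
  proof -
    define x :: "'b poly_op" where "x = monom_field (Poly_Mapping.single i (k + 1)) i"
    have x: "x \<in> witt_ge (int k)"
      unfolding x_def monom_field_eq_fld by (rule fld_witt_ge) (simp add: ord_ge_single)
    then have xv: "\<rho> x v = 0"
      using m annihilated_mono[of m k v V] unfolding annihilated_V k_def by simp
    have nil: "\<exists>N. (\<rho> x ^^ N) w = 0" for w
      using nilpotent_of_smooth[OF sm x _ v xv] by (simp add: k_def)
    have xd: "x \<in> derivations" using x witt_ge_derivation by auto
    show ?thesis
      unfolding locally_finite_def x_def[symmetric] subspace_span_V
    proof
      fix w
      obtain N where N: "(\<rho> x ^^ N) w = 0" using nil by blast
      let ?B = "(\<lambda>j. (\<rho> x ^^ j) w) ` {..<N}"
      have "(\<rho> x ^^ j) w \<in> span ?B" for j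
      proof (cases "j < N")
        case True then show ?thesis by (intro span_base) auto
      next
        case False
        then have "(\<rho> x ^^ j) w = 0" using pow_zero_mono[OF xd N, of j] by simp
        then show ?thesis using span_zero by simp
      qed
      then have "span {(\<rho> x ^^ j) w | j. True} = span ?B"
        unfolding span_eq by (auto intro: span_base)
      then show "\<exists>B. finite B \<and> B \<subseteq> carrier V \<and> span {(act V x ^^ k) w |k. True} = span B"
        by (intro exI[of _ ?B]) auto
    qed
  qed
  then show ?thesis by (intro exI[of _ "\<lambda>_. k"]) (simp add: k_def)
qed

end

section \<open>Polynomials in one of the variables\<close>

definition emb :: "'n \<Rightarrow> complex poly \<Rightarrow> 'n cpoly" where
  "emb i p = poly (map_poly (Poly_Mapping.single 0) p) (tvar i)"

lemma emb_0 [simp]: "emb i 0 = 0"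
  by (simp add: emb_def)

lemma emb_pCons: "emb i (pCons a p) = Poly_Mapping.single 0 a + tvar i * emb i p"
  by (simp add: emb_def map_poly_pCons)

lemma emb_add: "emb i (p + q) = emb i p + emb i q"
proof (induction p arbitrary: q)
  case (pCons a p)
  obtain b q' where q: "q = pCons b q'" by (cases q)
  show ?case
    by (simp add: q emb_pCons pCons.IH single_add algebra_simps)
qed simp

lemma emb_smult: "emb i (Polynomial.smult c p) = fscale c (emb i p)"
  by (induction p) (simp_all add: emb_pCons pm.scale_right_distrib fscale_mult_right)

lemma emb_diff: "emb i (p - q) = emb i p - emb i q"
  using emb_add[of i "p - q" q] by simp

lemma emb_mult: "emb i (p * q) = emb i p * emb i q"
  by (induction p) (simp_all add: emb_pCons emb_add emb_smult algebra_simps fscale_conv_mult)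

lemma emb_monom: "emb i (Polynomial.monom c a) = Poly_Mapping.single (Poly_Mapping.single i a) c"
  by (induction a) (simp_all add: monom_0 monom_Suc emb_pCons mult_single plus_1_eq_Suc flip: single_add)

lemma pdiff_const [simp]: "pdiff i (Poly_Mapping.single 0 c) = 0"
  by (simp add: pdiff_single)

lemma pdiff_emb: "pdiff j (emb i p) = (if j = i then emb i (pderiv p) else 0)"
  by (induction p) (auto simp: emb_pCons pdiff_add pdiff_mult pderiv_pCons emb_add)

text \<open>Monomials can be integrated in t_i. In \<open>square_in_ann_ideal\<close> this lets a
  derivative stand for an arbitrary polynomial.\<close>

lemma pdiff_surj: "\<exists>h. pdiff i h = q"
proof (induction q rule: poly_mapping_induct)
  case (single \<alpha> c)
  have "pdiff i (Poly_Mapping.single (\<alpha> + unit_idx i) (c / of_nat (Poly_Mapping.lookup \<alpha> i + 1)))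
      = Poly_Mapping.single \<alpha> c"
    by (simp add: pdiff_single lookup_add del: of_nat_add of_nat_Suc)
  then show ?case by blast
next
  case (add f g)
  then show ?case using pdiff_add by metis
qed

text \<open>Finitely many linear conditions leave a nonzero solution in an infinite-dimensional
  space: some combination of two solutions p, q for the smaller family satisfies the new condition
  too. The vanishing of low coefficients is part of the induction so that q can be given a larger
  degree than p, which keeps the combination nonzero.\<close>

lemma poly_common_kernel:
  fixes \<Phi> :: "(complex poly \<Rightarrow> complex) set"
  assumes "finite \<Phi>" "\<And>\<phi> p q. \<phi> \<in> \<Phi> \<Longrightarrow> \<phi> (p + q) = \<phi> p + \<phi> q"
    "\<And>\<phi> c p. \<phi> \<in> \<Phi> \<Longrightarrow> \<phi> (Polynomial.smult c p) = c * \<phi> p"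
  shows "\<exists>p. p \<noteq> 0 \<and> (\<forall>i<d. Polynomial.coeff p i = 0) \<and> (\<forall>\<phi>\<in>\<Phi>. \<phi> p = 0)"
  using assms
proof (induction \<Phi> arbitrary: d rule: finite_induct)
  case empty
  show ?case by (intro exI[of _ "Polynomial.monom 1 d"]) (simp add: monom_eq_0_iff)
next
  case (insert \<phi> \<Phi>)
  obtain p where p: "p \<noteq> 0" "\<forall>i<d. Polynomial.coeff p i = 0" "\<forall>\<phi>\<in>\<Phi>. \<phi> p = 0"
    using insert.IH[of d] insert.prems by auto
  obtain q where q: "q \<noteq> 0" "\<forall>i<Suc (degree p) + d. Polynomial.coeff q i = 0" "\<forall>\<phi>\<in>\<Phi>. \<phi> q = 0"
    using insert.IH[of "Suc (degree p) + d"] insert.prems by auto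
  show ?case
  proof (cases "\<phi> p = 0")
    case True
    then show ?thesis using p by auto
  next
    case False
    define r where "r = q + Polynomial.smult (- \<phi> q / \<phi> p) p"
    have lin: "\<psi> r = \<psi> q + (- \<phi> q / \<phi> p) * \<psi> p" if "\<psi> \<in> insert \<phi> \<Phi>" for \<psi>
      unfolding r_def using insert.prems that by metis
    have "Polynomial.coeff r (degree q) = lead_coeff q"
    proof -
      have "degree q > degree p"
      proof (rule ccontr)
        assume "\<not> degree q > degree p"
        then have "degree q < Suc (degree p) + d" by simp
        then have "lead_coeff q = 0" using q(2) by blast
        then show False using q(1) by simp
      qed
      then show ?thesis by (simp add: r_def coeff_eq_0)
    qed
    then have "r \<noteq> 0" using q(1) by (metis leading_coeff_0_iff coeff_0)
    moreover have "\<forall>i<d. Polynomial.coeff r i = 0" using p(2) q(2) by (simp add: r_def)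
    moreover have "\<forall>\<psi>\<in>insert \<phi> \<Phi>. \<psi> r = 0"
    proof
      fix \<psi> assume \<psi>: "\<psi> \<in> insert \<phi> \<Phi>"
      have "\<psi> p = 0" "\<psi> q = 0" if "\<psi> \<noteq> \<phi>" using \<psi> that p(3) q(3) by auto
      then show "\<psi> r = 0" using lin[OF \<psi>] False by (cases "\<psi> = \<phi>") simp_all
    qed
    ultimately show ?thesis by blast
  qed
qed

section \<open>From local finiteness to smoothness\<close>

locale locally_finite_wmod = wmod +
  fixes k :: "'b \<Rightarrow> nat"
  assumes k_pos: "\<And>i. k i > 0"
    and lf: "\<And>i. locally_finite V (monom_field (Poly_Mapping.single i (k i + 1)) i)"
begin

abbreviation "T i \<equiv> tmonom (Poly_Mapping.single i (k i + 1)) :: 'b cpoly"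
abbreviation "X i \<equiv> F (T i) i"

lemma pdiff_T: "pdiff j (T i) = (if j = i then Poly_Mapping.single (Poly_Mapping.single i (k i)) (of_nat (k i + 1)) else 0)"
proof -
  have "Poly_Mapping.single i (k i + 1) - unit_idx i = Poly_Mapping.single i (k i)"
    by (intro poly_mapping_eqI) (simp add: lookup_minus lookup_single when_def)
  then show ?thesis by (simp add: pdiff_single lookup_single when_def)
qed

lemma X_commute: "X i (X j v) = X j (X i v)"
  using F_swap[of "T i" i "T j" j v] by (cases "i = j") (simp_all add: pdiff_T)

lemma X_swap:
  "X i (F q j w) = F q j (X i w) + (F (T i * pdiff i q) j w - F (q * pdiff j (T i)) i w)"
  by (rule F_swap)

lemma X_lf: "\<exists>C. finite C \<and> span {(X i ^^ n) v | n. True} = span C"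
  using lf[of i] by (simp add: locally_finite_def subspace_span_V monom_field_eq_fld)

text \<open>One operator is treated at a time: the X_i^n b span a finite-dimensional space, and
  since the X_j commute, this space stays stable under the operators treated before.\<close>

lemma finite_stable:
  assumes "finite S" "finite I"
  shows "\<exists>B. finite B \<and> S \<subseteq> span B \<and> (\<forall>i\<in>I. \<forall>w\<in>span B. X i w \<in> span B)"
  using assms(2)
proof (induction I rule: finite_induct)
  case empty
  show ?case using assms(1) span_superset by blast
next
  case (insert i I)
  obtain B where B: "finite B" "S \<subseteq> span B" "\<And>j w. j \<in> I \<Longrightarrow> w \<in> span B \<Longrightarrow> X j w \<in> span B"
    using insert by blast
  obtain C where C: "\<And>b. finite (C b)" "\<And>b. span {(X i ^^ n) b | n. True} = span (C b)"
    using X_lf[of i] by metis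
  let ?G = "{(X i ^^ n) b | n b. b \<in> B}" and ?C = "\<Union>b\<in>B. C b"
  have "span ?G = span ?C"
    unfolding span_eq
  proof (intro conjI subsetI)
    fix v assume "v \<in> ?G"
    then obtain n b where "v = (X i ^^ n) b" "b \<in> B" by blast
    then have "v \<in> span (C b)" unfolding C(2)[symmetric] by (intro span_base) blast
    then show "v \<in> span ?C" using span_mono[of "C b" ?C] \<open>b \<in> B\<close> by blast
  next
    fix v assume "v \<in> ?C"
    then obtain b where b: "b \<in> B" "v \<in> C b" by blast
    then have "v \<in> span {(X i ^^ n) b | n. True}" unfolding C(2) by (intro span_base)
    moreover have "{(X i ^^ n) b | n. True} \<subseteq> ?G" using b(1) by blast
    ultimately show "v \<in> span ?G" using span_mono by blast
  qed
  moreover have G: "(X i ^^ n) w \<in> span ?G" if "w \<in> span B" for n w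
    using that
  proof (induction rule: span_induct)
    case base
    show ?case
      by (auto simp: subspace_def pow_zero pow_add pow_scale intro: span_zero span_add span_scale)
  next
    case (step b)
    then show ?case by (intro span_base) blast
  qed
  moreover have "S \<subseteq> span ?G" using B(2) G[where n = 0] by auto
  moreover have "X i w \<in> span ?G" if "w \<in> span ?G" for w
  proof (rule \<rho>_span[OF _ _ _ that])
    fix s assume "s \<in> ?G"
    then obtain n b where s: "s = (X i ^^ n) b" "b \<in> B" by blast
    then have "X i s = (X i ^^ Suc n) b" by simp
    then show "X i s \<in> span ?G" using s(2) G[of b "Suc n"] span_base by metis
  qed auto
  moreover have "X j w \<in> span ?G" if "j \<in> I" "w \<in> span ?G" for j w
  proof (rule \<rho>_span[OF _ _ _ that(2)])
    fix s assume "s \<in> ?G"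
    then obtain n b where s: "s = (X i ^^ n) b" "b \<in> B" by blast
    have "X j ((X i ^^ n) b) = (X i ^^ n) (X j b)" for b
      by (induction n) (simp_all add: X_commute[of j])
    then have "X j s = (X i ^^ n) (X j b)" using s(1) by simp
    moreover have "X j b \<in> span B" using s(2) by (intro B(3)[OF that(1)] span_base)
    ultimately show "X j s \<in> span ?G" using G by simp
  qed auto
  moreover have "finite ?C" using B(1) C(1) by auto
  ultimately show ?case by (intro exI[of _ ?C]) auto
qed

text \<open>Let \<alpha>' be \<alpha> with the exponent at i lowered by k_i. The commutator of X_i
  and t^\<alpha>' \<partial>_j is a multiple of t^\<alpha> \<partial>_j. Where the factor is
  nonzero, an X-stable space that receives t^\<alpha>' \<partial>_j also receives t^\<alpha>
  \<partial>_j, so finitely many exponents decide.\<close>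

lemma finite_action:
  assumes B: "finite B" "\<And>i w. w \<in> span B \<Longrightarrow> X i w \<in> span B"
  shows "\<exists>C. finite C \<and> (\<forall>p j. \<forall>w\<in>span B. F p j w \<in> span C)"
proof -
  \<comment> \<open>An exponent of at least 2 k_i + 2 at i leaves at least k_i + 2 in \<alpha>', so
    that the factor \<alpha>'_i - (k_i + 1) arising for j = i is nonzero.\<close>
  define A where "A = {\<alpha> :: 'b \<Rightarrow>\<^sub>0 nat. \<forall>i. Poly_Mapping.lookup \<alpha> i \<le> 2 * k i + 1}"
  have "finite A"
  proof (rule finite_subset[OF _ finite_mdeg_le])
    show "A \<subseteq> {\<alpha>. mdeg \<alpha> \<le> (\<Sum>i\<in>UNIV. 2 * k i + 1)}"
      unfolding A_def mdeg_def by (auto intro!: sum_mono)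
  qed
  then have "finite ((\<lambda>(\<alpha>, j, b). F (tmonom \<alpha>) j b) ` (A \<times> UNIV \<times> B))" using B(1) by auto
  from finite_stable[OF this, of UNIV] obtain C where C: "finite C"
    "(\<lambda>(\<alpha>, j, b). F (tmonom \<alpha>) j b) ` (A \<times> UNIV \<times> B) \<subseteq> span C" "\<And>i w. w \<in> span C \<Longrightarrow> X i w \<in> span C"
    by auto
  have gen: "F (tmonom \<alpha>) j b \<in> span C" if "\<alpha> \<in> A" "b \<in> B" for \<alpha> j b
    using C(2) that by (auto simp: image_subset_iff)
  have mon: "F (tmonom \<alpha>) j w \<in> span C" if "w \<in> span B" for \<alpha> j w
    using that
  proof (induction "mdeg \<alpha>" arbitrary: \<alpha> w rule: less_induct)
    case less
    show ?case
    proof (cases "\<alpha> \<in> A")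
      case True
      show ?thesis
        using gen True by (intro \<rho>_span[OF _ _ subspace_span less(2)]) auto
    next
      case False
      then obtain i where i: "Poly_Mapping.lookup \<alpha> i \<ge> 2 * k i + 2"
        by (auto simp: A_def not_le) (metis Suc_leI add_2_eq_Suc' Suc_eq_plus1)
      define \<alpha>' where "\<alpha>' = \<alpha> - Poly_Mapping.single i (k i)"
      have \<alpha>: "\<alpha> = \<alpha>' + Poly_Mapping.single i (k i)"
        using i by (intro poly_mapping_eqI) (auto simp: \<alpha>'_def lookup_add lookup_minus lookup_single when_def)
      have ai: "Poly_Mapping.lookup \<alpha>' i \<ge> k i + 2"
        using i by (simp add: \<alpha>'_def lookup_minus)
      have deg: "mdeg \<alpha>' < mdeg \<alpha>" using k_pos[of i] by (simp add: \<alpha>)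
      have "Poly_Mapping.single i (k i + 1) + (\<alpha>' - unit_idx i) = \<alpha>"
        using ai by (intro poly_mapping_eqI) (auto simp: \<alpha> lookup_add lookup_minus lookup_single when_def)
      then have 1: "T i * pdiff i (tmonom \<alpha>') = Poly_Mapping.single \<alpha> (of_nat (Poly_Mapping.lookup \<alpha>' i))"
        by (simp add: pdiff_single mult_single)
      have 2: "tmonom \<alpha>' * pdiff j (T i) = (if j = i then Poly_Mapping.single \<alpha> (of_nat (k i + 1)) else 0)"
        by (simp add: pdiff_T mult_single \<alpha>)
      define c :: complex where
        "c = of_nat (Poly_Mapping.lookup \<alpha>' i) - (if j = i then of_nat (k i + 1) else 0)"
      have "c \<noteq> 0"
      proof -
        have "c = of_nat (Poly_Mapping.lookup \<alpha>' i - (if j = i then k i + 1 else 0))"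
          using ai by (simp add: c_def of_nat_diff)
        then show ?thesis using ai by (simp only: of_nat_eq_0_iff) auto
      qed
      have "X i (F (tmonom \<alpha>') j w) - F (tmonom \<alpha>') j (X i w) = scale c (F (tmonom \<alpha>) j w)"
        unfolding X_swap 1 2 c_def
        by (cases "j = i") (simp_all add: F_single[of \<alpha> "of_nat _"] F_single[of \<alpha> "of_nat _ + _"] scale_left_diff_distrib)
      moreover have "F (tmonom \<alpha>') j w \<in> span C" "F (tmonom \<alpha>') j (X i w) \<in> span C"
        using less deg B(2) by auto
      ultimately have "scale c (F (tmonom \<alpha>) j w) \<in> span C"
        using C(3) span_diff by metis
      then have "scale (inverse c) (scale c (F (tmonom \<alpha>) j w)) \<in> span C" by (rule span_scale)
      then show ?thesis using \<open>c \<noteq> 0\<close> by simp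
    qed
  qed
  have "F p j w \<in> span C" if w: "w \<in> span B" for p j w
    unfolding F_expand[of p] by (intro span_sum span_scale mon w)
  then show ?thesis using C(1) by blast
qed

text \<open>The coordinates of p(t_i) \<partial>_i b, for b in B and with respect to a basis of the
  span of C, are finitely many linear functionals of p.\<close>

lemma finite_kernel:
  assumes B: "finite B" and C: "finite C" "\<And>p j w. w \<in> span B \<Longrightarrow> F p j w \<in> span C"
  shows "\<exists>p. p \<noteq> 0 \<and> (\<forall>w\<in>span B. F (emb i p) i w = 0)"
proof -
  obtain C' where C': "C' \<subseteq> C" "independent C'" "C \<subseteq> span C'"
    using maximal_independent_subset[of C] by blast
  then have sp: "span C' = span C" by (metis span_eq span_superset subset_trans)
  have fin: "finite C'" using C'(1) C(1) finite_subset by blast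
  define \<phi> where "\<phi> b c p = representation C' (F (emb i p) i b) c" for b c p
  have in_span: "F (emb i p) i b \<in> span C'" if "b \<in> B" for b p
    unfolding sp using that by (intro C(2) span_base)
  let ?\<Phi> = "(\<lambda>(b, c). \<phi> b c) ` (B \<times> C')"
  have "\<exists>p. p \<noteq> 0 \<and> (\<forall>i<0. Polynomial.coeff p i = 0) \<and> (\<forall>\<psi>\<in>?\<Phi>. \<psi> p = 0)"
  proof (rule poly_common_kernel)
    show "finite ?\<Phi>" using B fin by auto
    show "\<psi> (p + q) = \<psi> p + \<psi> q" if "\<psi> \<in> ?\<Phi>" for \<psi> p q
      using that in_span by (auto simp: \<phi>_def emb_add F_add representation_add[OF C'(2)])
    show "\<psi> (Polynomial.smult c p) = c * \<psi> p" if "\<psi> \<in> ?\<Phi>" for \<psi> c p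
      using that in_span by (auto simp: \<phi>_def emb_smult F_scale representation_scale[OF C'(2)])
  qed
  then obtain p where p: "p \<noteq> 0" "\<And>b c. b \<in> B \<Longrightarrow> c \<in> C' \<Longrightarrow> \<phi> b c p = 0" by auto
  have "F (emb i p) i b = 0" if "b \<in> B" for b
  proof -
    have "(\<Sum>c\<in>C'. scale (representation C' (F (emb i p) i b) c) c) = F (emb i p) i b"
      by (rule sum_representation_eq[OF C'(2) in_span[OF that] fin order_refl])
    then show ?thesis using p(2)[OF that] by (simp add: \<phi>_def)
  qed
  then have "F (emb i p) i w \<in> {0}" if "w \<in> span B" for w
    by (intro \<rho>_span[OF _ _ _ that]) (auto simp: subspace_def)
  then show ?thesis using p(1) by blast
qed

text \<open>The extra factor r and the arbitrary direction l make this an ideal of polynomials by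
  construction: all of q L kills W.\<close>

definition ann_ideal :: "'a set \<Rightarrow> 'b cpoly set" where
  "ann_ideal W = {q. \<forall>r l. \<forall>w\<in>W. F (q * r) l w = 0}"

lemma ann_ideal_mult: "q \<in> ann_ideal W \<Longrightarrow> q * r \<in> ann_ideal W"
  by (simp add: ann_ideal_def mult.assoc)

lemma ann_ideal_diff: "q \<in> ann_ideal W \<Longrightarrow> q' \<in> ann_ideal W \<Longrightarrow> q - q' \<in> ann_ideal W"
  by (simp add: ann_ideal_def left_diff_distrib F_diff)

lemma ann_ideal_fscale: "q \<in> ann_ideal W \<Longrightarrow> fscale c q \<in> ann_ideal W"
  using ann_ideal_mult[of q W "Poly_Mapping.single 0 c"] by (simp add: fscale_conv_mult mult.commute)

text \<open>In [X_i, q r \<partial>_l] = T_i \<partial>_i(q r) \<partial>_l - q r \<partial>_l(T_i)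
  \<partial>_i the last term kills W, and so does the part of the first in which r is
  differentiated.\<close>

lemma ann_ideal_X:
  assumes q: "q \<in> ann_ideal W" and W: "\<And>w. w \<in> W \<Longrightarrow> X i w \<in> W"
  shows "T i * pdiff i q \<in> ann_ideal W"
proof -
  have "F (T i * pdiff i q * r) l w = 0" if w: "w \<in> W" for r l w
  proof -
    have z: "F (q * s) j v = 0" if "v \<in> W" for s j v using q that by (simp add: ann_ideal_def)
    have "X i (F (q * r) l w) = F (q * r) l (X i w)
        + (F (T i * pdiff i (q * r)) l w - F (q * r * pdiff l (T i)) i w)"
      by (rule X_swap)
    then have "F (T i * pdiff i (q * r)) l w = 0"
      using z[OF w, of r] z[OF W[OF w], of r] z[OF w, of "r * pdiff l (T i)"] by (simp add: mult.assoc)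
    moreover have "T i * pdiff i (q * r) = T i * pdiff i q * r + q * (T i * pdiff i r)"
      by (simp add: pdiff_mult algebra_simps)
    ultimately show ?thesis using z[OF w] by (simp add: F_add)
  qed
  then show ?thesis by (simp add: ann_ideal_def)
qed

text \<open>The derivation t^(k+1) d/dt preserves the ideal. Apply it to t^a P and subtract the
  multiple of t^k t^a P that removes the leading term: what remains is t^(k+a) Q, where Q has fewer
  nonzero coefficients than P. The descent ends at a monomial.\<close>

lemma monom_in_ann_ideal:
  assumes W: "\<And>w. w \<in> W \<Longrightarrow> X i w \<in> W"
    and "P \<noteq> 0" "emb i (Polynomial.monom 1 a * P) \<in> ann_ideal W"
  shows "\<exists>m. tmonom (Poly_Mapping.single i m) \<in> ann_ideal W"
  using assms(2,3)
proof (induction "card {c. Polynomial.coeff P c \<noteq> 0}" arbitrary: P a rule: less_induct)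
  case less
  let ?d = "degree P" and ?R = "Polynomial.monom 1 a * P"
  have fin: "finite {c. Polynomial.coeff P c \<noteq> 0}"
    by (rule finite_subset[of _ "{..degree P}"]) (auto simp: le_degree)
  \<comment> \<open>Q = t P' - deg(P) P multiplies the coefficient of index c by c - deg(P), so
    exactly the leading one is lost.\<close>
  define Q where "Q = pCons 0 (pderiv P) - Polynomial.smult (of_nat ?d) P"
  have cQ: "Polynomial.coeff Q c = (of_nat c - of_nat ?d) * Polynomial.coeff P c" for c
    by (cases c) (simp_all add: Q_def coeff_pderiv algebra_simps)
  have eq: "Polynomial.monom 1 (k i + 1) * pderiv ?R
      - Polynomial.smult (of_nat (a + ?d)) (Polynomial.monom 1 (k i) * ?R)
      = Polynomial.monom 1 (k i + a) * Q"
  proof -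
    have "Polynomial.monom 1 1 * pderiv (Polynomial.monom 1 a) = Polynomial.smult (of_nat a) (Polynomial.monom 1 a :: complex poly)"
      by (cases a) (simp_all add: pderiv_monom mult_monom smult_monom plus_1_eq_Suc)
    then have e3: "Polynomial.monom 1 1 * pderiv (Polynomial.monom 1 a) = [:of_nat a:] * (Polynomial.monom 1 a :: complex poly)"
      by simp
    have e1: "Polynomial.monom 1 (k i + 1) = Polynomial.monom 1 (k i) * (Polynomial.monom 1 1 :: complex poly)"
      and e2: "Polynomial.monom 1 (k i + a) = Polynomial.monom 1 (k i) * (Polynomial.monom 1 a :: complex poly)"
      by (simp_all add: mult_monom)
    have e4: "pCons 0 p = Polynomial.monom 1 1 * (p :: complex poly)" for p
      using monom_Suc[of "1 :: complex" 0] by (simp add: monom_0 One_nat_def)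
    have e5: "Polynomial.smult c p = [:c:] * p" for c and p :: "complex poly" by simp
    have e6: "[:of_nat (a + ?d):] = [:of_nat a:] + ([:of_nat ?d:] :: complex poly)" by simp
    have ring: "M * x * (A * P' + P * A') - (ca + cd) * (M * (A * P)) = M * A * (x * P' - cd * P)"
      if "x * A' = ca * A" for M x A P P' A' ca cd :: "complex poly"
    proof -
      have "M * x * (A * P' + P * A') = M * A * x * P' + M * P * (x * A')"
        by (simp add: algebra_simps)
      then show ?thesis unfolding that by (simp add: algebra_simps)
    qed
    show ?thesis
      unfolding Q_def e1 e2 e4 e5 e6 pderiv_mult by (rule ring[OF e3])
  qed
  have "emb i (Polynomial.monom 1 (k i + a) * Q)
      = T i * pdiff i (emb i ?R) - fscale (of_nat (a + ?d)) (emb i ?R * tmonom (Poly_Mapping.single i (k i)))"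
    unfolding eq[symmetric] by (simp add: emb_diff emb_smult emb_mult[of i "Polynomial.monom 1 (k i + 1)"]
      emb_mult[of i "Polynomial.monom 1 (k i)"] emb_monom pdiff_emb mult.commute)
  then have mem: "emb i (Polynomial.monom 1 (k i + a) * Q) \<in> ann_ideal W"
    by (simp only:) (intro ann_ideal_diff ann_ideal_fscale ann_ideal_mult[OF less(3)] ann_ideal_X[OF less(3) W])
  show ?case
  proof (cases "Q = 0")
    case False
    have "{c. Polynomial.coeff Q c \<noteq> 0} \<subset> {c. Polynomial.coeff P c \<noteq> 0}"
      using less(2) cQ by auto
    then have "card {c. Polynomial.coeff Q c \<noteq> 0} < card {c. Polynomial.coeff P c \<noteq> 0}"
      by (rule psubset_card_mono[OF fin])
    then show ?thesis using less(1)[OF _ False mem] by blast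
  next
    \<comment> \<open>All coefficients of P except the leading one vanish, so t^a P is a multiple of
      a monomial.\<close>
    case True
    then have "Polynomial.coeff P c = 0" if "c \<noteq> ?d" for c
      using cQ[of c] that by simp
    then have P: "P = Polynomial.monom (lead_coeff P) ?d"
      by (intro poly_eqI) auto
    have "emb i ?R = Poly_Mapping.single (Poly_Mapping.single i (a + ?d)) (lead_coeff P)"
      by (subst P) (simp add: mult_monom emb_monom)
    then have "fscale (inverse (lead_coeff P)) (Poly_Mapping.single (Poly_Mapping.single i (a + ?d)) (lead_coeff P)) \<in> ann_ideal W"
      using less(3) ann_ideal_fscale by metis
    then show ?thesis using less(2) by auto
  qed
qed

text \<open>The bracket [f \<partial>_i, f h \<partial>_i] = f^2 \<partial>_i(h) \<partial>_i with
  \<partial>_i(h) arbitrary settles the direction i; [f^2 q \<partial>_i, t_i \<partial>_l] = f^2 q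
  \<partial>_l - f^2 t_i \<partial>_l(q) \<partial>_i transfers the result to the direction l. Each
  bracket involves one further application of L, hence the chain W0, W1, W2.\<close>

lemma square_in_ann_ideal:
  assumes f: "\<And>j. j \<noteq> i \<Longrightarrow> pdiff j f = 0"
    and W2: "\<And>w. w \<in> W2 \<Longrightarrow> F f i w = 0"
    and W12: "\<And>p j w. w \<in> W1 \<Longrightarrow> F p j w \<in> W2" "W1 \<subseteq> W2"
    and W01: "\<And>p j w. w \<in> W0 \<Longrightarrow> F p j w \<in> W1" "W0 \<subseteq> W1"
  shows "f * f \<in> ann_ideal W0"
proof -
  have 1: "F (f * f * q) i w = 0" if w: "w \<in> W1" for q w
  proof -
    obtain h where h: "pdiff i h = q" using pdiff_surj[of i q] by (elim exE)
    have "F f i (F (f * h) i w) = F (f * h) i (F f i w)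
        + (F (f * pdiff i (f * h)) i w - F (f * h * pdiff i f) i w)"
      by (rule F_swap)
    moreover have "F f i (F (f * h) i w) = 0" "F f i w = 0"
      using w W12 W2 by auto
    ultimately have "F (f * pdiff i (f * h) - f * h * pdiff i f) i w = 0"
      by (simp add: F_diff)
    moreover have "f * pdiff i (f * h) - f * h * pdiff i f = f * f * q"
      by (simp add: pdiff_mult h algebra_simps)
    ultimately show ?thesis by simp
  qed
  have 2: "F (f * f * q) l w = 0" if w: "w \<in> W0" and l: "l \<noteq> i" for q l w
  proof -
    have "F (f * f * q) i (F (tvar i) l w) = F (tvar i) l (F (f * f * q) i w)
       + (F (f * f * q * pdiff i (tvar i)) l w - F (tvar i * pdiff l (f * f * q)) i w)"
      by (rule F_swap)
    moreover have "tvar i * pdiff l (f * f * q) = f * f * (tvar i * pdiff l q)"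
      using f[OF l] by (simp add: pdiff_mult algebra_simps)
    ultimately show ?thesis using 1 w W01 by auto
  qed
  show ?thesis
    unfolding ann_ideal_def
  proof (intro CollectI allI ballI)
    fix q l w assume "w \<in> W0"
    then show "F (f * f * q) l w = 0" using 1[of w q] 2[of w l q] W01(2) by (cases "l = i") auto
  qed
qed

theorem annihilated_of_locally_finite: "\<exists>m. v \<in> annihilated V m"
proof -
  have stable: "\<exists>B. finite B \<and> S \<subseteq> span B \<and> (\<forall>i. \<forall>w\<in>span B. X i w \<in> span B)" if "finite S" for S
    using finite_stable[OF that, of UNIV] by simp
  \<comment> \<open>Three nested stable spaces: L maps span(B0) into span(B1) and span(B1) into
    span(B2), as \<open>square_in_ann_ideal\<close> requires; C2 receives the image of span(B2) for
    \<open>finite_kernel\<close>.\<close>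
  obtain B0 where B0: "finite B0" "v \<in> span B0" "\<And>i w. w \<in> span B0 \<Longrightarrow> X i w \<in> span B0"
    using stable[of "{v}"] by auto
  obtain C0 where C0: "finite C0" "\<And>p j w. w \<in> span B0 \<Longrightarrow> F p j w \<in> span C0"
    using finite_action[of B0] B0 by blast
  obtain B1 where B1: "finite B1" "B0 \<union> C0 \<subseteq> span B1" "\<And>i w. w \<in> span B1 \<Longrightarrow> X i w \<in> span B1"
    using stable[of "B0 \<union> C0"] B0(1) C0(1) by auto
  obtain C1 where C1: "finite C1" "\<And>p j w. w \<in> span B1 \<Longrightarrow> F p j w \<in> span C1"
    using finite_action[of B1] B1 by blast
  obtain B2 where B2: "finite B2" "B1 \<union> C1 \<subseteq> span B2" "\<And>i w. w \<in> span B2 \<Longrightarrow> X i w \<in> span B2"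
    using stable[of "B1 \<union> C1"] B1(1) C1(1) by auto
  obtain C2 where C2: "finite C2" "\<And>p j w. w \<in> span B2 \<Longrightarrow> F p j w \<in> span C2"
    using finite_action[of B2] B2 by blast
  have sub: "span B0 \<subseteq> span B1" "span C0 \<subseteq> span B1" "span B1 \<subseteq> span B2" "span C1 \<subseteq> span B2"
    using B1(2) B2(2) by (simp_all add: span_minimal)
  have "\<exists>m. tmonom (Poly_Mapping.single i m) \<in> ann_ideal (span B0)" for i
  proof -
    obtain p where p: "p \<noteq> 0" "\<And>w. w \<in> span B2 \<Longrightarrow> F (emb i p) i w = 0"
      using finite_kernel[OF B2(1) C2(1)] C2(2) by blast
    have "emb i p * emb i p \<in> ann_ideal (span B0)"
      by (rule square_in_ann_ideal[where i = i and ?W2.0 = "span B2" and ?W1.0 = "span B1"])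
        (use p C0(2) C1(2) sub in \<open>auto simp: pdiff_emb\<close>)
    then have "emb i (Polynomial.monom 1 0 * (p * p)) \<in> ann_ideal (span B0)"
      by (simp add: emb_mult)
    then show ?thesis
      using monom_in_ann_ideal[of "span B0" i "p * p" 0] B0(3) p(1) by simp
  qed
  then obtain m where m: "\<And>i. tmonom (Poly_Mapping.single i (m i)) \<in> ann_ideal (span B0)" by metis
  have "v \<in> annihilated V (\<Sum>i\<in>UNIV. m i)"
  proof (rule annihilatedI)
    fix \<alpha> :: "'b \<Rightarrow>\<^sub>0 nat" and j assume a: "Suc (\<Sum>i\<in>UNIV. m i) \<le> mdeg \<alpha>"
    \<comment> \<open>Pigeonhole: a total degree above the sum of the m i forces some exponent to
      reach m i.\<close>
    have "\<exists>i. m i \<le> Poly_Mapping.lookup \<alpha> i"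
    proof (rule ccontr)
      assume "\<nexists>i. m i \<le> Poly_Mapping.lookup \<alpha> i"
      then have "mdeg \<alpha> \<le> (\<Sum>i\<in>UNIV. m i)"
        unfolding mdeg_def by (intro sum_mono) (simp add: not_le less_imp_le)
      then show False using a by simp
    qed
    then obtain i where i: "m i \<le> Poly_Mapping.lookup \<alpha> i" by blast
    then have "\<alpha> = Poly_Mapping.single i (m i) + (\<alpha> - Poly_Mapping.single i (m i))"
      by (intro poly_mapping_eqI) (auto simp: lookup_add lookup_minus lookup_single when_def)
    then have "tmonom \<alpha> = tmonom (Poly_Mapping.single i (m i)) * tmonom (\<alpha> - Poly_Mapping.single i (m i))"
      by (metis mult_single mult_1)
    then show "F (tmonom \<alpha>) j v = 0"
      using m[of i] B0(2) by (simp add: ann_ideal_def)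
  qed
  then show ?thesis by blast
qed

end

context simple_wmod begin

theorem smooth_iff_locally_finite:
  "(\<exists>k::'b \<Rightarrow> nat. (\<forall>i. k i > 0) \<and>
     (\<forall>i. locally_finite V (monom_field (Poly_Mapping.single i (k i + 1)) i))) \<longleftrightarrow> smooth V"
proof
  assume "\<exists>k::'b \<Rightarrow> nat. (\<forall>i. k i > 0) \<and>
     (\<forall>i. locally_finite V (monom_field (Poly_Mapping.single i (k i + 1)) i))"
  then obtain k :: "'b \<Rightarrow> nat" where "\<And>i. k i > 0"
    "\<And>i. locally_finite V (monom_field (Poly_Mapping.single i (k i + 1)) i)" by blast
  then interpret locally_finite_wmod scale \<rho> k by unfold_locales
  show "smooth V" using annihilated_of_locally_finite M.smooth_iff by simp
qed (rule locally_finite_of_smooth)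

end

section \<open>Freeness over the constant derivations\<close>

lemma mpow_commute:
  assumes "x \<in> C" "\<And>i y. y \<in> C \<Longrightarrow> d i y \<in> C"
    and "\<And>i j y. y \<in> C \<Longrightarrow> d i (d j y) = d j (d i y)"
  shows "mpow d \<beta> (d i x) = d i (mpow d \<beta> x)"
proof (induction \<beta> rule: multi_idx_induct)
  case (step \<beta> j)
  have "mpow d \<beta> x \<in> C" using assms by (intro mpow_induct[where Q = "\<lambda>x. x \<in> C"]) auto
  then show ?case
    using step mpow_step[of x C d \<beta> j] mpow_step[of "d i x" C d \<beta> j] assms by simp
qed simp

abbreviation pd :: "('n::finite \<Rightarrow>\<^sub>0 nat) \<Rightarrow> 'n cpoly \<Rightarrow> 'n cpoly" where
  "pd \<equiv> mpow pdiff"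

lemma pd_step: "pd (\<beta> + unit_idx i) p = pd \<beta> (pdiff i p)"
  using mpow_step[of p UNIV pdiff \<beta> i] mpow_commute[of p UNIV pdiff \<beta> i]
  by (simp add: pdiff_commute)

definition idx_fact :: "('n::finite \<Rightarrow>\<^sub>0 nat) \<Rightarrow> complex" where
  "idx_fact \<alpha> = (\<Prod>i\<in>UNIV. fact (Poly_Mapping.lookup \<alpha> i))"

text \<open>The divided power t^\<alpha>/\<alpha>!, on which partial derivatives subtract exponents
  without producing factors.\<close>

definition dmonom :: "('n::finite \<Rightarrow>\<^sub>0 nat) \<Rightarrow> 'n cpoly" where
  "dmonom \<alpha> = Poly_Mapping.single \<alpha> (inverse (idx_fact \<alpha>))"

lemma idx_fact_nonzero [simp]: "idx_fact \<alpha> \<noteq> 0"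
  by (simp add: idx_fact_def)

lemma idx_fact_step:
  "idx_fact (\<alpha> + unit_idx i) = of_nat (Poly_Mapping.lookup \<alpha> i + 1) * idx_fact \<alpha>"
proof -
  have "(\<Prod>j\<in>UNIV. fact (Poly_Mapping.lookup (\<alpha> + unit_idx i) j) :: complex)
      = (\<Prod>j\<in>UNIV. (if j = i then of_nat (Poly_Mapping.lookup \<alpha> i + 1) else 1) * fact (Poly_Mapping.lookup \<alpha> j))"
    by (rule prod.cong) (auto simp: lookup_add lookup_single when_def simp flip: Suc_eq_plus1)
  then show ?thesis by (simp add: idx_fact_def prod.distrib prod.delta)
qed

lemma pdiff_dmonom_step: "pdiff i (dmonom (\<alpha> + unit_idx i)) = dmonom \<alpha>"
  by (simp add: dmonom_def pdiff_single idx_fact_step lookup_add field_simps del: of_nat_add of_nat_Suc)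

lemma pdiff_dmonom_zero: "Poly_Mapping.lookup \<alpha> i = 0 \<Longrightarrow> pdiff i (dmonom \<alpha>) = 0"
  by (simp add: dmonom_def pdiff_single)

lemma pd_dmonom: "pd \<beta> (dmonom (\<beta> + \<gamma>)) = dmonom \<gamma>"
proof (induction \<beta> rule: multi_idx_induct)
  case (step \<beta> i)
  have "\<beta> + unit_idx i + \<gamma> = (\<beta> + \<gamma>) + unit_idx i" by (simp add: ac_simps)
  then show ?case using step by (simp add: pd_step pdiff_dmonom_step)
qed simp

lemma pd_zero [simp]: "pd \<beta> 0 = 0"
  by (induction \<beta> rule: multi_idx_induct) (simp_all add: pd_step)

lemma pd_dmonom_zero:
  assumes "\<nexists>\<gamma>. \<alpha> = \<beta> + \<gamma>"
  shows "pd \<beta> (dmonom \<alpha>) = 0"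
  using assms
proof (induction \<beta> arbitrary: \<alpha> rule: multi_idx_induct)
  case (step \<beta> i)
  show ?case
  proof (cases "Poly_Mapping.lookup \<alpha> i = 0")
    case True
    then show ?thesis by (simp add: pd_step pdiff_dmonom_zero)
  next
    case False
    define \<alpha>' where "\<alpha>' = \<alpha> - unit_idx i"
    have \<alpha>: "\<alpha> = \<alpha>' + unit_idx i" using idx_minus_add[OF False] by (simp add: \<alpha>'_def)
    have "\<nexists>\<gamma>. \<alpha>' = \<beta> + \<gamma>"
    proof
      assume "\<exists>\<gamma>. \<alpha>' = \<beta> + \<gamma>"
      then obtain \<gamma> where "\<alpha>' = \<beta> + \<gamma>" by blast
      then have "\<alpha> = \<beta> + unit_idx i + \<gamma>" by (simp add: \<alpha> ac_simps)
      then show False using step.prems by blast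
    qed
    then show ?thesis using step.IH by (simp add: pd_step \<alpha> pdiff_dmonom_step)
  qed
qed simp

lemma ord_ge_dmonom: "k \<le> int (mdeg \<alpha>) \<Longrightarrow> ord_ge k (dmonom \<alpha>)"
  by (simp add: dmonom_def ord_ge_single)

text \<open>The weights form a mixed-radix system: the weight of a new index exceeds every possible
  sum over the old ones, so reduction modulo it recovers the old part.\<close>

lemma idx_weight_exists:
  fixes K :: nat
  assumes "finite S"
  shows "\<exists>w :: 'n \<Rightarrow> nat. \<forall>b b'. (\<forall>j. b j \<le> K \<and> b' j \<le> K) \<longrightarrow>
     (\<Sum>j\<in>S. b j * w j) = (\<Sum>j\<in>S. b' j * w j) \<longrightarrow> (\<forall>j\<in>S. b j = b' j)"
  using assms
proof (induction S rule: finite_induct)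
  case (insert i S)
  obtain w where w: "\<And>b b'. (\<And>j. b j \<le> K \<and> b' j \<le> K) \<Longrightarrow>
     (\<Sum>j\<in>S. b j * w j) = (\<Sum>j\<in>S. b' j * w j) \<Longrightarrow> (\<forall>j\<in>S. b j = b' j)"
    using insert.IH by meson
  define W where "W = Suc (\<Sum>j\<in>S. K * w j)"
  let ?w = "w(i := W)"
  show ?case
  proof (intro exI[of _ ?w] allI impI)
    fix b b' :: "'n \<Rightarrow> nat"
    assume le: "\<forall>j. b j \<le> K \<and> b' j \<le> K"
      and eq: "(\<Sum>j\<in>insert i S. b j * ?w j) = (\<Sum>j\<in>insert i S. b' j * ?w j)"
    have S: "(\<Sum>j\<in>S. a j * ?w j) = (\<Sum>j\<in>S. a j * w j)" for a :: "'n \<Rightarrow> nat"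
      using insert(2) by (intro sum.cong) auto
    have lt: "(\<Sum>j\<in>S. a j * w j) < W" if "\<And>j. a j \<le> K" for a
      unfolding W_def less_Suc_eq_le using that by (intro sum_mono mult_right_mono) auto
    have eq': "(\<Sum>j\<in>S. b j * w j) + W * b i = (\<Sum>j\<in>S. b' j * w j) + W * b' i"
      using eq insert(1,2) S by (simp add: ac_simps)
    have l1: "(\<Sum>j\<in>S. b j * w j) < W" and l2: "(\<Sum>j\<in>S. b' j * w j) < W"
      using lt le by blast+
    have "((\<Sum>j\<in>S. b j * w j) + W * b i) mod W = (\<Sum>j\<in>S. b j * w j)"
      "((\<Sum>j\<in>S. b' j * w j) + W * b' i) mod W = (\<Sum>j\<in>S. b' j * w j)"
      using l1 l2 by simp_all
    then have 1: "(\<Sum>j\<in>S. b j * w j) = (\<Sum>j\<in>S. b' j * w j)" using eq' by simp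
    then have "W * b i = W * b' i" using eq' by simp
    then have "b i = b' i" unfolding W_def mult_cancel1 by simp
    then show "\<forall>j\<in>insert i S. b j = b' j" using w[of b b'] le 1 by blast
  qed
qed simp

definition idx_wt :: "('n::finite \<Rightarrow> nat) \<Rightarrow> ('n \<Rightarrow>\<^sub>0 nat) \<Rightarrow> nat" where
  "idx_wt w \<beta> = (\<Sum>j\<in>UNIV. Poly_Mapping.lookup \<beta> j * w j)"

lemma idx_wt_add: "idx_wt w (\<beta> + \<gamma>) = idx_wt w \<beta> + idx_wt w \<gamma>"
  by (simp add: idx_wt_def lookup_add algebra_simps sum.distrib)

lemma idx_wt_exists: "\<exists>w :: 'n::finite \<Rightarrow> nat. inj_on (idx_wt w) {\<beta>. mdeg \<beta> \<le> K}"
proof -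
  obtain w :: "'n \<Rightarrow> nat" where w: "\<forall>b b'. (\<forall>j. b j \<le> K \<and> b' j \<le> K) \<longrightarrow>
     (\<Sum>j\<in>UNIV. b j * w j) = (\<Sum>j\<in>UNIV. b' j * w j) \<longrightarrow> (\<forall>j\<in>UNIV. b j = b' j)"
    using idx_weight_exists[OF finite] by blast
  have "inj_on (idx_wt w) {\<beta>. mdeg \<beta> \<le> K}"
  proof (rule inj_onI)
    fix \<beta> \<beta>' :: "'n \<Rightarrow>\<^sub>0 nat"
    assume "\<beta> \<in> {\<beta>. mdeg \<beta> \<le> K}" "\<beta>' \<in> {\<beta>. mdeg \<beta> \<le> K}" and eq: "idx_wt w \<beta> = idx_wt w \<beta>'"
    then have "Poly_Mapping.lookup \<beta> j \<le> K \<and> Poly_Mapping.lookup \<beta>' j \<le> K" for j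
      using lookup_le_mdeg[of \<beta> j] lookup_le_mdeg[of \<beta>' j] by simp
    then have "\<forall>j. Poly_Mapping.lookup \<beta> j = Poly_Mapping.lookup \<beta>' j"
      using w[rule_format, of "Poly_Mapping.lookup \<beta>" "Poly_Mapping.lookup \<beta>'"] eq
      unfolding idx_wt_def by simp
    then show "\<beta> = \<beta>'" by (intro poly_mapping_eqI) simp
  qed
  then show ?thesis by blast
qed

text \<open>If p vanishes at every x, so does p(c x) - c^M p(x), where M is the top index. Its top
  coefficient is gone, and the others carry factors c^m - c^M, nonzero because the powers of c are
  distinct.\<close>

lemma (in vector_space) vector_poly_zero:
  fixes a :: "nat \<Rightarrow> 'b" and c :: 'a
  assumes two: "inj (\<lambda>m. c ^ m)" and "\<And>x. (\<Sum>m<M. scale (x ^ m) (a m)) = 0" "m < M"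
  shows "a m = 0"
  using assms(2,3)
proof (induction M arbitrary: a m)
  case (Suc M)
  have 1: "scale (c ^ m - c ^ M) (a m) = 0" if "m < M" for m
  proof (rule Suc.IH[OF _ that])
    fix x
    have "(\<Sum>m<M. scale (x ^ m) (scale (c ^ m - c ^ M) (a m)))
        = (\<Sum>m<Suc M. scale (x ^ m) (scale (c ^ m - c ^ M) (a m)))" by simp
    also have "\<dots> = (\<Sum>m<Suc M. scale ((c * x) ^ m) (a m) - scale (c ^ M) (scale (x ^ m) (a m)))"
      by (rule sum.cong) (simp_all add: power_mult_distrib algebra_simps)
    also have "\<dots> = (\<Sum>m<Suc M. scale ((c * x) ^ m) (a m)) - scale (c ^ M) (\<Sum>m<Suc M. scale (x ^ m) (a m))"
      by (simp only: sum_subtractf scale_sum_right)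
    also have "\<dots> = 0" unfolding Suc.prems(1) by simp
    finally show "(\<Sum>m<M. scale (x ^ m) (scale (c ^ m - c ^ M) (a m))) = 0" .
  qed
  have 2: "a m = 0" if "m < M" for m
    using 1[OF that] injD[OF two, of m M] that by auto
  have "(\<Sum>m<Suc M. scale (1 ^ m) (a m)) = a M" using 2 by simp
  then have "a M = 0" using Suc.prems(1) by metis
  then show ?case using 2 Suc.prems(2) less_Suc_eq by auto
qed simp

lemma inj_power_two: "inj (\<lambda>m. (2 :: complex) ^ m)"
proof (rule injI)
  fix m n assume "(2 :: complex) ^ m = 2 ^ n"
  then have "of_nat (2 ^ m) = (of_nat (2 ^ n) :: complex)" by simp
  then have "(2 :: nat) ^ m = 2 ^ n" by (simp only: of_nat_eq_iff)
  then show "m = n" by simp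
qed

abbreviation "lvl N \<equiv> {\<beta> :: 'n::finite \<Rightarrow>\<^sub>0 nat. mdeg \<beta> = N}"

lemma finite_lvl: "finite (lvl N)"
  by (rule finite_subset[OF _ finite_mdeg_le[of N]]) auto

section \<open>The top degree of a relation\<close>

context wmod begin

abbreviation dp :: "('n \<Rightarrow>\<^sub>0 nat) \<Rightarrow> 'v \<Rightarrow> 'v" where
  "dp \<equiv> mpow (\<lambda>i. \<rho> (pdiff i))"

lemma dp_step: "dp (\<beta> + unit_idx i) v = \<rho> (pdiff i) (dp \<beta> v)"
  using M.mpow_Suc[of v \<beta> i] by simp

lemma F_dp_swap: "F p j (\<rho> (pdiff i) u) = \<rho> (pdiff i) (F p j u) - F (pdiff i p) j u"
  using F_swap[of p j 1 i u] by (simp flip: pdiff_eq_fld)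

lemma F_annihilated:
  assumes "e \<in> annihilated V r" "ord_ge (int r + 1) p"
  shows "F p j e = 0"
  using assms fld_witt_ge[of "int r" p j] by (simp add: annihilated_V)

text \<open>Each partial derivative that p \<partial>_j passes costs p at most one order of
  vanishing; what finally meets e still has order at least r + 1.\<close>

lemma F_dp_zero:
  assumes e: "e \<in> annihilated V r" and "ord_ge (int r + 1 + int (mdeg \<beta>)) p"
  shows "F p j (dp \<beta> e) = 0"
  using assms(2)
proof (induction \<beta> arbitrary: p rule: multi_idx_induct)
  case zero
  then show ?case using F_annihilated[OF e] by simp
next
  case (step \<beta> i)
  have "F p j (dp \<beta> e) = 0" using step.prems by (intro step.IH) (auto elim: ord_ge_mono)
  moreover have "F (pdiff i p) j (dp \<beta> e) = 0"
    using ord_ge_pdiff[OF step.prems, of i] by (intro step.IH) (simp add: ac_simps)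
  ultimately show ?case by (simp add: dp_step F_dp_swap)
qed

text \<open>One order below \<open>F_dp_zero\<close>, the only surviving term is the one in which
  all partial derivatives have fallen on p, each with a sign.\<close>

lemma F_dp_top:
  assumes e: "e \<in> annihilated V r" and "ord_ge (int r + int (mdeg \<beta>)) p"
  shows "F p j (dp \<beta> e) = scale ((-1) ^ mdeg \<beta>) (F (pd \<beta> p) j e)"
  using assms(2)
proof (induction \<beta> arbitrary: p rule: multi_idx_induct)
  case (step \<beta> i)
  have "F p j (dp \<beta> e) = 0" using step.prems by (intro F_dp_zero[OF e]) (simp add: ac_simps)
  moreover have "F (pdiff i p) j (dp \<beta> e) = scale ((-1) ^ mdeg \<beta>) (F (pd \<beta> (pdiff i p)) j e)"
    using ord_ge_pdiff[OF step.prems, of i] by (intro step.IH) (simp add: ac_simps)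
  ultimately show ?case by (simp add: dp_step F_dp_swap pd_step power_add)
qed simp

text \<open>These are the conditions that a relation sum d^\<beta> e_\<beta> = 0 of top degree N
  imposes on its coefficients of degree N. Constant derivations no longer act on V in them, only on
  the test polynomial p.\<close>

definition top_rel :: "nat \<Rightarrow> nat \<Rightarrow> (('n \<Rightarrow>\<^sub>0 nat) \<Rightarrow> 'v) \<Rightarrow> bool" where
  "top_rel r N e \<longleftrightarrow> (\<forall>\<beta>. e \<beta> \<in> annihilated V r) \<and>
     (\<forall>p j. ord_ge (int r + int N) p \<longrightarrow> (\<Sum>\<beta>\<in>lvl N. F (pd \<beta> p) j (e \<beta>)) = 0)"

text \<open>Apply p \<partial>_j to the relation: terms of degree below N vanish by
  \<open>F_dp_zero\<close>, and those of degree N become values on the e_\<beta> by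
  \<open>F_dp_top\<close>, all with the same sign.\<close>

lemma top_relation:
  assumes A: "finite A" and e: "\<And>\<beta>. e \<beta> \<in> annihilated V r" and sum: "(\<Sum>\<beta>\<in>A. dp \<beta> (e \<beta>)) = 0"
    and N: "\<And>\<beta>. \<beta> \<in> A \<Longrightarrow> mdeg \<beta> > N \<Longrightarrow> e \<beta> = 0" and A0: "\<And>\<beta>. \<beta> \<notin> A \<Longrightarrow> e \<beta> = 0"
  shows "top_rel r N e"
  unfolding top_rel_def
proof (intro conjI allI impI e)
  fix p :: "'n cpoly" and j assume p: "ord_ge (int r + int N) p"
  have "F p j (dp \<beta> (e \<beta>)) = (if mdeg \<beta> = N then scale ((-1) ^ N) (F (pd \<beta> p) j (e \<beta>)) else 0)"
    if "\<beta> \<in> A" for \<beta>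
  proof (cases "mdeg \<beta> < N")
    case True
    then show ?thesis using p by (simp add: F_dp_zero[OF e] ord_ge_mono)
  next
    case False
    then have "mdeg \<beta> > N \<or> mdeg \<beta> = N" by linarith
    then show ?thesis
    proof
      assume "mdeg \<beta> > N"
      then show ?thesis using N[OF that] M.mpow_zero_vec[of \<beta>] by simp
    next
      assume "mdeg \<beta> = N"
      then show ?thesis using F_dp_top[OF e, where \<beta> = \<beta>] p by simp
    qed
  qed
  then have "(\<Sum>\<beta>\<in>A. F p j (dp \<beta> (e \<beta>)))
      = (\<Sum>\<beta>\<in>A. if mdeg \<beta> = N then scale ((-1) ^ N) (F (pd \<beta> p) j (e \<beta>)) else 0)"
    by (intro sum.cong) auto
  also have "\<dots> = (\<Sum>\<beta>\<in>A \<inter> lvl N. scale ((-1) ^ N) (F (pd \<beta> p) j (e \<beta>)))"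
    by (simp add: sum.inter_restrict[OF A])
  also have "\<dots> = (\<Sum>\<beta>\<in>lvl N. if \<beta> \<in> A then scale ((-1) ^ N) (F (pd \<beta> p) j (e \<beta>)) else 0)"
    by (subst Int_commute) (simp add: sum.inter_restrict[OF finite_lvl])
  also have "\<dots> = (\<Sum>\<beta>\<in>lvl N. scale ((-1) ^ N) (F (pd \<beta> p) j (e \<beta>)))"
    using A0 by (intro sum.cong) auto
  also have "\<dots> = scale ((-1) ^ N) (\<Sum>\<beta>\<in>lvl N. F (pd \<beta> p) j (e \<beta>))"
    by (simp add: scale_sum_right)
  finally have "scale ((-1) ^ N) (\<Sum>\<beta>\<in>lvl N. F (pd \<beta> p) j (e \<beta>)) = F p j (\<Sum>\<beta>\<in>A. dp \<beta> (e \<beta>))"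
    by (simp add: \<rho>_sum)
  then show "(\<Sum>\<beta>\<in>lvl N. F (pd \<beta> p) j (e \<beta>)) = 0" unfolding sum by simp
qed

lemma free_of_top:
  assumes top: "\<And>N e \<beta>. top_rel r N e \<Longrightarrow> mdeg \<beta> = N \<Longrightarrow> e \<beta> = 0"
    and A: "finite A" and e: "\<And>\<beta>. \<beta> \<in> A \<Longrightarrow> e \<beta> \<in> annihilated V r" and sum: "(\<Sum>\<beta>\<in>A. dp \<beta> (e \<beta>)) = 0"
    and \<beta>: "\<beta> \<in> A"
  shows "e \<beta> = 0"
proof (rule ccontr)
  assume ne: "e \<beta> \<noteq> 0"
  let ?S = "{\<beta> \<in> A. e \<beta> \<noteq> 0}"
  define N where "N = Max (mdeg ` ?S)"
  define e' where "e' \<beta> = (if \<beta> \<in> A then e \<beta> else 0)" for \<beta>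
  have S: "finite (mdeg ` ?S)" "mdeg ` ?S \<noteq> {}" using A \<beta> ne by auto
  have "top_rel r N e'"
  proof (rule top_relation[OF A])
    show "e' \<beta> \<in> annihilated V r" for \<beta>
      using e M.annihilated_submodule[of r] by (auto simp: e'_def M.submodule_iff)
    show "(\<Sum>\<beta>\<in>A. dp \<beta> (e' \<beta>)) = 0" using sum by (simp add: e'_def)
    show "e' \<beta> = 0" if "\<beta> \<in> A" "N < mdeg \<beta>" for \<beta>
    proof (rule ccontr)
      assume "e' \<beta> \<noteq> 0"
      then have "mdeg \<beta> \<le> N" unfolding N_def using S(1) that(1) by (intro Max_ge) (auto simp: e'_def)
      then show False using that(2) by simp
    qed
    show "e' \<beta> = 0" if "\<beta> \<notin> A" for \<beta> using that by (simp add: e'_def)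
  qed
  moreover have "N \<in> mdeg ` ?S" unfolding N_def by (rule Max_in[OF S])
  then obtain \<beta>0 where \<beta>0: "\<beta>0 \<in> ?S" "mdeg \<beta>0 = N" by (elim imageE) simp
  ultimately have "e' \<beta>0 = 0" using top[of N e' \<beta>0] by simp
  then show False using \<beta>0(1) by (simp add: e'_def)
qed

text \<open>As in McCoy's theorem on zero divisors in polynomial rings: the fields of degree \<open>r - 1\<close> commute
  on vectors annihilated in degrees at least \<open>r\<close>. Descending along a weight that separates monomials,
  each of them kills the coefficient of largest weight, so that applying it to all coefficients gives
  a relation with fewer terms; as only \<open>0\<close> is killed by all of them, the relation is trivial.\<close>

lemma mccoy:
  assumes r: "r \<ge> 2" and no: "\<And>v. v \<in> annihilated V (r - 1) \<Longrightarrow> v = 0"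
    and w: "inj_on (idx_wt w) {\<beta> :: 'n \<Rightarrow>\<^sub>0 nat. mdeg \<beta> \<le> N}"
    and e: "\<And>\<beta>. e \<beta> \<in> annihilated V r"
    and rel: "\<And>\<alpha> j. mdeg \<alpha> = r + N \<Longrightarrow> (\<Sum>\<beta>\<in>lvl N. F (pd \<beta> (dmonom \<alpha>)) j (e \<beta>)) = 0"
    and B: "\<And>\<beta>. mdeg \<beta> = N \<Longrightarrow> e \<beta> \<noteq> 0 \<Longrightarrow> idx_wt w \<beta> < B" and \<beta>: "mdeg \<beta> = N"
  shows "e \<beta> = 0"
  using e rel B \<beta>
proof (induction B arbitrary: e \<beta>)
  case 0
  then show ?case by blast
next
  case (Suc B)
  \<comment> \<open>The bracket of two fields of degree at least r - 1 has degree at least 2 r - 2,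
    and this is at least r because r \<ge> 2.\<close>
  have comm: "F p j (F q l v) = F q l (F p j v)"
    if "ord_ge (int r) p" "ord_ge (int r) q" "v \<in> annihilated V r" for p q j l v
  proof -
    have "lbracket witt (fld p j) (fld q l) \<in> witt_ge ((int r - 1) + (int r - 1))"
      using that by (intro witt_ge_bracket fld_witt_ge) auto
    then have "lbracket witt (fld p j) (fld q l) \<in> witt_ge (int r)"
      by (rule witt_ge_mono[rotated]) (use r in simp)
    then have "\<rho> (lbracket witt (fld p j) (fld q l)) v = 0"
      using that(3) by (simp add: annihilated_V)
    then show ?thesis using \<rho>_swap[of "fld p j" "fld q l" v] by simp
  qed
  \<comment> \<open>Induction from large weights of \<gamma> to small ones; the measure is the
    distance of the weight from an upper bound.\<close>
  have kill: "F (dmonom \<gamma>) j (e \<beta>) = 0" if "mdeg \<gamma> = r" "mdeg \<beta> = N" for \<gamma> j \<beta>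
    using that
  proof (induction "(\<Sum>\<gamma>\<in>lvl r. idx_wt w \<gamma>) - idx_wt w \<gamma>" arbitrary: \<gamma> \<beta> rule: less_induct)
    case less
    have bound: "idx_wt w \<gamma>' \<le> (\<Sum>\<gamma>\<in>lvl r. idx_wt w \<gamma>)" if "mdeg \<gamma>' = r" for \<gamma>'
      using that by (intro member_le_sum) (auto simp: finite_lvl)
    have higher: "F (dmonom \<gamma>') j (e \<beta>) = 0"
      if "mdeg \<gamma>' = r" "idx_wt w \<gamma> < idx_wt w \<gamma>'" "mdeg \<beta> = N" for \<gamma>' \<beta>
      using that bound[OF that(1)] by (intro less(1)) auto
    let ?e = "\<lambda>\<beta>. F (dmonom \<gamma>) j (e \<beta>)"
    have ord\<gamma>: "ord_ge (int r) (dmonom \<gamma>)" using less(2) by (intro ord_ge_dmonom) simp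
    have top: "?e \<beta>0 = 0" if \<beta>0: "mdeg \<beta>0 = N" "idx_wt w \<beta>0 = B" for \<beta>0
    proof -
      \<comment> \<open>In the relation for \<beta>0 + \<gamma>, any other term that is not
        trivially zero has \<beta> of smaller weight than \<beta>0, hence a cofactor \<gamma>' of
        larger weight than \<gamma>, and vanishes by \<open>higher\<close>.\<close>
      let ?\<alpha> = "\<beta>0 + \<gamma>"
      have other: "F (pd \<beta> (dmonom ?\<alpha>)) j (e \<beta>) = 0" if \<beta>: "\<beta> \<in> lvl N" "\<beta> \<noteq> \<beta>0" for \<beta>
      proof (cases "e \<beta> = 0 \<or> (\<nexists>\<gamma>'. ?\<alpha> = \<beta> + \<gamma>')")
        case True
        then show ?thesis using pd_dmonom_zero[of ?\<alpha> \<beta>] by auto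
      next
        case False
        then obtain \<gamma>' where \<gamma>': "?\<alpha> = \<beta> + \<gamma>'" and ne: "e \<beta> \<noteq> 0" by blast
        have "idx_wt w \<beta> < Suc B" using Suc.prems(3) \<beta> ne by auto
        moreover have "idx_wt w \<beta> \<noteq> B" using inj_onD[OF w, of \<beta> \<beta>0] \<beta> \<beta>0 by auto
        moreover have "idx_wt w \<beta>0 + idx_wt w \<gamma> = idx_wt w \<beta> + idx_wt w \<gamma>'"
          using \<gamma>' by (metis idx_wt_add)
        moreover have "mdeg \<gamma>' = r"
          using arg_cong[OF \<gamma>', of mdeg] \<beta> \<beta>0 less(2) by simp
        ultimately have "F (dmonom \<gamma>') j (e \<beta>) = 0" using \<beta> \<beta>0 by (intro higher) auto
        then show ?thesis unfolding \<gamma>' pd_dmonom .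
      qed
      have "0 = (\<Sum>\<beta>\<in>lvl N. F (pd \<beta> (dmonom ?\<alpha>)) j (e \<beta>))"
        using Suc.prems(2)[of ?\<alpha> j] \<beta>0 less(2) by simp
      also have "\<dots> = F (pd \<beta>0 (dmonom ?\<alpha>)) j (e \<beta>0)"
        using \<beta>0 other by (subst sum.remove[of _ \<beta>0]) (auto simp: finite_lvl)
      finally show ?thesis unfolding pd_dmonom by simp
    qed
    \<comment> \<open>After t^\<gamma> \<partial>_j has been applied, the coefficient of weight B is
      gone, so the outer induction hypothesis covers the new family.\<close>
    show ?case
    proof (rule Suc.IH[of ?e])
      show "?e \<beta> \<in> annihilated V r" for \<beta>
        using M.annihilated_act_nonneg[of "e \<beta>" r "fld (dmonom \<gamma>) j"] Suc.prems(1) ord\<gamma> r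
        by (simp add: fld_witt_ge ord_ge_mono)
      show "idx_wt w \<beta> < B" if "mdeg \<beta> = N" "?e \<beta> \<noteq> 0" for \<beta>
        using Suc.prems(3)[of \<beta>] top[of \<beta>] that by (cases "e \<beta> = 0") (auto simp: less_Suc_eq)
      show "mdeg \<beta> = N" by (rule less(3))
      fix \<alpha> :: "'n \<Rightarrow>\<^sub>0 nat" and l assume \<alpha>: "mdeg \<alpha> = r + N"
      have "F (pd \<beta> (dmonom \<alpha>)) l (?e \<beta>) = F (dmonom \<gamma>) j (F (pd \<beta> (dmonom \<alpha>)) l (e \<beta>))"
        if "\<beta> \<in> lvl N" for \<beta>
      proof (cases "\<exists>\<gamma>'. \<alpha> = \<beta> + \<gamma>'")
        case True
        then obtain \<gamma>' where \<gamma>': "\<alpha> = \<beta> + \<gamma>'" by blast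
        then have "mdeg \<gamma>' = r" using \<alpha> that by simp
        then show ?thesis
          unfolding \<gamma>' pd_dmonom
            by (intro comm[OF _ ord\<gamma> Suc.prems(1)] ord_ge_dmonom) simp
      next
        case False
        then show ?thesis by (simp add: pd_dmonom_zero)
      qed
      then have "(\<Sum>\<beta>\<in>lvl N. F (pd \<beta> (dmonom \<alpha>)) l (?e \<beta>))
          = F (dmonom \<gamma>) j (\<Sum>\<beta>\<in>lvl N. F (pd \<beta> (dmonom \<alpha>)) l (e \<beta>))"
        by (simp add: \<rho>_sum)
      then show "(\<Sum>\<beta>\<in>lvl N. F (pd \<beta> (dmonom \<alpha>)) l (?e \<beta>)) = 0"
        using Suc.prems(2)[OF \<alpha>, of l] by simp
    qed
  qed
  \<comment> \<open>Fields of degree r - 1 kill e \<beta> by \<open>kill\<close>, those of higher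
    degree because e \<beta> is annihilated from degree r on.\<close>
  have "e \<beta> \<in> annihilated V (r - 1)"
  proof (rule annihilatedI)
    fix \<alpha> :: "'n \<Rightarrow>\<^sub>0 nat" and j assume "Suc (r - 1) \<le> mdeg \<alpha>"
    then have "r \<le> mdeg \<alpha>" using r by simp
    then have "mdeg \<alpha> = r \<or> r < mdeg \<alpha>" by linarith
    then show "F (tmonom \<alpha>) j (e \<beta>) = 0"
    proof
      assume \<alpha>: "mdeg \<alpha> = r"
      have "scale (inverse (idx_fact \<alpha>)) (F (tmonom \<alpha>) j (e \<beta>)) = 0"
        using kill[OF \<alpha> Suc.prems(4), of j] unfolding dmonom_def F_single[of \<alpha> "inverse _"] .
      then show ?thesis by simp
    next
      assume "r < mdeg \<alpha>"
      then show ?thesis using F_annihilated[OF Suc.prems(1)] by (simp add: ord_ge_single)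
    qed
  qed
  then show ?case by (rule no)
qed

lemma top_rel_zero:
  assumes "r \<ge> 2" "\<And>v. v \<in> annihilated V (r - 1) \<Longrightarrow> v = 0" "top_rel r N e" "mdeg \<beta> = N"
  shows "e \<beta> = 0"
proof -
  obtain w :: "'n \<Rightarrow> nat" where w: "inj_on (idx_wt w) {\<beta>. mdeg \<beta> \<le> N}"
    using idx_wt_exists by blast
  have bound: "idx_wt w \<beta> < Suc (\<Sum>\<beta>\<in>lvl N. idx_wt w \<beta>)" if "mdeg \<beta> = N" for \<beta>
    using that by (intro le_imp_less_Suc member_le_sum) (auto simp: finite_lvl)
  show ?thesis
  proof (rule mccoy[OF assms(1,2) w _ _ bound assms(4)])
    show "e \<beta> \<in> annihilated V r" for \<beta> using assms(3) by (simp add: top_rel_def)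
    show "(\<Sum>\<beta>\<in>lvl N. F (pd \<beta> (dmonom \<alpha>)) j (e \<beta>)) = 0" if "mdeg \<alpha> = r + N" for \<alpha> j
      using assms(3) that by (simp add: top_rel_def ord_ge_dmonom)
  qed
qed

end

section \<open>Eigenvectors of the Euler field\<close>

lemma map_ident_poly_mapping [simp]: "Poly_Mapping.map (\<lambda>a. a) p = p"
  by (rule poly_mapping_eqI) (simp add: Poly_Mapping.map.rep_eq when_def)

definition lin_form :: "('n::finite \<Rightarrow> complex) \<Rightarrow> 'n cpoly" where
  "lin_form c = (\<Sum>i\<in>UNIV. fscale (c i) (tvar i))"

lemma pdiff_sum: "pdiff i (sum f A) = (\<Sum>a\<in>A. pdiff i (f a))"
  by (rule derivation_sum) simp

lemma fscale_one: "fscale c (1 :: 'n cpoly) = Poly_Mapping.single 0 c"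
  by (simp add: fscale_conv_mult)

lemma pdiff_lin_form: "pdiff i (lin_form c) = Poly_Mapping.single 0 (c i)"
  by (simp add: lin_form_def pdiff_sum pdiff_fscale if_distrib sum.delta fscale_one cong: if_cong
      del: fscale_single map_single)

lemma pdiff_power: "pdiff i (p ^ Suc n) = fscale (of_nat (Suc n)) (p ^ n) * pdiff i p"
proof (induction n)
  case (Suc n)
  have "pdiff i (p ^ Suc (Suc n)) = pdiff i p * p ^ Suc n + p * pdiff i (p ^ Suc n)"
    by (simp add: pdiff_mult)
  also have "\<dots> = p ^ Suc n * pdiff i p + fscale (of_nat (Suc n)) (p ^ Suc n * pdiff i p)"
    unfolding Suc by (simp add: fscale_mult_left fscale_mult_right mult.assoc mult.commute)
  also have "\<dots> = fscale (of_nat (Suc (Suc n))) (p ^ Suc n) * pdiff i p"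
    using pm.scale_left_distrib[of 1 "of_nat (Suc n)" "p ^ Suc n * pdiff i p"]
    by (simp add: fscale_mult_left del: of_nat_Suc) (simp add: fscale_mult_left)
  finally show ?case .
next
  case 0
  show ?case by simp
qed

definition cpow :: "('n::finite \<Rightarrow> complex) \<Rightarrow> ('n \<Rightarrow>\<^sub>0 nat) \<Rightarrow> complex" where
  "cpow c \<beta> = (\<Prod>i\<in>UNIV. c i ^ Poly_Mapping.lookup \<beta> i)"

lemma cpow_step: "cpow c (\<beta> + unit_idx i) = c i * cpow c \<beta>"
proof -
  have "(\<Prod>j\<in>UNIV. c j ^ Poly_Mapping.lookup (\<beta> + unit_idx i) j)
      = (\<Prod>j\<in>UNIV. (if j = i then c i else 1) * c j ^ Poly_Mapping.lookup \<beta> j)"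
    by (rule prod.cong) (auto simp: lookup_add lookup_single when_def power_add)
  then show ?thesis by (simp add: cpow_def prod.distrib prod.delta)
qed

lemma cpow_zero [simp]: "cpow c 0 = 1"
  by (simp add: cpow_def)

text \<open>All derivatives of one order of a power of l_c are multiples of the same power, and
  \<beta> enters only through c^\<beta>. Tested against such powers, a relation collapses to a
  condition on the sum of the c^\<beta> e_\<beta>.\<close>

lemma pd_lin_form_power:
  "pd \<beta> (lin_form c ^ (n + mdeg \<beta>)) = fscale (cpow c \<beta> * (fact (n + mdeg \<beta>) / fact n)) (lin_form c ^ n)"
proof (induction \<beta> rule: multi_idx_induct)
  case (step \<beta> i)
  let ?m = "n + mdeg \<beta>"
  have eq: "n + mdeg (\<beta> + unit_idx i) = Suc ?m" by simp
  have "pdiff i (lin_form c ^ (n + mdeg (\<beta> + unit_idx i))) = fscale (of_nat (Suc ?m) * c i) (lin_form c ^ ?m)"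
    unfolding eq pdiff_power by (simp add: pdiff_lin_form fscale_mult_left mult.commute flip: fscale_conv_mult)
  moreover have "pd \<beta> (fscale a p) = fscale a (pd \<beta> p)" for a p
    by (induction \<beta> arbitrary: p rule: multi_idx_induct) (simp_all add: pd_step pdiff_fscale)
  ultimately have "pd (\<beta> + unit_idx i) (lin_form c ^ (n + mdeg (\<beta> + unit_idx i)))
      = fscale (of_nat (Suc ?m) * c i) (fscale (cpow c \<beta> * (fact ?m / fact n)) (lin_form c ^ n))"
    by (simp only: pd_step step)
  also have "\<dots> = fscale (of_nat (Suc ?m) * c i * (cpow c \<beta> * (fact ?m / fact n))) (lin_form c ^ n)"
    by (rule pm.scale_scale)
  also have "of_nat (Suc ?m) * c i * (cpow c \<beta> * (fact ?m / fact n))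
      = cpow c (\<beta> + unit_idx i) * (fact (n + mdeg (\<beta> + unit_idx i)) / fact n)"
    unfolding eq fact_Suc cpow_step by (simp add: mult_ac del: of_nat_Suc)
  finally show ?case .
qed simp

lemma ord_ge_power: "ord_ge k p \<Longrightarrow> ord_ge (int n * k) (p ^ n)"
proof (induction n)
  case (Suc n)
  then have "ord_ge (k + int n * k) (p * p ^ n)" by (intro ord_ge_mult) auto
  then show ?case by (simp add: algebra_simps)
qed (simp add: ord_ge_nonpos)

lemma ord_ge_lin_form: "ord_ge 1 (lin_form c)"
  unfolding lin_form_def by (intro ord_ge_sum ord_ge_fscale ord_ge_single) simp

lemma lin_form_update:
  "lin_form (c(j := c j + z)) = lin_form c + fscale z (tvar j)"
proof -
  have "lin_form (c(j := c j + z)) = (\<Sum>i\<in>UNIV. fscale (c i) (tvar i) + (if i = j then fscale z (tvar j) else 0))"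
    unfolding lin_form_def by (rule sum.cong) (auto simp: single_add)
  then show ?thesis by (simp add: sum.distrib lin_form_def sum.delta)
qed

context wmod begin

definition usum :: "nat \<Rightarrow> (('n \<Rightarrow>\<^sub>0 nat) \<Rightarrow> 'v) \<Rightarrow> ('n \<Rightarrow> complex) \<Rightarrow> 'v" where
  "usum N e c = (\<Sum>\<beta>\<in>lvl N. scale (cpow c \<beta>) (e \<beta>))"

lemma usum_annihilated:
  assumes "top_rel r N e" shows "usum N e c \<in> annihilated V r"
  using assms M.annihilated_submodule[of r] unfolding usum_def top_rel_def submodule_V
  by (intro subspace_sum) (auto simp: subspace_scale)

text \<open>Apply the top-degree relation to the power \<open>l\<^sub>c\<^sup>N\<^sup>+\<^sup>1\<close> of the linear form.\<close>

lemma usum_relation: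
  assumes "top_rel 1 N e"
  shows "F (lin_form c) j (usum N e c) = 0"
proof -
  let ?p = "lin_form c ^ (1 + N)"
  have "ord_ge (int 1 + int N) ?p"
    using ord_ge_power[OF ord_ge_lin_form, of "1 + N" c] by simp
  then have 0: "(\<Sum>\<beta>\<in>lvl N. F (pd \<beta> ?p) j (e \<beta>)) = 0"
    using assms unfolding top_rel_def by blast
  have "F (pd \<beta> ?p) j (e \<beta>) = scale (fact (1 + N)) (scale (cpow c \<beta>) (F (lin_form c) j (e \<beta>)))"
    if "\<beta> \<in> lvl N" for \<beta>
    using that pd_lin_form_power[of \<beta> c 1] by (simp add: F_scale mult.commute)
  then have "scale (fact (1 + N)) (\<Sum>\<beta>\<in>lvl N. scale (cpow c \<beta>) (F (lin_form c) j (e \<beta>))) = 0"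
    using 0 by (simp add: scale_sum_right)
  then have "(\<Sum>\<beta>\<in>lvl N. scale (cpow c \<beta>) (F (lin_form c) j (e \<beta>))) = 0" by simp
  then show ?thesis by (simp add: usum_def \<rho>_sum \<rho>_scale)
qed

text \<open>Kronecker substitution: for c_i = x^(w_i) with separating weights w, the sum becomes a
  polynomial in x whose nonzero coefficients are single e_\<beta>.\<close>

lemma usum_nonzero:
  assumes "e \<beta> \<noteq> 0" "mdeg \<beta> = N"
  shows "\<exists>c. usum N e c \<noteq> 0"
proof (rule ccontr)
  assume no: "\<nexists>c. usum N e c \<noteq> 0"
  obtain w :: "'n \<Rightarrow> nat" where "inj_on (idx_wt w) {\<beta>. mdeg \<beta> \<le> N}"
    using idx_wt_exists by blast
  then have inj: "inj_on (idx_wt w) (lvl N)" by (rule inj_on_subset) auto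
  define M where "M = Suc (\<Sum>\<beta>\<in>lvl N. idx_wt w \<beta>)"
  have lt: "idx_wt w \<gamma> < M" if "\<gamma> \<in> lvl N" for \<gamma>
    unfolding M_def using that by (intro le_imp_less_Suc member_le_sum) (auto simp: finite_lvl)
  define a where "a m = (\<Sum>\<gamma>\<in>lvl N. if idx_wt w \<gamma> = m then e \<gamma> else 0)" for m
  have "(\<Sum>m<M. scale (x ^ m) (a m)) = 0" for x
  proof -
    have cp: "cpow (\<lambda>i. x ^ w i) \<gamma> = x ^ idx_wt w \<gamma>" for \<gamma>
      by (simp add: cpow_def idx_wt_def power_sum mult.commute flip: power_mult)
    have "(\<Sum>m<M. scale (x ^ m) (a m)) = (\<Sum>m<M. \<Sum>\<gamma>\<in>lvl N. if idx_wt w \<gamma> = m then scale (x ^ m) (e \<gamma>) else 0)"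
      unfolding a_def scale_sum_right by (intro sum.cong) auto
    also have "\<dots> = (\<Sum>\<gamma>\<in>lvl N. \<Sum>m<M. if idx_wt w \<gamma> = m then scale (x ^ m) (e \<gamma>) else 0)"
      by (rule sum.swap)
    also have "\<dots> = usum N e (\<lambda>i. x ^ w i)"
      unfolding usum_def cp using lt by (intro sum.cong) (auto simp: sum.delta)
    also have "\<dots> = 0" using no by blast
    finally show ?thesis .
  qed
  then have "a (idx_wt w \<beta>) = 0"
    using vector_poly_zero[OF inj_power_two] lt assms(2) by blast
  moreover have "a (idx_wt w \<beta>) = (\<Sum>\<gamma>\<in>lvl N. if \<gamma> = \<beta> then e \<gamma> else 0)"
    unfolding a_def using inj assms(2) by (intro sum.cong) (auto simp: inj_on_def)
  ultimately show False using assms by (simp add: sum.delta finite_lvl)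
qed

text \<open>The Taylor coefficients of u at c in the direction of the j-th coordinate, where u(c) is
  \<open>usum N e c\<close>.\<close>

definition wcoef :: "nat \<Rightarrow> (('n \<Rightarrow>\<^sub>0 nat) \<Rightarrow> 'v) \<Rightarrow> ('n \<Rightarrow> complex) \<Rightarrow> 'n \<Rightarrow> nat \<Rightarrow> 'v" where
  "wcoef N e c j k = (\<Sum>\<beta>\<in>lvl N. scale
     (of_nat (Poly_Mapping.lookup \<beta> j choose k) * c j ^ (Poly_Mapping.lookup \<beta> j - k)
       * (\<Prod>i\<in>UNIV - {j}. c i ^ Poly_Mapping.lookup \<beta> i)) (e \<beta>))"

lemma usum_shift:
  "usum N e (c(j := c j + z)) = (\<Sum>k\<le>N. scale (z ^ k) (wcoef N e c j k))"
proof -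
  let ?R = "\<lambda>\<beta>. \<Prod>i\<in>UNIV - {j}. c i ^ Poly_Mapping.lookup \<beta> i"
  have "cpow (c(j := c j + z)) \<beta> = (\<Sum>k\<le>N. z ^ k * (of_nat (Poly_Mapping.lookup \<beta> j choose k)
      * c j ^ (Poly_Mapping.lookup \<beta> j - k) * ?R \<beta>))" if "\<beta> \<in> lvl N" for \<beta>
  proof -
    let ?b = "Poly_Mapping.lookup \<beta> j"
    have le: "?b \<le> N" using that lookup_le_mdeg[of \<beta> j] by simp
    have "cpow (c(j := c j + z)) \<beta> = (c j + z) ^ ?b * (\<Prod>i\<in>UNIV - {j}. (c(j := c j + z)) i ^ Poly_Mapping.lookup \<beta> i)"
      unfolding cpow_def by (subst prod.remove[of _ j]) auto
    also have "(\<Prod>i\<in>UNIV - {j}. (c(j := c j + z)) i ^ Poly_Mapping.lookup \<beta> i) = ?R \<beta>"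
      by (rule prod.cong) auto
    also have "(c j + z) ^ ?b = (\<Sum>k\<le>?b. of_nat (?b choose k) * z ^ k * c j ^ (?b - k))"
      using binomial_ring[of z "c j" ?b] by (simp add: add.commute)
    also have "\<dots> = (\<Sum>k\<le>N. of_nat (?b choose k) * z ^ k * c j ^ (?b - k))"
      using le by (intro sum.mono_neutral_left) auto
    finally have "cpow (c(j := c j + z)) \<beta>
        = (\<Sum>k\<le>N. of_nat (?b choose k) * z ^ k * c j ^ (?b - k)) * ?R \<beta>" .
    then show ?thesis
      by (simp only: sum_distrib_right) (rule sum.cong, simp_all only: mult_ac)
  qed
  then have "usum N e (c(j := c j + z)) = (\<Sum>\<beta>\<in>lvl N. \<Sum>k\<le>N. scale (z ^ k) (scale
     (of_nat (Poly_Mapping.lookup \<beta> j choose k) * c j ^ (Poly_Mapping.lookup \<beta> j - k) * ?R \<beta>) (e \<beta>)))"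
    unfolding usum_def by (intro sum.cong) (auto simp: scale_sum_left)
  also have "\<dots> = (\<Sum>k\<le>N. scale (z ^ k) (wcoef N e c j k))"
    unfolding wcoef_def scale_sum_right by (rule sum.swap)
  finally show ?thesis .
qed

lemma wcoef_0: "wcoef N e c j 0 = usum N e c"
  using usum_shift[of N e c j 0] by (simp add: power_0_left if_distrib[of "\<lambda>x. scale x _"] sum.delta cong: if_cong)

lemma wcoef_beyond: "k > N \<Longrightarrow> wcoef N e c j k = 0"
  unfolding wcoef_def
proof (rule sum.neutral, rule ballI)
  fix \<beta> :: "'n \<Rightarrow>\<^sub>0 nat" assume "k > N" "\<beta> \<in> lvl N"
  then have "Poly_Mapping.lookup \<beta> j < k" using lookup_le_mdeg[of \<beta> j] by simp
  then show "scale (of_nat (Poly_Mapping.lookup \<beta> j choose k) * c j ^ (Poly_Mapping.lookup \<beta> j - k)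
       * (\<Prod>i\<in>UNIV - {j}. c i ^ Poly_Mapping.lookup \<beta> i)) (e \<beta>) = 0" by (simp add: binomial_eq_0)
qed

text \<open>If c_j is raised by z, then l_c becomes l_c + z t_j and u(c) becomes a polynomial in z.
  The identities compare the powers of z in the relation of \<open>usum_relation\<close>.\<close>

lemma wcoef_relation:
  assumes e: "top_rel 1 N e"
  shows "F (lin_form c) l (wcoef N e c j 0) = 0"
    and "F (lin_form c) l (wcoef N e c j (Suc k)) + F (tvar j) l (wcoef N e c j k) = 0"
proof -
  \<comment> \<open>The length N + k + 2 exceeds both the degree N + 1 of the product in z and the
    index k + 1 that is wanted.\<close>
  let ?w = "wcoef N e c j" and ?M = "N + k + 2"
  define a where "a m = F (lin_form c) l (?w m) + (if m = 0 then 0 else F (tvar j) l (?w (m - 1)))" for m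
  have "(\<Sum>m<?M. scale (z ^ m) (a m)) = 0" for z
  proof -
    have ext: "(\<Sum>m\<le>N. scale (z ^ m) (?w m)) = (\<Sum>m<L. scale (z ^ m) (?w m))" if "L > N" for L
      using that by (intro sum.mono_neutral_left) (auto simp: wcoef_beyond)
    let ?u = "usum N e (c(j := c j + z))"
    have u1: "?u = (\<Sum>m<?M. scale (z ^ m) (?w m))" and u2: "?u = (\<Sum>m<?M - 1. scale (z ^ m) (?w m))"
      unfolding usum_shift by (rule ext; simp)+
    have "0 = F (lin_form c) l ?u + scale z (F (tvar j) l ?u)"
      using usum_relation[OF e, of "c(j := c j + z)" l] unfolding lin_form_update
      by (simp only: F_add F_scale)
    also have "F (lin_form c) l ?u = (\<Sum>m<?M. scale (z ^ m) (F (lin_form c) l (?w m)))"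
      unfolding u1 by (simp only: \<rho>_sum[OF fld_derivation] \<rho>_scale[OF fld_derivation])
    also have "scale z (F (tvar j) l ?u) = (\<Sum>m<?M - 1. scale (z ^ Suc m) (F (tvar j) l (?w m)))"
      unfolding u2 by (simp only: \<rho>_sum[OF fld_derivation] \<rho>_scale[OF fld_derivation]
          scale_sum_right scale_scale power_Suc)
    also have "\<dots> = (\<Sum>m<?M. if m = 0 then 0 else scale (z ^ m) (F (tvar j) l (?w (m - 1))))"
    proof -
      have M: "?M = Suc (N + k + 1)" "?M - 1 = N + k + 1" by simp_all
      show ?thesis unfolding M sum.lessThan_Suc_shift by (simp add: add.assoc del: sum.lessThan_Suc)
    qed
    also have "(\<Sum>m<?M. scale (z ^ m) (F (lin_form c) l (?w m))) + \<dots> = (\<Sum>m<?M. scale (z ^ m) (a m))"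
      unfolding sum.distrib[symmetric] by (rule sum.cong) (auto simp: a_def scale_right_distrib)
    finally show ?thesis by simp
  qed
  then have a: "a m = 0" if "m < ?M" for m
    using vector_poly_zero[OF inj_power_two, where M = ?M and a = a and m = m] that by simp
  show "F (lin_form c) l (?w 0) = 0" using a[of 0] by (simp add: a_def)
  show "F (lin_form c) l (?w (Suc k)) + F (tvar j) l (?w k) = 0" using a[of "Suc k"] by (simp add: a_def)
qed

text \<open>The rising product x (x + 1) ... (x + K - 1), applied to v.\<close>

fun ppow :: "'n poly_op \<Rightarrow> nat \<Rightarrow> 'v \<Rightarrow> 'v" where
  "ppow x 0 v = v"
| "ppow x (Suc K) v = \<rho> x (ppow x K v) + scale (of_nat K) (ppow x K v)"

lemma ppow_zero: "x \<in> derivations \<Longrightarrow> ppow x K 0 = 0"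
  by (induction K) auto

lemma ppow_commute:
  assumes "x \<in> derivations" "y \<in> derivations" "lbracket witt y x = 0"
  shows "\<rho> y (ppow x K v) = ppow x K (\<rho> y v)"
proof (induction K)
  case (Suc K)
  have "\<rho> y (\<rho> x u) = \<rho> x (\<rho> y u)" for u using \<rho>_swap[OF assms(2,1), of u] assms(3) by simp
  then show ?case using Suc assms by (simp add: \<rho>_add \<rho>_scale)
qed simp

lemma ppow_ppow_commute:
  assumes "x \<in> derivations" "y \<in> derivations" "lbracket witt y x = 0"
  shows "ppow y L (ppow x K v) = ppow x K (ppow y L v)"
proof (induction L)
  case (Suc L)
  have lin: "ppow x K (u + scale a w) = ppow x K u + scale a (ppow x K w)" for u w a
    using assms(1) by (induction K) (auto simp: \<rho>_add \<rho>_scale algebra_simps scale_right_distrib)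
  show ?case using Suc ppow_commute[OF assms] by (simp add: lin)
qed simp

lemma ppow_annihilated:
  assumes "x \<in> witt_ge 0" "v \<in> annihilated V r"
  shows "ppow x K v \<in> annihilated V r"
proof (induction K)
  case (Suc K)
  then show ?case
    using M.annihilated_act_nonneg[OF Suc assms(1)] M.annihilated_submodule[of r]
    by (simp add: submodule_V subspace_add subspace_scale)
qed (use assms in simp)

text \<open>From [x, y] = - y follows (x + k) y^k = y^k x. So the factor x + k passes the y^k
  already collected and turns w_k into - y w_(k+1).\<close>

lemma ppow_chain:
  assumes d: "x \<in> derivations" "y \<in> derivations" and br: "lbracket witt x y = - y"
    and rel: "\<And>k. \<rho> y (w (Suc k)) + \<rho> x (w k) = 0"
  shows "ppow x K (w 0) = scale ((-1) ^ K) ((\<rho> y ^^ K) (w K))"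
proof (induction K)
  case (Suc K)
  have my: "\<rho> (- y) v = - \<rho> y v" for v
    using scale_\<rho>[OF d(2), of "-1" v] by simp
  have xy: "\<rho> x (\<rho> y v) = \<rho> y (\<rho> x v) - \<rho> y v" for v
    using \<rho>_swap[OF d, of v] by (simp add: br my)
  have pow: "\<rho> x ((\<rho> y ^^ k) v) + scale (of_nat k) ((\<rho> y ^^ k) v) = (\<rho> y ^^ k) (\<rho> x v)" for k v
  proof (induction k)
    case (Suc k)
    have "\<rho> x ((\<rho> y ^^ Suc k) v) + scale (of_nat (Suc k)) ((\<rho> y ^^ Suc k) v)
       = \<rho> y (\<rho> x ((\<rho> y ^^ k) v) + scale (of_nat k) ((\<rho> y ^^ k) v))"
      using d by (simp add: xy \<rho>_add \<rho>_scale scale_left_distrib)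
    then show ?case using Suc by simp
  qed simp
  have wx: "\<rho> x (w K) = - \<rho> y (w (Suc K))" using rel[of K] by (simp add: eq_neg_iff_add_eq_0 add.commute)
  have "ppow x (Suc K) (w 0) = scale ((-1) ^ K) ((\<rho> y ^^ K) (\<rho> x (w K)))"
    unfolding ppow.simps Suc \<rho>_scale[OF d(1)] pow[symmetric]
    by (simp add: scale_right_distrib mult.commute)
  also have "\<dots> = scale ((-1) ^ Suc K) ((\<rho> y ^^ Suc K) (w (Suc K)))"
  proof -
    have "(\<rho> y ^^ K) (- v) = - (\<rho> y ^^ K) v" for v
      using pow_scale[OF d(2), of K "-1" v] by simp
    then show ?thesis by (simp add: wx funpow_swap1)
  qed
  finally show ?case .
qed simp

text \<open>Expanding \<open>l\<^sub>c \<partial>\<^sub>j u(c) = 0\<close>, where \<open>u(c) = \<Sum>\<^sub>\<beta> c\<^sup>\<beta> e\<^sub>\<beta>\<close> and \<open>l\<^sub>c = \<Sum>\<^sub>i c\<^sub>i t\<^sub>i\<close>, in the direction \<open>c\<^sub>j\<close> shows that a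
  polynomial in \<open>X\<^sub>j = t\<^sub>j (\<partial>\<^sub>j - (c\<^sub>j / c\<^sub>i) \<partial>\<^sub>i)\<close> kills \<open>u(c)\<close>. The \<open>X\<^sub>j\<close> commute and, up to a multiple of
  \<open>l\<^sub>c \<partial>\<^sub>i\<close>, their sum is the Euler field.\<close>

lemma euler_eigenvector:
  assumes e: "top_rel 1 N e" and \<beta>: "e \<beta> \<noteq> 0" "mdeg \<beta> = N"
  shows "\<exists>v \<mu>. v \<noteq> 0 \<and> v \<in> annihilated V 1 \<and> \<rho> euler v = scale \<mu> v"
proof (cases "N = 0")
  case True
  \<comment> \<open>For N = 0 the relation says that linear fields kill e 0, so the eigenvalue is
    0.\<close>
  have "F (tvar j) j (e 0) = 0" for j
  proof -
    have "ord_ge (int 1 + int N) (tvar j :: 'n cpoly)" using True by (simp add: ord_ge_single)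
    then have "(\<Sum>\<beta>\<in>lvl N. F (pd \<beta> (tvar j)) j (e \<beta>)) = 0"
      using e unfolding top_rel_def by blast
    then show ?thesis using True by simp
  qed
  then have "\<rho> euler (e 0) = scale 0 (e 0)"
    unfolding euler_def by (subst sum_\<rho>) auto
  moreover have "e 0 \<noteq> 0" using \<beta> True by auto
  moreover have "e 0 \<in> annihilated V 1" using e by (simp add: top_rel_def)
  ultimately show ?thesis by blast
next
  case N: False
  obtain c where u: "usum N e c \<noteq> 0" using usum_nonzero[of e \<beta> N, OF \<beta>] by blast
  have "\<exists>i. c i \<noteq> 0"
  proof (rule ccontr)
    assume "\<nexists>i. c i \<noteq> 0"
    then have c0: "c i = 0" for i by blast
    have "cpow c \<beta> = 0" if \<beta>: "\<beta> \<in> lvl N" for \<beta>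
    proof -
      have "\<beta> \<noteq> 0" using \<beta> N by auto
      then obtain i where "Poly_Mapping.lookup \<beta> i \<noteq> 0" by (metis lookup_zero poly_mapping_eqI)
      then show ?thesis using c0 by (auto simp: cpow_def intro!: exI[of _ i])
    qed
    then have "usum N e c = 0" unfolding usum_def by (intro sum.neutral) simp
    then show False using u by simp
  qed
  then obtain i0 where i0: "c i0 \<noteq> 0" by blast
  let ?l = "lin_form c"
  \<comment> \<open>With this factor \<partial>_j - \<kappa>_j \<partial>_i0 kills the linear form
    l_c, which keeps the brackets below simple.\<close>
  define \<kappa> where "\<kappa> j = c j / c i0" for j
  \<comment> \<open>At j = i0 a multiple of l_c \<partial>_i0 fills the gap: it kills u(c) and
    completes the sum of the other fields to the Euler field.\<close>
  define xf where "xf j = (if j = i0 then op_scale (inverse (c i0)) (fld ?l i0)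
      else fld (tvar j) j - op_scale (\<kappa> j) (fld (tvar j) i0))" for j
  define yf where "yf j = fld ?l j - op_scale (\<kappa> j) (fld ?l i0)" for j
  have xd: "xf j \<in> derivations" and yd: "yf j \<in> derivations" for j
    unfolding xf_def yf_def by (auto intro!: derivations_closed)
  have xw: "xf j \<in> witt_ge 0" for j
    unfolding xf_def
    by (auto intro!: op.subspace_diff[OF witt_ge_subspace] op.subspace_scale[OF witt_ge_subspace]
        fld_witt_ge ord_ge_single ord_ge_lin_form)
  have fldl: "fld p j ?l = fscale (c j) p" for p j
    by (simp add: fld_def pdiff_lin_form fscale_conv_mult mult.commute)
  have app: "xf j p = (if j = i0 then fscale (inverse (c i0)) (fld ?l i0 p)
      else fld (tvar j) j p - fscale (\<kappa> j) (fld (tvar j) i0 p))"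
    "yf j p = fld ?l j p - fscale (\<kappa> j) (fld ?l i0 p)" for j p
    by (simp_all add: xf_def yf_def op_scale_def)
  have \<kappa>c: "fscale (c j) p = fscale (\<kappa> j) (fscale (c i0) p)" for j and p :: "'n cpoly"
    using i0 by (simp add: \<kappa>_def)
  have xl: "xf j ?l = (if j = i0 then ?l else 0)" for j
    using i0 by (simp add: app fldl \<kappa>_def del: fscale_single map_single)
  have xt: "xf j (tvar m) = (if j = i0 then (if m = i0 then fscale (inverse (c i0)) ?l else 0)
      else fscale ((if j = m then 1 else 0) - (if i0 = m then \<kappa> j else 0)) (tvar j))" for j m
    by (auto simp: app pm.scale_left_diff_distrib simp del: fscale_single map_single)
  have xx: "lbracket witt (xf j) (xf k) = 0" for j k
  proof (rule derivation_eqI)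
    fix m
    have z: "xf k (tvar j) = 0" if "j \<noteq> k" "j \<noteq> i0" for j k
      using that unfolding xt[of k j] by (simp del: fscale_single map_single)
    show "lbracket witt (xf j) (xf k) (tvar m) = 0 (tvar m)"
    proof (cases "j = k")
      case True then show ?thesis by (simp add: lbracket_witt)
    next
      case False
      then show ?thesis
        unfolding lbracket_witt xt[of k m] xt[of j m] zero_fun_apply
        using z[of k j] z[of j k]
        by (auto simp: derivation_fscale[OF xd] derivation_zero[OF xd] xl simp del: fscale_single map_single)
    qed
  qed (simp_all add: xd)
  have xy: "lbracket witt (xf j) (yf j) = - yf j" if j: "j \<noteq> i0" for j
  proof (rule derivation_eqI)
    fix m
    have yt: "yf j (tvar m) = fscale ((if j = m then 1 else 0) - (if i0 = m then \<kappa> j else 0)) ?l" for m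
      by (auto simp: app pm.scale_left_diff_distrib simp del: fscale_single map_single)
    show "lbracket witt (xf j) (yf j) (tvar m) = (- yf j) (tvar m)"
      unfolding lbracket_witt yt uminus_apply xt[of j m] using j
      by (simp add: derivation_fscale[OF xd] derivation_fscale[OF yd] xl yt del: fscale_single map_single)
  qed (use j in \<open>auto intro!: derivations_closed simp: xd yd\<close>)
  have eul: "euler = (\<Sum>j\<in>UNIV. xf j)"
  proof (rule derivation_eqI)
    fix m
    have "(\<Sum>j\<in>UNIV. xf j) (tvar m) = xf i0 (tvar m) + (\<Sum>j\<in>UNIV - {i0}. xf j (tvar m))"
      unfolding sum_fun_apply by (subst sum.remove[of _ i0]) auto
    also have "(\<Sum>j\<in>UNIV - {i0}. xf j (tvar m))
      = (\<Sum>j\<in>UNIV - {i0}. fscale ((if j = m then 1 else 0) - (if i0 = m then \<kappa> j else 0)) (tvar j))"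
      by (rule sum.cong) (auto simp: xt)
    also have "xf i0 (tvar m) + \<dots> = tvar m"
    proof (cases "m = i0")
      case True
      have "fscale (inverse (c i0)) ?l = (\<Sum>j\<in>UNIV. fscale (\<kappa> j) (tvar j))"
        unfolding lin_form_def pm.scale_sum_right
        by (rule sum.cong) (auto simp: \<kappa>_def field_simps)
      also have "\<dots> = tvar i0 + (\<Sum>j\<in>UNIV - {i0}. fscale (\<kappa> j) (tvar j))"
        using i0 by (subst sum.remove[of _ i0]) (auto simp: \<kappa>_def)
      finally have "fscale (inverse (c i0)) ?l = tvar i0 + (\<Sum>j\<in>UNIV - {i0}. fscale (\<kappa> j) (tvar j))" .
      moreover have "(\<Sum>j\<in>UNIV - {i0}. fscale ((if j = m then 1 else 0) - (if i0 = m then \<kappa> j else 0)) (tvar j))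
         = - (\<Sum>j\<in>UNIV - {i0}. fscale (\<kappa> j) (tvar j))"
        unfolding sum_negf[symmetric] using True by (intro sum.cong) (auto simp: single_uminus)
      ultimately show ?thesis using True by (simp add: xt del: fscale_single map_single)
    next
      case False
      have "(\<Sum>j\<in>UNIV - {i0}. fscale ((if j = m then 1 else 0) - (if i0 = m then \<kappa> j else 0)) (tvar j))
         = (\<Sum>j\<in>UNIV - {i0}. if j = m then tvar m else 0)"
        using False by (intro sum.cong) auto
      then show ?thesis using False by (simp add: xt sum.delta del: fscale_single map_single)
    qed
    finally show "euler (tvar m) = (\<Sum>j\<in>UNIV. xf j) (tvar m)" by simp
  qed (auto intro!: derivations_closed simp: xd)
  have x0: "\<rho> (xf i0) (usum N e c) = 0"
    using usum_relation[OF e, of c i0] by (simp add: xf_def scale_\<rho>)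
  have nil: "ppow (xf j) (Suc N) (usum N e c) = 0" if j: "j \<noteq> i0" for j
  proof -
    have rel: "\<rho> (yf j) (wcoef N e c j (Suc k)) + \<rho> (xf j) (wcoef N e c j k) = 0" for k
    proof -
      have "\<rho> (yf j) (wcoef N e c j (Suc k)) + \<rho> (xf j) (wcoef N e c j k)
        = (F ?l j (wcoef N e c j (Suc k)) + F (tvar j) j (wcoef N e c j k))
          - scale (\<kappa> j) (F ?l i0 (wcoef N e c j (Suc k)) + F (tvar j) i0 (wcoef N e c j k))"
        using j by (simp add: xf_def yf_def diff_\<rho> scale_\<rho> derivations_closed algebra_simps scale_right_distrib)
      then show ?thesis unfolding wcoef_relation(2)[OF e] by simp
    qed
    have "ppow (xf j) (Suc N) (wcoef N e c j 0) = scale ((-1) ^ Suc N) ((\<rho> (yf j) ^^ Suc N) (wcoef N e c j (Suc N)))"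
      by (rule ppow_chain[where w = "wcoef N e c j", OF xd yd xy[OF j] rel])
    also have "\<dots> = 0"
      unfolding wcoef_beyond[OF lessI] pow_zero[OF yd] by simp
    finally show ?thesis unfolding wcoef_0 .
  qed
  \<comment> \<open>The fields are diagonalized one after another. As they commute, eigenvalues
    found earlier persist, and the vanishing of the products \<open>ppow (xf j) (Suc N)\<close> is
    carried along for the fields still to come.\<close>
  have "\<exists>v. v \<noteq> 0 \<and> v \<in> annihilated V 1 \<and> \<rho> (xf i0) v = 0 \<and> (\<forall>j\<in>S. \<exists>\<mu>. \<rho> (xf j) v = scale \<mu> v)
      \<and> (\<forall>j. j \<noteq> i0 \<longrightarrow> ppow (xf j) (Suc N) v = 0)" if "finite S" "S \<subseteq> UNIV - {i0}" for S
    using that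
  proof (induction S rule: finite_induct)
    case empty
    show ?case using u usum_annihilated[OF e] x0 nil by auto
  next
    case (insert j S)
    then obtain v where v: "v \<noteq> 0" "v \<in> annihilated V 1" "\<rho> (xf i0) v = 0"
      "\<And>j. j \<in> S \<Longrightarrow> \<exists>\<mu>. \<rho> (xf j) v = scale \<mu> v" "\<And>j. j \<noteq> i0 \<Longrightarrow> ppow (xf j) (Suc N) v = 0"
      by auto
    \<comment> \<open>The last nonzero product is an eigenvector: the next factor x_j + K kills it,
      so its eigenvalue is -K.\<close>
    define K where "K = (LEAST K. ppow (xf j) (Suc K) v = 0)"
    have K: "ppow (xf j) (Suc K) v = 0"
      unfolding K_def by (rule LeastI[of _ N]) (use insert v(5) in auto)
    let ?v = "ppow (xf j) K v"
    have "?v \<noteq> 0"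
    proof (cases K)
      case (Suc L)
      then have "\<not> ppow (xf j) (Suc L) v = 0" unfolding K_def by (intro not_less_Least) auto
      then show ?thesis using Suc by simp
    qed (use v(1) in simp)
    moreover have "?v \<in> annihilated V 1" by (rule ppow_annihilated[OF xw v(2)])
    moreover have "\<rho> (xf i0) ?v = 0"
      using ppow_commute[OF xd xd xx, where v = v] v(3) ppow_zero[OF xd] by simp
    moreover have "\<exists>\<mu>. \<rho> (xf k) ?v = scale \<mu> ?v" if kS: "k \<in> insert j S" for k
    proof (cases "k = j")
      case True
      have "\<rho> (xf j) ?v = scale (- of_nat K) ?v"
        using K by (simp add: eq_neg_iff_add_eq_0)
      then show ?thesis using True by blast
    next
      case False
      then obtain \<mu> where \<mu>: "\<rho> (xf k) v = scale \<mu> v" using v(4) kS by blast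
      have lin: "ppow (xf j) K (scale a w) = scale a (ppow (xf j) K w)" for a w K
        by (induction K) (auto simp: \<rho>_scale[OF xd] scale_right_distrib mult.commute)
      have "\<rho> (xf k) ?v = scale \<mu> ?v"
        unfolding ppow_commute[OF xd xd xx] \<mu> by (rule lin)
      then show ?thesis by blast
    qed
    moreover have "ppow (xf k) (Suc N) ?v = 0" if "k \<noteq> i0" for k
      unfolding ppow_ppow_commute[OF xd xd xx] v(5)[OF that] by (rule ppow_zero[OF xd])
    ultimately show ?case by blast
  qed
  from this[of "UNIV - {i0}"] obtain v where v: "v \<noteq> 0" "v \<in> annihilated V 1" "\<rho> (xf i0) v = 0"
    "\<And>j. j \<noteq> i0 \<Longrightarrow> \<exists>\<mu>. \<rho> (xf j) v = scale \<mu> v" by auto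
  obtain \<mu> where \<mu>: "\<And>j. j \<noteq> i0 \<Longrightarrow> \<rho> (xf j) v = scale (\<mu> j) v" using v(4) by metis
  have "\<rho> euler v = (\<Sum>j\<in>UNIV. \<rho> (xf j) v)" unfolding eul by (rule sum_\<rho>) (rule xd)
  also have "\<dots> = \<rho> (xf i0) v + (\<Sum>j\<in>UNIV - {i0}. \<rho> (xf j) v)"
    by (subst sum.remove[of _ i0]) auto
  also have "\<dots> = (\<Sum>j\<in>UNIV - {i0}. scale (\<mu> j) v)"
    using v(3) \<mu> by simp
  also have "\<dots> = scale (\<Sum>j\<in>UNIV - {i0}. \<mu> j) v" by (simp add: scale_sum_left)
  finally show ?thesis using v(1,2) by blast
qed

end

section \<open>Tensor products\<close>

lemma keys_induct [consumes 1, case_names zero single add]: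
  assumes "Poly_Mapping.keys f \<subseteq> S" and "P 0"
    and single: "\<And>s c. s \<in> S \<Longrightarrow> P (Poly_Mapping.single s c)"
    and add: "\<And>f g. Poly_Mapping.keys f \<subseteq> S \<Longrightarrow> Poly_Mapping.keys g \<subseteq> S \<Longrightarrow> P f \<Longrightarrow> P g \<Longrightarrow> P (f + g)"
  shows "P (f :: 'b \<Rightarrow>\<^sub>0 complex)"
  using assms(1)
proof (induction f rule: Poly_Mapping.update_induct)
  case const
  show ?case by (rule assms(2))
next
  case (update f a b)
  have upd: "Poly_Mapping.update a b f = f + Poly_Mapping.single a b"
    using update by (intro poly_mapping_eqI)
      (auto simp: lookup_update lookup_add lookup_single when_def in_keys_iff)
  have "Poly_Mapping.keys (Poly_Mapping.update a b f) = insert a (Poly_Mapping.keys f)"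
    using update(2) by (auto simp: in_keys_iff lookup_update split: if_splits)
  then have "a \<in> S" "Poly_Mapping.keys f \<subseteq> S" using update.prems by auto
  then show ?case unfolding upd using update.IH by (intro add single) auto
qed

lemma keys_subspace: "pm.subspace {f. Poly_Mapping.keys f \<subseteq> S}"
  unfolding pm.subspace_def
  by (auto simp: in_keys_iff lookup_add subset_iff) (metis add_0)

text \<open>A basis of R is extended to one of the whole space, and \<pi> kills the first part and
  fixes the rest. Congruences modulo R thereby become equations between values of \<pi>, which can
  be rewritten.\<close>

lemma exists_projection:
  assumes R: "pm.subspace (R :: ('b \<Rightarrow>\<^sub>0 complex) set)"
  obtains \<pi> :: "('b \<Rightarrow>\<^sub>0 complex) \<Rightarrow> ('b \<Rightarrow>\<^sub>0 complex)"
  where "\<And>f g. \<pi> (f + g) = \<pi> f + \<pi> g" "\<And>c f. \<pi> (fscale c f) = fscale c (\<pi> f)"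
    "\<And>f. \<pi> f = 0 \<longleftrightarrow> f \<in> R"
proof -
  interpret vp: vector_space_pair "fscale :: complex \<Rightarrow> ('b \<Rightarrow>\<^sub>0 complex) \<Rightarrow> _" "fscale :: complex \<Rightarrow> ('b \<Rightarrow>\<^sub>0 complex) \<Rightarrow> _" ..
  obtain B where B: "B \<subseteq> R" "pm.independent B" "R \<subseteq> pm.span B"
    using pm.maximal_independent_subset[of R] by blast
  have RB: "pm.span B = R" using B R by (simp add: pm.span_subspace)
  define B' where "B' = pm.extend_basis B"
  have B': "pm.independent B'" "pm.span B' = UNIV" "B \<subseteq> B'"
    unfolding B'_def by (rule pm.independent_extend_basis[OF B(2)] pm.span_extend_basis[OF B(2)]
      pm.extend_basis_superset[OF B(2)])+
  obtain \<pi> where lin: "Vector_Spaces.linear fscale fscale \<pi>" and \<pi>: "\<And>b. b \<in> B' \<Longrightarrow> \<pi> b = (if b \<in> B then 0 else b)"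
    using vp.linear_independent_extend[OF B'(1), of "\<lambda>b. if b \<in> B then 0 else b"] by blast
  interpret l: Vector_Spaces.linear fscale fscale \<pi> by (rule lin)
  have "f \<in> R" if 0: "\<pi> f = 0" for f
  proof -
    let ?r = "pm.representation B' f"
    have fin: "finite {b. ?r b \<noteq> 0}" by (rule pm.finite_representation)
    have sub: "b \<in> B'" if "?r b \<noteq> 0" for b using pm.representation_ne_zero[OF that] .
    have f: "(\<Sum>b | ?r b \<noteq> 0. fscale (?r b) b) = f"
      by (rule pm.sum_nonzero_representation_eq[OF B'(1)]) (simp add: B'(2))
    have "(\<Sum>b | ?r b \<noteq> 0. fscale (?r b) (\<pi> b)) = 0"
      using 0 by (subst (asm) f[symmetric]) (simp add: l.sum l.scale)
    also have "(\<Sum>b | ?r b \<noteq> 0. fscale (?r b) (\<pi> b)) = (\<Sum>b \<in> {b. ?r b \<noteq> 0} - B. fscale (?r b) b)"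
      using fin sub by (intro sum.mono_neutral_cong_right) (auto simp: \<pi>)
    finally have z: "(\<Sum>b \<in> {b. ?r b \<noteq> 0} - B. fscale (?r b) b) = 0" .
    have "b \<in> B" if b: "?r b \<noteq> 0" for b
    proof (rule ccontr)
      assume "b \<notin> B"
      then have "?r b = 0"
        using pm.independentD[OF B'(1) _ _ z, of b] fin sub b by blast
      then show False using b by simp
    qed
    then have "(\<Sum>b | ?r b \<noteq> 0. fscale (?r b) b) \<in> pm.span B"
      by (intro pm.span_sum pm.span_scale pm.span_base) auto
    then show ?thesis using f RB by simp
  qed
  moreover have "\<pi> f = 0" if "f \<in> R" for f
  proof -
    have "f \<in> pm.span B" using that RB by simp
    then show ?thesis
    proof (induction rule: pm.span_induct)
      case base
      show ?case by (auto simp: pm.subspace_def l.add l.scale l.zero)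
    next
      case (step b)
      then show ?case using \<pi> B'(3) by auto
    qed
  qed
  ultimately show ?thesis using that[of \<pi>] l.add l.scale by blast
qed

lemma lin_ext_superset:
  assumes "finite A" "Poly_Mapping.keys f \<subseteq> A"
  shows "lin_ext G f = (\<Sum>b\<in>A. fscale (Poly_Mapping.lookup f b) (G b))"
  unfolding lin_ext_def using assms by (intro sum.mono_neutral_left) (auto simp: in_keys_iff)

lemma lin_ext_add: "lin_ext G (f + g) = lin_ext G f + lin_ext G g"
proof -
  let ?A = "Poly_Mapping.keys f \<union> Poly_Mapping.keys g"
  show ?thesis
    using keys_add[of f g]
    by (subst (1 2 3) lin_ext_superset[of ?A])
      (auto simp: lookup_add pm.scale_left_distrib sum.distrib)
qed

lemma lin_ext_single [simp]: "lin_ext G (Poly_Mapping.single b c) = fscale c (G b)"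
  by (subst lin_ext_superset[of "{b}"]) auto

lemma lin_ext_fscale: "lin_ext G (fscale c f) = fscale c (lin_ext G f)"
  by (induction f rule: poly_mapping_induct)
    (simp_all add: lin_ext_add pm.scale_right_distrib)

lemma lin_ext_zero [simp]: "lin_ext G 0 = 0"
  by (simp add: lin_ext_def)

lemma lin_ext_diff: "lin_ext G (f - g) = lin_ext G f - lin_ext G g"
  using lin_ext_add[of G "f - g" g] by simp

lemma lin_ext_sum: "lin_ext G (sum f A) = (\<Sum>a\<in>A. lin_ext G (f a))"
  by (induction A rule: infinite_finite_induct) (auto simp: lin_ext_add)

lemma free_space_simps [simp]:
  "carrier (free_space S T) = {f. Poly_Mapping.keys f \<subseteq> S}" "zero (free_space S T) = 0"
  "add (free_space S T) = (+)" "smult (free_space S T) = fscale" "act (free_space S T) = T"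
  by (simp_all add: free_space_def)

lemma free_space_cmod: "cmod (free_space S T)"
proof (rule cmod.intro, rule Module.moduleI)
  show "cring complex_ring" by (rule cring_complex_ring)
  note sub = keys_subspace[of S, unfolded pm.subspace_def]
  show "abelian_group (free_space S T)"
  proof (rule abelian_groupI)
    fix f assume "f \<in> carrier (free_space S T)"
    then show "\<exists>g\<in>carrier (free_space S T). g \<oplus>\<^bsub>free_space S T\<^esub> f = \<zero>\<^bsub>free_space S T\<^esub>"
      by (intro bexI[of _ "- f"]) (auto simp: in_keys_iff)
  qed (use sub in \<open>auto simp: algebra_simps\<close>)
qed (use keys_subspace[of S, unfolded pm.subspace_def] in
   \<open>auto simp: pm.scale_right_distrib pm.scale_left_distrib\<close>)

locale tensor =
  fixes X :: "('a, 'x) op_module" and Y :: "('b, 'y) op_module" and B :: "('x \<times> 'y \<Rightarrow>\<^sub>0 complex) set"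
    and L :: "'g::ab_group_add lie_algebra" and \<tau> :: "'g \<Rightarrow> 'x \<times> 'y \<Rightarrow> ('x \<times> 'y \<Rightarrow>\<^sub>0 complex)"
  assumes X: "cmod X" and Y: "cmod Y"
    and B: "B \<subseteq> {f. Poly_Mapping.keys f \<subseteq> carrier X \<times> carrier Y}"
begin

sublocale X: cmod X by (rule X)
sublocale Y: cmod Y by (rule Y)

definition "S = carrier X \<times> carrier Y"
definition "R = pm.span (bilinear_rels X Y \<union> B)"
definition "FS = free_space S (\<lambda>x. lin_ext (\<tau> x))"
definition "Q = tensor_module X Y B (\<lambda>x. lin_ext (\<tau> x))"

lemma Q_eq: "Q = quot_module FS R"
  by (simp add: Q_def FS_def R_def S_def tensor_module_def)

lemma R_subspace: "pm.subspace R"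
  by (simp add: R_def)

lemma bilinear_rels_carrier: "bilinear_rels X Y \<subseteq> {f. Poly_Mapping.keys f \<subseteq> S}"
proof -
  define K where "K = {f :: 'x \<times> 'y \<Rightarrow>\<^sub>0 complex. Poly_Mapping.keys f \<subseteq> S}"
  have d: "f - g \<in> K" if "f \<in> K" "g \<in> K" for f g
    using pm.subspace_diff[OF keys_subspace] that unfolding K_def by blast
  have p: "Poly_Mapping.single (x, y) c \<in> K" if "x \<in> carrier X" "y \<in> carrier Y" for x y c
    using that by (simp add: K_def S_def)
  have "bilinear_rels X Y \<subseteq> K"
    unfolding bilinear_rels_def by (auto intro!: d p)
  then show ?thesis by (simp add: K_def)
qed

lemma R_carrier: "R \<subseteq> {f. Poly_Mapping.keys f \<subseteq> S}"
  unfolding R_def using bilinear_rels_carrier B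
  by (intro pm.span_minimal keys_subspace) (auto simp: S_def)

sublocale FS: cmod FS
  unfolding FS_def by (rule free_space_cmod)

sublocale FQ: csub FS R
  by (intro csub.intro FS.cmod_axioms csub_axioms.intro)
    (unfold FS.submodule_iff, use R_carrier R_subspace in \<open>auto simp: FS_def pm.subspace_def\<close>)

lemma FS_minus: "f \<in> carrier FS \<Longrightarrow> g \<in> carrier FS \<Longrightarrow> f \<ominus>\<^bsub>FS\<^esub> g = f - g"
proof -
  assume *: "f \<in> carrier FS" "g \<in> carrier FS"
  have "fscale (-1) g = - g" using pm.scale_minus_left[of 1 g] pm.scale_one[of g] by simp
  then show ?thesis using FS.diff_eq_smult[OF *] by (simp add: FS_def)
qed

definition cls :: "('x \<times> 'y \<Rightarrow>\<^sub>0 complex) \<Rightarrow> ('x \<times> 'y \<Rightarrow>\<^sub>0 complex) set" where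
  "cls f = R +>\<^bsub>FS\<^esub> f"

definition \<pi> :: "('x \<times> 'y \<Rightarrow>\<^sub>0 complex) \<Rightarrow> ('x \<times> 'y \<Rightarrow>\<^sub>0 complex)" where
  "\<pi> = (SOME \<pi>. (\<forall>f g. \<pi> (f + g) = \<pi> f + \<pi> g) \<and> (\<forall>c f. \<pi> (fscale c f) = fscale c (\<pi> f)) \<and>
     (\<forall>f. \<pi> f = 0 \<longleftrightarrow> f \<in> R))"

lemma \<pi>: "\<pi> (f + g) = \<pi> f + \<pi> g" "\<pi> (fscale c f) = fscale c (\<pi> f)" "\<pi> f = 0 \<longleftrightarrow> f \<in> R"
proof -
  obtain p :: "('x \<times> 'y \<Rightarrow>\<^sub>0 complex) \<Rightarrow> ('x \<times> 'y \<Rightarrow>\<^sub>0 complex)"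
    where p: "\<And>f g. p (f + g) = p f + p g" "\<And>c f. p (fscale c f) = fscale c (p f)" "\<And>f. p f = 0 \<longleftrightarrow> f \<in> R"
    by (rule exists_projection[OF R_subspace], rule that)
  have "\<exists>\<pi> :: ('x \<times> 'y \<Rightarrow>\<^sub>0 complex) \<Rightarrow> ('x \<times> 'y \<Rightarrow>\<^sub>0 complex). (\<forall>f g. \<pi> (f + g) = \<pi> f + \<pi> g) \<and> (\<forall>c f. \<pi> (fscale c f) = fscale c (\<pi> f)) \<and>
     (\<forall>f. \<pi> f = 0 \<longleftrightarrow> f \<in> R)"
    by (intro exI[of _ p]) (simp add: p)
  from someI_ex[OF this] show "\<pi> (f + g) = \<pi> f + \<pi> g" "\<pi> (fscale c f) = fscale c (\<pi> f)" "\<pi> f = 0 \<longleftrightarrow> f \<in> R"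
    unfolding \<pi>_def by blast+
qed

lemma \<pi>_zero [simp]: "\<pi> 0 = 0"
  using \<pi>(3)[of 0] pm.subspace_0[OF R_subspace] by simp

lemma \<pi>_diff: "\<pi> (f - g) = \<pi> f - \<pi> g"
  using \<pi>(1)[of "f - g" g] by simp

lemma \<pi>_sum: "\<pi> (sum f A) = (\<Sum>a\<in>A. \<pi> (f a))"
  by (induction A rule: infinite_finite_induct) (auto simp: \<pi>(1))

lemma mem_R_iff: "f - g \<in> R \<longleftrightarrow> \<pi> f = \<pi> g"
  using \<pi>(3)[of "f - g"] by (simp add: \<pi>_diff)

lemma cls_eq_iff: "f \<in> carrier FS \<Longrightarrow> g \<in> carrier FS \<Longrightarrow> cls f = cls g \<longleftrightarrow> \<pi> f = \<pi> g"
  by (simp add: cls_def FQ.cls_eq_iff FS_minus mem_R_iff)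

text \<open>The tensor of x and y, represented by its value under \<pi> instead of its
  coset.\<close>

definition tp :: "'x \<Rightarrow> 'y \<Rightarrow> ('x \<times> 'y \<Rightarrow>\<^sub>0 complex)" where
  "tp x y = \<pi> (pure x y)"

lemma rel_mem: "r \<in> bilinear_rels X Y \<union> B \<Longrightarrow> \<pi> r = 0"
  unfolding \<pi>(3) R_def by (rule pm.span_base)

lemma tp_add_left: "x \<in> carrier X \<Longrightarrow> x' \<in> carrier X \<Longrightarrow> y \<in> carrier Y \<Longrightarrow>
    tp (x \<oplus>\<^bsub>X\<^esub> x') y = tp x y + tp x' y"
proof -
  assume "x \<in> carrier X" "x' \<in> carrier X" "y \<in> carrier Y"
  then have "pure (x \<oplus>\<^bsub>X\<^esub> x') y - pure x y - pure x' y \<in> bilinear_rels X Y \<union> B"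
    unfolding bilinear_rels_def by blast
  from rel_mem[OF this] show ?thesis by (simp add: tp_def \<pi>_diff \<pi>(1) algebra_simps)
qed

lemma tp_add_right: "x \<in> carrier X \<Longrightarrow> y \<in> carrier Y \<Longrightarrow> y' \<in> carrier Y \<Longrightarrow>
    tp x (y \<oplus>\<^bsub>Y\<^esub> y') = tp x y + tp x y'"
proof -
  assume "x \<in> carrier X" "y \<in> carrier Y" "y' \<in> carrier Y"
  then have "pure x (y \<oplus>\<^bsub>Y\<^esub> y') - pure x y - pure x y' \<in> bilinear_rels X Y \<union> B"
    unfolding bilinear_rels_def by blast
  from rel_mem[OF this] show ?thesis by (simp add: tp_def \<pi>_diff \<pi>(1) algebra_simps)
qed

lemma tp_smult_left: "x \<in> carrier X \<Longrightarrow> y \<in> carrier Y \<Longrightarrow> tp (c \<odot>\<^bsub>X\<^esub> x) y = fscale c (tp x y)"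
proof -
  assume "x \<in> carrier X" "y \<in> carrier Y"
  then have "pure (c \<odot>\<^bsub>X\<^esub> x) y - fscale c (pure x y) \<in> bilinear_rels X Y \<union> B"
    unfolding bilinear_rels_def by blast
  from rel_mem[OF this] show ?thesis
    by (simp add: tp_def \<pi>_diff \<pi>(2) del: fscale_single map_single)
qed

lemma tp_smult_right: "x \<in> carrier X \<Longrightarrow> y \<in> carrier Y \<Longrightarrow> tp x (c \<odot>\<^bsub>Y\<^esub> y) = fscale c (tp x y)"
proof -
  assume "x \<in> carrier X" "y \<in> carrier Y"
  then have "pure x (c \<odot>\<^bsub>Y\<^esub> y) - fscale c (pure x y) \<in> bilinear_rels X Y \<union> B"
    unfolding bilinear_rels_def by blast
  from rel_mem[OF this] show ?thesis
    by (simp add: tp_def \<pi>_diff \<pi>(2) del: fscale_single map_single)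
qed

lemma tp_zero_right: "x \<in> carrier X \<Longrightarrow> tp x \<zero>\<^bsub>Y\<^esub> = 0"
  using tp_smult_right[of x "\<zero>\<^bsub>Y\<^esub>" 0] by simp

lemma pure_carrier: "x \<in> carrier X \<Longrightarrow> y \<in> carrier Y \<Longrightarrow> pure x y \<in> carrier FS"
  by (simp add: FS_def S_def)

lemma FS_sum: "(\<And>a. a \<in> A \<Longrightarrow> f a \<in> carrier FS) \<Longrightarrow> sum f A \<in> carrier FS"
  unfolding FS_def using pm.subspace_sum[OF keys_subspace[of S], of A f] by simp

lemma FS_add: "f \<in> carrier FS \<Longrightarrow> g \<in> carrier FS \<Longrightarrow> f + g \<in> carrier FS"
  using FS.add_closed[of f g] by (simp add: FS_def)

lemma submodule_all:
  assumes N: "submodule N complex_ring Q"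
    and pures: "\<And>x y. x \<in> carrier X \<Longrightarrow> y \<in> carrier Y \<Longrightarrow> cls (pure x y) \<in> N"
  shows "N = carrier Q"
proof -
  interpret Q: cmod Q unfolding Q_eq by (rule FQ.quot_cmod)
  have N': "N \<subseteq> carrier Q" "\<zero>\<^bsub>Q\<^esub> \<in> N" "\<And>a b. a \<in> N \<Longrightarrow> b \<in> N \<Longrightarrow> a \<oplus>\<^bsub>Q\<^esub> b \<in> N"
    "\<And>c a. a \<in> N \<Longrightarrow> c \<odot>\<^bsub>Q\<^esub> a \<in> N"
    using N by (auto simp: Q.submodule_iff)
  have "cls f \<in> N" if f: "Poly_Mapping.keys f \<subseteq> S" for f
    using f
  proof (induction f rule: keys_induct)
    case zero
    have "cls 0 = \<zero>\<^bsub>Q\<^esub>"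
      unfolding Q_eq FQ.zero_quot cls_def using FQ.cls_zero by (simp add: FS_def)
    then show ?case using N'(2) by simp
  next
    case (single s c)
    obtain x y where s: "s = (x, y)" "x \<in> carrier X" "y \<in> carrier Y" using single by (auto simp: S_def)
    have "c \<odot>\<^bsub>Q\<^esub> cls (pure x y) = cls (fscale c (pure x y))"
      unfolding Q_eq cls_def using FQ.smult_quot[OF pure_carrier[OF s(2,3)], of c] by (simp add: FS_def)
    then show ?case using N'(4)[OF pures[OF s(2,3)], of c] by (simp add: s(1))
  next
    case (add f g)
    then have "cls f \<oplus>\<^bsub>Q\<^esub> cls g = cls (f + g)"
      unfolding Q_eq cls_def using FQ.add_quot[of f g] by (simp add: FS_def)
    then show ?case using N'(3)[OF add(3,4)] by simp
  qed
  moreover have "carrier Q = cls ` carrier FS"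
    unfolding Q_eq FQ.carrier_quot cls_def by simp
  ultimately show ?thesis using N'(1) by (auto simp: FS_def)
qed

end

text \<open>It suffices to check the axioms of a Lie module on pure tensors.\<close>

locale tensor_lie = tensor +
  assumes L: "lie_closed L"
    and \<tau>_closed: "\<And>x s. x \<in> lset L \<Longrightarrow> s \<in> S \<Longrightarrow> \<tau> x s \<in> carrier FS"
    and \<tau>_rel: "\<And>x r. x \<in> lset L \<Longrightarrow> r \<in> bilinear_rels X Y \<union> B \<Longrightarrow> \<pi> (lin_ext (\<tau> x) r) = 0"
    and \<tau>_add: "\<And>x y s. x \<in> lset L \<Longrightarrow> y \<in> lset L \<Longrightarrow> s \<in> S \<Longrightarrow> \<pi> (\<tau> (x + y) s) = \<pi> (\<tau> x s) + \<pi> (\<tau> y s)"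
    and \<tau>_scale: "\<And>x c s. x \<in> lset L \<Longrightarrow> s \<in> S \<Longrightarrow> \<pi> (\<tau> (lscale L c x) s) = fscale c (\<pi> (\<tau> x s))"
    and \<tau>_bracket: "\<And>x y s. x \<in> lset L \<Longrightarrow> y \<in> lset L \<Longrightarrow> s \<in> S \<Longrightarrow>
      \<pi> (\<tau> (lbracket L x y) s) = \<pi> (lin_ext (\<tau> x) (\<tau> y s)) - \<pi> (lin_ext (\<tau> y) (\<tau> x s))"
begin

lemma T_closed: "x \<in> lset L \<Longrightarrow> f \<in> carrier FS \<Longrightarrow> lin_ext (\<tau> x) f \<in> carrier FS"
proof -
  assume x: "x \<in> lset L" and "f \<in> carrier FS"
  then have "Poly_Mapping.keys f \<subseteq> S" by (simp add: FS_def)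
  then show ?thesis
  proof (induction f rule: keys_induct)
    case zero
    show ?case using FS.zero_closed by (simp add: FS_def)
  next
    case (single s c)
    show ?case using FS.smult_closed[OF \<tau>_closed[OF x single], of c] by (simp add: FS_def)
  next
    case (add f g)
    then show ?case by (simp add: lin_ext_add FS_add)
  qed
qed

lemma T_R: "x \<in> lset L \<Longrightarrow> f \<in> R \<Longrightarrow> lin_ext (\<tau> x) f \<in> R"
proof -
  assume x: "x \<in> lset L" and "f \<in> R"
  then have "f \<in> pm.span (bilinear_rels X Y \<union> B)" by (simp add: R_def)
  then show ?thesis
  proof (induction rule: pm.span_induct)
    case base
    show ?case
      by (auto simp: pm.subspace_def lin_ext_add lin_ext_fscale
          intro!: pm.subspace_0[OF R_subspace] pm.subspace_add[OF R_subspace] pm.subspace_scale[OF R_subspace])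
  next
    case (step r)
    then show ?case using \<tau>_rel[OF x] \<pi>(3) by blast
  qed
qed

lemma FS_mod:
  assumes "f \<in> carrier FS"
  shows "x \<in> lset L \<Longrightarrow> y \<in> lset L \<Longrightarrow> \<pi> (lin_ext (\<tau> (x + y)) f) = \<pi> (lin_ext (\<tau> x) f) + \<pi> (lin_ext (\<tau> y) f)"
    and "x \<in> lset L \<Longrightarrow> \<pi> (lin_ext (\<tau> (lscale L c x)) f) = fscale c (\<pi> (lin_ext (\<tau> x) f))"
    and "x \<in> lset L \<Longrightarrow> y \<in> lset L \<Longrightarrow> \<pi> (lin_ext (\<tau> (lbracket L x y)) f)
       = \<pi> (lin_ext (\<tau> x) (lin_ext (\<tau> y) f)) - \<pi> (lin_ext (\<tau> y) (lin_ext (\<tau> x) f))"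
proof -
  have f: "Poly_Mapping.keys f \<subseteq> S" using assms by (simp add: FS_def)
  show "\<pi> (lin_ext (\<tau> (x + y)) f) = \<pi> (lin_ext (\<tau> x) f) + \<pi> (lin_ext (\<tau> y) f)"
    if "x \<in> lset L" "y \<in> lset L"
    using f by (induction f rule: keys_induct)
      (simp_all add: lin_ext_add \<pi>(1,2) \<tau>_add[OF that] pm.scale_right_distrib)
  show "\<pi> (lin_ext (\<tau> (lscale L c x)) f) = fscale c (\<pi> (lin_ext (\<tau> x) f))"
    if "x \<in> lset L"
    using f by (induction f rule: keys_induct)
      (simp_all add: lin_ext_add \<pi>(1,2) \<tau>_scale[OF that] pm.scale_right_distrib pm.scale_left_commute del: pm.scale_scale)
  show "\<pi> (lin_ext (\<tau> (lbracket L x y)) f)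
       = \<pi> (lin_ext (\<tau> x) (lin_ext (\<tau> y) f)) - \<pi> (lin_ext (\<tau> y) (lin_ext (\<tau> x) f))"
    if "x \<in> lset L" "y \<in> lset L"
    using f by (induction f rule: keys_induct)
      (simp_all add: lin_ext_add lin_ext_fscale \<pi>(1,2) \<tau>_bracket[OF that] pm.scale_right_diff_distrib)
qed

lemma Q_lie: "lie_module L Q" 
  and Q_act: "x \<in> lset L \<Longrightarrow> f \<in> carrier FS \<Longrightarrow> act Q x (cls f) = cls (lin_ext (\<tau> x) f)"
proof -
  have actFS: "act FS = (\<lambda>x. lin_ext (\<tau> x))" "add FS = (+)" "smult FS = fscale"
    by (simp_all add: FS_def)
  have cl: "x \<in> lset L \<Longrightarrow> y \<in> lset L \<Longrightarrow> x + y \<in> lset L \<and> lbracket L x y \<in> lset L \<and> lscale L c x \<in> lset L"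
    for x y c using L by (auto simp: lie_closed_def)
  have dc: "f - g \<in> carrier FS" "fscale c f \<in> carrier FS" if "f \<in> carrier FS" "g \<in> carrier FS" for f g c
    using FS.diff_closed[OF that] FS_minus[OF that] FS.smult_closed[OF that(1), of c] by (simp_all add: FS_def)
  note * = quot_lie_module[OF FQ.csub_axioms L, unfolded actFS]
  show "lie_module L Q"
    unfolding Q_eq
    by (rule *(1)) (simp_all add: T_closed T_R lin_ext_add lin_ext_fscale FS_minus cl dc FS_add
        mem_R_iff FS_mod \<pi>(1,2) \<pi>_diff)
  show "act Q x (cls f) = cls (lin_ext (\<tau> x) f)" if "x \<in> lset L" "f \<in> carrier FS"
    unfolding Q_eq cls_def
    by (rule *(2)) (use that in \<open>simp_all add: T_closed T_R lin_ext_add lin_ext_fscale FS_minus cl dc FS_add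
        mem_R_iff FS_mod \<pi>(1,2) \<pi>_diff\<close>)
qed

end

section \<open>The Weyl algebra and the module $P_0$\<close>

lemma weyl_zero: "0 \<in> weyl_ops"
proof -
  have "op_scale 0 id = (0 :: 'n poly_op)" by (rule op.scale_zero_left)
  then show ?thesis using weyl_ops.scale[OF weyl_ops.one, of 0] by metis
qed

lemma weyl_subspace: "op.subspace weyl_ops"
  by (simp add: op.subspace_def weyl_zero weyl_ops.add weyl_ops.scale)

lemma weyl_linear:
  "P \<in> weyl_ops \<Longrightarrow> P (p + q) = P p + P q"
  "P \<in> weyl_ops \<Longrightarrow> P (fscale c p) = fscale c (P p)"
proof -
  have "(\<forall>p q. P (p + q) = P p + P q) \<and> (\<forall>c p. P (fscale c p) = fscale c (P p))" if "P \<in> weyl_ops"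
    using that
  proof (induction rule: weyl_ops.induct)
    case (var i)
    show ?case by (simp add: mult_op_def distrib_left fscale_mult_right)
  next
    case (add P Q)
    then show ?case by (simp add: pm.scale_right_distrib add_ac)
  next
    case (scale P c)
    then show ?case by (simp add: op_scale_def pm.scale_right_distrib pm.scale_left_commute del: pm.scale_scale)
  qed (simp_all add: pdiff_add pdiff_fscale)
  then show "P \<in> weyl_ops \<Longrightarrow> P (p + q) = P p + P q"
    "P \<in> weyl_ops \<Longrightarrow> P (fscale c p) = fscale c (P p)" by blast+
qed

lemma mult_op_add: "mult_op (f + g) = mult_op f + mult_op g"
  and mult_op_diff: "mult_op (f - g) = mult_op f - mult_op g"
  and mult_op_mult: "mult_op (f * g) = mult_op f \<circ> mult_op g"
  and mult_op_one: "mult_op 1 = id"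
  and mult_op_zero: "mult_op 0 = 0"
  by (auto simp: mult_op_def fun_eq_iff algebra_simps)

lemma mult_op_fscale: "mult_op (fscale c f) = op_scale c (mult_op f)"
  by (simp add: mult_op_def fun_eq_iff op_scale_def fscale_mult_left)

lemma mult_op_weyl [simp]: "mult_op f \<in> weyl_ops"
proof (induction f rule: poly_mapping_induct)
  case (single \<alpha> c)
  have "mult_op (tmonom \<alpha>) \<in> weyl_ops"
  proof (induction "\<alpha>" rule: Poly_Mapping.update_induct)
    case const
    show ?case using weyl_ops.one mult_op_one by (metis single_one)
  next
    case (update f a b)
    have pow: "mult_op (tmonom (Poly_Mapping.single a n)) \<in> weyl_ops" for n
    proof (induction n)
      case 0
      show ?case using weyl_ops.one mult_op_one by (metis single_one single_zero)
    next
      case (Suc n)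
      have "tmonom (Poly_Mapping.single a (Suc n)) = tvar a * tmonom (Poly_Mapping.single a n)"
        by (simp add: mult_single plus_1_eq_Suc flip: single_add)
      then show ?case using weyl_ops.comp[OF weyl_ops.var Suc, of a] by (simp only: mult_op_mult)
    qed
    have "Poly_Mapping.update a b f = f + Poly_Mapping.single a b"
      using update by (intro poly_mapping_eqI)
        (auto simp: lookup_update lookup_add lookup_single when_def in_keys_iff)
    then have "tmonom (Poly_Mapping.update a b f) = tmonom f * tmonom (Poly_Mapping.single a b)"
      by (simp add: mult_single)
    then show ?case using weyl_ops.comp[OF update.IH pow] by (simp only: mult_op_mult)
  qed
  then show ?case
    using weyl_ops.scale[of "mult_op (tmonom \<alpha>)" c] mult_op_fscale[of c "tmonom \<alpha>"] by simp
qed (simp only: mult_op_add weyl_ops.add)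

lemma derivation_weyl [simp]: "D \<in> derivations \<Longrightarrow> (D :: 'n::finite poly_op) \<in> weyl_ops"
proof -
  assume D: "D \<in> derivations"
  have "fld p j \<in> weyl_ops" for p and j :: 'n
    using weyl_ops.comp[OF mult_op_weyl[of p] weyl_ops.diff[of j]]
    by (simp add: fld_def mult_op_def comp_def)
  then show ?thesis
    by (subst derivation_expand[OF D]) (intro op.subspace_sum[OF weyl_subspace])
qed

lemma comp_add_right: "P \<in> weyl_ops \<Longrightarrow> P \<circ> (Q + Q') = (P \<circ> Q) + (P \<circ> Q')"
  and comp_scale_right: "P \<in> weyl_ops \<Longrightarrow> P \<circ> op_scale c Q = op_scale c (P \<circ> Q)"
  and comp_add_left: "(P + P') \<circ> Q = (P \<circ> Q) + (P' \<circ> Q)"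
  and comp_diff_left: "(P - P') \<circ> Q = (P \<circ> Q) - (P' \<circ> Q)"
  and comp_scale_left: "op_scale c P \<circ> Q = op_scale c (P \<circ> Q)"
  by (auto simp: fun_eq_iff weyl_linear op_scale_def)

lemma comp_sum_right: "P \<in> weyl_ops \<Longrightarrow> P \<circ> (\<Sum>a\<in>A. Q a) = (\<Sum>a\<in>A. P \<circ> Q a)"
proof -
  assume P: "P \<in> weyl_ops"
  have "P 0 = 0" using weyl_linear(1)[OF P, of 0 0] by simp
  then have "P (sum f A) = (\<Sum>a\<in>A. P (f a))" for f
    by (induction A rule: infinite_finite_induct) (simp_all add: weyl_linear(1)[OF P])
  then show ?thesis by (simp add: fun_eq_iff sum_fun_apply)
qed

lemma comp_sum_left: "(\<Sum>a\<in>A. Q a) \<circ> P = (\<Sum>a\<in>A. Q a \<circ> P)"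
  by (simp add: fun_eq_iff sum_fun_apply)

lemma derivation_mult_op:
  "D \<in> derivations \<Longrightarrow> D \<circ> mult_op f = (mult_op f \<circ> D) + mult_op (D f)"
  by (auto simp: fun_eq_iff mult_op_def derivation_mult algebra_simps)

definition weyl_left :: "'n::finite poly_op set" where
  "weyl_left = {\<Sum>i\<in>UNIV. a i \<circ> mult_op (tvar i) | a. \<forall>i. a i \<in> weyl_ops}"

lemma weyl_left_subspace: "op.subspace (weyl_left :: 'n::finite poly_op set)"
  unfolding op.subspace_def
proof (intro conjI ballI allI)
  have "(\<Sum>i\<in>(UNIV :: 'n set). (\<lambda>_. 0) i \<circ> mult_op (tvar i)) \<in> weyl_left"
    unfolding weyl_left_def by (intro CollectI exI[of _ "\<lambda>_. 0"]) (simp add: weyl_zero)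
  moreover have "(\<Sum>i\<in>UNIV. (\<lambda>_. 0) i \<circ> mult_op (tvar i)) = (0 :: 'n poly_op)"
    by (simp add: fun_eq_iff sum_fun_apply)
  ultimately show "0 \<in> (weyl_left :: 'n poly_op set)" by (simp only:)
  fix x y :: "'n poly_op" and c assume "x \<in> weyl_left"
  then obtain a where a: "\<And>i. a i \<in> weyl_ops" "x = (\<Sum>i\<in>UNIV. a i \<circ> mult_op (tvar i))"
    unfolding weyl_left_def by blast
  have "op_scale c x = (\<Sum>i\<in>UNIV. op_scale c (a i) \<circ> mult_op (tvar i))"
    unfolding a(2) by (simp add: op.scale_sum_right comp_scale_left)
  moreover have "\<forall>i. op_scale c (a i) \<in> weyl_ops" using a(1) weyl_ops.scale by blast
  ultimately show "op_scale c x \<in> weyl_left"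
    unfolding weyl_left_def by (intro CollectI exI[of _ "\<lambda>i. op_scale c (a i)"]) blast
  assume "y \<in> weyl_left"
  then obtain b where b: "\<And>i. b i \<in> weyl_ops" "y = (\<Sum>i\<in>UNIV. b i \<circ> mult_op (tvar i))"
    unfolding weyl_left_def by blast
  have "x + y = (\<Sum>i\<in>UNIV. (a i + b i) \<circ> mult_op (tvar i))"
    unfolding a(2) b(2) by (simp add: sum.distrib comp_add_left)
  moreover have "\<forall>i. a i + b i \<in> weyl_ops" using a(1) b(1) weyl_ops.add by blast
  ultimately show "x + y \<in> weyl_left"
    unfolding weyl_left_def by (intro CollectI exI[of _ "\<lambda>i. a i + b i"]) blast
qed

lemma weyl_left_var: "P \<in> weyl_ops \<Longrightarrow> P \<circ> mult_op (tvar i) \<in> weyl_left"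
proof -
  assume P: "P \<in> weyl_ops"
  let ?a = "\<lambda>j. if j = i then P else 0"
  have "(0 \<circ> mult_op (tvar j)) = (0 :: 'a poly_op)" for j by (simp add: fun_eq_iff)
  then have "(\<Sum>j\<in>UNIV. ?a j \<circ> mult_op (tvar j)) = (\<Sum>j\<in>UNIV. if j = i then P \<circ> mult_op (tvar i) else 0)"
    by (intro sum.cong) auto
  also have "\<dots> = P \<circ> mult_op (tvar i)" by (simp add: sum.delta)
  finally have "P \<circ> mult_op (tvar i) = (\<Sum>j\<in>UNIV. ?a j \<circ> mult_op (tvar j))" by simp
  moreover have "\<forall>j. ?a j \<in> weyl_ops" using P weyl_zero by simp
  ultimately show ?thesis unfolding weyl_left_def by (intro CollectI exI[of _ ?a]) blast
qed

lemma weyl_left_weyl: "P \<in> weyl_left \<Longrightarrow> P \<in> weyl_ops"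
  unfolding weyl_left_def
  by (auto intro!: op.subspace_sum[OF weyl_subspace] weyl_ops.comp)

lemma weyl_left_comp: "P \<in> weyl_ops \<Longrightarrow> Q \<in> weyl_left \<Longrightarrow> P \<circ> Q \<in> weyl_left"
proof -
  assume P: "P \<in> weyl_ops" and "Q \<in> weyl_left"
  then obtain a where a: "\<And>i. a i \<in> weyl_ops" "Q = (\<Sum>i\<in>UNIV. a i \<circ> mult_op (tvar i))"
    unfolding weyl_left_def by blast
  show ?thesis
    unfolding a(2) comp_sum_right[OF P] comp_assoc[symmetric]
    by (intro op.subspace_sum[OF weyl_left_subspace] weyl_left_var weyl_ops.comp P a)
qed

text \<open>Every monomial of f contains a variable, which can be split off on the right.\<close>

lemma weyl_left_mult:
  assumes P: "P \<in> weyl_ops" and f: "Poly_Mapping.lookup f 0 = 0"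
  shows "P \<circ> mult_op f \<in> weyl_left"
proof -
  have "P \<circ> mult_op (Poly_Mapping.single \<alpha> c) \<in> weyl_left" if "\<alpha> \<noteq> 0" for \<alpha> c
  proof -
    obtain i where i: "Poly_Mapping.lookup \<alpha> i \<noteq> 0" using \<open>\<alpha> \<noteq> 0\<close> by (metis lookup_zero poly_mapping_eqI)
    have "Poly_Mapping.single \<alpha> c = Poly_Mapping.single (\<alpha> - unit_idx i) c * tvar i"
      using idx_minus_add[OF i] by (simp add: mult_single)
    then have "mult_op (Poly_Mapping.single \<alpha> c) = mult_op (Poly_Mapping.single (\<alpha> - unit_idx i) c) \<circ> mult_op (tvar i)"
      by (simp only: mult_op_mult)
    then show ?thesis
      using weyl_left_var[OF weyl_ops.comp[OF P mult_op_weyl]] by (simp only: comp_assoc)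
  qed
  moreover have "\<alpha> \<noteq> 0" if "\<alpha> \<in> Poly_Mapping.keys f" for \<alpha> using that f by (auto simp: in_keys_iff)
  moreover have "mult_op (sum g A) = (\<Sum>a\<in>A. mult_op (g a))" for g :: "_ \<Rightarrow> 'a cpoly" and A
    by (induction A rule: infinite_finite_induct) (simp_all add: mult_op_zero mult_op_add)
  ultimately have "P \<circ> (\<Sum>\<alpha>\<in>Poly_Mapping.keys f. mult_op (Poly_Mapping.single \<alpha> (Poly_Mapping.lookup f \<alpha>))) \<in> weyl_left"
    "mult_op f = (\<Sum>\<alpha>\<in>Poly_Mapping.keys f. mult_op (Poly_Mapping.single \<alpha> (Poly_Mapping.lookup f \<alpha>)))"
    using arg_cong[OF poly_mapping_expand[of f], of mult_op]
    by (auto simp: comp_sum_right[OF P] intro!: op.subspace_sum[OF weyl_left_subspace])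
  then show ?thesis by simp
qed

subsection \<open>The module $P_0$ is not zero\<close>

text \<open>The moments of a Gaussian density give a linear functional for which multiplication by a
  variable is self-adjoint and every operator in the Weyl algebra has an adjoint. Hence an equation
  \<open>1 = \<Sum>\<^sub>i a\<^sub>i t\<^sub>i\<close> between operators would yield one of the form \<open>1 = \<Sum>\<^sub>i t\<^sub>i b\<^sub>i\<close> between polynomials.\<close>

fun moment :: "nat \<Rightarrow> complex" where
  "moment 0 = 1"
| "moment (Suc 0) = 0"
| "moment (Suc (Suc k)) = of_nat (Suc k) * moment k"

definition moments :: "('n::finite \<Rightarrow>\<^sub>0 nat) \<Rightarrow> complex" where
  "moments \<alpha> = (\<Prod>i\<in>UNIV. moment (Poly_Mapping.lookup \<alpha> i))"

definition gauss :: "'n::finite cpoly \<Rightarrow> complex" where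
  "gauss p = (\<Sum>\<alpha>\<in>Poly_Mapping.keys p. Poly_Mapping.lookup p \<alpha> * moments \<alpha>)"

lemma gauss_superset:
  "finite A \<Longrightarrow> Poly_Mapping.keys p \<subseteq> A \<Longrightarrow> gauss p = (\<Sum>\<alpha>\<in>A. Poly_Mapping.lookup p \<alpha> * moments \<alpha>)"
  unfolding gauss_def by (intro sum.mono_neutral_left) (auto simp: in_keys_iff)

lemma gauss_add: "gauss (p + q) = gauss p + gauss q"
proof -
  let ?A = "Poly_Mapping.keys p \<union> Poly_Mapping.keys q"
  show ?thesis
    using keys_add[of p q] by (subst (1 2 3) gauss_superset[of ?A])
      (auto simp: lookup_add algebra_simps sum.distrib)
qed

lemma gauss_single: "gauss (Poly_Mapping.single \<alpha> c) = c * moments \<alpha>"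
  by (subst gauss_superset[of "{\<alpha>}"]) auto

lemma gauss_fscale: "gauss (fscale c p) = c * gauss p"
  by (induction p rule: poly_mapping_induct)
    (simp_all add: gauss_single gauss_add pm.scale_right_distrib distrib_left)

lemma gauss_diff: "gauss (p - q) = gauss p - gauss q"
  using gauss_add[of "p - q" q] by simp

lemma gauss_zero [simp]: "gauss 0 = 0"
  by (simp add: gauss_def)

lemma gauss_sum: "gauss (sum f A) = (\<Sum>a\<in>A. gauss (f a))"
  by (induction A rule: infinite_finite_induct) (auto simp: gauss_add)

text \<open>Gaussian integration by parts; on monomials it is the recursion of the moments, m(k+2) =
  (k+1) m(k).\<close>

lemma gauss_tvar: "gauss (tvar i * p) = gauss (pdiff i p)"
proof (induction p rule: poly_mapping_induct)
  case (single \<alpha> c)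
  let ?R = "\<lambda>\<alpha>. \<Prod>j\<in>UNIV - {i}. moment (Poly_Mapping.lookup \<alpha> j)"
  have m: "moments \<alpha> = moment (Poly_Mapping.lookup \<alpha> i) * ?R \<alpha>" for \<alpha> :: "'a \<Rightarrow>\<^sub>0 nat"
    unfolding moments_def by (rule prod.remove) auto
  have R: "?R (unit_idx i + \<alpha>) = ?R \<alpha>" "?R (\<alpha> - unit_idx i) = ?R \<alpha>"
    by (rule prod.cong; simp add: lookup_add lookup_minus lookup_single)+
  show ?case
  proof (cases "Poly_Mapping.lookup \<alpha> i")
    case 0
    moreover have "moment 1 = 0" by (simp add: One_nat_def)
    ultimately have "moments (unit_idx i + \<alpha>) = 0"
      by (simp add: m[of "unit_idx i + \<alpha>"] lookup_add)
    then show ?thesis using 0 by (simp add: mult_single pdiff_single gauss_single)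
  next
    case (Suc k)
    have "moments (unit_idx i + \<alpha>) = moment (Suc (Suc k)) * ?R \<alpha>"
      unfolding m[of "unit_idx i + \<alpha>"] R using Suc by (simp add: lookup_add plus_1_eq_Suc del: moment.simps)
    moreover have "moments (\<alpha> - unit_idx i) = moment k * ?R \<alpha>"
      unfolding m[of "\<alpha> - unit_idx i"] R using Suc by (simp add: lookup_minus)
    ultimately show ?thesis using Suc
      by (simp add: mult_single pdiff_single gauss_single del: of_nat_Suc)
  qed
qed (simp add: gauss_add distrib_left pdiff_add)

text \<open>By the Leibniz rule and integration by parts the adjoint of \<partial>_i is t_i -
  \<partial>_i; the adjoint of a product is the product of adjoints in reverse order.\<close>

lemma weyl_adjoint:
  "P \<in> weyl_ops \<Longrightarrow> \<exists>P'. \<forall>q r. gauss (P q * r) = gauss (q * P' r)"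
proof (induction rule: weyl_ops.induct)
  case (var i)
  show ?case by (intro exI[of _ "\<lambda>r. tvar i * r"]) (simp add: mult_op_def mult_ac)
next
  case (diff i)
  have "gauss (pdiff i q * r) = gauss (q * (tvar i * r - pdiff i r))" for q r
  proof -
    have "gauss (pdiff i q * r) = gauss (pdiff i (q * r)) - gauss (q * pdiff i r)"
      by (simp add: pdiff_mult gauss_add)
    also have "gauss (pdiff i (q * r)) = gauss (q * (tvar i * r))"
      unfolding gauss_tvar[symmetric] by (simp add: mult_ac)
    finally show ?thesis by (simp add: right_diff_distrib gauss_diff)
  qed
  then show ?case by (intro exI[of _ "\<lambda>r. tvar i * r - pdiff i r"]) simp
next
  case one
  show ?case by (intro exI[of _ id]) simp
next
  case (add P Q)
  then obtain P' Q' where "\<And>q r. gauss (P q * r) = gauss (q * P' r)" "\<And>q r. gauss (Q q * r) = gauss (q * Q' r)"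
    by blast
  then show ?case by (intro exI[of _ "\<lambda>r. P' r + Q' r"]) (simp add: distrib_left distrib_right gauss_add)
next
  case (scale P c)
  then obtain P' where "\<And>q r. gauss (P q * r) = gauss (q * P' r)" by blast
  then show ?case
    by (intro exI[of _ "\<lambda>r. fscale c (P' r)"])
      (simp add: op_scale_def fscale_mult_left fscale_mult_right gauss_fscale)
next
  case (comp P Q)
  then obtain P' Q' where "\<And>q r. gauss (P q * r) = gauss (q * P' r)" "\<And>q r. gauss (Q q * r) = gauss (q * Q' r)"
    by blast
  then show ?case by (intro exI[of _ "\<lambda>r. Q' (P' r)"]) simp
qed

text \<open>The radical of the bilinear form is stable under partial derivatives. Differentiating z
  by one of its exponents of maximal degree leaves a nonzero constant, on which the functional does
  not vanish.\<close>

lemma gauss_nondegenerate: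
  assumes "\<And>q. gauss (q * z) = 0"
  shows "z = 0"
proof (rule ccontr)
  assume "z \<noteq> 0"
  then have ne: "Poly_Mapping.keys z \<noteq> {}"
    by (metis in_keys_iff empty_iff lookup_zero poly_mapping_eqI)
  define N where "N = Max (mdeg ` Poly_Mapping.keys z)"
  have "N \<in> mdeg ` Poly_Mapping.keys z" unfolding N_def using ne by (intro Max_in) auto
  then obtain \<alpha> where \<alpha>: "\<alpha> \<in> Poly_Mapping.keys z" "mdeg \<alpha> = N" by blast
  have max: "mdeg \<beta> \<le> mdeg \<alpha>" if "\<beta> \<in> Poly_Mapping.keys z" for \<beta>
    unfolding \<alpha>(2) N_def using that by (intro Max_ge) auto
  have rad: "gauss (q * pd \<beta> z) = 0" for q \<beta>
    using assms
  proof (induction \<beta> arbitrary: q z rule: multi_idx_induct)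
    case (step \<beta> i)
    have "gauss (q * pdiff i z) = gauss (tvar i * (q * z)) - gauss (pdiff i q * z)" for q
      unfolding gauss_tvar by (simp add: pdiff_mult gauss_add)
    then have "gauss (q * pdiff i z) = 0" for q
      using step.prems[of "tvar i * q"] step.prems by (simp add: mult.assoc)
    then show ?case unfolding pd_step by (rule step.IH)
  qed simp
  have pd_add: "pd \<beta> (p + q) = pd \<beta> p + pd \<beta> q" and pd_fscale: "pd \<beta> (fscale c p) = fscale c (pd \<beta> p)"
    for \<beta> p q and c :: complex
    by (induction \<beta> arbitrary: p q rule: multi_idx_induct) (simp_all add: pd_step pdiff_add pdiff_fscale)
  have pd_sum: "pd \<beta> (sum f A) = (\<Sum>a\<in>A. pd \<beta> (f a))" for \<beta> and f :: "_ \<Rightarrow> 'a cpoly" and A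
    by (induction A rule: infinite_finite_induct) (simp_all add: pd_add)
  have z: "z = (\<Sum>\<beta>\<in>Poly_Mapping.keys z. fscale (Poly_Mapping.lookup z \<beta> * idx_fact \<beta>) (dmonom \<beta>))"
    by (rule trans[OF poly_mapping_expand[of z]]) (intro sum.cong refl, simp add: dmonom_def mult.assoc)
  have "pd \<alpha> (dmonom \<beta>) = (if \<beta> = \<alpha> then 1 else 0)" if "\<beta> \<in> Poly_Mapping.keys z" for \<beta>
  proof (cases "\<exists>\<gamma>. \<beta> = \<alpha> + \<gamma>")
    case True
    then obtain \<gamma> where \<gamma>: "\<beta> = \<alpha> + \<gamma>" by blast
    then have "\<gamma> = 0" using max[OF that] by simp
    then show ?thesis using pd_dmonom[of \<alpha> 0] \<gamma> by (simp add: dmonom_def idx_fact_def)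
  next
    case False
    then have "\<beta> \<noteq> \<alpha>" by (metis add.right_neutral)
    then show ?thesis using pd_dmonom_zero[OF False] by simp
  qed
  then have "pd \<alpha> z = (\<Sum>\<beta>\<in>Poly_Mapping.keys z. if \<beta> = \<alpha> then fscale (Poly_Mapping.lookup z \<alpha> * idx_fact \<alpha>) 1 else 0)"
    by (subst z) (simp only: pd_sum pd_fscale, intro sum.cong, auto)
  also have "\<dots> = Poly_Mapping.single 0 (Poly_Mapping.lookup z \<alpha> * idx_fact \<alpha>)"
    using \<alpha>(1) by (simp add: sum.delta fscale_one)
  finally have "gauss (1 * pd \<alpha> z) = Poly_Mapping.lookup z \<alpha> * idx_fact \<alpha>"
    by (simp add: gauss_single moments_def)
  then show False using rad[of 1 \<alpha>] \<alpha>(1) by (simp add: in_keys_iff)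
qed

lemma id_notin_weyl_left: "id \<notin> (weyl_left :: 'n::finite poly_op set)"
proof
  assume "id \<in> (weyl_left :: 'n poly_op set)"
  then obtain a :: "'n \<Rightarrow> 'n poly_op" where a: "\<And>i. a i \<in> weyl_ops" "id = (\<Sum>i\<in>UNIV. a i \<circ> mult_op (tvar i))"
    unfolding weyl_left_def by blast
  have "\<forall>i. \<exists>b. \<forall>q. gauss (a i q * 1) = gauss (q * b)"
    using weyl_adjoint[OF a(1)] by blast
  then obtain b where b: "\<And>i q. gauss (a i q * 1) = gauss (q * b i)" by metis
  define z where "z = 1 - (\<Sum>i\<in>UNIV. tvar i * b i)"
  have "gauss (q * z) = 0" for q
  proof -
    have "q = (\<Sum>i\<in>UNIV. a i (tvar i * q))"
      using fun_cong[OF a(2), of q] by (simp add: sum_fun_apply mult_op_def)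
    then have "gauss q = (\<Sum>i\<in>UNIV. gauss (a i (tvar i * q) * 1))"
      by (metis (no_types, lifting) gauss_sum mult_1_right sum.cong)
    also have "\<dots> = gauss (q * (\<Sum>i\<in>UNIV. tvar i * b i))"
      unfolding b by (simp add: gauss_sum sum_distrib_left mult_ac)
    finally show ?thesis by (simp add: z_def right_diff_distrib gauss_diff)
  qed
  then have "z = 0" by (rule gauss_nondegenerate)
  moreover have "Poly_Mapping.lookup z 0 = 1"
  proof -
    have "unit_idx i + \<beta> \<noteq> 0" for i :: 'n and \<beta>
    proof
      assume "unit_idx i + \<beta> = 0"
      then have "Poly_Mapping.lookup (unit_idx i + \<beta>) i = 0" by simp
      then show False by (simp add: lookup_add)
    qed
    then have "0 \<notin> Poly_Mapping.keys (tvar i * b i)" for i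
      using keys_mult[of "tvar i" "b i"] by fastforce
    then have "Poly_Mapping.lookup (tvar i * b i) 0 = 0" for i by (simp add: in_keys_iff)
    then show ?thesis by (simp add: z_def lookup_minus lookup_sum lookup_one)
  qed
  ultimately show False by simp
qed

section \<open>The quotient of the Weyl algebra by the left ideal of the variables\<close>

lemma weyl_algebra_simps [simp]:
  "carrier weyl_algebra = weyl_ops" "zero weyl_algebra = 0" "add weyl_algebra = (+)"
  "smult weyl_algebra = op_scale" "act weyl_algebra = (\<circ>)"
  by (simp_all add: weyl_algebra_def)

lemma weyl_cmod: "cmod (weyl_algebra :: ('n poly_op, 'n poly_op) op_module)"
proof (rule cmod.intro, rule Module.moduleI)
  let ?W = "weyl_algebra :: ('n poly_op, 'n poly_op) op_module"
  show "cring complex_ring" by (rule cring_complex_ring)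
  note sub = weyl_subspace[where 'a = 'n, unfolded op.subspace_def]
  show "abelian_group ?W"
  proof (rule abelian_groupI)
    fix f assume "f \<in> carrier ?W"
    then show "\<exists>g\<in>carrier ?W. g \<oplus>\<^bsub>?W\<^esub> f = \<zero>\<^bsub>?W\<^esub>"
      by (intro bexI[of _ "- f"]) (auto intro: op.subspace_neg[OF weyl_subspace])
  qed (use sub in \<open>auto simp: algebra_simps\<close>)
qed (auto simp: op.scale_right_distrib op.scale_left_distrib weyl_ops.add weyl_ops.scale)

lemma weyl_csub: "csub (weyl_algebra :: ('n::finite poly_op, 'n poly_op) op_module) weyl_left"
proof (intro csub.intro weyl_cmod csub_axioms.intro)
  show "submodule weyl_left complex_ring (weyl_algebra :: ('n poly_op, 'n poly_op) op_module)"
    unfolding cmod.submodule_iff[OF weyl_cmod]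
    using weyl_left_subspace[unfolded op.subspace_def] weyl_left_weyl by auto
qed

lemma P0_eq: "P0 = quot_module weyl_algebra weyl_left"
  by (simp add: P0_def weyl_left_def)

definition pc :: "'n::finite poly_op \<Rightarrow> 'n poly_op set" where
  "pc P = weyl_left +>\<^bsub>weyl_algebra\<^esub> P"

lemma P0_carrier: "carrier P0 = pc ` weyl_ops"
  by (simp add: P0_eq csub.carrier_quot[OF weyl_csub] pc_def)

lemma pc_carrier [simp]: "P \<in> weyl_ops \<Longrightarrow> pc P \<in> carrier P0"
  by (simp add: P0_carrier)

lemma P0_cmod: "cmod P0"
  unfolding P0_eq by (rule csub.quot_cmod[OF weyl_csub])

lemma pc_add: "P \<in> weyl_ops \<Longrightarrow> Q \<in> weyl_ops \<Longrightarrow> pc P \<oplus>\<^bsub>P0\<^esub> pc Q = pc (P + Q)"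
  using csub.add_quot[OF weyl_csub, of P Q] by (simp add: P0_eq pc_def)

lemma pc_smult: "P \<in> weyl_ops \<Longrightarrow> c \<odot>\<^bsub>P0\<^esub> pc P = pc (op_scale c P)"
  using csub.smult_quot[OF weyl_csub, of P c] by (simp add: P0_eq pc_def)

lemma pc_eq_iff: "P \<in> weyl_ops \<Longrightarrow> Q \<in> weyl_ops \<Longrightarrow> pc P = pc Q \<longleftrightarrow> P - Q \<in> weyl_left"
proof -
  assume PQ: "P \<in> weyl_ops" "Q \<in> weyl_ops"
  have "op_scale (-1) Q = - Q" using op.scale_minus_left[of 1 Q] by simp
  then have "P \<ominus>\<^bsub>weyl_algebra\<^esub> Q = P - Q" using cmod.diff_eq_smult[OF weyl_cmod, of P Q] PQ by simp
  then show ?thesis using csub.cls_eq_iff[OF weyl_csub, of P Q] PQ by (simp add: pc_def)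
qed

lemma P0_act: "D \<in> weyl_ops \<Longrightarrow> P \<in> weyl_ops \<Longrightarrow> act P0 D (pc P) = pc (D \<circ> P)"
  using csub.act_quot[OF weyl_csub, of P D]
  by (simp add: P0_eq pc_def weyl_ops.comp comp_add_right weyl_left_comp)

text \<open>As the partial derivatives and the variables generate the Weyl algebra, \<open>P\<^sub>0\<close> is spanned by the
  images of the words in the partial derivatives.\<close>

inductive_set pdiff_span :: "'n::finite poly_op set" where
  one: "id \<in> pdiff_span"
| left: "P \<in> weyl_left \<Longrightarrow> P \<in> pdiff_span"
| diff: "P \<in> pdiff_span \<Longrightarrow> pdiff i \<circ> P \<in> pdiff_span"
| add: "P \<in> pdiff_span \<Longrightarrow> Q \<in> pdiff_span \<Longrightarrow> P + Q \<in> pdiff_span"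
| scale: "P \<in> pdiff_span \<Longrightarrow> op_scale c P \<in> pdiff_span"

lemma pdiff_span_weyl: "P \<in> pdiff_span \<Longrightarrow> P \<in> weyl_ops"
  by (induction rule: pdiff_span.induct) (assumption | rule weyl_ops.intros weyl_left_weyl)+

text \<open>The variable moves to the right past the partial derivatives, each of which leaves a
  shorter word through [t_i, \<partial>_j] = - \<delta>_ij, until the left ideal absorbs it.\<close>

lemma pdiff_span_mult: "P \<in> pdiff_span \<Longrightarrow> mult_op (tvar i) \<circ> P \<in> pdiff_span"
proof (induction rule: pdiff_span.induct)
  case one
  show ?case using weyl_left_var[OF weyl_ops.one, of i] by (intro pdiff_span.left) (simp add: comp_def)
next
  case (left P)
  show ?case by (intro pdiff_span.left weyl_left_comp left weyl_ops.var)
next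
  case (diff P j)
  have eq: "mult_op (tvar i) \<circ> (pdiff j \<circ> P) =
      (pdiff j \<circ> (mult_op (tvar i) \<circ> P)) + op_scale (if i = j then -1 else 0) P"
    by (auto simp: fun_eq_iff mult_op_def op_scale_def pdiff_mult pdiff_tvar pm.scale_minus_left[of 1, simplified])
  show ?case unfolding eq by (intro pdiff_span.add pdiff_span.diff pdiff_span.scale diff)
next
  case (add P Q)
  show ?case unfolding comp_add_right[OF weyl_ops.var] by (intro pdiff_span.add add)
next
  case (scale P c)
  show ?case unfolding comp_scale_right[OF weyl_ops.var] by (intro pdiff_span.scale scale)
qed

lemma weyl_pdiff_span: "P \<in> weyl_ops \<Longrightarrow> P \<in> pdiff_span"
proof -
  have "P \<circ> Q \<in> pdiff_span" if "P \<in> weyl_ops" "Q \<in> pdiff_span" for P Q :: "'a poly_op"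
    using that
  proof (induction arbitrary: Q rule: weyl_ops.induct)
    case (comp P P')
    then show ?case unfolding comp_assoc by blast
  qed (auto simp: comp_add_left comp_scale_left intro: pdiff_span_mult pdiff_span.intros)
  from this[OF _ pdiff_span.one] show "P \<in> weyl_ops \<Longrightarrow> P \<in> pdiff_span" by simp
qed

section \<open>The modules $F(P_0, M)$\<close>

lemma bilinear_rels_cases [consumes 1, case_names add_left add_right smult_left smult_right]:
  assumes "r \<in> bilinear_rels X Y"
  obtains x x' y where "x \<in> carrier X" "x' \<in> carrier X" "y \<in> carrier Y"
      "r = pure (x \<oplus>\<^bsub>X\<^esub> x') y - pure x y - pure x' y"
    | x y y' where "x \<in> carrier X" "y \<in> carrier Y" "y' \<in> carrier Y"
      "r = pure x (y \<oplus>\<^bsub>Y\<^esub> y') - pure x y - pure x y'"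
    | c x y where "x \<in> carrier X" "y \<in> carrier Y" "r = pure (c \<odot>\<^bsub>X\<^esub> x) y - fscale c (pure x y)"
    | c x y where "x \<in> carrier X" "y \<in> carrier Y" "r = pure x (c \<odot>\<^bsub>Y\<^esub> y) - fscale c (pure x y)"
  using assms unfolding bilinear_rels_def Un_iff mem_Collect_eq by (elim disjE exE conjE; blast)

lemma act_diff:
  assumes "lmod L V" "lie_closed L" "x \<in> lset L" "y \<in> lset L" "v \<in> carrier V" "lscale L (-1) y = - y"
  shows "act V (x - y) v = act V x v \<ominus>\<^bsub>V\<^esub> act V y v"
proof -
  interpret lmod L V by fact
  have "lscale L (-1) y \<in> lset L" using assms(2,4) unfolding lie_closed_def by blast
  then show ?thesis
    using add_act[of x "lscale L (-1) y" v] scale_act[of y v "-1"] assms by (simp add: diff_eq_smult)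
qed

lemma mat_unit_mult: "mat_unit i j ** mat_unit k l = (if j = k then mat_unit i l else 0)"
proof -
  have "(\<Sum>b\<in>UNIV. (if a = i \<and> b = j then 1 else 0) * (if b = k \<and> c = l then 1 else 0 :: complex))
      = (\<Sum>b\<in>UNIV. if b = j then (if a = i \<and> j = k \<and> c = l then 1 else 0) else 0)" for a c
    by (intro sum.cong) auto
  then show ?thesis
    by (auto simp: mat_unit_def matrix_matrix_mult_def vec_eq_iff sum.delta)
qed

lemma sum_pair: "(\<Sum>i\<in>UNIV. \<Sum>j\<in>UNIV. g i j) = (\<Sum>p\<in>UNIV. g (fst p) (snd p))"
  unfolding sum.cartesian_product by (simp add: case_prod_unfold)

lemma mult_op_sum: "mult_op (sum f A) = (\<Sum>a\<in>A. mult_op (f a))"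
  by (simp add: mult_op_def fun_eq_iff sum_fun_apply sum_distrib_right)

lemma pdiff_diff: "pdiff i (p - q) = pdiff i p - pdiff i q"
  using pdiff_add[of i "p - q" q] by simp

lemma sum_pair4: "(\<Sum>i\<in>UNIV. \<Sum>j\<in>UNIV. \<Sum>k\<in>UNIV. \<Sum>l\<in>UNIV. f i j k l) =
    (\<Sum>p\<in>UNIV. \<Sum>q\<in>UNIV. f (fst p) (snd p) (fst q) (snd q))"
  by (rule trans[OF sum_pair]) (intro sum.cong refl sum_pair)

locale tensor_field =
  fixes M :: "(complex^'n^'n, 'm) op_module"
  assumes M_lie: "lie_module gl M"
begin

definition \<tau> :: "'n poly_op \<Rightarrow> 'n poly_op set \<times> 'm \<Rightarrow> ('n poly_op set \<times> 'm \<Rightarrow>\<^sub>0 complex)" where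
  "\<tau> D = (\<lambda>(g, v). pure (act P0 D g) v + (\<Sum>i\<in>UNIV. \<Sum>j\<in>UNIV.
        pure (act P0 (mult_op (pdiff i (D (tvar j)))) g) (act M (mat_unit i j) v)))"

sublocale M: lmod gl M
  by (rule lie_module_lmod[OF M_lie])

sublocale T: tensor P0 M "{}" witt \<tau>
  by (intro tensor.intro P0_cmod M.cmod_axioms) simp

lemma Q_field: "T.Q = tensor_field_module M"
  unfolding T.Q_def tensor_field_module_def
  by (rule arg_cong[of _ _ "tensor_module P0 M {}"]) (simp add: fun_eq_iff tensor_field_act_def \<tau>_def)

abbreviation J :: "'n poly_op \<Rightarrow> 'n \<Rightarrow> 'n \<Rightarrow> 'n cpoly" where
  "J D i j \<equiv> pdiff i (D (tvar j))"

abbreviation ee :: "'n \<Rightarrow> 'n \<Rightarrow> 'm \<Rightarrow> 'm" where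
  "ee i j \<equiv> act M (mat_unit i j)"

definition w :: "'n poly_op \<Rightarrow> 'm \<Rightarrow> ('n poly_op set \<times> 'm \<Rightarrow>\<^sub>0 complex)" where
  "w P v = T.tp (pc P) v"

lemma gl_set [simp]: "A \<in> lset gl"
  by (simp add: gl_def)

lemma w_add_left: "P \<in> weyl_ops \<Longrightarrow> P' \<in> weyl_ops \<Longrightarrow> v \<in> carrier M \<Longrightarrow> w (P + P') v = w P v + w P' v"
  using T.tp_add_left[of "pc P" "pc P'" v] by (simp add: w_def pc_add)

lemma w_scale_left: "P \<in> weyl_ops \<Longrightarrow> v \<in> carrier M \<Longrightarrow> w (op_scale c P) v = fscale c (w P v)"
  using T.tp_smult_left[of "pc P" v c] by (simp add: w_def pc_smult)

lemma w_add_right: "P \<in> weyl_ops \<Longrightarrow> v \<in> carrier M \<Longrightarrow> v' \<in> carrier M \<Longrightarrow> w P (v \<oplus>\<^bsub>M\<^esub> v') = w P v + w P v'"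
  using T.tp_add_right[of "pc P" v v'] by (simp add: w_def)

lemma w_scale_right: "P \<in> weyl_ops \<Longrightarrow> v \<in> carrier M \<Longrightarrow> w P (c \<odot>\<^bsub>M\<^esub> v) = fscale c (w P v)"
  using T.tp_smult_right[of "pc P" v c] by (simp add: w_def)

lemma w_zero_right: "P \<in> weyl_ops \<Longrightarrow> w P \<zero>\<^bsub>M\<^esub> = 0"
  using T.tp_zero_right[of "pc P"] by (simp add: w_def)

lemma w_zero_left: "v \<in> carrier M \<Longrightarrow> w 0 v = 0"
  using w_scale_left[OF weyl_zero, of v 0] by simp

lemma w_diff_left:
  assumes "P \<in> weyl_ops" "P' \<in> weyl_ops" "v \<in> carrier M"
  shows "w (P - P') v = w P v - w P' v"
  using w_add_left[OF op.subspace_diff[OF weyl_subspace assms(1,2)] assms(2,3)] by simp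

lemma w_diff_right:
  assumes "P \<in> weyl_ops" "v \<in> carrier M" "v' \<in> carrier M"
  shows "w P (v \<ominus>\<^bsub>M\<^esub> v') = w P v - w P v'"
proof -
  have "fscale (-1) x = - x" for x :: "'z \<Rightarrow>\<^sub>0 complex" using pm.scale_minus_left[of 1 x] pm.scale_one[of x] by simp
  then show ?thesis using assms by (simp add: M.diff_eq_smult w_add_right w_scale_right)
qed

lemma w_sum_left:
  assumes "\<And>a. a \<in> A \<Longrightarrow> P a \<in> weyl_ops" "v \<in> carrier M"
  shows "w (\<Sum>a\<in>A. P a) v = (\<Sum>a\<in>A. w (P a) v)"
  using assms(1)
proof (induction A rule: infinite_finite_induct)
  case (insert a A)
  have "(\<Sum>a\<in>A. P a) \<in> weyl_ops" using insert by (intro op.subspace_sum[OF weyl_subspace]) auto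
  then have "w (P a + (\<Sum>a\<in>A. P a)) v = w (P a) v + w (\<Sum>a\<in>A. P a) v"
    using insert assms(2) by (intro w_add_left) auto
  moreover have "w (\<Sum>a\<in>A. P a) v = (\<Sum>a\<in>A. w (P a) v)" using insert by blast
  ultimately show ?case by (simp only: sum.insert[OF insert(1,2)])
qed (simp_all add: w_zero_left assms(2))

lemma w_left: "P - P' \<in> weyl_left \<Longrightarrow> P \<in> weyl_ops \<Longrightarrow> P' \<in> weyl_ops \<Longrightarrow> w P v = w P' v"
  using pc_eq_iff[of P P'] by (simp add: w_def)

lemma ee_closed [simp]: "v \<in> carrier M \<Longrightarrow> ee i j v \<in> carrier M"
  by simp

lemma ee_bracket:
  assumes P: "P \<in> weyl_ops" and v: "v \<in> carrier M"
  shows "w P (ee i j (ee k l v)) - w P (ee k l (ee i j v)) =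
    (if j = k then w P (ee i l v) else 0) - (if l = i then w P (ee k j v) else 0)"
proof -
  have sc: "lscale gl c A = (\<chi> i j. c * A $ i $ j)" for c and A :: "complex^'n^'n" by (simp add: gl_def)
  have z: "act M 0 v = \<zero>\<^bsub>M\<^esub>"
    using M.scale_act[of 0 v 0] v by (simp add: sc zero_vec_def)
  have m: "lscale gl (-1) A = - A" for A :: "complex^'n^'n" by (simp add: sc vec_eq_iff)
  have "w P (ee i j (ee k l v)) - w P (ee k l (ee i j v)) = w P (act M (lbracket gl (mat_unit i j) (mat_unit k l)) v)"
    using P v by (simp add: M.bracket_act w_diff_right)
  also have "lbracket gl (mat_unit i j) (mat_unit k l) =
      (if j = k then mat_unit i l else 0) - (if l = i then mat_unit k j else 0 :: complex^'n^'n)"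
    by (simp add: gl_def mat_unit_mult)
  also have "w P (act M \<dots> v) = w P (act M (if j = k then mat_unit i l else 0) v)
      - w P (act M (if l = i then mat_unit k j else 0) v)"
    using P v by (simp add: act_diff[OF M.lmod_axioms lie_closed_gl _ _ _ m] w_diff_right del: if_split)
  finally show ?thesis using P v by (simp add: z w_zero_right split: if_splits)
qed

definition val :: "'n poly_op \<Rightarrow> 'n poly_op \<Rightarrow> 'm \<Rightarrow> ('n poly_op set \<times> 'm \<Rightarrow>\<^sub>0 complex)" where
  "val D P v = w (D \<circ> P) v + (\<Sum>i\<in>UNIV. \<Sum>j\<in>UNIV. w (mult_op (J D i j) \<circ> P) (ee i j v))"

lemma \<pi>_\<tau>:
  assumes "D \<in> derivations" "P \<in> weyl_ops" "v \<in> carrier M"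
  shows "T.\<pi> (\<tau> D (pc P, v)) = val D P v"
  using assms by (simp add: \<tau>_def val_def w_def T.tp_def T.\<pi>(1) T.\<pi>_sum P0_act)

lemma \<tau>_closed:
  assumes "D \<in> derivations" "P \<in> weyl_ops" "v \<in> carrier M"
  shows "\<tau> D (pc P, v) \<in> carrier T.FS"
  using assms by (simp add: \<tau>_def P0_act)
    (intro T.FS_add T.FS_sum T.pure_carrier; simp add: weyl_ops.comp)

lemma \<pi>_lin_ext_\<tau>:
  assumes "D \<in> derivations" "P \<in> weyl_ops" "v \<in> carrier M"
  shows "T.\<pi> (lin_ext (\<tau> D) (pure (pc P) v)) = val D P v"
  using assms by (simp add: \<pi>_\<tau>)

lemma val_add_left:
  assumes "D \<in> derivations" "P \<in> weyl_ops" "P' \<in> weyl_ops" "v \<in> carrier M"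
  shows "val D (P + P') v = val D P v + val D P' v"
  using assms by (simp add: val_def comp_add_right w_add_left weyl_ops.comp sum.distrib)

lemma val_scale_left:
  assumes "D \<in> derivations" "P \<in> weyl_ops" "v \<in> carrier M"
  shows "val D (op_scale c P) v = fscale c (val D P v)"
  using assms by (simp add: val_def comp_scale_right w_scale_left weyl_ops.comp pm.scale_right_distrib pm.scale_sum_right)

lemma val_add_right:
  assumes "D \<in> derivations" "P \<in> weyl_ops" "v \<in> carrier M" "v' \<in> carrier M"
  shows "val D P (v \<oplus>\<^bsub>M\<^esub> v') = val D P v + val D P v'"
  using assms by (simp add: val_def w_add_right weyl_ops.comp sum.distrib M.act_add)

lemma val_scale_right:
  assumes "D \<in> derivations" "P \<in> weyl_ops" "v \<in> carrier M"
  shows "val D P (c \<odot>\<^bsub>M\<^esub> v) = fscale c (val D P v)"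
  using assms by (simp add: val_def w_scale_right weyl_ops.comp pm.scale_right_distrib pm.scale_sum_right M.act_smult)

lemma val_add:
  assumes "D \<in> derivations" "D' \<in> derivations" "P \<in> weyl_ops" "v \<in> carrier M"
  shows "val (D + D') P v = val D P v + val D' P v"
  using assms by (simp add: val_def comp_add_left w_add_left weyl_ops.comp sum.distrib pdiff_add mult_op_add)

lemma val_scale:
  assumes "D \<in> derivations" "P \<in> weyl_ops" "v \<in> carrier M"
  shows "val (op_scale c D) P v = fscale c (val D P v)"
proof -
  have "op_scale c D (tvar j) = fscale c (D (tvar j))" for j by (simp add: op_scale_def)
  then show ?thesis
    using assms by (simp add: val_def comp_scale_left w_scale_left weyl_ops.comp pdiff_fscale mult_op_fscale
      pm.scale_right_distrib pm.scale_sum_right)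
qed

text \<open>Rests on \<partial>_i(D p) = D(\<partial>_i p) + sum over l of \<partial>_i(D t_l)
  \<partial>_l p. The two sums are the products of the Jacobian matrices in both orders;
  \<open>quadratic_part\<close> produces them from the commutators of the matrix units.\<close>

lemma J_bracket:
  assumes D: "D \<in> derivations" and D': "D' \<in> derivations"
  shows "J (lbracket witt D D') i j = D (J D' i j) - D' (J D i j)
     + (\<Sum>l\<in>UNIV. J D i l * J D' l j) - (\<Sum>l\<in>UNIV. J D' i l * J D l j)"
proof -
  have "pdiff i (D p) = D (pdiff i p) + (\<Sum>l\<in>UNIV. J D i l * pdiff l p)" if "D \<in> derivations" for D p
    unfolding derivation_apply[OF that, of p] derivation_apply[OF that, of "pdiff i p"]
    by (simp add: pdiff_sum pdiff_mult sum.distrib add.commute pdiff_commute[of i])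
  then show ?thesis using D D' by (simp add: lbracket_witt pdiff_diff)
qed

text \<open>The groups are D D' on the operator, two mixed ones, the one with D applied to the
  Jacobian of D', and the quadratic one. Exchanging D and D' swaps the mixed groups, so they cancel
  in the commutator.\<close>

lemma val_bracket:
  assumes D: "D \<in> derivations" and D': "D' \<in> derivations" and P: "P \<in> weyl_ops" and v: "v \<in> carrier M"
  shows "T.\<pi> (lin_ext (\<tau> D) (\<tau> D' (pc P, v))) = w (D \<circ> (D' \<circ> P)) v
     + (\<Sum>i\<in>UNIV. \<Sum>j\<in>UNIV. w (mult_op (J D i j) \<circ> (D' \<circ> P)) (ee i j v))
     + (\<Sum>i\<in>UNIV. \<Sum>j\<in>UNIV. w (mult_op (J D' i j) \<circ> (D \<circ> P)) (ee i j v))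
     + (\<Sum>i\<in>UNIV. \<Sum>j\<in>UNIV. w (mult_op (D (J D' i j)) \<circ> P) (ee i j v))
     + (\<Sum>q\<in>UNIV. \<Sum>p\<in>UNIV. w (mult_op (J D (fst p) (snd p) * J D' (fst q) (snd q)) \<circ> P)
          (ee (fst p) (snd p) (ee (fst q) (snd q) v)))"
proof -
  have W: "D \<in> weyl_ops" "D' \<in> weyl_ops" using D D' by auto
  have c: "D \<circ> (mult_op f \<circ> P) = (mult_op f \<circ> (D \<circ> P)) + (mult_op (D f) \<circ> P)" for f
  proof -
    have "D \<circ> (mult_op f \<circ> P) = ((mult_op f \<circ> D) + mult_op (D f)) \<circ> P"
      by (simp only: comp_assoc[symmetric] derivation_mult_op[OF D])
    also have "\<dots> = ((mult_op f \<circ> D) \<circ> P) + (mult_op (D f) \<circ> P)" by (rule comp_add_left)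
    finally show ?thesis by (simp only: comp_assoc)
  qed
  have cm: "mult_op f \<circ> (mult_op g \<circ> P) = mult_op (f * g) \<circ> P" for f g
    by (simp only: comp_assoc[symmetric] mult_op_mult)
  have e1: "T.\<pi> (lin_ext (\<tau> D) (\<tau> D' (pc P, v))) =
      val D (D' \<circ> P) v + (\<Sum>k\<in>UNIV. \<Sum>l\<in>UNIV. val D (mult_op (J D' k l) \<circ> P) (ee k l v))"
  proof -
    have c: "D' \<circ> P \<in> weyl_ops" "mult_op f \<circ> P \<in> weyl_ops" for f
      using W P by (auto intro: weyl_ops.comp mult_op_weyl)
    have "\<tau> D' (pc P, v) = pure (pc (D' \<circ> P)) v
        + (\<Sum>k\<in>UNIV. \<Sum>l\<in>UNIV. pure (pc (mult_op (J D' k l) \<circ> P)) (ee k l v))"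
      unfolding \<tau>_def prod.case P0_act[OF W(2) P] P0_act[OF mult_op_weyl P] ..
    then show ?thesis
      by (simp only: lin_ext_add lin_ext_sum T.\<pi>(1) T.\<pi>_sum \<pi>_lin_ext_\<tau>[OF D c(1) v]
        \<pi>_lin_ext_\<tau>[OF D c(2) ee_closed[OF v]])
  qed
  have e2: "val D (mult_op (J D' k l) \<circ> P) (ee k l v) = w (mult_op (J D' k l) \<circ> (D \<circ> P)) (ee k l v)
      + w (mult_op (D (J D' k l)) \<circ> P) (ee k l v)
      + (\<Sum>p\<in>UNIV. w (mult_op (J D (fst p) (snd p) * J D' k l) \<circ> P) (ee (fst p) (snd p) (ee k l v)))" for k l
    unfolding val_def c cm sum_pair
    by (rule arg_cong[of _ _ "\<lambda>x. x + y" for y], intro w_add_left weyl_ops.comp mult_op_weyl W P ee_closed v)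
  show ?thesis
    unfolding e1 e2 sum.distrib
    unfolding val_def
    unfolding sum_pair[of "\<lambda>k l. \<Sum>p\<in>UNIV. w (mult_op (J D (fst p) (snd p) * J D' k l) \<circ> P) (ee (fst p) (snd p) (ee k l v))"]
    unfolding add.assoc ..
qed

text \<open>Polynomial coefficients commute, so after renaming the summation indices only the
  commutator of two matrix units remains; its two Kronecker deltas contract the coefficients to
  matrix products.\<close>

lemma quadratic_part:
  assumes P: "P \<in> weyl_ops" and v: "v \<in> carrier M"
  shows "(\<Sum>q\<in>UNIV. \<Sum>p\<in>UNIV. w (mult_op (a (fst p) (snd p) * b (fst q) (snd q)) \<circ> P)
          (ee (fst p) (snd p) (ee (fst q) (snd q) v)))
     - (\<Sum>q\<in>UNIV. \<Sum>p\<in>UNIV. w (mult_op (b (fst p) (snd p) * a (fst q) (snd q)) \<circ> P)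
          (ee (fst p) (snd p) (ee (fst q) (snd q) v)))
     = (\<Sum>i\<in>UNIV. \<Sum>j\<in>UNIV. w (mult_op (\<Sum>l\<in>UNIV. a i l * b l j) \<circ> P) (ee i j v))
     - (\<Sum>i\<in>UNIV. \<Sum>j\<in>UNIV. w (mult_op (\<Sum>l\<in>UNIV. b i l * a l j) \<circ> P) (ee i j v))"
    (is "?A - ?B = ?C - ?D")
proof -
  let ?m = "\<lambda>i j k l. mult_op (a i j * b k l) \<circ> P"
  have W: "?m i j k l \<in> weyl_ops" for i j k l using P by (intro weyl_ops.comp) simp_all
  have "?A = (\<Sum>p\<in>UNIV. \<Sum>q\<in>UNIV. w (?m (fst p) (snd p) (fst q) (snd q)) (ee (fst p) (snd p) (ee (fst q) (snd q) v)))"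
    by (rule sum.swap)
  moreover have "?B = (\<Sum>p\<in>UNIV. \<Sum>q\<in>UNIV. w (?m (fst p) (snd p) (fst q) (snd q)) (ee (fst q) (snd q) (ee (fst p) (snd p) v)))"
    by (simp only: mult.commute)
  ultimately have "?A - ?B = (\<Sum>p\<in>UNIV. \<Sum>q\<in>UNIV.
      (if snd p = fst q then w (?m (fst p) (snd p) (fst q) (snd q)) (ee (fst p) (snd q) v) else 0)
      - (if snd q = fst p then w (?m (fst p) (snd p) (fst q) (snd q)) (ee (fst q) (snd p) v) else 0))"
    unfolding ee_bracket[OF W v, symmetric] by (simp only: sum_subtractf)
  also have "\<dots> = (\<Sum>i\<in>UNIV. \<Sum>j\<in>UNIV. \<Sum>k\<in>UNIV. \<Sum>l\<in>UNIV. if j = k then w (?m i j k l) (ee i l v) else 0)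
      - (\<Sum>i\<in>UNIV. \<Sum>j\<in>UNIV. \<Sum>k\<in>UNIV. \<Sum>l\<in>UNIV. if l = i then w (?m i j k l) (ee k j v) else 0)"
    unfolding sum_pair4 by (simp only: sum_subtractf)
  also have "(\<Sum>i\<in>UNIV. \<Sum>j\<in>UNIV. \<Sum>k\<in>UNIV. \<Sum>l\<in>UNIV. if j = k then w (?m i j k l) (ee i l v) else 0) = ?C"
  proof -
    have "(\<Sum>k\<in>UNIV. \<Sum>l\<in>UNIV. if j = k then w (?m i j k l) (ee i l v) else 0) =
        (\<Sum>l\<in>UNIV. w (?m i j j l) (ee i l v))" for i j
      by (subst sum.swap) (simp add: sum.delta')
    moreover have "(\<Sum>j\<in>UNIV. \<Sum>l\<in>UNIV. w (?m i j j l) (ee i l v)) =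
        (\<Sum>j\<in>UNIV. w (mult_op (\<Sum>l\<in>UNIV. a i l * b l j) \<circ> P) (ee i j v))" for i
      by (subst sum.swap) (simp add: mult_op_sum comp_sum_left w_sum_left W v)
    ultimately show ?thesis by simp
  qed
  also have "(\<Sum>i\<in>UNIV. \<Sum>j\<in>UNIV. \<Sum>k\<in>UNIV. \<Sum>l\<in>UNIV. if l = i then w (?m i j k l) (ee k j v) else 0) = ?D"
  proof -
    have "(\<Sum>k\<in>UNIV. \<Sum>l\<in>UNIV. if l = i then w (?m i j k l) (ee k j v) else 0) =
        (\<Sum>k\<in>UNIV. w (?m i j k i) (ee k j v))" for i j
      by (simp add: sum.delta)
    then have "(\<Sum>i\<in>UNIV. \<Sum>j\<in>UNIV. \<Sum>k\<in>UNIV. \<Sum>l\<in>UNIV. if l = i then w (?m i j k l) (ee k j v) else 0)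
        = (\<Sum>i\<in>UNIV. \<Sum>j\<in>UNIV. \<Sum>k\<in>UNIV. w (?m i j k i) (ee k j v))" by simp
    also have "\<dots> = (\<Sum>i\<in>UNIV. \<Sum>k\<in>UNIV. \<Sum>j\<in>UNIV. w (?m i j k i) (ee k j v))"
      by (intro sum.cong refl sum.swap)
    also have "\<dots> = (\<Sum>k\<in>UNIV. \<Sum>i\<in>UNIV. \<Sum>j\<in>UNIV. w (?m i j k i) (ee k j v))" by (rule sum.swap)
    also have "\<dots> = (\<Sum>k\<in>UNIV. \<Sum>j\<in>UNIV. \<Sum>i\<in>UNIV. w (?m i j k i) (ee k j v))"
      by (intro sum.cong refl sum.swap)
    also have "\<dots> = ?D" by (simp add: mult_op_sum comp_sum_left w_sum_left P v weyl_ops.comp mult.commute)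
    finally show ?thesis .
  qed
  finally show ?thesis .
qed

sublocale TL: tensor_lie P0 M "{}" witt \<tau>
proof (intro tensor_lie.intro T.tensor_axioms tensor_lie_axioms.intro)
  show "lie_closed witt" by simp
  have S: "\<exists>P v. s = (pc P, v) \<and> P \<in> weyl_ops \<and> v \<in> carrier M" if "s \<in> T.S" for s
    using that by (auto simp: T.S_def P0_carrier)
  fix D :: "'n poly_op" assume "D \<in> lset witt"
  then have D: "D \<in> derivations" by simp
  show "\<tau> D s \<in> carrier T.FS" if "s \<in> T.S" for s using S[OF that] \<tau>_closed[OF D] by auto
  show "T.\<pi> (\<tau> (lscale witt c D) s) = fscale c (T.\<pi> (\<tau> D s))" if s: "s \<in> T.S" for c s
    using S[OF s] D by (auto simp: \<pi>_\<tau> derivations_closed val_scale)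
  show "T.\<pi> (lin_ext (\<tau> D) r) = 0" if r: "r \<in> bilinear_rels P0 M \<union> {}" for r
  proof -
    note [simp] = lin_ext_diff T.\<pi>_diff \<pi>_\<tau> pc_add pc_smult weyl_ops.add weyl_ops.scale D
      val_add_left val_add_right val_scale_left val_scale_right T.\<pi>(2)
    have "r \<in> bilinear_rels P0 M" using r by simp
    then show ?thesis
      by (cases rule: bilinear_rels_cases) (auto simp: P0_carrier)
  qed
  fix D' :: "'n poly_op" assume "D' \<in> lset witt"
  then have D': "D' \<in> derivations" by simp
  fix s assume "s \<in> T.S"
  then obtain P v where s: "s = (pc P, v)" and P: "P \<in> weyl_ops" and v: "v \<in> carrier M" using S by blast
  show "T.\<pi> (\<tau> (D + D') s) = T.\<pi> (\<tau> D s) + T.\<pi> (\<tau> D' s)"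
    using P v D D' by (simp add: s \<pi>_\<tau> derivations_closed val_add)
  have W: "D \<in> weyl_ops" "D' \<in> weyl_ops" using D D' by auto
  have b: "lbracket witt D D' \<circ> P = (D \<circ> (D' \<circ> P)) - (D' \<circ> (D \<circ> P))"
    by (simp add: lbracket_witt fun_eq_iff)
  have l1: "w ((D \<circ> (D' \<circ> P)) - (D' \<circ> (D \<circ> P))) v = w (D \<circ> (D' \<circ> P)) v - w (D' \<circ> (D \<circ> P)) v"
    using W P v by (intro w_diff_left weyl_ops.comp)
  have l2: "w (mult_op (f1 - f2 + f3 - f4) \<circ> P) (ee i j v) = w (mult_op f1 \<circ> P) (ee i j v)
      - w (mult_op f2 \<circ> P) (ee i j v) + w (mult_op f3 \<circ> P) (ee i j v) - w (mult_op f4 \<circ> P) (ee i j v)"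
    for f1 f2 f3 f4 i j
  proof -
    have u: "ee i j v \<in> carrier M" "mult_op f \<circ> P \<in> weyl_ops" for f
      using v P by (simp, intro weyl_ops.comp mult_op_weyl)
    have "w (mult_op (f + g) \<circ> P) (ee i j v) = w (mult_op f \<circ> P) (ee i j v) + w (mult_op g \<circ> P) (ee i j v)"
      "w (mult_op (f - g) \<circ> P) (ee i j v) = w (mult_op f \<circ> P) (ee i j v) - w (mult_op g \<circ> P) (ee i j v)" for f g
      unfolding mult_op_add mult_op_diff comp_add_left comp_diff_left
      by (intro w_add_left w_diff_left u)+
    then show ?thesis by simp
  qed
  have arith: "(x1 - x2) + (s3 - s4 + c - d) = (x1 + s1 + s2 + s3 + a) - (x2 + s2 + s1 + s4 + b)"
    if "a - b = c - d" for x1 x2 s1 s2 s3 s4 a b c d :: "'n poly_op set \<times> 'm \<Rightarrow>\<^sub>0 complex"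
  proof -
    have "a = c - d + b" using that by (simp add: algebra_simps)
    then show ?thesis by (simp add: algebra_simps)
  qed
  show "T.\<pi> (\<tau> (lbracket witt D D') s) = T.\<pi> (lin_ext (\<tau> D) (\<tau> D' s)) - T.\<pi> (lin_ext (\<tau> D') (\<tau> D s))"
    unfolding s val_bracket[OF D D' P v] val_bracket[OF D' D P v]
      \<pi>_\<tau>[OF lbracket_witt_derivation[OF D D'] P v] val_def J_bracket[OF D D'] b
      l1 l2 sum.distrib sum_subtractf
    by (rule arith, rule quadratic_part[OF P v])
qed

end

section \<open>Detecting nonzero tensors\<close>

definition lsum :: "(complex \<Rightarrow> 'z \<Rightarrow> 'z) \<Rightarrow> ('s \<Rightarrow> 'z) \<Rightarrow> ('s \<Rightarrow>\<^sub>0 complex) \<Rightarrow> 'z::ab_group_add" where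
  "lsum sc h f = (\<Sum>s\<in>Poly_Mapping.keys f. sc (Poly_Mapping.lookup f s) (h s))"

locale complex_vector_space = vector_space scale
  for scale :: "complex \<Rightarrow> 'z::ab_group_add \<Rightarrow> 'z"
begin

lemma lsum_superset:
  assumes "finite A" "Poly_Mapping.keys f \<subseteq> A"
  shows "lsum scale h f = (\<Sum>s\<in>A. scale (Poly_Mapping.lookup f s) (h s))"
  unfolding lsum_def using assms by (intro sum.mono_neutral_left) (auto simp: in_keys_iff)

lemma lsum_add: "lsum scale h (f + g) = lsum scale h f + lsum scale h g"
proof -
  let ?A = "Poly_Mapping.keys f \<union> Poly_Mapping.keys g"
  show ?thesis
    using keys_add[of f g]
    by (subst (1 2 3) lsum_superset[of ?A])
      (auto simp: lookup_add scale_left_distrib sum.distrib)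
qed

lemma lsum_single [simp]: "lsum scale h (Poly_Mapping.single s c) = scale c (h s)"
  by (subst lsum_superset[of "{s}"]) auto

lemma lsum_zero [simp]: "lsum scale h 0 = 0"
  by (simp add: lsum_def)

lemma lsum_diff: "lsum scale h (f - g) = lsum scale h f - lsum scale h g"
  using lsum_add[of h "f - g" g] by simp

lemma lsum_fscale: "lsum scale h (fscale c f) = scale c (lsum scale h f)"
  by (induction f rule: poly_mapping_induct) (simp_all add: lsum_add pm.scale_right_distrib scale_right_distrib)

end

context tensor begin

lemma cls_carrier: "f \<in> carrier FS \<Longrightarrow> cls f \<in> carrier Q"
  by (auto simp: Q_eq FQ.carrier_quot cls_def)

lemma cls_add: "f \<in> carrier FS \<Longrightarrow> g \<in> carrier FS \<Longrightarrow> cls f \<oplus>\<^bsub>Q\<^esub> cls g = cls (f + g)"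
  unfolding Q_eq cls_def using FQ.add_quot[of f g] by (simp add: FS_def)

lemma cls_smult: "f \<in> carrier FS \<Longrightarrow> c \<odot>\<^bsub>Q\<^esub> cls f = cls (fscale c f)"
  unfolding Q_eq cls_def using FQ.smult_quot[of f c] by (simp add: FS_def)

lemma cls_0: "cls 0 = \<zero>\<^bsub>Q\<^esub>"
  unfolding Q_eq FQ.zero_quot cls_def using FQ.cls_zero by (simp add: FS_def)

lemma cls_eqI: "\<pi> f = \<pi> g \<Longrightarrow> f \<in> carrier FS \<Longrightarrow> g \<in> carrier FS \<Longrightarrow> cls f = cls g"
  by (simp add: cls_eq_iff)

lemma FS_fscale: "f \<in> carrier FS \<Longrightarrow> fscale c f \<in> carrier FS"
  using FS.smult_closed[of f c] by (simp add: FS_def)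

lemma FS_0: "0 \<in> carrier FS"
  by (simp add: FS_def)

lemma cls_pure_add_left:
  assumes "x \<in> carrier X" "x' \<in> carrier X" "y \<in> carrier Y"
  shows "cls (pure (x \<oplus>\<^bsub>X\<^esub> x') y) = cls (pure x y) \<oplus>\<^bsub>Q\<^esub> cls (pure x' y)"
  unfolding cls_add[OF pure_carrier[OF assms(1,3)] pure_carrier[OF assms(2,3)]]
  using tp_add_left[OF assms] assms
  by (intro cls_eqI FS_add pure_carrier) (auto simp: tp_def \<pi>(1))

lemma cls_pure_add_right:
  assumes "x \<in> carrier X" "y \<in> carrier Y" "y' \<in> carrier Y"
  shows "cls (pure x (y \<oplus>\<^bsub>Y\<^esub> y')) = cls (pure x y) \<oplus>\<^bsub>Q\<^esub> cls (pure x y')"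
  unfolding cls_add[OF pure_carrier[OF assms(1,2)] pure_carrier[OF assms(1,3)]]
  using tp_add_right[OF assms] assms
  by (intro cls_eqI FS_add pure_carrier) (auto simp: tp_def \<pi>(1))

lemma cls_pure_smult_left:
  assumes "x \<in> carrier X" "y \<in> carrier Y"
  shows "cls (pure (c \<odot>\<^bsub>X\<^esub> x) y) = c \<odot>\<^bsub>Q\<^esub> cls (pure x y)"
  unfolding cls_smult[OF pure_carrier[OF assms]]
  using tp_smult_left[OF assms, of c] assms
  by (intro cls_eqI FS_fscale pure_carrier) (auto simp: tp_def \<pi>(2) simp del: fscale_single map_single)

lemma cls_pure_smult_right:
  assumes "x \<in> carrier X" "y \<in> carrier Y"
  shows "cls (pure x (c \<odot>\<^bsub>Y\<^esub> y)) = c \<odot>\<^bsub>Q\<^esub> cls (pure x y)"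
  unfolding cls_smult[OF pure_carrier[OF assms]]
  using tp_smult_right[OF assms, of c] assms
  by (intro cls_eqI FS_fscale pure_carrier) (auto simp: tp_def \<pi>(2) simp del: fscale_single map_single)

text \<open>A bilinear map h compatible with B extends linearly to the free space and vanishes on
  all relations. A tensor on which it is nonzero therefore survives in the quotient.\<close>

lemma cls_pure_nonzero:
  fixes scale :: "complex \<Rightarrow> 'z::ab_group_add \<Rightarrow> 'z" and h :: "'x \<Rightarrow> 'y \<Rightarrow> 'z"
  assumes vs: "vector_space scale"
    and add_left: "\<And>x x' y. x \<in> carrier X \<Longrightarrow> x' \<in> carrier X \<Longrightarrow> y \<in> carrier Y \<Longrightarrow> h (x \<oplus>\<^bsub>X\<^esub> x') y = h x y + h x' y"
    and add_right: "\<And>x y y'. x \<in> carrier X \<Longrightarrow> y \<in> carrier Y \<Longrightarrow> y' \<in> carrier Y \<Longrightarrow> h x (y \<oplus>\<^bsub>Y\<^esub> y') = h x y + h x y'"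
    and smult_left: "\<And>c x y. x \<in> carrier X \<Longrightarrow> y \<in> carrier Y \<Longrightarrow> h (c \<odot>\<^bsub>X\<^esub> x) y = scale c (h x y)"
    and smult_right: "\<And>c x y. x \<in> carrier X \<Longrightarrow> y \<in> carrier Y \<Longrightarrow> h x (c \<odot>\<^bsub>Y\<^esub> y) = scale c (h x y)"
    and rels: "\<And>r. r \<in> B \<Longrightarrow> lsum scale (\<lambda>s. h (fst s) (snd s)) r = 0"
    and xy: "x \<in> carrier X" "y \<in> carrier Y" "h x y \<noteq> 0"
  shows "cls (pure x y) \<noteq> \<zero>\<^bsub>Q\<^esub>"
proof
  interpret Z: complex_vector_space scale by (intro complex_vector_space.intro vs)
  let ?h = "\<lambda>s. h (fst s) (snd s)"
  assume "cls (pure x y) = \<zero>\<^bsub>Q\<^esub>"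
  then have "\<pi> (pure x y) = 0"
    unfolding cls_0[symmetric] by (simp add: cls_eq_iff pure_carrier[OF xy(1,2)] FS_0)
  then have "pure x y \<in> pm.span (bilinear_rels X Y \<union> B)" by (simp add: \<pi>(3) R_def)
  then have "lsum scale ?h (pure x y) = 0"
  proof (induction rule: pm.span_induct)
    case base
    show ?case by (auto simp: pm.subspace_def Z.lsum_add Z.lsum_fscale)
  next
    case (step r)
    then consider "r \<in> bilinear_rels X Y" | "r \<in> B" by blast
    then show ?case
    proof cases
      case 1
      then show ?thesis
        by (cases rule: bilinear_rels_cases)
          (simp_all add: Z.lsum_diff add_left add_right smult_left smult_right)
    qed (rule rels)
  qed
  then show False using xy(3) by simp
qed

end

lemma lookup_pdiff_0: "Poly_Mapping.lookup (pdiff i p) 0 = Poly_Mapping.lookup p (unit_idx i)"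
proof (induction p rule: poly_mapping_induct)
  case (single \<alpha> c)
  show ?case
  proof (cases "Poly_Mapping.lookup \<alpha> i = 0")
    case True
    then have "\<alpha> \<noteq> unit_idx i" by auto
    then show ?thesis using True by (simp add: pdiff_single lookup_single when_def)
  next
    case False
    then have "\<alpha> - unit_idx i = 0 \<longleftrightarrow> \<alpha> = unit_idx i"
      using idx_minus_add[of \<alpha> i] by (metis add.left_neutral diff_self_eq_0 add_diff_cancel_right')
    then show ?thesis by (auto simp: pdiff_single lookup_single when_def)
  qed
qed (simp add: pdiff_add lookup_add)

abbreviation lin_coeff :: "'n poly_op \<Rightarrow> 'n \<Rightarrow> 'n \<Rightarrow> complex" where
  "lin_coeff x i j \<equiv> Poly_Mapping.lookup (x (tvar j)) (unit_idx i)"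

lemma exists_functional:
  assumes S: "op.subspace S" and "v \<notin> S"
  obtains lam :: "'n poly_op \<Rightarrow> complex"
  where "\<And>f g. lam (f + g) = lam f + lam g" "\<And>c f. lam (op_scale c f) = c * lam f"
    "\<And>f. f \<in> S \<Longrightarrow> lam f = 0" "lam v = 1"
proof -
  interpret vp: vector_space_pair "op_scale :: complex \<Rightarrow> 'n poly_op \<Rightarrow> _" "(*) :: complex \<Rightarrow> complex \<Rightarrow> _"
    by unfold_locales (auto simp: algebra_simps)
  obtain B where B: "B \<subseteq> S" "op.independent B" "S \<subseteq> op.span B"
    using op.maximal_independent_subset[of S] by blast
  have SB: "op.span B = S" using B S by (simp add: op.span_subspace)
  have ind: "op.independent (insert v B)" and "v \<notin> B"
    using B(2) SB \<open>v \<notin> S\<close> op.span_base by (auto simp: op.independent_insert)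
  obtain lam where lin: "Vector_Spaces.linear op_scale (*) lam"
    and lam: "\<And>b. b \<in> insert v B \<Longrightarrow> lam b = (if b = v then 1 else 0)"
    using vp.linear_independent_extend[OF ind, of "\<lambda>b. if b = v then 1 else 0"] by blast
  interpret l: Vector_Spaces.linear op_scale "(*)" lam by (rule lin)
  have "lam f = 0" if "f \<in> S" for f
  proof -
    have "f \<in> op.span B" using that SB by simp
    then show ?thesis
    proof (induction rule: op.span_induct)
      case base
      show ?case by (auto simp: op.subspace_def l.add l.scale l.zero)
    next
      case (step b)
      then show ?case using lam[of b] \<open>v \<notin> B\<close> by auto
    qed
  qed
  then show ?thesis using that[of lam] l.add l.scale lam[of v] by simp
qed

section \<open>The lowest part of the tensor module\<close>

context tensor_field begin

text \<open>Polynomials without constant term lie in the left ideal, so on the class of 1 a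
  multiplication acts through its constant term.\<close>

lemma w_mult_op:
  assumes m: "m \<in> carrier M"
  shows "w (mult_op f) m = fscale (Poly_Mapping.lookup f 0) (w id m)"
proof -
  let ?c = "Poly_Mapping.lookup f 0"
  have "mult_op f - op_scale ?c id = id \<circ> mult_op (f - fscale ?c 1)"
    by (simp add: mult_op_diff mult_op_fscale mult_op_one)
  also have "\<dots> \<in> weyl_left"
    by (intro weyl_left_mult weyl_ops.one) (simp add: lookup_minus lookup_one)
  finally have "w (mult_op f) m = w (op_scale ?c id) m"
    by (rule w_left) (intro mult_op_weyl weyl_ops.scale weyl_ops.one)+
  then show ?thesis using w_scale_left[OF weyl_ops.one m] by simp
qed

text \<open>As operators p \<partial>_j = \<partial>_j p - \<partial>_j(p), and \<partial>_j p lies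
  in the left ideal. The negative trace in \<open>act_\<iota>\<close> originates here.\<close>

lemma w_fld:
  assumes m: "m \<in> carrier M" and p: "Poly_Mapping.lookup p 0 = 0"
  shows "w (fld p j) m = fscale (- Poly_Mapping.lookup p (unit_idx j)) (w id m)"
proof -
  have "fld p j - (- mult_op (pdiff j p)) = pdiff j \<circ> mult_op p"
    by (simp add: fun_eq_iff fld_def mult_op_def pdiff_mult add.commute)
  also have "\<dots> \<in> weyl_left" by (intro weyl_left_mult weyl_ops.diff p)
  finally have "w (fld p j) m = w (- mult_op (pdiff j p)) m"
    by (rule w_left) (auto intro: op.subspace_neg[OF weyl_subspace])
  also have "\<dots> = w (mult_op (- pdiff j p)) m"
    using mult_op_diff[of 0 "pdiff j p"] by (simp add: mult_op_zero)
  finally show ?thesis by (simp add: w_mult_op[OF m] lookup_pdiff_0)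
qed

definition \<iota> :: "'m \<Rightarrow> ('n poly_op set \<times> 'm \<Rightarrow>\<^sub>0 complex) set" where
  "\<iota> m = T.cls (pure (pc id) m)"

lemma \<iota>_closed: "m \<in> carrier M \<Longrightarrow> \<iota> m \<in> carrier T.Q"
  unfolding \<iota>_def by (intro T.cls_carrier T.pure_carrier pc_carrier weyl_ops.one)

lemma \<iota>_add: "m \<in> carrier M \<Longrightarrow> m' \<in> carrier M \<Longrightarrow> \<iota> (m \<oplus>\<^bsub>M\<^esub> m') = \<iota> m \<oplus>\<^bsub>T.Q\<^esub> \<iota> m'"
  unfolding \<iota>_def by (intro T.cls_pure_add_right pc_carrier weyl_ops.one)

lemma \<iota>_smult: "m \<in> carrier M \<Longrightarrow> \<iota> (c \<odot>\<^bsub>M\<^esub> m) = c \<odot>\<^bsub>T.Q\<^esub> \<iota> m"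
  unfolding \<iota>_def by (intro T.cls_pure_smult_right pc_carrier weyl_ops.one)

lemma \<iota>_zero: "\<iota> \<zero>\<^bsub>M\<^esub> = \<zero>\<^bsub>T.Q\<^esub>"
proof -
  have "T.cls (pure (pc id) \<zero>\<^bsub>M\<^esub>) = T.cls 0"
    using w_zero_right[OF weyl_ops.one]
    by (intro T.cls_eqI T.FS_0 T.pure_carrier pc_carrier weyl_ops.one) (auto simp: w_def T.tp_def)
  then show ?thesis by (simp add: \<iota>_def T.cls_0)
qed

lemma act_cls:
  assumes "x \<in> derivations" "P \<in> weyl_ops" "m \<in> carrier M" "f \<in> carrier T.FS" "val x P m = T.\<pi> f"
  shows "act T.Q x (T.cls (pure (pc P) m)) = T.cls f"
proof -
  have "act T.Q x (T.cls (pure (pc P) m)) = T.cls (lin_ext (\<tau> x) (pure (pc P) m))"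
    using assms by (intro TL.Q_act T.pure_carrier pc_carrier) auto
  also have "\<dots> = T.cls f"
    using assms by (intro T.cls_eqI) (simp_all add: \<pi>_\<tau> \<tau>_closed)
  finally show ?thesis .
qed

text \<open>On the lowest part of the tensor module a vector field with linear part \<open>A\<close> acts as
  \<open>A - tr A\<close>.\<close>

lemma act_\<iota>:
  assumes x: "x \<in> witt_ge 0" and m: "m \<in> carrier M" "m' \<in> carrier M"
    and eq: "w id m' = (\<Sum>i\<in>UNIV. \<Sum>j\<in>UNIV. fscale (lin_coeff x i j) (w id (ee i j m)))
      - fscale (\<Sum>i\<in>UNIV. lin_coeff x i i) (w id m)"
  shows "act T.Q x (\<iota> m) = \<iota> m'"
proof -
  have D: "x \<in> derivations" using x by (rule witt_ge_derivation)
  have 0: "Poly_Mapping.lookup (x (tvar j)) 0 = 0" for j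
  proof -
    have "\<forall>\<alpha>\<in>Poly_Mapping.keys (x (tvar j)). 1 \<le> mdeg \<alpha>"
      using x by (simp add: witt_ge_iff ord_ge_def)
    then have "0 \<notin> Poly_Mapping.keys (x (tvar j))" by fastforce
    then show ?thesis by (simp add: in_keys_iff)
  qed
  have "w x m = (\<Sum>j\<in>UNIV. w (fld (x (tvar j)) j) m)"
    using w_sum_left[of UNIV "\<lambda>j. fld (x (tvar j)) j" m] m by (simp flip: derivation_expand[OF D])
  also have "\<dots> = (\<Sum>j\<in>UNIV. fscale (- lin_coeff x j j) (w id m))"
    by (simp only: w_fld[OF m(1) 0])
  also have "\<dots> = - fscale (\<Sum>i\<in>UNIV. lin_coeff x i i) (w id m)"
    by (simp only: pm.scale_minus_left sum_negf pm.scale_sum_left)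
  finally have "val x id m = w id m'"
    unfolding eq val_def comp_id w_mult_op[OF ee_closed[OF m(1)]] lookup_pdiff_0 by simp
  then show ?thesis
    unfolding \<iota>_def by (intro act_cls D m weyl_ops.one T.pure_carrier pc_carrier) (simp add: w_def T.tp_def)
qed

lemma act_\<iota>_zero:
  assumes x: "x \<in> witt_ge 1" and m: "m \<in> carrier M"
  shows "act T.Q x (\<iota> m) = \<zero>\<^bsub>T.Q\<^esub>"
proof -
  have "lin_coeff x i j = 0" for i j
    using x by (force simp: witt_ge_iff ord_ge_def in_keys_iff)
  moreover have "x \<in> witt_ge 0" using witt_ge_mono[of 0 1] x by auto
  ultimately show ?thesis
    unfolding \<iota>_zero[symmetric] by (intro act_\<iota> m M.zero_closed) (simp_all add: w_zero_right[OF weyl_ops.one])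
qed

text \<open>P0 is spanned by words in the partial derivatives, and \<partial>_i acts on P0 \<otimes>
  M through the first factor alone, since its coefficients are constant.\<close>

lemma generated:
  assumes N: "lie_submodule witt N T.Q" and "\<iota> ` carrier M \<subseteq> N"
  shows "N = carrier T.Q"
proof -
  interpret Q: lmod witt T.Q by (rule lie_module_lmod[OF TL.Q_lie])
  have N'1: "submodule N complex_ring T.Q" using N by (simp add: lie_submodule_def)
  have N': "\<zero>\<^bsub>T.Q\<^esub> \<in> N" "\<And>a b. a \<in> N \<Longrightarrow> b \<in> N \<Longrightarrow> a \<oplus>\<^bsub>T.Q\<^esub> b \<in> N"
    "\<And>c a. a \<in> N \<Longrightarrow> c \<odot>\<^bsub>T.Q\<^esub> a \<in> N" "\<And>x a. x \<in> derivations \<Longrightarrow> a \<in> N \<Longrightarrow> act T.Q x a \<in> N"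
    using N by (simp_all add: Q.lie_submodule_iff)
  have "\<forall>v\<in>carrier M. T.cls (pure (pc P) v) \<in> N" if "P \<in> pdiff_span" for P
    using that
  proof (induction rule: pdiff_span.induct)
    case one
    show ?case using assms(2) unfolding \<iota>_def by blast
  next
    case (left P)
    have "T.cls (pure (pc P) v) = T.cls 0" if v: "v \<in> carrier M" for v
      using w_left[of P 0 v] w_zero_left[OF v] left weyl_left_weyl[OF left] weyl_zero v
      by (intro T.cls_eqI T.FS_0 T.pure_carrier pc_carrier) (auto simp: w_def T.tp_def)
    then show ?case using N'(1) by (simp add: T.cls_0)
  next
    case (diff P i)
    have P: "P \<in> weyl_ops" "pdiff i \<circ> P \<in> weyl_ops"
      using pdiff_span_weyl[OF diff(1)] by (auto intro: weyl_ops.comp[OF weyl_ops.diff])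
    have "T.cls (pure (pc (pdiff i \<circ> P)) v) = act T.Q (pdiff i) (T.cls (pure (pc P) v))" if v: "v \<in> carrier M" for v
    proof -
      have "J (pdiff i) k j = 0" for k j by (simp add: derivation_one derivation_zero)
      then have "val (pdiff i) P v = w (pdiff i \<circ> P) v"
        unfolding val_def by (simp add: mult_op_zero) (simp add: zero_fun_def[symmetric] comp_def w_zero_left v)
      then show ?thesis
        by (intro act_cls[symmetric] P v T.pure_carrier pc_carrier) (simp_all add: w_def T.tp_def)
    qed
    moreover have "pdiff i \<in> derivations" by simp
    ultimately show ?case using diff.IH N'(4) by metis
  next
    case (add P Q)
    have eq: "pc (P + Q) = pc P \<oplus>\<^bsub>P0\<^esub> pc Q"
      using pc_add[OF pdiff_span_weyl[OF add(1)] pdiff_span_weyl[OF add(2)]] ..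
    note pc = pc_carrier[OF pdiff_span_weyl[OF add(1)]] pc_carrier[OF pdiff_span_weyl[OF add(2)]]
    show ?case
    proof
      fix v assume v: "v \<in> carrier M"
      show "T.cls (pure (pc (P + Q)) v) \<in> N"
        unfolding eq T.cls_pure_add_left[OF pc v] by (intro N'(2) bspec[OF add(3) v] bspec[OF add(4) v])
    qed
  next
    case (scale P c)
    have eq: "pc (op_scale c P) = c \<odot>\<^bsub>P0\<^esub> pc P"
      using pc_smult[OF pdiff_span_weyl[OF scale(1)]] ..
    note pc = pc_carrier[OF pdiff_span_weyl[OF scale(1)]]
    show ?case
    proof
      fix v assume v: "v \<in> carrier M"
      show "T.cls (pure (pc (op_scale c P)) v) \<in> N"
        unfolding eq T.cls_pure_smult_left[OF pc v] by (intro N'(3) bspec[OF scale(2) v])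
    qed
  qed
  then have "T.cls (pure (pc P) v) \<in> N" if "P \<in> weyl_ops" "v \<in> carrier M" for P v
    using weyl_pdiff_span[OF that(1)] that(2) by simp
  then show ?thesis using N'1 by (intro T.submodule_all) (auto simp: P0_carrier)
qed

text \<open>As 1 is not in the left ideal, some linear functional on P0 takes the value 1 at its
  class; its product with \<phi> is a bilinear map that detects 1 \<otimes> m.\<close>

lemma \<iota>_nonzero:
  fixes scale :: "complex \<Rightarrow> 'z::ab_group_add \<Rightarrow> 'z" and \<phi> :: "'m \<Rightarrow> 'z"
  assumes vs: "vector_space scale"
    and add: "\<And>v v'. v \<in> carrier M \<Longrightarrow> v' \<in> carrier M \<Longrightarrow> \<phi> (v \<oplus>\<^bsub>M\<^esub> v') = \<phi> v + \<phi> v'"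
    and smult: "\<And>c v. v \<in> carrier M \<Longrightarrow> \<phi> (c \<odot>\<^bsub>M\<^esub> v) = scale c (\<phi> v)"
    and m: "m \<in> carrier M" "\<phi> m \<noteq> 0"
  shows "\<iota> m \<noteq> \<zero>\<^bsub>T.Q\<^esub>"
proof -
  interpret Z: complex_vector_space scale by (intro complex_vector_space.intro vs)
  obtain lam :: "'n poly_op \<Rightarrow> complex"
    where lam: "\<And>f g. lam (f + g) = lam f + lam g" "\<And>c f. lam (op_scale c f) = c * lam f"
      "\<And>f. f \<in> weyl_left \<Longrightarrow> lam f = 0" "lam id = 1"
    by (rule exists_functional[OF weyl_left_subspace id_notin_weyl_left]) blast
  \<comment> \<open>\<open>lam\<close> vanishes on the left ideal, so its value does not depend on
    the representative chosen.\<close>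
  define lam' where "lam' g = lam (SOME P. P \<in> weyl_ops \<and> g = pc P)" for g
  have lam': "lam' (pc P) = lam P" if P: "P \<in> weyl_ops" for P
  proof -
    define P' where "P' = (SOME P'. P' \<in> weyl_ops \<and> pc P = pc P')"
    have "P' \<in> weyl_ops \<and> pc P = pc P'" unfolding P'_def by (rule someI[of _ P]) (use P in simp)
    then have "lam (P - P') = 0" using lam(3) pc_eq_iff[of P P'] P by blast
    then have "lam P = lam P'" using lam(1)[of "P - P'" P'] by simp
    then show ?thesis by (simp add: lam'_def P'_def)
  qed
  show ?thesis
    unfolding \<iota>_def
  proof (rule T.cls_pure_nonzero[OF vs, where h = "\<lambda>g v. scale (lam' g) (\<phi> v)"])
    fix g g' :: "'n poly_op set" and v v' :: 'm and c :: complex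
    assume "g \<in> carrier P0"
    then obtain P where P: "P \<in> weyl_ops" "g = pc P" by (auto simp: P0_carrier)
    show "scale (lam' (c \<odot>\<^bsub>P0\<^esub> g)) (\<phi> v) = scale c (scale (lam' g) (\<phi> v))"
      using P by (simp add: pc_smult lam' weyl_ops.scale lam(2))
    show "scale (lam' (g \<oplus>\<^bsub>P0\<^esub> g')) (\<phi> v) = scale (lam' g) (\<phi> v) + scale (lam' g') (\<phi> v)" if g': "g' \<in> carrier P0"
    proof -
      obtain P' where P': "P' \<in> weyl_ops" "g' = pc P'" using g' by (auto simp: P0_carrier)
      have "lam' (pc (P + P')) = lam (P + P')" by (intro lam' weyl_ops.add P P')
      then show ?thesis using P P' by (simp only: pc_add lam' lam(1) Z.scale_left_distrib)
    qed
    assume v: "v \<in> carrier M"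
    show "scale (lam' g) (\<phi> (c \<odot>\<^bsub>M\<^esub> v)) = scale c (scale (lam' g) (\<phi> v))"
      using v by (simp add: smult mult.commute)
    show "scale (lam' g) (\<phi> (v \<oplus>\<^bsub>M\<^esub> v')) = scale (lam' g) (\<phi> v) + scale (lam' g) (\<phi> v')" if "v' \<in> carrier M"
      using v that by (simp add: add Z.scale_right_distrib)
  qed (use m pc_carrier[OF weyl_ops.one] lam'[OF weyl_ops.one] in \<open>simp_all add: lam(4)\<close>)
qed

end

section \<open>Induced modules\<close>

lemma free_algebra_simps [simp]:
  "carrier (free_algebra S) = {f. \<forall>w\<in>Poly_Mapping.keys f. set (letters w) \<subseteq> S}"
  "mult (free_algebra S) = (*)" "one (free_algebra S) = 1" "zero (free_algebra S) = 0"
  "add (free_algebra S) = (+)" "smult (free_algebra S) = fscale" "act (free_algebra S) = (*)"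
  by (simp_all add: free_algebra_def)

lemma letters_add [simp]: "letters (u + v) = letters u @ letters v"
  and letters_zero [simp]: "letters 0 = []"
  by (simp_all add: plus_free_monoid_def zero_free_monoid_def)

lemma fscale_mult_right_free:
  fixes p q :: "'a::monoid_add \<Rightarrow>\<^sub>0 complex"
  shows "p * fscale c q = fscale c (p * q)"
proof (induction p rule: poly_mapping_induct)
  case (single s d)
  show ?case
    by (induction q rule: poly_mapping_induct)
      (simp_all add: mult_single pm.scale_right_distrib distrib_left mult.left_commute)
qed (simp add: distrib_right pm.scale_right_distrib)

lemma free_algebra_carrier: "carrier (free_algebra S) = {f. Poly_Mapping.keys f \<subseteq> {w. set (letters w) \<subseteq> S}}"
  by auto

lemma free_algebra_mult:
  assumes "f \<in> carrier (free_algebra S)" "g \<in> carrier (free_algebra S)"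
  shows "f * g \<in> carrier (free_algebra S)"
proof -
  have "set (letters w) \<subseteq> S" if w: "w \<in> Poly_Mapping.keys (f * g)" for w
  proof -
    obtain a b where "a \<in> Poly_Mapping.keys f" "b \<in> Poly_Mapping.keys g" "w = a + b"
      using keys_mult[of f g] w by blast
    then show ?thesis using assms by auto
  qed
  then show ?thesis by simp
qed

lemma free_algebra_subspace: "pm.subspace (carrier (free_algebra S))"
  unfolding free_algebra_carrier by (rule keys_subspace)

lemma free_algebra_one: "1 \<in> carrier (free_algebra S)"
proof -
  have "Poly_Mapping.keys (1 :: 'a free_alg) \<subseteq> {0}"
    unfolding single_one[symmetric] by simp
  then show ?thesis by fastforce
qed

lemma free_algebra_ring: "ring (free_algebra S)" and free_algebra_cmod: "cmod (free_algebra S)"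
proof -
  note sub = free_algebra_subspace[of S]
  have ab: "abelian_group (free_algebra S)"
  proof (rule abelian_groupI)
    fix f g assume fg: "f \<in> carrier (free_algebra S)" "g \<in> carrier (free_algebra S)"
    show "f \<oplus>\<^bsub>free_algebra S\<^esub> g \<in> carrier (free_algebra S)"
      using pm.subspace_add[OF sub fg] by simp
    show "\<exists>h\<in>carrier (free_algebra S). h \<oplus>\<^bsub>free_algebra S\<^esub> f = \<zero>\<^bsub>free_algebra S\<^esub>"
      using pm.subspace_neg[OF sub fg(1)] by (intro bexI[of _ "- f"]) simp_all
  qed (use pm.subspace_0[OF sub] in \<open>simp_all add: add_ac\<close>)
  have "Group.monoid (free_algebra S)"
  proof (rule monoidI)
    fix f g assume "f \<in> carrier (free_algebra S)" "g \<in> carrier (free_algebra S)"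
    then show "f \<otimes>\<^bsub>free_algebra S\<^esub> g \<in> carrier (free_algebra S)"
      using free_algebra_mult by simp
  qed (use free_algebra_one[of S] in \<open>simp_all add: mult.assoc\<close>)
  then show "ring (free_algebra S)"
    using ab by (intro ringI) (simp_all add: distrib_left distrib_right)
  show "cmod (free_algebra S)"
  proof (rule cmod.intro, rule Module.moduleI[OF cring_complex_ring ab])
    fix c f assume f: "f \<in> carrier (free_algebra S)"
    show "c \<odot>\<^bsub>free_algebra S\<^esub> f \<in> carrier (free_algebra S)"
      using pm.subspace_scale[OF sub f] by simp
  qed (simp_all add: pm.scale_right_distrib pm.scale_left_distrib)
qed

lemma gen_carrier: "x \<in> S \<Longrightarrow> gen x \<in> carrier (free_algebra S)"
  by simp

lemma free_algebra_mono: "S \<subseteq> S' \<Longrightarrow> f \<in> carrier (free_algebra S) \<Longrightarrow> f \<in> carrier (free_algebra S')"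
  by auto

lemma env_rels_carrier: "lie_closed L \<Longrightarrow> env_rels L \<subseteq> carrier (free_algebra (lset L))"
proof -
  assume L: "lie_closed L"
  note sub = free_algebra_subspace[of "lset L"]
  note * = pm.subspace_diff[OF sub] pm.subspace_scale[OF sub] free_algebra_mult gen_carrier
  show ?thesis
    unfolding env_rels_def
  proof (intro Un_least subsetI; elim CollectE exE conjE; hypsubst)
  qed (use L in \<open>(intro *; auto simp: lie_closed_def)+\<close>)
qed

locale induced =
  fixes E :: "('n::finite poly_op, 'e) op_module"
  assumes E_lie: "lie_module witt_nonneg E"
begin

abbreviation "Fa \<equiv> free_algebra (derivations :: 'n poly_op set)"
definition "I = env_ideal (witt :: 'n poly_op lie_algebra)"
definition ec :: "'n poly_op free_alg \<Rightarrow> 'n poly_op free_alg set" where "ec = env_class witt"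
abbreviation "U \<equiv> env_algebra (witt :: 'n poly_op lie_algebra)"

sublocale E: lmod witt_nonneg E
  by (rule lie_module_lmod[OF E_lie])

lemma I_ideal: "ideal I Fa"
  unfolding I_def env_ideal_def using ring.genideal_ideal[OF free_algebra_ring env_rels_carrier[of "witt :: 'n poly_op lie_algebra"]] by simp

lemma I_rel: "r \<in> env_rels witt \<Longrightarrow> r \<in> I"
  unfolding I_def env_ideal_def
  using ring.genideal_self[OF free_algebra_ring env_rels_carrier[of "witt :: 'n poly_op lie_algebra"]] by auto

lemma I_mult: "r \<in> I \<Longrightarrow> a \<in> carrier Fa \<Longrightarrow> r * a \<in> I" "r \<in> I \<Longrightarrow> a \<in> carrier Fa \<Longrightarrow> a * r \<in> I"
  using ideal.I_r_closed[OF I_ideal, of r a] ideal.I_l_closed[OF I_ideal, of r a] by simp_all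

lemma csub_I: "csub Fa I"
proof (intro csub.intro free_algebra_cmod csub_axioms.intro)
  interpret I: ideal I Fa by (rule I_ideal)
  have "fscale c r \<in> I" if "r \<in> I" for c r
  proof -
    have "fscale c r = fscale c 1 * r" by (simp only: fscale_mult_left mult_1_left)
    moreover have "fscale c 1 \<in> carrier Fa" by (rule pm.subspace_scale[OF free_algebra_subspace free_algebra_one])
    ultimately show ?thesis using I_mult(2)[OF that] by simp
  qed
  then show "submodule I complex_ring Fa"
    unfolding cmod.submodule_iff[OF free_algebra_cmod]
    using I.a_subset additive_subgroup.zero_closed[OF I.additive_subgroup_axioms]
      additive_subgroup.a_closed[OF I.additive_subgroup_axioms] by simp
qed

lemma U_eq: "U = quot_module Fa I"
  by (simp add: env_algebra_def I_def)

lemma ec_eq: "ec a = I +>\<^bsub>Fa\<^esub> a"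
  by (simp add: ec_def env_class_def I_def)

lemma U_cmod: "cmod U"
  unfolding U_eq by (rule csub.quot_cmod[OF csub_I])

lemma U_carrier: "carrier U = ec ` carrier Fa"
  unfolding U_eq csub.carrier_quot[OF csub_I] ec_eq ..

lemma ec_carrier [simp]: "a \<in> carrier Fa \<Longrightarrow> ec a \<in> carrier U"
  unfolding U_carrier by (rule imageI)

lemma ec_add: "a \<in> carrier Fa \<Longrightarrow> b \<in> carrier Fa \<Longrightarrow> ec a \<oplus>\<^bsub>U\<^esub> ec b = ec (a + b)"
  using csub.add_quot[OF csub_I, of a b] by (simp add: U_eq ec_eq)

lemma ec_smult: "a \<in> carrier Fa \<Longrightarrow> c \<odot>\<^bsub>U\<^esub> ec a = ec (fscale c a)"
  using csub.smult_quot[OF csub_I, of a c] by (simp add: U_eq ec_eq)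

lemma ec_mult: "a \<in> carrier Fa \<Longrightarrow> b \<in> carrier Fa \<Longrightarrow> ec a \<otimes>\<^bsub>U\<^esub> ec b = ec (a * b)"
  using ideal.rcoset_mult_add[OF I_ideal, of a b] by (simp add: U_eq ec_eq quot_module_def)

lemma ec_cong: "a \<in> carrier Fa \<Longrightarrow> b \<in> carrier Fa \<Longrightarrow> a - b \<in> I \<Longrightarrow> ec a = ec b"
proof -
  assume ab: "a \<in> carrier Fa" "b \<in> carrier Fa" "a - b \<in> I"
  have "fscale (-1) b = - b" using pm.scale_minus_left[of 1 b] pm.scale_one[of b] by simp
  then have "a \<ominus>\<^bsub>Fa\<^esub> b = a - b" using cmod.diff_eq_smult[OF free_algebra_cmod ab(1,2)] by simp
  then show ?thesis using csub.cls_eq_iff[OF csub_I ab(1,2)] ab(3) by (simp add: ec_eq)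
qed

definition \<tau> :: "'n poly_op \<Rightarrow> 'n poly_op free_alg set \<times> 'e \<Rightarrow> ('n poly_op free_alg set \<times> 'e \<Rightarrow>\<^sub>0 complex)" where
  "\<tau> x = (\<lambda>(u, e). pure (ec (gen x) \<otimes>\<^bsub>U\<^esub> u) e)"

lemma foldr_act_closed: "set xs \<subseteq> witt_ge 0 \<Longrightarrow> e \<in> carrier E \<Longrightarrow> foldr (act E) xs e \<in> carrier E"
  by (induction xs) auto

lemma env_act_closed:
  "b \<in> carrier (free_algebra (witt_ge 0)) \<Longrightarrow> e \<in> carrier E \<Longrightarrow> env_act E b e \<in> carrier E"
  unfolding env_act_def by (intro E.mm.M.finsum_closed Pi_I E.smult_closed foldr_act_closed) auto

lemma env_act_gen: "x \<in> witt_ge 0 \<Longrightarrow> e \<in> carrier E \<Longrightarrow> env_act E (gen x) e = act E x e"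
  by (simp add: env_act_def)

lemma nonneg_Fa: "b \<in> carrier (free_algebra (witt_ge 0)) \<Longrightarrow> b \<in> carrier Fa"
  by (rule free_algebra_mono[OF _ ]) (auto intro: witt_ge_derivation)

abbreviation "Bal \<equiv> balanced_rels witt witt_nonneg E"

lemma balanced_cases:
  assumes "r \<in> Bal"
  obtains a b e where "a \<in> carrier Fa" "b \<in> carrier (free_algebra (witt_ge 0))" "e \<in> carrier E"
    "r = pure (ec (a * b)) e - pure (ec a) (env_act E b e)"
proof -
  obtain u b e where *: "u \<in> carrier U" "b \<in> carrier (free_algebra (witt_ge 0))" "e \<in> carrier E"
    "r = pure (u \<otimes>\<^bsub>U\<^esub> ec b) e - pure u (env_act E b e)"
    using assms unfolding balanced_rels_def ec_def[symmetric] lset_witt_nonneg by auto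
  obtain a where a: "a \<in> carrier Fa" "u = ec a" using *(1) unfolding U_carrier by blast
  show ?thesis by (rule that[OF a(1) *(2,3)]) (simp only: *(4) a(2) ec_mult[OF a(1) nonneg_Fa[OF *(2)]])
qed

sublocale T: tensor U E Bal witt \<tau>
proof (intro tensor.intro U_cmod E.cmod_axioms subsetI)
  fix r assume "r \<in> Bal"
  then show "r \<in> {f. Poly_Mapping.keys f \<subseteq> carrier U \<times> carrier E}"
  proof (cases rule: balanced_cases)
    case (1 a b e)
    have "pure (ec (a * b)) e \<in> {f. Poly_Mapping.keys f \<subseteq> carrier U \<times> carrier E}"
      "pure (ec a) (env_act E b e) \<in> {f. Poly_Mapping.keys f \<subseteq> carrier U \<times> carrier E}"
      using 1(1-3) ec_carrier[OF free_algebra_mult[OF 1(1) nonneg_Fa[OF 1(2)]]] ec_carrier[OF 1(1)] env_act_closed[OF 1(2,3)]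
      by auto
    then show ?thesis unfolding 1(4) by (rule pm.subspace_diff[OF keys_subspace])
  qed
qed

lemma Q_induced: "T.Q = induced_module witt witt_nonneg E"
  unfolding T.Q_def induced_module_def
  by (rule arg_cong[of _ _ "tensor_module U E Bal"]) (simp add: fun_eq_iff \<tau>_def ec_def)

definition w :: "'n poly_op free_alg \<Rightarrow> 'e \<Rightarrow> ('n poly_op free_alg set \<times> 'e \<Rightarrow>\<^sub>0 complex)" where
  "w a e = T.tp (ec a) e"

lemma w_add_left: "a \<in> carrier Fa \<Longrightarrow> b \<in> carrier Fa \<Longrightarrow> e \<in> carrier E \<Longrightarrow> w (a + b) e = w a e + w b e"
  unfolding w_def ec_add[symmetric] by (intro T.tp_add_left ec_carrier)

lemma w_scale_left: "a \<in> carrier Fa \<Longrightarrow> e \<in> carrier E \<Longrightarrow> w (fscale c a) e = fscale c (w a e)"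
  unfolding w_def ec_smult[symmetric] by (intro T.tp_smult_left ec_carrier)

lemma w_add_right: "a \<in> carrier Fa \<Longrightarrow> e \<in> carrier E \<Longrightarrow> e' \<in> carrier E \<Longrightarrow> w a (e \<oplus>\<^bsub>E\<^esub> e') = w a e + w a e'"
  unfolding w_def by (intro T.tp_add_right ec_carrier)

lemma w_scale_right: "a \<in> carrier Fa \<Longrightarrow> e \<in> carrier E \<Longrightarrow> w a (c \<odot>\<^bsub>E\<^esub> e) = fscale c (w a e)"
  unfolding w_def by (intro T.tp_smult_right ec_carrier)

lemma w_cong: "a \<in> carrier Fa \<Longrightarrow> b \<in> carrier Fa \<Longrightarrow> a - b \<in> I \<Longrightarrow> w a e = w b e"
  unfolding w_def by (simp only: ec_cong)

lemma w_diff_left: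
  assumes "a \<in> carrier Fa" "b \<in> carrier Fa" "e \<in> carrier E"
  shows "w (a - b) e = w a e - w b e"
  using w_add_left[OF pm.subspace_diff[OF free_algebra_subspace assms(1,2)] assms(2,3)] by simp

lemma w_balanced:
  assumes "a \<in> carrier Fa" "b \<in> carrier (free_algebra (witt_ge 0))" "e \<in> carrier E"
  shows "w (a * b) e = w a (env_act E b e)"
proof -
  have "pure (ec a \<otimes>\<^bsub>U\<^esub> env_class witt b) e - pure (ec a) (env_act E b e) \<in> bilinear_rels U E \<union> Bal"
    unfolding balanced_rels_def lset_witt_nonneg using assms ec_carrier by blast
  then have "T.\<pi> (pure (ec a \<otimes>\<^bsub>U\<^esub> env_class witt b) e - pure (ec a) (env_act E b e)) = 0"
    by (rule T.rel_mem)
  then show ?thesis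
    unfolding ec_def[symmetric] ec_mult[OF assms(1) nonneg_Fa[OF assms(2)]] by (simp add: w_def T.tp_def T.\<pi>_diff)
qed

lemma gen_Fa: "x \<in> derivations \<Longrightarrow> gen x \<in> carrier Fa"
  by (rule gen_carrier)

lemma gen_mult_Fa: "x \<in> derivations \<Longrightarrow> a \<in> carrier Fa \<Longrightarrow> gen x * a \<in> carrier Fa"
  by (intro free_algebra_mult gen_Fa)

lemma \<tau>_ec:
  assumes "x \<in> derivations" "a \<in> carrier Fa"
  shows "\<tau> x (ec a, e) = pure (ec (gen x * a)) e"
  unfolding \<tau>_def prod.case ec_mult[OF gen_Fa[OF assms(1)] assms(2)] ..

lemma \<pi>_\<tau>:
  assumes "x \<in> derivations" "a \<in> carrier Fa"
  shows "T.\<pi> (\<tau> x (ec a, e)) = w (gen x * a) e"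
  unfolding \<tau>_ec[OF assms] w_def T.tp_def ..

text \<open>The defining relations of U(g) remain in the two-sided ideal after right multiplication
  by a; hence left multiplication satisfies the axioms of a Lie module.\<close>

lemma gen_mult_w:
  assumes a: "a \<in> carrier Fa" and e: "e \<in> carrier E" and x: "x \<in> derivations" "y \<in> derivations"
  shows "w (gen (x + y) * a) e = w (gen x * a) e + w (gen y * a) e"
    "w (gen (op_scale c x) * a) e = fscale c (w (gen x * a) e)"
    "w (gen (lbracket witt x y) * a) e = w (gen x * (gen y * a)) e - w (gen y * (gen x * a)) e"
proof -
  note sub = free_algebra_subspace[of "derivations :: 'n poly_op set"]
  have xy: "x + y \<in> derivations" "op_scale c x \<in> derivations" "lbracket witt x y \<in> derivations"
    using x by (auto intro: derivations_closed)
  note cl = gen_Fa[OF x(1)] gen_Fa[OF x(2)] gen_Fa[OF xy(1)] gen_Fa[OF xy(2)] gen_Fa[OF xy(3)]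
    gen_mult_Fa[OF x(1)] gen_mult_Fa[OF x(2)]
  have "gen (x + y) - gen x - gen y \<in> env_rels witt" "gen (op_scale c x) - fscale c (gen x) \<in> env_rels witt"
    "gen x * gen y - gen y * gen x - gen (lbracket witt x y) \<in> env_rels witt"
    unfolding env_rels_def lset_witt lscale_witt using x by blast+
  note r = this[THEN I_rel, THEN I_mult(1), OF a]
  have "w (gen (x + y) * a) e = w (gen x * a + gen y * a) e"
  proof (rule w_cong)
    show "gen (x + y) * a - (gen x * a + gen y * a) \<in> I" using r(1) by (simp add: left_diff_distrib distrib_right diff_diff_eq)
  qed (intro free_algebra_mult pm.subspace_add[OF sub] cl a)+
  then show "w (gen (x + y) * a) e = w (gen x * a) e + w (gen y * a) e"
    using w_add_left[OF cl(6,7)[OF a] e] by simp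
  have "w (gen (op_scale c x) * a) e = w (fscale c (gen x * a)) e"
  proof (rule w_cong)
    show "gen (op_scale c x) * a - fscale c (gen x * a) \<in> I"
      using r(2) unfolding left_diff_distrib fscale_mult_left .
  qed (intro free_algebra_mult pm.subspace_scale[OF sub] cl a)+
  then show "w (gen (op_scale c x) * a) e = fscale c (w (gen x * a) e)"
    unfolding w_scale_left[OF cl(6)[OF a] e] .
  have m: "gen x * (gen y * a) \<in> carrier Fa" "gen y * (gen x * a) \<in> carrier Fa"
    by (intro free_algebra_mult cl a)+
  have "w (gen x * (gen y * a) - gen y * (gen x * a)) e = w (gen (lbracket witt x y) * a) e"
  proof (rule w_cong)
    show "gen x * (gen y * a) - gen y * (gen x * a) - gen (lbracket witt x y) * a \<in> I"
      using r(3) unfolding left_diff_distrib mult.assoc .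
  qed (intro free_algebra_mult pm.subspace_diff[OF sub] cl a)+
  then show "w (gen (lbracket witt x y) * a) e = w (gen x * (gen y * a)) e - w (gen y * (gen x * a)) e"
    unfolding w_diff_left[OF m e] by simp
qed

sublocale TL: tensor_lie U E Bal witt \<tau>
proof (intro tensor_lie.intro T.tensor_axioms tensor_lie_axioms.intro)
  show "lie_closed witt" by simp
  have S: "\<exists>a e. s = (ec a, e) \<and> a \<in> carrier Fa \<and> e \<in> carrier E" if "s \<in> T.S" for s
    using that unfolding T.S_def U_carrier by blast
  fix x :: "'n poly_op" assume "x \<in> lset witt"
  then have x: "x \<in> derivations" by simp
  show "T.\<pi> (lin_ext (\<tau> x) r) = 0" if r: "r \<in> bilinear_rels U E \<union> Bal" for r
    using r
  proof
    assume "r \<in> bilinear_rels U E"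
    then show ?thesis
    proof (cases rule: bilinear_rels_cases)
      case (add_left u u' e)
      then obtain a a' where a: "a \<in> carrier Fa" "u = ec a" "a' \<in> carrier Fa" "u' = ec a'" unfolding U_carrier by blast
      have "r = pure (ec (a + a')) e - pure (ec a) e - pure (ec a') e"
        unfolding add_left(4) a(2,4) ec_add[OF a(1,3)] ..
      then show ?thesis
        using w_add_left[OF gen_mult_Fa[OF x a(1)] gen_mult_Fa[OF x a(3)] add_left(3)]
          pm.subspace_add[OF free_algebra_subspace a(1,3)]
        by (simp add: lin_ext_diff T.\<pi>_diff \<pi>_\<tau>[OF x] a(1,3) distrib_left del: free_algebra_simps(1))
    next
      case (add_right u e e')
      then obtain a where a: "a \<in> carrier Fa" "u = ec a" unfolding U_carrier by blast
      show ?thesis unfolding add_right(4) a(2)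
        using w_add_right[OF gen_mult_Fa[OF x a(1)] add_right(2,3)]
        by (simp add: lin_ext_diff T.\<pi>_diff \<pi>_\<tau>[OF x] a(1) del: free_algebra_simps(1))
    next
      case (smult_left c u e)
      then obtain a where a: "a \<in> carrier Fa" "u = ec a" unfolding U_carrier by blast
      have "r = pure (ec (fscale c a)) e - fscale c (pure (ec a) e)"
        unfolding smult_left(3) a(2) ec_smult[OF a(1)] ..
      then show ?thesis
        using w_scale_left[OF gen_mult_Fa[OF x a(1)] smult_left(2), of c]
          pm.subspace_scale[OF free_algebra_subspace a(1), of c]
        by (simp add: lin_ext_diff lin_ext_fscale T.\<pi>(2) T.\<pi>_diff \<pi>_\<tau>[OF x] a(1) fscale_mult_right_free
            del: free_algebra_simps(1) fscale_single map_single)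
    next
      case (smult_right c u e)
      then obtain a where a: "a \<in> carrier Fa" "u = ec a" unfolding U_carrier by blast
      show ?thesis unfolding smult_right(3) a(2)
        using w_scale_right[OF gen_mult_Fa[OF x a(1)] smult_right(2), of c]
        by (simp add: lin_ext_diff lin_ext_fscale T.\<pi>(2) T.\<pi>_diff \<pi>_\<tau>[OF x] a(1)
            del: free_algebra_simps(1) fscale_single map_single)
    qed
  next
    assume "r \<in> Bal"
    then show ?thesis
    proof (cases rule: balanced_cases)
      case (1 a b e)
      show ?thesis unfolding 1(4)
        using w_balanced[OF gen_mult_Fa[OF x 1(1)] 1(2,3)] free_algebra_mult[OF 1(1) nonneg_Fa[OF 1(2)]]
        by (simp add: lin_ext_diff T.\<pi>_diff \<pi>_\<tau>[OF x] 1(1) mult.assoc del: free_algebra_simps(1))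
    qed
  qed
  fix s assume "s \<in> T.S"
  then obtain a e where s: "s = (ec a, e)" and a: "a \<in> carrier Fa" and e: "e \<in> carrier E" using S by blast
  show "\<tau> x s \<in> carrier T.FS"
    unfolding s \<tau>_ec[OF x a] by (intro T.pure_carrier ec_carrier gen_mult_Fa x a e)
  show "T.\<pi> (\<tau> (lscale witt c x) s) = fscale c (T.\<pi> (\<tau> x s))" for c
    unfolding s lscale_witt \<pi>_\<tau>[OF x a] \<pi>_\<tau>[OF derivations_closed(3)[OF x] a] by (rule gen_mult_w(2)[OF a e x x])
  fix y :: "'n poly_op" assume "y \<in> lset witt"
  then have y: "y \<in> derivations" by simp
  show "T.\<pi> (\<tau> (x + y) s) = T.\<pi> (\<tau> x s) + T.\<pi> (\<tau> y s)"
    unfolding s \<pi>_\<tau>[OF x a] \<pi>_\<tau>[OF y a] \<pi>_\<tau>[OF derivations_closed(2)[OF x y] a] by (rule gen_mult_w(1)[OF a e x y])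
  show "T.\<pi> (\<tau> (lbracket witt x y) s) = T.\<pi> (lin_ext (\<tau> x) (\<tau> y s)) - T.\<pi> (lin_ext (\<tau> y) (\<tau> x s))"
    unfolding s \<pi>_\<tau>[OF lbracket_witt_derivation[OF x y] a] \<tau>_ec[OF x a] \<tau>_ec[OF y a] lin_ext_single pm.scale_one
      \<pi>_\<tau>[OF x gen_mult_Fa[OF y a]] \<pi>_\<tau>[OF y gen_mult_Fa[OF x a]]
    using gen_mult_w(3)[OF a e x y] by simp
qed

definition \<iota> :: "'e \<Rightarrow> ('n poly_op free_alg set \<times> 'e \<Rightarrow>\<^sub>0 complex) set" where
  "\<iota> e = T.cls (pure (ec 1) e)"

lemma \<iota>_closed: "e \<in> carrier E \<Longrightarrow> \<iota> e \<in> carrier T.Q"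
  unfolding \<iota>_def by (intro T.cls_carrier T.pure_carrier ec_carrier free_algebra_one)

lemma \<iota>_add: "e \<in> carrier E \<Longrightarrow> e' \<in> carrier E \<Longrightarrow> \<iota> (e \<oplus>\<^bsub>E\<^esub> e') = \<iota> e \<oplus>\<^bsub>T.Q\<^esub> \<iota> e'"
  unfolding \<iota>_def by (intro T.cls_pure_add_right ec_carrier free_algebra_one)

lemma \<iota>_smult: "e \<in> carrier E \<Longrightarrow> \<iota> (c \<odot>\<^bsub>E\<^esub> e) = c \<odot>\<^bsub>T.Q\<^esub> \<iota> e"
  unfolding \<iota>_def by (intro T.cls_pure_smult_right ec_carrier free_algebra_one)

lemma \<iota>_zero: "\<iota> \<zero>\<^bsub>E\<^esub> = \<zero>\<^bsub>T.Q\<^esub>"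
proof -
  interpret Q: lmod witt T.Q by (rule lie_module_lmod[OF TL.Q_lie])
  have "\<iota> (0 \<odot>\<^bsub>E\<^esub> \<zero>\<^bsub>E\<^esub>) = 0 \<odot>\<^bsub>T.Q\<^esub> \<iota> \<zero>\<^bsub>E\<^esub>" by (rule \<iota>_smult) simp
  then show ?thesis using \<iota>_closed[of "\<zero>\<^bsub>E\<^esub>"] by simp
qed

lemma act_cls:
  assumes "x \<in> derivations" "a \<in> carrier Fa" "e \<in> carrier E"
  shows "act T.Q x (T.cls (pure (ec a) e)) = T.cls (pure (ec (gen x * a)) e)"
proof -
  have "act T.Q x (T.cls (pure (ec a) e)) = T.cls (lin_ext (\<tau> x) (pure (ec a) e))"
    using assms(1) by (intro TL.Q_act T.pure_carrier ec_carrier assms) simp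
  then show ?thesis by (simp only: lin_ext_single pm.scale_one \<tau>_ec[OF assms(1,2)])
qed

text \<open>The balancing relation moves x across the tensor sign: x \<otimes> e = 1 x \<otimes> e =
  1 \<otimes> x e.\<close>

lemma act_\<iota>:
  assumes x: "x \<in> witt_ge 0" and e: "e \<in> carrier E"
  shows "act T.Q x (\<iota> e) = \<iota> (act E x e)"
proof -
  have D: "x \<in> derivations" using x by (rule witt_ge_derivation)
  have "act T.Q x (\<iota> e) = T.cls (pure (ec (1 * gen x)) e)"
    unfolding \<iota>_def act_cls[OF D free_algebra_one e] by simp
  also have "\<dots> = T.cls (pure (ec 1) (env_act E (gen x) e))"
    using w_balanced[OF free_algebra_one gen_carrier[OF x] e]
    by (intro T.cls_eqI T.pure_carrier ec_carrier e env_act_closed gen_carrier x free_algebra_mult free_algebra_one gen_Fa D)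
      (simp only: w_def T.tp_def)
  finally show ?thesis by (simp only: \<iota>_def env_act_gen[OF x e])
qed

text \<open>Left multiplication by its letters builds the class of a word from 1, and words span the
  enveloping algebra.\<close>

lemma generated:
  assumes N: "lie_submodule witt N T.Q" and sub: "\<iota> ` carrier E \<subseteq> N"
  shows "N = carrier T.Q"
proof -
  interpret Q: lmod witt T.Q by (rule lie_module_lmod[OF TL.Q_lie])
  have N1: "submodule N complex_ring T.Q" using N by (simp add: lie_submodule_def)
  have N': "\<zero>\<^bsub>T.Q\<^esub> \<in> N" "\<And>a b. a \<in> N \<Longrightarrow> b \<in> N \<Longrightarrow> a \<oplus>\<^bsub>T.Q\<^esub> b \<in> N"
    "\<And>c a. a \<in> N \<Longrightarrow> c \<odot>\<^bsub>T.Q\<^esub> a \<in> N" "\<And>x a. x \<in> derivations \<Longrightarrow> a \<in> N \<Longrightarrow> act T.Q x a \<in> N"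
    using N by (simp_all add: Q.lie_submodule_iff)
  have word: "T.cls (pure (ec (Poly_Mapping.single (Word xs) 1)) e) \<in> N"
    if "set xs \<subseteq> derivations" "e \<in> carrier E" for xs e
    using that(1)
  proof (induction xs)
    case Nil
    have "Poly_Mapping.single (Word []) 1 = (1 :: 'n poly_op free_alg)"
      by (simp add: zero_free_monoid_def[symmetric])
    then show ?case using sub that(2) unfolding \<iota>_def by auto
  next
    case (Cons x xs)
    have "Word [x] + Word xs = Word (x # xs)" by (simp add: plus_free_monoid_def)
    then have "Poly_Mapping.single (Word (x # xs)) 1 = gen x * Poly_Mapping.single (Word xs) 1"
      by (simp add: mult_single)
    moreover have "act T.Q x (T.cls (pure (ec (Poly_Mapping.single (Word xs) 1)) e)) \<in> N"
      using Cons by (intro N'(4)) auto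
    ultimately show ?case using Cons.prems that(2) by (subst (asm) act_cls) auto
  qed
  have "T.cls (pure (ec a) e) \<in> N" if a: "a \<in> carrier Fa" and e: "e \<in> carrier E" for a e
  proof -
    have "Poly_Mapping.keys a \<subseteq> {w. set (letters w) \<subseteq> derivations}" using a by auto
    then show ?thesis
    proof (induction a rule: keys_induct)
      case zero
      have "T.cls (pure (ec 0) e) = T.cls (fscale 0 (pure (ec 0) e))"
        using w_scale_left[of 0 e 0] e
        by (intro T.cls_eqI T.FS_fscale T.pure_carrier ec_carrier) (simp_all add: w_def T.tp_def)
      then show ?case using N'(1) by (simp add: T.cls_0)
    next
      case (single s c)
      have s: "Poly_Mapping.single s 1 \<in> carrier Fa" using single by simp
      have "ec (Poly_Mapping.single s c) = c \<odot>\<^bsub>U\<^esub> ec (Poly_Mapping.single s 1)"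
        unfolding ec_smult[OF s] by simp
      moreover have "s = Word (letters s)" by simp
      ultimately show ?case
        using N'(3)[OF word[of "letters s" e]] single e T.cls_pure_smult_left[OF ec_carrier[OF s] e, of c] by simp
    next
      case (add a b)
      have ab: "a \<in> carrier Fa" "b \<in> carrier Fa" using add(1,2) by auto
      show ?case
        unfolding ec_add[OF ab, symmetric] T.cls_pure_add_left[OF ec_carrier[OF ab(1)] ec_carrier[OF ab(2)] e]
        by (rule N'(2)[OF add(3,4)])
    qed
  qed
  then show ?thesis using N1 by (intro T.submodule_all) (auto simp only: U_carrier)
qed

end

section \<open>Evaluation of the enveloping algebra on a module\<close>

context wmod begin

definition word_act :: "'n poly_op free_alg \<Rightarrow> 'v \<Rightarrow> 'v" where
  "word_act a v = lsum scale (\<lambda>u. foldr \<rho> (letters u) v) a"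

sublocale C: complex_vector_space scale
  by (intro complex_vector_space.intro vector_space_axioms)

lemma word_act_add: "word_act (a + b) v = word_act a v + word_act b v"
  and word_act_diff: "word_act (a - b) v = word_act a v - word_act b v"
  and word_act_fscale: "word_act (fscale c a) v = scale c (word_act a v)"
  and word_act_single: "word_act (Poly_Mapping.single u c) v = scale c (foldr \<rho> (letters u) v)"
  and word_act_zero: "word_act 0 v = 0"
  by (simp_all add: word_act_def C.lsum_add C.lsum_diff C.lsum_fscale)

lemma foldr_\<rho>:
  assumes "set xs \<subseteq> derivations"
  shows "foldr \<rho> xs (v + v') = foldr \<rho> xs v + foldr \<rho> xs v'"
    "foldr \<rho> xs (scale c v) = scale c (foldr \<rho> xs v)" "foldr \<rho> xs 0 = 0"
  using assms by (induction xs) (auto simp: \<rho>_add \<rho>_scale \<rho>_zero)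

lemma word_act_mult:
  assumes a: "a \<in> carrier (free_algebra derivations)"
  shows "word_act (a * b) v = word_act a (word_act b v)"
proof -
  have "Poly_Mapping.keys a \<subseteq> {w. set (letters w) \<subseteq> derivations}" using a by auto
  then show ?thesis
  proof (induction a rule: keys_induct)
    case (single s c)
    then have s: "set (letters s) \<subseteq> derivations" by simp
    show ?case
    proof (induction b rule: poly_mapping_induct)
      case (single t d)
      show ?case using foldr_\<rho>[OF s] by (simp add: mult_single word_act_single)
    next
      case (add p q)
      then show ?case using foldr_\<rho>[OF s]
        by (simp add: distrib_left word_act_add word_act_single scale_right_distrib)
    qed
  qed (simp_all add: distrib_right word_act_add word_act_zero)
qed

text \<open>The elements that kill all of V form a two-sided ideal, and the module axioms put the
  defining relations into it.\<close>

lemma word_act_ideal: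
  assumes "a \<in> env_ideal witt"
  shows "word_act a v = 0"
proof -
  let ?Fa = "free_algebra (derivations :: 'n poly_op set)"
  let ?K = "{a \<in> carrier ?Fa. \<forall>v. word_act a v = 0}"
  note sub = free_algebra_subspace[of "derivations :: 'n poly_op set"]
  interpret R: ring ?Fa by (rule free_algebra_ring)
  have "ideal ?K ?Fa"
  proof (rule idealI[OF R.ring_axioms])
    show "subgroup ?K (add_monoid ?Fa)"
    proof (rule R.add.subgroupI)
      show "?K \<noteq> {}" using pm.subspace_0[OF sub] word_act_zero by blast
      show "a \<oplus>\<^bsub>?Fa\<^esub> b \<in> ?K" if "a \<in> ?K" "b \<in> ?K" for a b
        using that pm.subspace_add[OF sub, of a b] by (simp add: word_act_add)
      fix a assume ab: "a \<in> ?K"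
      have "\<ominus>\<^bsub>?Fa\<^esub> a = - a"
        using ab pm.subspace_neg[OF sub, of a] by (intro R.minus_equality) auto
      moreover have "word_act (- a) v = 0" for v
        using ab word_act_diff[of 0 a v] by (simp add: word_act_zero)
      ultimately show "\<ominus>\<^bsub>?Fa\<^esub> a \<in> ?K"
        using ab pm.subspace_neg[OF sub, of a] by simp
    qed auto
    fix a x assume ax: "a \<in> ?K" "x \<in> carrier ?Fa"
    have "word_act x 0 = 0" using word_act_mult[OF ax(2), of 0 0] by (simp add: word_act_zero)
    then show "x \<otimes>\<^bsub>?Fa\<^esub> a \<in> ?K" "a \<otimes>\<^bsub>?Fa\<^esub> x \<in> ?K"
      using ax free_algebra_mult[of x derivations a] free_algebra_mult[of a derivations x] word_act_mult[of x a] word_act_mult[of a x]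
      by simp_all
  qed
  moreover have "env_rels witt \<subseteq> ?K"
  proof -
    have "word_act r v = 0" if "r \<in> env_rels witt" for r v
      using that unfolding env_rels_def
      by (auto simp: word_act_diff word_act_fscale word_act_single mult_single add_\<rho> scale_\<rho> bracket_\<rho> simp del: fscale_single map_single)
    then show ?thesis
      using env_rels_carrier[OF lie_closed_witt] unfolding lset_witt by blast
  qed
  ultimately have "env_ideal witt \<subseteq> ?K"
    unfolding env_ideal_def lset_witt by (rule R.genideal_minimal)
  then show ?thesis using assms by blast
qed

end

text \<open>An equivariant \<phi> extends to Ind E by u \<otimes> e \<mapsto> u \<phi>(e). This
  bilinear map respects the balancing relations and has the value \<phi>(e) at 1 \<otimes>
  e.\<close>

lemma (in induced) \<iota>_nonzero:
  fixes scale :: "complex \<Rightarrow> 'v::ab_group_add \<Rightarrow> 'v" and \<phi> :: "'e \<Rightarrow> 'v"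
  assumes V: "wmod scale \<rho>"
    and add: "\<And>e e'. e \<in> carrier E \<Longrightarrow> e' \<in> carrier E \<Longrightarrow> \<phi> (e \<oplus>\<^bsub>E\<^esub> e') = \<phi> e + \<phi> e'"
    and smult: "\<And>c e. e \<in> carrier E \<Longrightarrow> \<phi> (c \<odot>\<^bsub>E\<^esub> e) = scale c (\<phi> e)"
    and act: "\<And>x e. x \<in> witt_ge 0 \<Longrightarrow> e \<in> carrier E \<Longrightarrow> \<phi> (act E x e) = \<rho> x (\<phi> e)"
    and e: "e \<in> carrier E" "\<phi> e \<noteq> 0"
  shows "\<iota> e \<noteq> \<zero>\<^bsub>T.Q\<^esub>"
proof -
  interpret V: wmod scale \<rho> by (rule V)
  have \<phi>0: "\<phi> \<zero>\<^bsub>E\<^esub> = 0" using smult[of "\<zero>\<^bsub>E\<^esub>" 0] by simp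
  have foldr_\<phi>: "\<phi> (foldr (act E) xs e) = foldr \<rho> xs (\<phi> e)" if "set xs \<subseteq> witt_ge 0" "e \<in> carrier E" for xs e
    using that by (induction xs) (auto simp: act foldr_act_closed)
  \<comment> \<open>This identity makes the bilinear map vanish on the balancing relations.\<close>
  have ea: "\<phi> (env_act E b e) = V.word_act b (\<phi> e)"
    if b: "b \<in> carrier (free_algebra (witt_ge 0))" and e: "e \<in> carrier E" for b e
  proof -
    have fin: "\<phi> (finsum E f A) = (\<Sum>a\<in>A. \<phi> (f a))" if "finite A" "\<And>a. a \<in> A \<Longrightarrow> f a \<in> carrier E" for f :: "'n poly_op free_monoid \<Rightarrow> 'e" and A
      using that
    proof (induction A rule: finite_induct)
      case (insert a A)
      then have "finsum E f (insert a A) = f a \<oplus>\<^bsub>E\<^esub> finsum E f A" "finsum E f A \<in> carrier E"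
        by (auto intro!: E.mm.M.finsum_insert E.mm.M.finsum_closed)
      then show ?case using insert by (simp add: add)
    qed (simp add: \<phi>0)
    have c: "foldr (act E) (letters u) e \<in> carrier E" if "u \<in> Poly_Mapping.keys b" for u
      using b e that by (intro foldr_act_closed) auto
    show ?thesis
      unfolding env_act_def V.word_act_def lsum_def
      using b e by (subst fin) (auto intro!: E.smult_closed c sum.cong simp: smult c foldr_\<phi>)
  qed
  \<comment> \<open>Independent of the representative by \<open>word_act_ideal\<close>.\<close>
  define ev where "ev u = V.word_act (SOME a. a \<in> carrier Fa \<and> u = ec a)" for u
  have ev: "ev (ec a) = V.word_act a" if a: "a \<in> carrier Fa" for a
  proof -
    define b where "b = (SOME b. b \<in> carrier Fa \<and> ec a = ec b)"
    have b: "b \<in> carrier Fa \<and> ec a = ec b" unfolding b_def by (rule someI[of _ a]) (use a in blast)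
    have "fscale (-1) b = - b" using pm.scale_minus_left[of 1 b] pm.scale_one[of b] by simp
    then have "a \<ominus>\<^bsub>Fa\<^esub> b = a - b" using cmod.diff_eq_smult[OF free_algebra_cmod a] b by simp
    then have "a - b \<in> I" using csub.cls_eq_iff[OF csub_I a, of b] b by (simp only: ec_eq)
    then have "V.word_act (a - b) v = 0" for v unfolding I_def by (rule V.word_act_ideal)
    then have "V.word_act a = V.word_act b" by (simp add: V.word_act_diff fun_eq_iff)
    then show ?thesis by (simp add: ev_def b_def)
  qed
  have lin: "V.word_act a (v + v') = V.word_act a v + V.word_act a v'"
    "V.word_act a (scale c v) = scale c (V.word_act a v)" if a: "a \<in> carrier Fa" for a v v' c
  proof -
    have "Poly_Mapping.keys a \<subseteq> {w. set (letters w) \<subseteq> derivations}" using a by auto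
    then show "V.word_act a (v + v') = V.word_act a v + V.word_act a v'"
      "V.word_act a (scale c v) = scale c (V.word_act a v)"
      by (induction a rule: keys_induct)
        (simp_all add: V.word_act_zero V.word_act_single V.word_act_add V.foldr_\<rho> V.scale_right_distrib mult.commute)
  qed
  show ?thesis
    unfolding \<iota>_def
  proof (rule T.cls_pure_nonzero[OF V.vector_space_axioms, where h = "\<lambda>u e. ev u (\<phi> e)"])
    fix u u' e e' and c :: complex
    assume "u \<in> carrier U"
    then obtain a where a: "a \<in> carrier Fa" "u = ec a" unfolding U_carrier by blast
    show "ev (c \<odot>\<^bsub>U\<^esub> u) (\<phi> e) = scale c (ev u (\<phi> e))"
      unfolding a(2) ec_smult[OF a(1)] ev[OF a(1)] ev[OF pm.subspace_scale[OF free_algebra_subspace a(1)]]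
      by (rule V.word_act_fscale)
    show "ev (u \<oplus>\<^bsub>U\<^esub> u') (\<phi> e) = ev u (\<phi> e) + ev u' (\<phi> e)" if u': "u' \<in> carrier U"
    proof -
      obtain a' where a': "a' \<in> carrier Fa" "u' = ec a'" using u' unfolding U_carrier by blast
      show ?thesis
        unfolding a(2) a'(2) ec_add[OF a(1) a'(1)] ev[OF a(1)] ev[OF a'(1)] ev[OF pm.subspace_add[OF free_algebra_subspace a(1) a'(1)]]
        by (rule V.word_act_add)
    qed
    assume e: "e \<in> carrier E"
    show "ev u (\<phi> (c \<odot>\<^bsub>E\<^esub> e)) = scale c (ev u (\<phi> e))"
      unfolding a(2) ev[OF a(1)] smult[OF e] by (rule lin(2)[OF a(1)])
    show "ev u (\<phi> (e \<oplus>\<^bsub>E\<^esub> e')) = ev u (\<phi> e) + ev u (\<phi> e')" if "e' \<in> carrier E"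
      unfolding a(2) ev[OF a(1)] add[OF e that] by (rule lin(1)[OF a(1)])
  next
    fix r assume "r \<in> Bal"
    then show "lsum scale (\<lambda>s. ev (fst s) (\<phi> (snd s))) r = 0"
    proof (cases rule: balanced_cases)
      case (1 a b e)
      show ?thesis
        unfolding 1(4) V.C.lsum_diff V.C.lsum_single fst_conv snd_conv
          ev[OF 1(1)] ev[OF free_algebra_mult[OF 1(1) nonneg_Fa[OF 1(2)]]] ea[OF 1(2,3)] V.word_act_mult[OF 1(1)]
        by simp
    qed
  next
    have "V.word_act 1 v = v" for v
      using V.word_act_single[of 0 1 v] by simp
    then show "ev (ec 1) (\<phi> e) \<noteq> 0" using e(2) by (simp only: ev[OF free_algebra_one] not_False_eq_True)
  qed (use e ec_carrier[OF free_algebra_one] in simp_all)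
qed

section \<open>Classification of the smooth simple modules\<close>

text \<open>A subspace with new operators, possibly from another Lie algebra; in this way E and M
  are realized on the type of V.\<close>

definition sub_op ::
  "(complex \<Rightarrow> 'v \<Rightarrow> 'v) \<Rightarrow> 'v::ab_group_add set \<Rightarrow> ('a \<Rightarrow> 'v \<Rightarrow> 'v) \<Rightarrow> ('a, 'v) op_module" where
  "sub_op sc X \<sigma> = (op_module_of sc \<sigma>)\<lparr>carrier := X\<rparr>"

lemma sub_op_simps [simp]:
  "carrier (sub_op sc X \<sigma>) = X" "zero (sub_op sc X \<sigma>) = 0" "add (sub_op sc X \<sigma>) = (+)"
  "smult (sub_op sc X \<sigma>) = sc" "act (sub_op sc X \<sigma>) = \<sigma>"
  by (simp_all add: sub_op_def op_module_of_def)

context complex_vector_space begin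

lemma sub_op_cmod:
  assumes X: "subspace X"
  shows "cmod (sub_op scale X \<sigma>)"
proof (rule cmod.intro, rule Module.moduleI)
  show "cring complex_ring" by (rule cring_complex_ring)
  show "abelian_group (sub_op scale X \<sigma>)"
  proof (rule abelian_groupI)
    fix f assume "f \<in> carrier (sub_op scale X \<sigma>)"
    then show "\<exists>g\<in>carrier (sub_op scale X \<sigma>). g \<oplus>\<^bsub>sub_op scale X \<sigma>\<^esub> f = \<zero>\<^bsub>sub_op scale X \<sigma>\<^esub>"
      using subspace_neg[OF X] by (intro bexI[of _ "- f"]) auto
  qed (use subspace_add[OF X] subspace_0[OF X] in \<open>auto simp: add_ac\<close>)
qed (use subspace_scale[OF X] in \<open>auto simp: scale_right_distrib scale_left_distrib\<close>)

lemma sub_op_lie_module: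
  assumes X: "subspace X"
    and "\<And>x v. x \<in> lset L \<Longrightarrow> v \<in> X \<Longrightarrow> \<sigma> x v \<in> X"
    and "\<And>x v w. x \<in> lset L \<Longrightarrow> v \<in> X \<Longrightarrow> w \<in> X \<Longrightarrow> \<sigma> x (v + w) = \<sigma> x v + \<sigma> x w"
    and "\<And>x c v. x \<in> lset L \<Longrightarrow> v \<in> X \<Longrightarrow> \<sigma> x (scale c v) = scale c (\<sigma> x v)"
    and "\<And>x y v. x \<in> lset L \<Longrightarrow> y \<in> lset L \<Longrightarrow> v \<in> X \<Longrightarrow> \<sigma> (x + y) v = \<sigma> x v + \<sigma> y v"
    and "\<And>c x v. x \<in> lset L \<Longrightarrow> v \<in> X \<Longrightarrow> \<sigma> (lscale L c x) v = scale c (\<sigma> x v)"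
    and "\<And>x y v. x \<in> lset L \<Longrightarrow> y \<in> lset L \<Longrightarrow> v \<in> X \<Longrightarrow> \<sigma> (lbracket L x y) v = \<sigma> x (\<sigma> y v) - \<sigma> y (\<sigma> x v)"
  shows "lie_module L (sub_op scale X \<sigma>)"
proof -
  interpret S: cmod "sub_op scale X \<sigma>" by (rule sub_op_cmod[OF X])
  have "x \<ominus>\<^bsub>sub_op scale X \<sigma>\<^esub> y = x - y" if "x \<in> X" "y \<in> X" for x y
    using S.diff_eq_smult[of x y] that by simp
  then show ?thesis
    unfolding lie_module_def using S.module assms by simp
qed

lemma sub_op_simple:
  assumes X: "lie_module L (sub_op scale X \<sigma>)" "X \<noteq> {0}"
    and "\<And>Y. subspace Y \<Longrightarrow> Y \<subseteq> X \<Longrightarrow> (\<And>x y. x \<in> lset L \<Longrightarrow> y \<in> Y \<Longrightarrow> \<sigma> x y \<in> Y) \<Longrightarrow> Y \<noteq> {0} \<Longrightarrow> Y = X"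
  shows "simple_lie_module L (sub_op scale X \<sigma>)"
proof -
  interpret S: lmod L "sub_op scale X \<sigma>" by (rule lie_module_lmod[OF X(1)])
  have "Y = {0} \<or> Y = X" if Y: "lie_submodule L Y (sub_op scale X \<sigma>)" for Y
  proof (rule disjCI)
    assume "Y \<noteq> X"
    moreover have "subspace Y" "Y \<subseteq> X" "\<And>x y. x \<in> lset L \<Longrightarrow> y \<in> Y \<Longrightarrow> \<sigma> x y \<in> Y"
      using Y unfolding S.lie_submodule_iff subspace_def by auto
    ultimately show "Y = {0}" using assms(3)[of Y] by blast
  qed
  then show ?thesis using X by (simp add: simple_lie_module_def)
qed

end

subsection \<open>Smoothness of simple induced modules and of quotients of tensor modules\<close>

context simple_wmod begin

lemma smooth_of_iso:
  assumes Q: "lie_module witt Q" and iso: "lie_module_iso witt V Q"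
    and y: "y \<in> annihilated Q m" "y \<noteq> \<zero>\<^bsub>Q\<^esub>"
  shows "smooth V"
proof -
  interpret Q: lmod witt Q by (rule lie_module_lmod[OF Q])
  obtain \<phi> where bij: "bij_betw \<phi> (carrier V) (carrier Q)"
    and smult: "\<And>c v. \<phi> (scale c v) = c \<odot>\<^bsub>Q\<^esub> \<phi> v"
    and act: "\<And>x v. x \<in> derivations \<Longrightarrow> \<phi> (\<rho> x v) = act Q x (\<phi> v)"
    using iso by (auto simp: lie_module_iso_def)
  have mem: "\<phi> v \<in> carrier Q" for v using bij by (auto simp: bij_betw_def)
  have zero: "\<phi> 0 = \<zero>\<^bsub>Q\<^esub>" using smult[of 0 0] mem[of 0] by simp
  have inj: "v = w" if "\<phi> v = \<phi> w" for v w using bij that by (auto simp: bij_betw_def inj_on_def)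
  have "y \<in> carrier Q" using y(1) by (simp add: annihilated_iff)
  then obtain v where v: "y = \<phi> v" using bij by (auto simp: bij_betw_def)
  have "v \<in> annihilated V m"
    unfolding annihilated_iff
  proof (intro conjI ballI)
    fix x :: "'b poly_op" assume x: "x \<in> witt_ge (int m)"
    have "\<phi> (\<rho> x v) = \<phi> 0"
      using y(1) x act[OF witt_ge_derivation[OF x], of v] by (simp add: zero annihilated_iff v)
    then have "\<rho> x v = 0" by (rule inj)
    then show "act V x v = \<zero>\<^bsub>V\<^esub>" by simp
  qed simp
  moreover have "v \<noteq> 0" using y(2) v zero by auto
  ultimately show ?thesis using M.smooth_of_simple[OF simple, of v m] by simp
qed

lemma smooth_of_induced:
  fixes E :: "('b poly_op, 'e) op_module"
  assumes E: "lie_module witt_nonneg E" "smooth E"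
    and iso: "lie_module_iso witt V (induced_module witt witt_nonneg E)"
  shows "smooth V"
proof -
  interpret I: induced E by (rule induced.intro[OF E(1)])
  interpret Q: lmod witt I.T.Q by (rule lie_module_lmod[OF I.TL.Q_lie])
  have simpleQ: "simple_lie_module witt I.T.Q"
    using lie_module_iso_simple[OF simple I.TL.Q_lie] iso by (simp add: I.Q_induced)
  \<comment> \<open>If \<iota> were 0, the zero submodule would contain the generators and be all of
    Ind E, which is simple.\<close>
  have "\<exists>e\<in>carrier E. I.\<iota> e \<noteq> \<zero>\<^bsub>I.T.Q\<^esub>"
  proof (rule ccontr)
    assume "\<not> ?thesis"
    moreover have "lie_submodule witt {\<zero>\<^bsub>I.T.Q\<^esub>} I.T.Q" by (simp add: Q.lie_submodule_iff)
    ultimately have "{\<zero>\<^bsub>I.T.Q\<^esub>} = carrier I.T.Q" by (intro I.generated) auto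
    then show False using simpleQ by (simp add: simple_lie_module_def)
  qed
  then obtain e where e: "e \<in> carrier E" "I.\<iota> e \<noteq> \<zero>\<^bsub>I.T.Q\<^esub>" by blast
  obtain m where m: "e \<in> annihilated E m"
    using E(2) e(1) smooth_iff_annihilated[OF I.E.lmod_axioms] by auto
  have "I.\<iota> e \<in> annihilated I.T.Q m"
    unfolding annihilated_iff
  proof (intro conjI ballI I.\<iota>_closed e(1))
    fix x :: "'b poly_op" assume x: "x \<in> witt_ge (int m)"
    have x0: "x \<in> witt_ge 0" using witt_ge_mono[of 0 "int m"] x by auto
    show "act I.T.Q x (I.\<iota> e) = \<zero>\<^bsub>I.T.Q\<^esub>"
      using m x by (simp add: I.act_\<iota>[OF x0 e(1)] annihilated_iff I.\<iota>_zero)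
  qed
  then show ?thesis using smooth_of_iso[OF I.TL.Q_lie _ _ e(2)] iso by (simp add: I.Q_induced)
qed

text \<open>As \<iota>(M) generates, some \<iota>(m) lies outside N; its class is nonzero and killed
  by all fields of degree at least 1.\<close>

lemma smooth_of_tensor_field:
  fixes M' :: "(complex^'b^'b, 'm) op_module"
  assumes M': "lie_module gl M'" and iso: "iso_unique_simple_quotient witt V (tensor_field_module M')"
  shows "smooth V"
proof -
  interpret I: tensor_field M' by (rule tensor_field.intro[OF M'])
  interpret Q: lmod witt I.T.Q by (rule lie_module_lmod[OF I.TL.Q_lie])
  obtain N where N: "simple_quotient_kernel witt I.T.Q N" "lie_module_iso witt V (quot_module I.T.Q N)"
    using iso by (auto simp: iso_unique_simple_quotient_def I.Q_field)
  have sub: "lie_submodule witt N I.T.Q" and sq: "simple_lie_module witt (quot_module I.T.Q N)"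
    using N(1) by (auto simp: simple_quotient_kernel_def)
  interpret N: csub I.T.Q N
    using sub by (intro csub.intro Q.cmod_axioms csub_axioms.intro) (simp add: lie_submodule_def)
  note quot = Q.lie_submodule_quot[OF lie_closed_witt sub]
  have "\<exists>m\<in>carrier M'. I.\<iota> m \<notin> N"
  proof (rule ccontr)
    assume "\<not> ?thesis"
    then have "N = carrier I.T.Q" by (intro I.generated[OF sub]) auto
    then have "N +>\<^bsub>I.T.Q\<^esub> x = N" if "x \<in> carrier I.T.Q" for x
      using N.cls_eq_N_iff[OF that] that by blast
    then have "carrier (quot_module I.T.Q N) \<subseteq> {N}"
      unfolding N.carrier_quot by blast
    moreover have "N \<in> carrier (quot_module I.T.Q N)"
      unfolding N.carrier_quot by (rule image_eqI[of _ _ "\<zero>\<^bsub>I.T.Q\<^esub>"]) (simp_all add: N.cls_zero)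
    ultimately show False using sq by (auto simp: simple_lie_module_def N.zero_quot)
  qed
  then obtain m where m: "m \<in> carrier M'" "I.\<iota> m \<notin> N" by blast
  have "N +>\<^bsub>I.T.Q\<^esub> I.\<iota> m \<in> annihilated (quot_module I.T.Q N) 1"
    unfolding annihilated_iff
  proof (intro conjI ballI)
    show "N +>\<^bsub>I.T.Q\<^esub> I.\<iota> m \<in> carrier (quot_module I.T.Q N)"
      unfolding N.carrier_quot by (intro imageI I.\<iota>_closed m)
    fix x :: "'b poly_op" assume "x \<in> witt_ge (int 1)"
    then have x: "x \<in> witt_ge 1" by simp
    have "act (quot_module I.T.Q N) x (N +>\<^bsub>I.T.Q\<^esub> I.\<iota> m) = N +>\<^bsub>I.T.Q\<^esub> act I.T.Q x (I.\<iota> m)"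
      by (rule quot(2)) (simp_all add: witt_ge_derivation[OF x] I.\<iota>_closed m)
    then show "act (quot_module I.T.Q N) x (N +>\<^bsub>I.T.Q\<^esub> I.\<iota> m) = \<zero>\<^bsub>quot_module I.T.Q N\<^esub>"
      by (simp only: I.act_\<iota>_zero[OF x m(1)] N.cls_zero N.zero_quot)
  qed
  moreover have "N +>\<^bsub>I.T.Q\<^esub> I.\<iota> m \<noteq> \<zero>\<^bsub>quot_module I.T.Q N\<^esub>"
    using m(2) by (simp add: N.zero_quot N.cls_eq_N_iff[OF I.\<iota>_closed[OF m(1)]])
  ultimately show ?thesis by (rule smooth_of_iso[OF quot(1) N(2)])
qed

lemma smooth_of_induced_or_tensor_quotient:
  "induced_or_tensor_quotient TYPE('e) TYPE('m) V \<Longrightarrow> smooth V"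
  unfolding induced_or_tensor_quotient_def
  using smooth_of_induced smooth_of_tensor_field by (auto simp: simple_lie_module_def)

subsection \<open>Realizing a smooth simple module\<close>

text \<open>With W = V the construction describes the submodule of V generated by X; it serves to
  prove that E has no proper nonzero submodules.\<close>

lemma lifting_id:
  assumes "subspace X" "\<And>x v. x \<in> witt_ge 0 \<Longrightarrow> v \<in> X \<Longrightarrow> \<rho> x v \<in> X"
  shows "lifting V V X (\<lambda>v. v)"
  using assms by (intro lifting.intro M.witt_mod_axioms lifting_axioms.intro) (simp_all add: submodule_V)

definition free_on :: "'a set \<Rightarrow> bool" where
  "free_on X \<longleftrightarrow> (\<forall>e A. finite A \<longrightarrow> (\<forall>\<beta>\<in>A. e \<beta> \<in> X) \<longrightarrow> (\<Sum>\<beta>\<in>A. dp \<beta> (e \<beta>)) = 0 \<longrightarrow> (\<forall>\<beta>\<in>A. e \<beta> = 0))"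

lemma free_over_free_on:
  assumes "lifting V W X \<iota>" "free_on X"
  shows "lifting.free_over V X"
  using assms(2) unfolding lifting.free_over_def[OF assms(1)] lifting.asum_def[OF assms(1)] free_on_def finsum_V
  by simp

text \<open>By simplicity of V, v = sum d^\<beta> y_\<beta> with y_\<beta> in Y. Subtracting v at
  \<beta> = 0 gives a relation with coefficients in X, and freeness yields v = y_0.\<close>

lemma minimal_of_free:
  assumes X: "subspace X" "free_on X" and Y: "subspace Y" "Y \<subseteq> X" "Y \<noteq> {0}"
    and stable: "\<And>x v. x \<in> witt_ge 0 \<Longrightarrow> v \<in> Y \<Longrightarrow> \<rho> x v \<in> Y"
  shows "Y = X"
proof (intro equalityI Y(2) subsetI)
  fix v assume v: "v \<in> X"
  interpret L: lifting V V Y "\<lambda>v. v" by (rule lifting_id[OF Y(1) stable])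
  obtain f where "(v, f) \<in> L.tgen" using L.tgen_fst_surj[OF simple] Y(3) by auto
  then obtain e A where e: "finite A" "\<And>\<beta>. e \<beta> \<in> Y" "\<And>\<beta>. \<beta> \<notin> A \<Longrightarrow> e \<beta> = 0" "v = (\<Sum>\<beta>\<in>A. dp \<beta> (e \<beta>))"
    using L.tgen_sum[of v f] by (auto simp: L.asum_def finsum_V)
  define e' where "e' \<beta> = (if \<beta> = 0 then e 0 - v else e \<beta>)" for \<beta>
  let ?B = "insert 0 A"
  have "v = (\<Sum>\<beta>\<in>?B. dp \<beta> (e \<beta>))"
    unfolding e(4) using e(1,3) M.mpow_zero_vec by (intro sum.mono_neutral_left) auto
  also have "\<dots> = e 0 + (\<Sum>\<beta>\<in>A - {0}. dp \<beta> (e \<beta>))"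
    using e(1) by (simp add: sum.insert_remove)
  finally have "(\<Sum>\<beta>\<in>?B. dp \<beta> (e' \<beta>)) = 0"
    using e(1) by (simp add: sum.insert_remove e'_def)
  moreover have "e' \<beta> \<in> X" for \<beta>
    using e(2)[of \<beta>] e(2)[of 0] Y(2) v subspace_diff[OF X(1)] by (auto simp: e'_def)
  ultimately have "e' 0 = 0" using X(2) e(1) unfolding free_on_def by blast
  then have "v = e 0" by (simp add: e'_def)
  then show "v \<in> Y" using e(2)[of 0] by simp
qed

text \<open>Y generates v, so \<open>eproj\<close> for a large K sends v into Y; on v itself it is
  multiplication by K!.\<close>

lemma minimal_of_eigen:
  assumes X: "\<And>v. v \<in> X \<Longrightarrow> \<rho> euler v = scale \<mu> v" and Y: "subspace Y" "Y \<subseteq> X" "Y \<noteq> {0}"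
    and stable: "\<And>x v. x \<in> witt_ge 0 \<Longrightarrow> v \<in> Y \<Longrightarrow> \<rho> x v \<in> Y"
  shows "Y = X"
proof (intro equalityI Y(2) subsetI)
  fix v assume v: "v \<in> X"
  interpret L: lifting V V Y "\<lambda>v. v" by (rule lifting_id[OF Y(1) stable])
  obtain f where "(v, f) \<in> L.tgen" using L.tgen_fst_surj[OF simple] Y(3) by auto
  then obtain m K where m: "m \<in> Y" "M.eproj \<mu> K v = scale (fact K) m"
    using L.eproj_tgen[of \<mu> v f] X Y(2) by auto
  have "M.eproj \<mu> K v = scale (fact K) v" using M.eproj_eigen[of v \<mu> K] X[OF v] by simp
  then have "v = m" using m(2) by (simp add: scale_cancel_left)
  then show "v \<in> Y" using m(1) by simp
qed

abbreviation ann :: "nat \<Rightarrow> 'a set" where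
  "ann r \<equiv> annihilated V r"

lemma ann_subspace: "subspace (ann r)"
  using M.annihilated_submodule by (simp add: submodule_V)

lemma ann_stable: "x \<in> witt_ge 0 \<Longrightarrow> v \<in> ann r \<Longrightarrow> \<rho> x v \<in> ann r"
  using M.annihilated_act_nonneg by simp

lemma induced_of_smooth:
  assumes r: "r \<ge> 2" "ann r \<noteq> {0}" "\<And>k. k < r \<Longrightarrow> ann k = {0}"
  shows "induced_or_tensor_quotient TYPE('a) TYPE('m) V"
proof -
  let ?X = "ann r"
  let ?E = "sub_op scale ?X \<rho>"
  have free: "free_on ?X"
    unfolding free_on_def
  proof (intro allI impI ballI)
    fix e A \<beta> assume *: "finite A" "\<forall>\<beta>\<in>A. e \<beta> \<in> ?X" "(\<Sum>\<beta>\<in>A. dp \<beta> (e \<beta>)) = 0" "\<beta> \<in> A"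
    \<comment> \<open>By minimality of r; this is the nondegeneracy that the descent in
      \<open>mccoy\<close> needs.\<close>
    have "v = 0" if "v \<in> ann (r - 1)" for v using r(3)[of "r - 1"] r(1) that by simp
    then have top: "e \<beta> = 0" if "top_rel r N e" "mdeg \<beta> = N" for N e \<beta>
      by (rule top_rel_zero[OF r(1) _ that])
    show "e \<beta> = 0" by (rule free_of_top[of r A e \<beta>]) (use top * in auto)
  qed
  have E: "lie_module witt_nonneg ?E"
    by (rule C.sub_op_lie_module)
      (simp_all add: ann_subspace ann_stable witt_ge_derivation \<rho>_add \<rho>_scale add_\<rho> scale_\<rho>
        bracket_\<rho>[unfolded lbracket_witt] lbracket_witt_nonneg)
  have simpleE: "simple_lie_module witt_nonneg ?E"
    by (rule C.sub_op_simple[OF E r(2)]) (simp, rule minimal_of_free[OF ann_subspace free])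
  interpret I: induced ?E by (rule induced.intro[OF E])
  have annE: "annihilated ?E k = ?X \<inter> ann k" for k
    by (auto simp: annihilated_iff)
  have sm: "smooth ?E"
    using smooth_iff_annihilated[OF I.E.lmod_axioms] by (auto simp: annE)
  have "annihilated ?E (height ?E) \<noteq> {0}"
    unfolding height_def using LeastI[of "\<lambda>k. annihilated ?E k \<noteq> {\<zero>\<^bsub>?E\<^esub>}" r] r(2) by (simp add: annE)
  \<comment> \<open>The spaces annihilated in E are the intersections of E with those of V, which
    are 0 below r.\<close>
  then have "height ?E \<ge> r"
    using r(3)[of "height ?E"] subspace_0[OF ann_subspace[of r]] by (cases "height ?E < r") (auto simp: annE)
  then have ht: "height ?E \<ge> 2" using r(1) by simp
  have lift: "lifting V I.T.Q ?X I.\<iota>"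
  proof (intro lifting.intro M.witt_mod_axioms witt_mod.intro lie_module_lmod I.TL.Q_lie lifting_axioms.intro)
    show "submodule ?X complex_ring V" by (rule M.annihilated_submodule)
  qed (use I.\<iota>_closed I.\<iota>_add I.\<iota>_smult I.act_\<iota> ann_stable in simp_all)
  interpret L: lifting V I.T.Q ?X I.\<iota> by (rule lift)
  have fct: "(\<zero>\<^bsub>V\<^esub>, f) \<in> L.tgen \<Longrightarrow> f = \<zero>\<^bsub>I.T.Q\<^esub>" for f
    by (rule L.free_over_functional[OF free_over_free_on[OF lift free]])
  have "\<exists>e\<in>?X. I.\<iota> e \<noteq> \<zero>\<^bsub>I.T.Q\<^esub>"
  proof -
    obtain e where "e \<in> ?X" "e \<noteq> 0" using r(2) subspace_0[OF ann_subspace[of r]] by blast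
    then show ?thesis
      by (intro bexI[of _ e] I.\<iota>_nonzero[OF wmod_axioms, where \<phi> = "\<lambda>v. v"]) simp_all
  qed
  then have "generated_lifting V I.T.Q ?X I.\<iota>"
    using I.generated L.base_closed_functional[OF fct] simple
    by (intro generated_lifting.intro lift generated_lifting_axioms.intro) simp_all
  from generated_lifting.iso_of_functional[OF this fct]
  have "lie_module_iso witt V (induced_module witt witt_nonneg ?E)" by (simp add: I.Q_induced)
  then show ?thesis unfolding induced_or_tensor_quotient_def using simpleE sm ht by blast
qed

end

section \<open>Linear vector fields and matrices\<close>

definition lin_fld :: "complex^'n^'n \<Rightarrow> 'n::finite poly_op" where
  "lin_fld A = (\<Sum>j\<in>UNIV. \<Sum>i\<in>UNIV. op_scale (A $ i $ j) (fld (tvar i) j))"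

lemma lin_fld_tvar: "lin_fld A (tvar l) = (\<Sum>i\<in>UNIV. fscale (A $ i $ l) (tvar i))"
proof -
  have "lin_fld A (tvar l) = (\<Sum>j\<in>UNIV. \<Sum>i\<in>UNIV. fscale (A $ i $ j) (if j = l then tvar i else 0))"
    by (simp only: lin_fld_def sum_fun_apply op_scale_def fld_tvar)
  also have "\<dots> = (\<Sum>j\<in>UNIV. if j = l then \<Sum>i\<in>UNIV. fscale (A $ i $ l) (tvar i) else 0)"
    by (intro sum.cong) auto
  finally show ?thesis by simp
qed

lemma lin_fld_witt_ge: "lin_fld A \<in> witt_ge 0"
  unfolding lin_fld_def
  by (intro op.subspace_sum[OF witt_ge_subspace] op.subspace_scale[OF witt_ge_subspace] fld_witt_ge)
    (simp add: ord_ge_single)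

lemma lin_fld_derivation [simp]: "lin_fld A \<in> derivations"
  by (rule witt_ge_derivation[OF lin_fld_witt_ge])

lemma lin_fld_add: "lin_fld (A + B) = lin_fld A + lin_fld B"
  by (rule derivation_eqI) (simp_all add: derivations_closed lin_fld_tvar pm.scale_left_distrib sum.distrib
    del: fscale_single map_single)

lemma lin_fld_scale: "lin_fld (\<chi> i j. c * A $ i $ j) = op_scale c (lin_fld A)"
  by (rule derivation_eqI[OF lin_fld_derivation derivations_closed(3)[OF lin_fld_derivation]])
    (simp add: lin_fld_tvar op_scale_def pm.scale_sum_right del: fscale_single map_single)

lemma lin_fld_unit: "lin_fld (mat_unit i j) = fld (tvar i) j"
proof (rule derivation_eqI)
  fix l
  have "lin_fld (mat_unit i j) (tvar l) = (\<Sum>k\<in>UNIV. if k = i then (if j = l then tvar i else 0) else 0)"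
    unfolding lin_fld_tvar mat_unit_def by (intro sum.cong) auto
  then show "lin_fld (mat_unit i j) (tvar l) = fld (tvar i) j (tvar l)"
    by (simp add: fld_tvar)
qed simp_all

text \<open>With the row index on the variable, the fields sum A_ij t_i \<partial>_j compose on
  linear forms in the order of the matrix product, so brackets are preserved without a
  transposition.\<close>

lemma lin_fld_comp: "lin_fld A (lin_fld B (tvar l)) = (\<Sum>i\<in>UNIV. fscale ((A ** B) $ i $ l) (tvar i))"
proof -
  have "lin_fld A (lin_fld B (tvar l)) = (\<Sum>k\<in>UNIV. fscale (B $ k $ l) (lin_fld A (tvar k)))"
    unfolding lin_fld_tvar[of B]
    by (simp only: derivation_sum[OF lin_fld_derivation] derivation_fscale[OF lin_fld_derivation])
  also have "\<dots> = (\<Sum>k\<in>UNIV. \<Sum>i\<in>UNIV. fscale (A $ i $ k * B $ k $ l) (tvar i))"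
    unfolding lin_fld_tvar by (simp only: pm.scale_sum_right pm.scale_scale mult.commute)
  also have "\<dots> = (\<Sum>i\<in>UNIV. \<Sum>k\<in>UNIV. fscale (A $ i $ k * B $ k $ l) (tvar i))" by (rule sum.swap)
  finally show ?thesis
    by (simp only: matrix_matrix_mult_def vec_lambda_beta pm.scale_sum_left)
qed

lemma lin_fld_bracket: "lin_fld (A ** B - B ** A) = lbracket witt (lin_fld A) (lin_fld B)"
proof (rule derivation_eqI)
  fix l
  show "lin_fld (A ** B - B ** A) (tvar l) = lbracket witt (lin_fld A) (lin_fld B) (tvar l)"
    unfolding lbracket_witt lin_fld_comp unfolding lin_fld_tvar vector_minus_component
    by (simp only: pm.scale_left_diff_distrib sum_subtractf)
qed simp_all

abbreviation lin_part :: "'n::finite poly_op \<Rightarrow> complex^'n^'n" where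
  "lin_part x \<equiv> \<chi> i j. lin_coeff x i j"

lemma mdeg_1: "mdeg \<alpha> = 1 \<Longrightarrow> \<exists>k. \<alpha> = unit_idx k"
proof -
  assume \<alpha>: "mdeg \<alpha> = 1"
  then obtain k where k: "Poly_Mapping.lookup \<alpha> k \<noteq> 0"
    unfolding mdeg_def by (metis sum.neutral zero_neq_one)
  have "mdeg (\<alpha> - unit_idx k) = 0" using mdeg_minus_unit[OF k] \<alpha> by simp
  then have "\<alpha> - unit_idx k = 0" by (simp only: mdeg_eq_0_iff)
  then have "\<alpha> = unit_idx k" using idx_minus_add[OF k] by simp
  then show ?thesis ..
qed

text \<open>Fields of degree at least 0 modulo those of degree at least 1 are matrices. On vectors
  killed by the latter only the linear part acts.\<close>

lemma witt_ge_lin_part: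
  assumes x: "x \<in> witt_ge 0"
  shows "x - lin_fld (lin_part x) \<in> witt_ge 1"
  unfolding witt_ge_iff
proof (intro conjI allI)
  have D: "x \<in> derivations" by (rule witt_ge_derivation[OF x])
  show "x - lin_fld (lin_part x) \<in> derivations" by (intro derivations_closed D lin_fld_derivation)
  fix j
  have "2 \<le> mdeg \<alpha>" if \<alpha>: "\<alpha> \<in> Poly_Mapping.keys (x (tvar j) - lin_fld (lin_part x) (tvar j))" for \<alpha>
  proof (rule ccontr)
    assume "\<not> 2 \<le> mdeg \<alpha>"
    then consider "mdeg \<alpha> = 0" | "mdeg \<alpha> = 1" by linarith
    then have "Poly_Mapping.lookup (x (tvar j)) \<alpha> = Poly_Mapping.lookup (lin_fld (lin_part x) (tvar j)) \<alpha>"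
    proof cases
      case 1
      have "ord_ge 1 (x (tvar j))" "ord_ge 1 (lin_fld (lin_part x) (tvar j))"
        using x lin_fld_witt_ge[of "lin_part x"] by (simp_all add: witt_ge_iff)
      then have "\<alpha> \<notin> Poly_Mapping.keys (x (tvar j))" "\<alpha> \<notin> Poly_Mapping.keys (lin_fld (lin_part x) (tvar j))"
        using 1 by (auto simp: ord_ge_def)
      then show ?thesis by (simp add: in_keys_iff)
    next
      case 2
      then obtain k where k: "\<alpha> = unit_idx k" using mdeg_1 by blast
      have inj: "unit_idx i = unit_idx k \<longleftrightarrow> i = k" for i :: 'a
        by (metis lookup_single_eq lookup_single_not_eq zero_neq_one)
      have "Poly_Mapping.lookup (lin_fld (lin_part x) (tvar j)) (unit_idx k)
          = (\<Sum>i\<in>UNIV. if i = k then lin_coeff x i j else 0)"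
        unfolding lin_fld_tvar lookup_sum by (intro sum.cong) (auto simp: lookup_single inj when_def)
      then show ?thesis by (simp add: k)
    qed
    then show False using \<alpha> by (simp add: in_keys_iff lookup_minus)
  qed
  then show "ord_ge (1 + 1) ((x - lin_fld (lin_part x)) (tvar j))" by (force simp: ord_ge_def)
qed

context simple_wmod begin

text \<open>The twist by the trace makes the embedding of \<open>X\<close> into the tensor module equivariant.\<close>

definition gl_act :: "complex^'b^'b \<Rightarrow> 'a \<Rightarrow> 'a" where
  "gl_act A v = \<rho> (lin_fld A) v + scale (\<Sum>i\<in>UNIV. A $ i $ i) v"

lemma gl_act_lie_module:
  assumes X: "subspace X" "\<And>x v. x \<in> witt_ge 0 \<Longrightarrow> v \<in> X \<Longrightarrow> \<rho> x v \<in> X"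
  shows "lie_module gl (sub_op scale X gl_act)"
proof (rule C.sub_op_lie_module[OF X(1)])
  fix A B :: "complex^'b^'b" and v w :: 'a and c :: complex
  show "gl_act A (v + w) = gl_act A v + gl_act A w"
    by (simp add: gl_act_def \<rho>_add scale_right_distrib)
  show "gl_act A (scale c v) = scale c (gl_act A v)"
    by (simp add: gl_act_def \<rho>_scale scale_right_distrib mult.commute)
  show "gl_act (A + B) v = gl_act A v + gl_act B v"
    by (simp add: gl_act_def lin_fld_add add_\<rho> sum.distrib scale_left_distrib)
  show "gl_act (lscale gl c A) v = scale c (gl_act A v)"
    by (simp add: gl_act_def gl_def lin_fld_scale scale_\<rho> scale_right_distrib flip: sum_distrib_left)
  have "(\<Sum>i\<in>UNIV. (A ** B) $ i $ i) = (\<Sum>i\<in>UNIV. (B ** A) $ i $ i)"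
    unfolding matrix_matrix_mult_def vec_lambda_beta by (subst sum.swap) (simp only: mult.commute)
  then have "gl_act (lbracket gl A B) v = \<rho> (lin_fld A) (\<rho> (lin_fld B) v) - \<rho> (lin_fld B) (\<rho> (lin_fld A) v)"
    by (simp add: gl_act_def gl_def lin_fld_bracket bracket_\<rho> sum_subtractf)
  then show "gl_act (lbracket gl A B) v = gl_act A (gl_act B v) - gl_act B (gl_act A v)"
    by (simp add: gl_act_def \<rho>_add \<rho>_scale scale_right_distrib mult.commute)
  show "gl_act A v \<in> X" if "v \<in> X"
    unfolding gl_act_def using that X
    by (intro subspace_add[OF X(1)] subspace_scale[OF X(1)] X(2) lin_fld_witt_ge)
qed

lemma act_lin_part:
  assumes x: "x \<in> witt_ge 0" and v: "v \<in> ann 1"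
  shows "\<rho> x v = \<rho> (lin_fld (lin_part x)) v"
proof -
  have "\<rho> (x - lin_fld (lin_part x)) v = 0"
    using witt_ge_lin_part[OF x] v by (simp add: annihilated_V)
  then show ?thesis by (simp add: diff_\<rho> witt_ge_derivation[OF x])
qed

text \<open>Undoes the trace twist of \<open>gl_act\<close> and so puts the action into the form
  that \<open>act_\<iota>\<close> of the tensor module asks for.\<close>

lemma act_gl_act:
  assumes x: "x \<in> witt_ge 0" and v: "v \<in> ann 1"
  shows "\<rho> x v = (\<Sum>i\<in>UNIV. \<Sum>j\<in>UNIV. scale (lin_coeff x i j) (gl_act (mat_unit i j) v))
     - scale (\<Sum>i\<in>UNIV. lin_coeff x i i) v"
proof -
  have tr: "(\<Sum>k\<in>UNIV. mat_unit i j $ k $ k) = (if i = j then 1 else 0 :: complex)" for i j :: 'b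
  proof -
    have "(\<Sum>k\<in>UNIV. mat_unit i j $ k $ k) = (\<Sum>k\<in>UNIV. if k = i then (if i = j then 1 else 0) else 0 :: complex)"
      unfolding mat_unit_def by (intro sum.cong) auto
    then show ?thesis by simp
  qed
  have "\<rho> (lin_fld (lin_part x)) v = (\<Sum>j\<in>UNIV. \<Sum>i\<in>UNIV. scale (lin_coeff x i j) (\<rho> (fld (tvar i) j) v))"
  proof -
    have "\<rho> (\<Sum>i\<in>UNIV. op_scale (lin_part x $ i $ j) (fld (tvar i) j)) v
        = (\<Sum>i\<in>UNIV. scale (lin_coeff x i j) (\<rho> (fld (tvar i) j) v))" for j
      by (subst sum_\<rho>) (simp_all add: derivations_closed scale_\<rho>)
    then show ?thesis
      unfolding lin_fld_def by (subst sum_\<rho>) (auto intro!: derivations_closed)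
  qed
  also have "\<dots> = (\<Sum>i\<in>UNIV. \<Sum>j\<in>UNIV. scale (lin_coeff x i j) (\<rho> (fld (tvar i) j) v))" by (rule sum.swap)
  also have "\<dots> = (\<Sum>i\<in>UNIV. \<Sum>j\<in>UNIV. scale (lin_coeff x i j) (gl_act (mat_unit i j) v)
      - (if j = i then scale (lin_coeff x i i) v else 0))"
    by (intro sum.cong refl) (simp add: gl_act_def lin_fld_unit tr scale_right_distrib)
  also have "\<dots> = (\<Sum>i\<in>UNIV. \<Sum>j\<in>UNIV. scale (lin_coeff x i j) (gl_act (mat_unit i j) v))
     - scale (\<Sum>i\<in>UNIV. lin_coeff x i i) v"
    by (simp add: sum_subtractf scale_sum_left)
  finally show ?thesis unfolding act_lin_part[OF assms] .
qed

text \<open>Common to both cases of height at most 1: X is V^(1) or an Euler eigenspace in it.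
  Minimality and \<open>base_closed\<close> remain hypotheses because their proofs differ; the
  latter is asked for every lifting, since the tensor module is built only inside the proof.\<close>

lemma tensor_of_smooth:
  assumes X: "subspace X" "X \<noteq> {0}" "X \<subseteq> ann 1" "\<And>x v. x \<in> witt_ge 0 \<Longrightarrow> v \<in> X \<Longrightarrow> \<rho> x v \<in> X"
    and minimal: "\<And>Y. subspace Y \<Longrightarrow> Y \<subseteq> X \<Longrightarrow> Y \<noteq> {0} \<Longrightarrow>
      (\<And>x v. x \<in> witt_ge 0 \<Longrightarrow> v \<in> Y \<Longrightarrow> \<rho> x v \<in> Y) \<Longrightarrow> Y = X"
    and closed: "\<And>(W :: ('b poly_op, ('b poly_op set \<times> 'a \<Rightarrow>\<^sub>0 complex) set) op_module) \<iota>.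
      lifting V W X \<iota> \<Longrightarrow> lifting.base_closed V W X \<iota>"
  shows "induced_or_tensor_quotient TYPE('e) TYPE('a) V"
proof -
  let ?M = "sub_op scale X gl_act"
  have M: "lie_module gl ?M" by (rule gl_act_lie_module[OF X(1,4)])
  have simpleM: "simple_lie_module gl ?M"
  proof (rule C.sub_op_simple[OF M X(2)])
    fix Y assume Y: "subspace Y" "Y \<subseteq> X" "Y \<noteq> {0}" and gl: "\<And>A v. A \<in> lset gl \<Longrightarrow> v \<in> Y \<Longrightarrow> gl_act A v \<in> Y"
    have "\<rho> x v \<in> Y" if x: "x \<in> witt_ge 0" and v: "v \<in> Y" for x v
    proof -
      have v1: "v \<in> ann 1" using v Y(2) X(3) by blast
      show ?thesis
        unfolding act_gl_act[OF x v1]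
        by (intro subspace_diff[OF Y(1)] subspace_sum[OF Y(1)] subspace_scale[OF Y(1)] gl v) (simp add: gl_def)
    qed
    then show "Y = X" by (rule minimal[OF Y])
  qed
  interpret I: tensor_field ?M by (rule tensor_field.intro[OF M])
  have lift: "lifting V I.T.Q X I.\<iota>"
  proof (intro lifting.intro M.witt_mod_axioms witt_mod.intro lie_module_lmod I.TL.Q_lie lifting_axioms.intro)
    show "submodule X complex_ring V" using X(1) by (simp add: submodule_V)
    fix x :: "'b poly_op" and v assume x: "x \<in> witt_ge 0" and v: "v \<in> X"
    show "act V x v \<in> X" using X(4)[OF x v] by simp
    define h where "h = I.w id"
    have hsc: "h (scale c u) = fscale c (h u)" if "u \<in> X" for c u
      using I.w_scale_right[OF weyl_ops.one, of u c] that by (simp add: h_def)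
    have hadd: "h (u + u') = h u + h u'" if "u \<in> X" "u' \<in> X" for u u'
      using I.w_add_right[OF weyl_ops.one, of u u'] that by (simp add: h_def)
    have h0: "h 0 = 0" using I.w_zero_right[OF weyl_ops.one] by (simp add: h_def)
    have hsum: "h (sum f UNIV) = (\<Sum>a\<in>UNIV. h (f a))" if f: "\<And>a. f a \<in> X" for f :: "'b \<Rightarrow> 'a"
    proof -
      have "h (sum f A) = (\<Sum>a\<in>A. h (f a))" for A
        by (induction A rule: infinite_finite_induct) (auto simp: h0 hadd f subspace_sum[OF X(1)])
      then show ?thesis .
    qed
    have hdiff: "h (u - u') = h u - h u'" if "u \<in> X" "u' \<in> X" for u u'
      using hadd[OF subspace_diff[OF X(1) that] that(2)] by simp
    have g: "gl_act (mat_unit i j) v \<in> X" for i j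
      using I.M.act_closed[OF I.gl_set, of v "mat_unit i j"] v by simp
    have v1: "v \<in> ann 1" using v X(3) by blast
    have "h (\<rho> x v) = (\<Sum>i\<in>UNIV. \<Sum>j\<in>UNIV. fscale (lin_coeff x i j) (h (gl_act (mat_unit i j) v)))
        - fscale (\<Sum>i\<in>UNIV. lin_coeff x i i) (h v)"
      unfolding act_gl_act[OF x v1]
      using v g by (simp add: hdiff hsum hsc subspace_sum[OF X(1)] subspace_scale[OF X(1)])
    then have "act I.T.Q x (I.\<iota> v) = I.\<iota> (\<rho> x v)"
      using X(4)[OF x v] v unfolding h_def by (intro I.act_\<iota> x) (simp_all only: sub_op_simps)
    then show "I.\<iota> (act V x v) = act I.T.Q x (I.\<iota> v)" by simp
  qed (use I.\<iota>_closed I.\<iota>_add I.\<iota>_smult in simp_all)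
  have "\<exists>e\<in>X. I.\<iota> e \<noteq> \<zero>\<^bsub>I.T.Q\<^esub>"
  proof -
    obtain e where "e \<in> X" "e \<noteq> 0" using X(2) subspace_0[OF X(1)] by blast
    then show ?thesis
      by (intro bexI[of _ e] I.\<iota>_nonzero[OF vector_space_axioms, where \<phi> = "\<lambda>v. v"]) simp_all
  qed
  then have "generated_lifting V I.T.Q X I.\<iota>"
    using I.generated closed[OF lift] simple
    by (intro generated_lifting.intro lift generated_lifting_axioms.intro) simp_all
  from generated_lifting.iso_unique_simple_quotient[OF this]
  show ?thesis unfolding induced_or_tensor_quotient_def I.Q_field using simpleM by blast
qed

lemma tensor_of_height_1:
  assumes "ann 1 \<noteq> {0}"
  shows "induced_or_tensor_quotient TYPE('e) TYPE('a) V"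
proof (cases "free_on (ann 1)")
  case True
  show ?thesis
  proof (rule tensor_of_smooth[OF ann_subspace assms order.refl ann_stable])
    show "Y = ann 1" if "subspace Y" "Y \<subseteq> ann 1" "Y \<noteq> {0}" "\<And>x v. x \<in> witt_ge 0 \<Longrightarrow> v \<in> Y \<Longrightarrow> \<rho> x v \<in> Y" for Y
      by (rule minimal_of_free[OF ann_subspace True that])
    fix W :: "('b poly_op, ('b poly_op set \<times> 'a \<Rightarrow>\<^sub>0 complex) set) op_module" and \<iota>
    assume lift: "lifting V W (ann 1) \<iota>"
    interpret L: lifting V W "ann 1" \<iota> by (rule lift)
    show "L.base_closed"
      by (rule L.base_closed_functional) (rule L.free_over_functional[OF free_over_free_on[OF lift True]])
  qed
next
  case False
  \<comment> \<open>If all top-degree relations were trivial, \<open>free_of_top\<close> would make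
    V^(1) free.\<close>
  have "\<exists>N e \<beta>. top_rel 1 N e \<and> mdeg \<beta> = N \<and> e \<beta> \<noteq> 0"
  proof (rule ccontr)
    assume none: "\<not> ?thesis"
    have "free_on (ann 1)"
      unfolding free_on_def
    proof (intro allI impI ballI)
      fix e A \<beta> assume *: "finite A" "\<forall>\<beta>\<in>A. e \<beta> \<in> ann 1" "(\<Sum>\<beta>\<in>A. dp \<beta> (e \<beta>)) = 0" "\<beta> \<in> A"
      show "e \<beta> = 0" by (rule free_of_top[of 1 A e \<beta>]) (use none * in auto)
    qed
    then show False using False by simp
  qed
  then obtain v \<mu> where v: "v \<noteq> 0" "v \<in> ann 1" "\<rho> euler v = scale \<mu> v"
    using euler_eigenvector by blast
  define X where "X = {v \<in> ann 1. \<rho> euler v = scale \<mu> v}"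
  have X: "subspace X"
    using ann_subspace[of 1] unfolding subspace_def X_def
    by (auto simp: \<rho>_add \<rho>_scale scale_right_distrib mult.commute)
  \<comment> \<open>On V^(1) only the linear part of x acts, and linear fields commute with the
    Euler field.\<close>
  have stable: "\<rho> x u \<in> X" if x: "x \<in> witt_ge 0" and u: "u \<in> X" for x u
  proof -
    let ?y = "lin_fld (lin_part x)"
    have "lbracket witt euler ?y = 0"
    proof (rule derivation_eqI)
      show "lbracket witt euler ?y (tvar l) = 0 (tvar l)" for l
        by (simp add: lbracket_witt lin_fld_tvar derivation_sum derivation_fscale del: fscale_single map_single)
    qed simp_all
    then have "\<rho> euler (\<rho> ?y u) = \<rho> ?y (\<rho> euler u)"
      using \<rho>_swap[OF euler_derivation lin_fld_derivation, of "lin_part x" u] by simp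
    then show ?thesis
      using u ann_stable[OF x, of u 1] by (simp add: X_def act_lin_part[OF x] \<rho>_scale)
  qed
  show ?thesis
  proof (rule tensor_of_smooth[OF X _ _ stable])
    show "X \<noteq> {0}" using v by (auto simp: X_def)
    show "X \<subseteq> ann 1" by (auto simp: X_def)
    show "Y = X" if "subspace Y" "Y \<subseteq> X" "Y \<noteq> {0}" "\<And>x v. x \<in> witt_ge 0 \<Longrightarrow> v \<in> Y \<Longrightarrow> \<rho> x v \<in> Y" for Y
      by (rule minimal_of_eigen[of X \<mu> Y, OF _ that]) (simp add: X_def)
    fix W :: "('b poly_op, ('b poly_op set \<times> 'a \<Rightarrow>\<^sub>0 complex) set) op_module" and \<iota>
    assume lift: "lifting V W X \<iota>"
    interpret L: lifting V W X \<iota> by (rule lift)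
    show "L.base_closed" by (rule L.base_closed_eigen[of \<mu>]) (simp add: X_def)
  qed
qed

lemma induced_or_tensor_quotient_of_smooth:
  assumes "smooth V"
  shows "induced_or_tensor_quotient TYPE('a) TYPE('a) V"
proof -
  obtain v :: 'a where v: "v \<noteq> 0" using ex_nonzero by blast
  have "\<exists>m. v \<in> ann m" using assms M.smooth_iff by simp
  then obtain m where "v \<in> ann m" ..
  with v have m: "ann m \<noteq> {0}" by auto
  define r where "r = (LEAST r. ann r \<noteq> {0})"
  have r: "ann r \<noteq> {0}" unfolding r_def by (rule LeastI[of "\<lambda>r. ann r \<noteq> {0}", OF m])
  have r': "ann k = {0}" if "k < r" for k
    using not_less_Least[of k "\<lambda>r. ann r \<noteq> {0}"] that by (simp add: r_def)
  show ?thesis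
  proof (cases "r \<ge> 2")
    case True
    then show ?thesis using r r' by (rule induced_of_smooth)
  next
    case False
    \<comment> \<open>Heights 0 and 1 are treated alike, through V^(1).\<close>
    then have "ann r \<subseteq> ann 1" using annihilated_mono[of r 1] by auto
    then have "ann 1 \<noteq> {0}" using r subspace_0[OF ann_subspace[of r]] by auto
    then show ?thesis by (rule tensor_of_height_1)
  qed
qed

end

text \<open>The second conjunct realizes E and M on the type of V itself. The third gives (3)
  implies (2) for carriers of any types, so the equivalence does not hinge on that choice.\<close>

theorem theorem6p4:
  fixes scale :: "complex \<Rightarrow> 'v::ab_group_add \<Rightarrow> 'v"
    and \<rho> :: "'n::finite poly_op \<Rightarrow> 'v \<Rightarrow> 'v"
  defines "V \<equiv> op_module_of scale \<rho>"
  assumes "simple_lie_module witt V"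
  shows "((\<exists>k::'n \<Rightarrow> nat. (\<forall>i. k i > 0) \<and>
            (\<forall>i. locally_finite V (monom_field (Poly_Mapping.single i (k i + 1)) i)))
          \<longleftrightarrow> smooth V)
    \<and> (smooth V \<longleftrightarrow> induced_or_tensor_quotient TYPE('v) TYPE('v) V)
    \<and> (induced_or_tensor_quotient TYPE('e) TYPE('m) V \<longrightarrow> smooth V)"
proof -
  interpret simple_wmod scale \<rho>
    using assms(2) unfolding V_def
    by (intro simple_wmod.intro wmod.intro simple_wmod_axioms.intro) (simp_all add: simple_lie_module_def)
  show ?thesis
    unfolding V_def
  proof (intro conjI)
    show "(\<exists>k::'n \<Rightarrow> nat. (\<forall>i. k i > 0) \<and>
        (\<forall>i. locally_finite (op_module_of scale \<rho>) (monom_field (Poly_Mapping.single i (k i + 1)) i)))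
      \<longleftrightarrow> smooth (op_module_of scale \<rho>)"
      by (rule smooth_iff_locally_finite)
  qed (rule iffI[OF induced_or_tensor_quotient_of_smooth smooth_of_induced_or_tensor_quotient]
      impI[OF smooth_of_induced_or_tensor_quotient]; assumption)+
qed

end
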